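(* Let $\omega\in\mathcal{W}$ with associated function $\tau$, and let $\mu$ be a finite positive Borel measure on $\mathbb{D}$. Let $0<p<\infty$, and let $\delta\in(0,m_\tau)$ be sufficiently small. Then the Toeplitz operator $T_\mu$ belongs to the Schatten class $S_p(A^2_\omega)$ if and only if the averaging function $\widehat{\mu}_\delta$ belongs to $L^p(\mathbb{D},d\lambda_\tau)$, where $d\lambda_\tau(z)=\tau(z)^{-2}\,dA(z)$.
   Context: $\mathbb{D}$ is the open unit disk in $\mathbb{C}$, $H(\mathbb{D})$ the space of analytic functions on $\mathbb{D}$, and $dA=\frac{dx\,dy}{\pi}$ normalized area measure. A weight is a positive function $\omega\in L^1(\mathbb{D},dA)$. $A^2_\omega$ is the space of $f\in H(\mathbb{D})$ with $\|f\|_{A^2_\omega}^2=\int_{\mathbb{D}}|f|^2\omega\,dA<\infty$, with inner product $\langle f,g\rangle_\omega=\int_{\mathbb{D}} f\,\overline{g}\,\omega\,dA$. The notation $a\lesssim b$ means $a\le Cb$ for a constant $C>0$, and $a\asymp b$ means $a\lesssim b$ and $b\lesssim a$. Class $\mathcal{W}$: radial decreasing weights $\omega=e^{-2\varphi}$, where $\varphi\in C^2(\mathbb{D})$ is radial with $(\Delta\varphi(z))^{-1/2}\asymp\tau(z)$ ($\Delta$ is the standard Laplacian) for a radial positive function $\tau$ (the function associated to $\omega$) that decreases to $0$ as $|z|\to1^-$ and satisfies $\lim_{r\to1^-}\tau'(r)=0$; moreover, either there is a constant $C>0$ such that $\tau(r)(1-r)^{-C}$ increases for $r$ close to $1$,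 or $\lim_{r\to1^-}\tau'(r)\log\frac1{\tau(r)}=0$. The function $\tau$ belongs to the class $\mathcal{L}$, i.e. there are constants $c_1,c_2$ with (A) $\tau(z)\le c_1(1-|z|)$ for all $z\in\mathbb{D}$, and (B) $|\tau(z)-\tau(\zeta)|\le c_2|z-\zeta|$ for all $z,\zeta\in\mathbb{D}$. Put $m_\tau=\frac14\min(1,c_1^{-1},c_2^{-1})$. For such $\omega$, point evaluations are bounded on $A^2_\omega$; $K_z\in A^2_\omega$ denotes the reproducing kernel, $f(z)=\langle f,K_z\rangle_\omega$ for $f\in A^2_\omega$. Toeplitz operator: $T_\mu f(z)=\int_{\mathbb{D}} f(\xi)\,\overline{K_z(\xi)}\,\omega(\xi)\,d\mu(\xi)$. $D(\delta\tau(z))$ is the Euclidean disk centered at $z$ with radius $\delta\tau(z)$, and the averaging function is $\widehat{\mu}_\delta(z)=\mu(D(\delta\tau(z)))/\tau(z)^2$, $z\in\mathbb{D}$. "$\delta$ sufficiently small" means: for all $\delta\in(0,\delta_0)$, for some $\delta_0\in(0,m_\tau]$ depending only on $\omega$ and $\tau$. $S_p(H)$, $0<p<\infty$, is the class of compact operators $T$ on the separable Hilbert space $H$ whose sequence of singular numbers (square roots of the eigenvalues of $T^*T$) is in $\ell^p$. *)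

theory Defs
  imports "HOL-Complex_Analysis.Complex_Analysis" "HOL-Library.Function_Algebras"
begin

section \<open>Schatten classes of Hilbert spaces of functions\<close>

text \<open>
  A Hilbert space of functions is given by its carrier \<open>H\<close> and its inner product \<open>ip\<close> (linear in
  the first argument); addition is the pointwise one of \<^theory>\<open>HOL-Library.Function_Algebras\<close>.
\<close>

definition scale_fun :: "complex \<Rightarrow> ('a \<Rightarrow> complex) \<Rightarrow> ('a \<Rightarrow> complex)" where
  "scale_fun c f = (\<lambda>x. c * f x)"

interpretation fun_space: vector_space "scale_fun :: complex \<Rightarrow> ('a \<Rightarrow> complex) \<Rightarrow> ('a \<Rightarrow> complex)"
  by standard (auto simp: scale_fun_def fun_eq_iff algebra_simps)

definition linear_operator_on ::
    "('a \<Rightarrow> complex) set \<Rightarrow> (('a \<Rightarrow> complex) \<Rightarrow> ('a \<Rightarrow> complex)) \<Rightarrow> bool" where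
  "linear_operator_on H T \<longleftrightarrow>
     (\<forall>f\<in>H. T f \<in> H) \<and>
     (\<forall>f\<in>H. \<forall>g\<in>H. T (f + g) = T f + T g) \<and>
     (\<forall>c. \<forall>f\<in>H. T (scale_fun c f) = scale_fun c (T f))"

definition ip_norm ::
    "(('a \<Rightarrow> complex) \<Rightarrow> ('a \<Rightarrow> complex) \<Rightarrow> complex) \<Rightarrow> ('a \<Rightarrow> complex) \<Rightarrow> real" where
  "ip_norm ip f = sqrt (Re (ip f f))"

definition compact_operator_on ::
    "('a \<Rightarrow> complex) set \<Rightarrow> (('a \<Rightarrow> complex) \<Rightarrow> ('a \<Rightarrow> complex) \<Rightarrow> complex) \<Rightarrow>
     (('a \<Rightarrow> complex) \<Rightarrow> ('a \<Rightarrow> complex)) \<Rightarrow> bool" where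
  "compact_operator_on H ip T \<longleftrightarrow>
     linear_operator_on H T \<and>
     (\<forall>f B. (\<forall>n::nat. f n \<in> H \<and> ip_norm ip (f n) \<le> B) \<longrightarrow>
        (\<exists>r g. strict_mono r \<and> g \<in> H \<and> (\<lambda>n. ip_norm ip (T (f (r n)) - g)) \<longlonglongrightarrow> 0))"

definition adjoint_on ::
    "('a \<Rightarrow> complex) set \<Rightarrow> (('a \<Rightarrow> complex) \<Rightarrow> ('a \<Rightarrow> complex) \<Rightarrow> complex) \<Rightarrow>
     (('a \<Rightarrow> complex) \<Rightarrow> ('a \<Rightarrow> complex)) \<Rightarrow> ('a \<Rightarrow> complex) \<Rightarrow> ('a \<Rightarrow> complex)" where
  "adjoint_on H ip T g = (THE h. h \<in> H \<and> (\<forall>f\<in>H. ip (T f) g = ip f h))"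

definition eigenspace ::
    "('a \<Rightarrow> complex) set \<Rightarrow> (('a \<Rightarrow> complex) \<Rightarrow> ('a \<Rightarrow> complex)) \<Rightarrow> complex \<Rightarrow> ('a \<Rightarrow> complex) set" where
  "eigenspace H S l = {f \<in> H. S f = scale_fun l f}"

text \<open>
  The decreasing sequence of the square roots of the nonzero eigenvalues of \<open>T\<^sup>* T\<close>, each repeated
  according to its multiplicity and followed by zeros if there are only finitely many. It is used
  for compact \<open>T\<close> only, where the eigenspaces involved are finite-dimensional.
\<close>

definition singular_numbers ::
    "('a \<Rightarrow> complex) set \<Rightarrow> (('a \<Rightarrow> complex) \<Rightarrow> ('a \<Rightarrow> complex) \<Rightarrow> complex) \<Rightarrow>
     (('a \<Rightarrow> complex) \<Rightarrow> ('a \<Rightarrow> complex)) \<Rightarrow> (nat \<Rightarrow> real) \<Rightarrow> bool" where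
  "singular_numbers H ip T s \<longleftrightarrow>
     decseq s \<and> (\<forall>n. 0 \<le> s n) \<and>
     (\<forall>l>0. finite {n. s n = sqrt l} \<and>
        card {n. s n = sqrt l} = fun_space.dim (eigenspace H (adjoint_on H ip T \<circ> T) (of_real l)))"

definition schatten_class ::
    "('a \<Rightarrow> complex) set \<Rightarrow> (('a \<Rightarrow> complex) \<Rightarrow> ('a \<Rightarrow> complex) \<Rightarrow> complex) \<Rightarrow> real \<Rightarrow>
     (('a \<Rightarrow> complex) \<Rightarrow> ('a \<Rightarrow> complex)) set" where
  "schatten_class H ip p =
     {T. compact_operator_on H ip T \<and>
         (\<exists>s. singular_numbers H ip T s \<and> summable (\<lambda>n. s n powr p))}"


section \<open>Weights on the unit disk\<close>

abbreviation disc :: "complex set" ("\<D>") where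
  "\<D> \<equiv> ball 0 1"

definition area :: "complex measure" where
  "area = scale_measure (ennreal (1 / pi)) (restrict_space lborel \<D>)"

definition weight :: "(complex \<Rightarrow> real) \<Rightarrow> bool" where
  "weight \<omega> \<longleftrightarrow> (\<forall>z\<in>\<D>. 0 < \<omega> z) \<and> integrable area \<omega>"

definition radial :: "(complex \<Rightarrow> real) \<Rightarrow> bool" where
  "radial f \<longleftrightarrow> (\<forall>z\<in>\<D>. f z = f (of_real (norm z)))"

definition profile :: "(complex \<Rightarrow> real) \<Rightarrow> real \<Rightarrow> real" where
  "profile f r = f (of_real r)"

definition radial_decreasing :: "(complex \<Rightarrow> real) \<Rightarrow> bool" where
  "radial_decreasing f \<longleftrightarrow> radial f \<and> antimono_on {0..<1} (profile f)"

definition partial_deriv :: "complex \<Rightarrow> (complex \<Rightarrow> real) \<Rightarrow> complex \<Rightarrow> real" where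
  "partial_deriv v f z = deriv (\<lambda>t::real. f (z + t *\<^sub>R v)) 0"

text \<open>The basis of \<^typ>\<open>complex\<close> as a real space is \<open>{1, \<i>}\<close>.\<close>

definition C1_on :: "complex set \<Rightarrow> (complex \<Rightarrow> real) \<Rightarrow> bool" where
  "C1_on S f \<longleftrightarrow>
     (\<forall>v\<in>Basis. (\<forall>z\<in>S. (\<lambda>t::real. f (z + t *\<^sub>R v)) differentiable (at 0)) \<and>
                 continuous_on S (partial_deriv v f))"

definition C2_on :: "complex set \<Rightarrow> (complex \<Rightarrow> real) \<Rightarrow> bool" where
  "C2_on S f \<longleftrightarrow> C1_on S f \<and> (\<forall>v\<in>Basis. C1_on S (partial_deriv v f))"

definition laplacian :: "(complex \<Rightarrow> real) \<Rightarrow> complex \<Rightarrow> real" where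
  "laplacian f z = (\<Sum>v\<in>Basis. partial_deriv v (partial_deriv v f) z)"

definition class_L_with :: "(complex \<Rightarrow> real) \<Rightarrow> real \<Rightarrow> real \<Rightarrow> bool" where
  "class_L_with \<tau> c1 c2 \<longleftrightarrow>
     0 < c1 \<and> 0 < c2 \<and>
     (\<forall>z\<in>\<D>. \<tau> z \<le> c1 * (1 - norm z)) \<and>
     (\<forall>z\<in>\<D>. \<forall>\<zeta>\<in>\<D>. \<bar>\<tau> z - \<tau> \<zeta>\<bar> \<le> c2 * norm (z - \<zeta>))"

definition class_L :: "(complex \<Rightarrow> real) \<Rightarrow> bool" where
  "class_L \<tau> \<longleftrightarrow> (\<exists>c1 c2. class_L_with \<tau> c1 c2)"

definition m_tau :: "real \<Rightarrow> real \<Rightarrow> real" where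
  "m_tau c1 c2 = (1/4) * min 1 (min (inverse c1) (inverse c2))"

text \<open>
  Positivity of \<open>\<Delta>\<phi>\<close> is implicit in its power with exponent \<open>-1/2\<close>; it is made explicit because
  \<^const>\<open>powr\<close> is total. A limit of \<open>\<tau>'\<close> at \<open>1\<close> presupposes that \<open>\<tau>\<close> is differentiable near \<open>1\<close>.
\<close>

definition class_W :: "(complex \<Rightarrow> real) \<Rightarrow> (complex \<Rightarrow> real) \<Rightarrow> bool" where
  "class_W \<omega> \<tau> \<longleftrightarrow>
     weight \<omega> \<and> radial_decreasing \<omega> \<and>
     (\<exists>\<phi>. C2_on \<D> \<phi> \<and> radial \<phi> \<and> (\<forall>z\<in>\<D>. \<omega> z = exp (- 2 * \<phi> z)) \<and>
        (\<forall>z\<in>\<D>. 0 < laplacian \<phi> z) \<and>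
        (\<exists>C>0. \<forall>z\<in>\<D>. laplacian \<phi> z powr (-1/2) \<le> C * \<tau> z) \<and>
        (\<exists>C>0. \<forall>z\<in>\<D>. \<tau> z \<le> C * laplacian \<phi> z powr (-1/2))) \<and>
     (\<forall>z\<in>\<D>. 0 < \<tau> z) \<and> radial_decreasing \<tau> \<and>
     (profile \<tau> \<longlongrightarrow> 0) (at_left 1) \<and>
     (\<forall>\<^sub>F r in at_left 1. profile \<tau> differentiable (at r)) \<and>
     (deriv (profile \<tau>) \<longlongrightarrow> 0) (at_left 1) \<and>
     ((\<exists>C>0. \<exists>r0\<in>{0..<1}. mono_on {r0..<1} (\<lambda>r. profile \<tau> r * (1 - r) powr (- C))) \<or>
      ((\<lambda>r. deriv (profile \<tau>) r * ln (1 / profile \<tau> r)) \<longlongrightarrow> 0) (at_left 1)) \<and>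
     class_L \<tau>"


section \<open>Weighted Bergman spaces and Toeplitz operators\<close>

text \<open>
  Analytic functions on the disk are represented by functions vanishing outside it, so that equality
  of elements of the space is equality on the disk.
\<close>

definition bergman :: "(complex \<Rightarrow> real) \<Rightarrow> (complex \<Rightarrow> complex) set" where
  "bergman \<omega> = {f. f holomorphic_on \<D> \<and> (\<forall>z. z \<notin> \<D> \<longrightarrow> f z = 0) \<and>
                   integrable area (\<lambda>z. (norm (f z))\<^sup>2 * \<omega> z)}"

definition bergman_inner ::
    "(complex \<Rightarrow> real) \<Rightarrow> (complex \<Rightarrow> complex) \<Rightarrow> (complex \<Rightarrow> complex) \<Rightarrow> complex" where
  "bergman_inner \<omega> f g = (LINT z|area. f z * cnj (g z) * of_real (\<omega> z))"

definition bergman_kernel :: "(complex \<Rightarrow> real) \<Rightarrow> complex \<Rightarrow> complex \<Rightarrow> complex" where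
  "bergman_kernel \<omega> z =
     (THE K. K \<in> bergman \<omega> \<and> (\<forall>f\<in>bergman \<omega>. f z = bergman_inner \<omega> f K))"

definition finite_borel_on_disc :: "complex measure \<Rightarrow> bool" where
  "finite_borel_on_disc \<mu> \<longleftrightarrow> sets \<mu> = sets (restrict_space borel \<D>) \<and> finite_measure \<mu>"

definition toeplitz ::
    "(complex \<Rightarrow> real) \<Rightarrow> complex measure \<Rightarrow> (complex \<Rightarrow> complex) \<Rightarrow> complex \<Rightarrow> complex" where
  "toeplitz \<omega> \<mu> f z =
     (if z \<in> \<D> then LINT \<xi>|\<mu>. f \<xi> * cnj (bergman_kernel \<omega> z \<xi>) * of_real (\<omega> \<xi>) else 0)"

text \<open>
  For a general finite \<open>\<mu>\<close> the integrals defining \<open>T\<^sub>\<mu> f\<close> need not converge, and the library's integral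
  is then \<open>0\<close>. Membership of \<open>T\<^sub>\<mu>\<close> in an operator class includes their convergence.
\<close>

definition toeplitz_converges :: "(complex \<Rightarrow> real) \<Rightarrow> complex measure \<Rightarrow> bool" where
  "toeplitz_converges \<omega> \<mu> \<longleftrightarrow>
     (\<forall>f\<in>bergman \<omega>. \<forall>z\<in>\<D>.
        integrable \<mu> (\<lambda>\<xi>. f \<xi> * cnj (bergman_kernel \<omega> z \<xi>) * of_real (\<omega> \<xi>)))"

definition averaging ::
    "(complex \<Rightarrow> real) \<Rightarrow> complex measure \<Rightarrow> real \<Rightarrow> complex \<Rightarrow> real" where
  "averaging \<tau> \<mu> \<delta> z = measure \<mu> (ball z (\<delta> * \<tau> z)) / (\<tau> z)\<^sup>2"

definition lambda_tau :: "(complex \<Rightarrow> real) \<Rightarrow> complex measure" where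
  "lambda_tau \<tau> = density area (\<lambda>z. ennreal (1 / (\<tau> z)\<^sup>2))"

definition Lp_space :: "'a measure \<Rightarrow> real \<Rightarrow> ('a \<Rightarrow> real) set" where
  "Lp_space M p = {f. f \<in> borel_measurable M \<and> integrable M (\<lambda>x. \<bar>f x\<bar> powr p)}"

end

theory Submission
  imports Defs
begin

text \<open>
  No estimate of the reproducing kernel is needed: the singular numbers \<open>s k\<close> of the positive operator
  \<open>T\<close> are compared by the min-max principle with the values of the averaging function, through the energy
  form \<open>\<langle>T f, f\<rangle> = \<integral> \<bar>f\<bar>\<^sup>2 \<omega> d\<mu>\<close>, for all \<open>p\<close> at once.

  Upper bound. Near \<open>a\<close> the weight is comparable to the squared modulus of a zero-free holomorphic function
  on a disc of radius comparable to \<open>\<tau> a\<close>. If \<open>f\<close>, divided by this function, vanishes to order \<open>k\<close> at a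
  lattice point \<open>a\<close>, then \<open>\<bar>f\<bar>\<^sup>2 \<omega>\<close> on the cell of \<open>a\<close> is smaller by a factor \<open>4\<^sup>-\<^sup>k\<close> than its local mean.
  Prescribing zeros of a suitable finite order at those \<open>a\<close> where the average is large gives
  \<open>\<langle>T f, f\<rangle> \<le> t \<parallel>f\<parallel>\<^sup>2\<close> on a subspace whose codimension is the number of pairs \<open>(a, j)\<close> with
  \<open>C 4\<^sup>-\<^sup>j avg a > t\<close>; the geometric factor makes the sum over \<open>j\<close> of the \<open>p\<close>-th powers harmless.

  Lower bound. Explicit functions \<open>(z / a)\<^sup>n\<close> times the fourth power of an averaged geometric sum are
  concentrated at \<open>a\<close> on the scale \<open>\<tau> a\<close>. On a set of points of large separation where the average exceeds
  \<open>t\<close>, their span satisfies \<open>\<langle>T f, f\<rangle> \<ge> c t \<parallel>f\<parallel>\<^sup>2\<close>, so the number of such points is at most the number of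
  \<open>k\<close> with \<open>s k \<ge> c t\<close>. A layer-cake integration over \<open>t\<close> concludes.
\<close>

section \<open>Hilbert spaces of functions and compact positive operators\<close>

text \<open>Counting singular values above a level t, instead of comparing norms, removes the
  distinction between p < 1 and p >= 1: neither convexity nor duality enters. High-order zeros are
  used because one zero at a lattice point gains only a fixed factor, while the average there may
  exceed t by any factor; the order grows with the logarithm of their ratio. The obstacle in the
  lower bound is that \<tau> may differ greatly between distant points. The Schur tests sum over
  either of two points, so the test functions must decay like the minimum of both values of \<tau>;
  the factor \<open>\<tau> z / \<tau> a\<close> is paid for by the convexity of the profile and the
  smallness of the derivative of \<tau> near the boundary. Fourth powers suffice: after a square is
  spent on the area of discs, a dyadic series with ratio 1/4 remains. Finally, the operator is given
  by integrals, and its form is the energy on the whole space once the embedding into L2 of \<omega>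
  \<mu> is bounded; each direction proves this boundedness before it uses the spectral
  sequence.\<close>

lemma minus_eq_add_scale: "f - g = f + scale_fun (-1) g"
  by (auto simp: scale_fun_def fun_eq_iff)

text \<open>The Bergman space is a set of functions, not a type, so the Hilbert space axioms are
  relative to a carrier. Completeness is stated with sequences, the form in which minimizing and
  approximating sequences use it.\<close>

locale fun_hilbert =
  fixes H :: "('a \<Rightarrow> complex) set"
    and ip :: "('a \<Rightarrow> complex) \<Rightarrow> ('a \<Rightarrow> complex) \<Rightarrow> complex"
  assumes zero_in: "0 \<in> H"
    and add_in: "f \<in> H \<Longrightarrow> g \<in> H \<Longrightarrow> f + g \<in> H"
    and scale_in: "f \<in> H \<Longrightarrow> scale_fun c f \<in> H"
    and ip_add_left: "f \<in> H \<Longrightarrow> g \<in> H \<Longrightarrow> h \<in> H \<Longrightarrow> ip (f + g) h = ip f h + ip g h"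
    and ip_scale_left: "f \<in> H \<Longrightarrow> h \<in> H \<Longrightarrow> ip (scale_fun c f) h = c * ip f h"
    and ip_commute: "f \<in> H \<Longrightarrow> g \<in> H \<Longrightarrow> ip g f = cnj (ip f g)"
    and ip_self_ge_0: "f \<in> H \<Longrightarrow> 0 \<le> Re (ip f f)"
    and ip_self_eq_0: "f \<in> H \<Longrightarrow> ip f f = 0 \<Longrightarrow> f = 0"
    and complete: "(\<And>n. X n \<in> H) \<Longrightarrow>
       (\<And>e. 0 < e \<Longrightarrow> \<exists>N. \<forall>m\<ge>N. \<forall>n\<ge>N. ip_norm ip (X m - X n) < e) \<Longrightarrow>
       \<exists>g\<in>H. (\<lambda>n. ip_norm ip (X n - g)) \<longlonglongrightarrow> 0"
begin

abbreviation nrm :: "('a \<Rightarrow> complex) \<Rightarrow> real" where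
  "nrm \<equiv> ip_norm ip"

lemma diff_in: "f \<in> H \<Longrightarrow> g \<in> H \<Longrightarrow> f - g \<in> H"
  by (simp only: minus_eq_add_scale add_in scale_in)

lemma sum_in: "(\<And>i. i \<in> A \<Longrightarrow> f i \<in> H) \<Longrightarrow> (\<Sum>i\<in>A. f i) \<in> H"
  by (induction A rule: infinite_finite_induct) (auto simp: zero_in[unfolded zero_fun_def] zero_in add_in)

lemma ip_add_right: "f \<in> H \<Longrightarrow> g \<in> H \<Longrightarrow> h \<in> H \<Longrightarrow> ip h (f + g) = ip h f + ip h g"
  by (metis add_in complex_cnj_add ip_add_left ip_commute)

lemma ip_scale_right: "f \<in> H \<Longrightarrow> h \<in> H \<Longrightarrow> ip h (scale_fun c f) = cnj c * ip h f"
  by (metis scale_in complex_cnj_mult ip_scale_left ip_commute)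

lemma ip_diff_left: "f \<in> H \<Longrightarrow> g \<in> H \<Longrightarrow> h \<in> H \<Longrightarrow> ip (f - g) h = ip f h - ip g h"
  by (simp only: minus_eq_add_scale ip_add_left ip_scale_left scale_in) simp

lemma ip_diff_right: "f \<in> H \<Longrightarrow> g \<in> H \<Longrightarrow> h \<in> H \<Longrightarrow> ip h (f - g) = ip h f - ip h g"
  by (simp only: minus_eq_add_scale ip_add_right ip_scale_right scale_in) simp

lemma ip_zero_left: "h \<in> H \<Longrightarrow> ip 0 h = 0"
  using ip_diff_left[of h h h] by simp

lemma ip_zero_right: "h \<in> H \<Longrightarrow> ip h 0 = 0"
  using ip_diff_right[of h h h] by simp

lemma ip_sum_left: "(\<And>i. i \<in> A \<Longrightarrow> f i \<in> H) \<Longrightarrow> h \<in> H \<Longrightarrow> ip (\<Sum>i\<in>A. f i) h = (\<Sum>i\<in>A. ip (f i) h)"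
  by (induction A rule: infinite_finite_induct)
    (auto simp: ip_zero_left[unfolded zero_fun_def] ip_zero_left ip_add_left sum_in)

lemma ip_sum_right: "(\<And>i. i \<in> A \<Longrightarrow> f i \<in> H) \<Longrightarrow> h \<in> H \<Longrightarrow> ip h (\<Sum>i\<in>A. f i) = (\<Sum>i\<in>A. ip h (f i))"
  by (induction A rule: infinite_finite_induct)
    (auto simp: ip_zero_right[unfolded zero_fun_def] ip_zero_right ip_add_right sum_in)

lemma ip_self: "f \<in> H \<Longrightarrow> ip f f = of_real ((nrm f)\<^sup>2)"
proof -
  assume f: "f \<in> H"
  have "Im (ip f f) = 0"
    using ip_commute[OF f f] by (metis complex_cnj cancel_comm_monoid_add_class.diff_cancel complex.sel(2) 
      equation_minus_iff  neg_equal_zero cnj.simps(2))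
  then show ?thesis
    using ip_self_ge_0[OF f] by (simp add: ip_norm_def complex_eq_iff)
qed

lemma nrm_ge_0: "f \<in> H \<Longrightarrow> 0 \<le> nrm f"
  by (simp add: ip_norm_def ip_self_ge_0)

lemma nrm_sq: "f \<in> H \<Longrightarrow> (nrm f)\<^sup>2 = Re (ip f f)"
  by (simp add: ip_norm_def ip_self_ge_0)

lemma nrm_eq_0: "f \<in> H \<Longrightarrow> nrm f = 0 \<Longrightarrow> f = 0"
  using ip_self[of f] ip_self_eq_0[of f] by simp

lemma nrm_zero: "nrm 0 = 0"
  by (simp add: ip_norm_def ip_zero_left zero_in)

lemma nrm_scale: "f \<in> H \<Longrightarrow> nrm (scale_fun c f) = cmod c * nrm f"
proof -
  assume f: "f \<in> H"
  have "(nrm (scale_fun c f))\<^sup>2 = (cmod c * nrm f)\<^sup>2"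
    using f ip_self[of f] scale_in[OF f, of c]
    by (simp add: nrm_sq ip_scale_left ip_scale_right power_mult_distrib cmod_power2)
       (simp add: algebra_simps power2_eq_square)
  then show ?thesis
    using f scale_in[OF f, of c] nrm_ge_0 by (simp add: nrm_ge_0)
qed

lemma nrm_minus_commute: "f \<in> H \<Longrightarrow> g \<in> H \<Longrightarrow> nrm (f - g) = nrm (g - f)"
proof -
  assume "f \<in> H" "g \<in> H"
  moreover have "f - g = scale_fun (-1) (g - f)"
    by (auto simp: scale_fun_def fun_eq_iff)
  ultimately show ?thesis
    by (metis nrm_scale diff_in norm_minus_cancel norm_one mult_1)
qed

lemma nrm_add_sq:
  "f \<in> H \<Longrightarrow> g \<in> H \<Longrightarrow> (nrm (f + g))\<^sup>2 = (nrm f)\<^sup>2 + 2 * Re (ip f g) + (nrm g)\<^sup>2"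
  using ip_commute[of f g] by (simp add: nrm_sq add_in ip_add_left ip_add_right)

lemma nrm_diff_sq:
  "f \<in> H \<Longrightarrow> g \<in> H \<Longrightarrow> (nrm (f - g))\<^sup>2 = (nrm f)\<^sup>2 - 2 * Re (ip f g) + (nrm g)\<^sup>2"
  using ip_commute[of f g] by (simp add: nrm_sq diff_in ip_diff_left ip_diff_right)

end

text \<open>Stated for semidefinite forms because it is also applied to \<open>\<langle>T f, g\<rangle>\<close>.\<close>

lemma semidefinite_Cauchy_Schwarz:
  fixes q :: "('a \<Rightarrow> complex) \<Rightarrow> ('a \<Rightarrow> complex) \<Rightarrow> complex"
  assumes sub: "\<And>c d. scale_fun c f + scale_fun d g \<in> V"
    and nonneg: "\<And>h. h \<in> V \<Longrightarrow> 0 \<le> Re (q h h)"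
    and expand: "\<And>c d. q (scale_fun c f + scale_fun d g) (scale_fun c f + scale_fun d g) =
       c * cnj c * q f f + c * cnj d * q f g + d * cnj c * q g f + d * cnj d * q g g"
    and herm: "q g f = cnj (q f g)" "Im (q f f) = 0" "Im (q g g) = 0"
  shows "(cmod (q f g))\<^sup>2 \<le> Re (q f f) * Re (q g g)"
proof -
  define A B C where "A = Re (q f f)" and "B = q f g" and "C = Re (q g g)"
  have ff: "q f f = of_real A" and gg: "q g g = of_real C"
    using herm by (simp_all add: A_def C_def complex_eq_iff)
  have *: "0 \<le> Re (c * cnj c) * A + 2 * Re (c * cnj d * B) + Re (d * cnj d) * C" for c d
  proof -
    have "0 \<le> Re (c * cnj c * of_real A + c * cnj d * B + d * cnj c * cnj B + d * cnj d * of_real C)"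
      using nonneg[OF sub[of c d]] unfolding expand ff gg B_def herm(1) by simp
    also have "d * cnj c * cnj B = cnj (c * cnj d * B)"
      by simp
    finally show ?thesis
      by (simp add: algebra_simps)
  qed
  \<comment> \<open>Choosing \<open>c = - of_real t * cnj B\<close> aligns the phase of the mixed
    term and leaves a real quadratic polynomial in t.\<close>
  have CB: "0 \<le> t\<^sup>2 * (cmod B)\<^sup>2 * A - 2 * t * (cmod B)\<^sup>2 + C" for t :: real
    using *[of "- of_real t * cnj B" 1]
    by (simp only: cmod_power2) (simp add: algebra_simps power2_eq_square)
  have A0: "0 \<le> A"
    using *[of 1 0] by simp
  have C0: "0 \<le> C"
    using *[of 0 1] by simp
  show ?thesis
  proof (cases "A = 0")
    case True
    have "B = 0"
    proof (rule ccontr)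
      assume "B \<noteq> 0"
      then have "0 < (cmod B)\<^sup>2" by simp
      \<comment> \<open>For \<open>A = 0\<close> the polynomial is affine in t with negative slope;
        this t makes its value \<open>- C - 2\<close>.\<close>
      then have "0 \<le> C - 2 * (C + 1)"
        using CB[of "(C + 1) / (cmod B)\<^sup>2"] True by simp
      with C0 show False by simp
    qed
    then show ?thesis
      using True by (simp add: A_def[symmetric] B_def[symmetric])
  next
    case False
    then have "A > 0" using A0 by simp
    have "0 \<le> A * (- ((cmod B)\<^sup>2 / A) + C)"
      using mult_nonneg_nonneg[OF A0 CB[of "1 / A"]] \<open>A > 0\<close>
      by (simp add: power2_eq_square field_simps)
    then show ?thesis
      using \<open>A > 0\<close> by (simp add: A_def[symmetric] B_def[symmetric] C_def[symmetric] algebra_simps)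
  qed
qed

context fun_hilbert
begin

lemma Cauchy_Schwarz:
  assumes "f \<in> H" "g \<in> H"
  shows "cmod (ip f g) \<le> nrm f * nrm g"
proof -
  have "(cmod (ip f g))\<^sup>2 \<le> Re (ip f f) * Re (ip g g)"
  proof (rule semidefinite_Cauchy_Schwarz[where V = H])
    fix c d
    show "ip (scale_fun c f + scale_fun d g) (scale_fun c f + scale_fun d g) =
       c * cnj c * ip f f + c * cnj d * ip f g + d * cnj c * ip g f + d * cnj d * ip g g"
      using assms by (simp add: ip_add_left ip_add_right ip_scale_left ip_scale_right add_in scale_in algebra_simps)
  qed (use assms in \<open>auto simp: add_in scale_in ip_self_ge_0 ip_commute[of f g] ip_self\<close>)
  also have "\<dots> = (nrm f * nrm g)\<^sup>2"
    using assms by (simp add: nrm_sq power_mult_distrib)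
  finally show ?thesis
    using assms by (meson mult_nonneg_nonneg nrm_ge_0 power2_le_imp_le)
qed

lemma nrm_triangle:
  assumes "f \<in> H" "g \<in> H"
  shows "nrm (f + g) \<le> nrm f + nrm g"
proof (rule power2_le_imp_le)
  have "Re (ip f g) \<le> nrm f * nrm g"
    using Cauchy_Schwarz[OF assms] complex_Re_le_cmod order_trans by blast
  then show "(nrm (f + g))\<^sup>2 \<le> (nrm f + nrm g)\<^sup>2"
    using assms by (simp add: nrm_add_sq power2_sum)
qed (use assms nrm_ge_0 in auto)

lemma nrm_triangle_diff:
  assumes "f \<in> H" "g \<in> H" "h \<in> H"
  shows "nrm (f - h) \<le> nrm (f - g) + nrm (g - h)"
  using nrm_triangle[of "f - g" "g - h"] assms by (simp add: diff_in)

lemma nrm_diff_ge: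
  assumes "f \<in> H" "g \<in> H"
  shows "\<bar>nrm f - nrm g\<bar> \<le> nrm (f - g)"
  using nrm_triangle[of "f - g" g] nrm_triangle[of "g - f" f] assms nrm_minus_commute[of f g]
  by (simp add: diff_in)

lemma ip_tendsto:
  assumes "\<And>n. X n \<in> H" "g \<in> H" "h \<in> H" "(\<lambda>n. nrm (X n - g)) \<longlonglongrightarrow> 0"
  shows "(\<lambda>n. ip (X n) h) \<longlonglongrightarrow> ip g h"
proof -
  have "(\<lambda>n. ip (X n) h - ip g h) \<longlonglongrightarrow> 0"
  proof (rule Lim_null_comparison)
    show "\<forall>\<^sub>F n in sequentially. cmod (ip (X n) h - ip g h) \<le> nrm (X n - g) * nrm h"
      using assms Cauchy_Schwarz diff_in by (intro always_eventually) (auto simp flip: ip_diff_left)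
    show "(\<lambda>n. nrm (X n - g) * nrm h) \<longlonglongrightarrow> 0"
      using tendsto_mult_right[OF assms(4), of "nrm h"] by simp
  qed
  then show ?thesis
    using LIM_zero_iff by blast
qed

lemma nrm_tendsto:
  assumes "\<And>n. X n \<in> H" "g \<in> H" "(\<lambda>n. nrm (X n - g)) \<longlonglongrightarrow> 0"
  shows "(\<lambda>n. nrm (X n)) \<longlonglongrightarrow> nrm g"
proof -
  have "(\<lambda>n. nrm (X n) - nrm g) \<longlonglongrightarrow> 0"
    by (rule Lim_null_comparison[OF _ assms(3)])
      (use assms nrm_diff_ge in \<open>auto intro!: always_eventually\<close>)
  then show ?thesis
    using LIM_zero_iff by blast
qed

text \<open>M is not assumed closed, so the projection g lies in its closure and is delivered
  together with a sequence of M approximating it. Applied to the kernel of a functional it yields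
  the Riesz representation, applied to the span of the reproducing kernels it yields
  density.\<close>

lemma projection_exists:
  assumes sub: "M \<subseteq> H" "M \<noteq> {}" "\<And>f g. f \<in> M \<Longrightarrow> g \<in> M \<Longrightarrow> f + g \<in> M"
      "\<And>c f. f \<in> M \<Longrightarrow> scale_fun c f \<in> M"
    and f: "f \<in> H"
  obtains X g where "\<And>n::nat. X n \<in> M" "g \<in> H" "(\<lambda>n. nrm (X n - g)) \<longlonglongrightarrow> 0"
    "\<And>h. h \<in> M \<Longrightarrow> ip (f - g) h = 0"
proof -
  define d where "d = Inf ((\<lambda>h. nrm (f - h)) ` M)"
  have bdd: "bdd_below ((\<lambda>h. nrm (f - h)) ` M)"
    using sub f by (intro bdd_belowI[of _ 0]) (auto intro!: nrm_ge_0 diff_in)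
  have d_le: "d \<le> nrm (f - h)" if "h \<in> M" for h
    unfolding d_def using that by (intro cInf_lower bdd) auto
  have d0: "0 \<le> d"
    unfolding d_def using sub f by (intro cInf_greatest) (auto intro!: nrm_ge_0 diff_in)
  have "\<exists>h\<in>M. nrm (f - h) < d + 1 / real (Suc n)" for n
  proof -
    have "Inf ((\<lambda>h. nrm (f - h)) ` M) < d + 1 / real (Suc n)"
      by (simp add: d_def[symmetric])
    then show ?thesis
      using cInf_lessD[of "(\<lambda>h. nrm (f - h)) ` M"] sub by auto
  qed
  then obtain X where X: "\<And>n. X n \<in> M" "\<And>n. nrm (f - X n) < d + 1 / real (Suc n)"
    by metis
  have XH: "X n \<in> H" for n
    using X sub by auto
  \<comment> \<open>Parallelogram law: the midpoint of \<open>X m\<close> and \<open>X n\<close>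
    lies in M and is no closer to f than d, so a minimizing sequence is Cauchy.\<close>
  have par: "(nrm (X m - X n))\<^sup>2 \<le> 2 * (nrm (f - X m))\<^sup>2 + 2 * (nrm (f - X n))\<^sup>2 - 4 * d\<^sup>2" for m n
  proof -
    define u v where "u = f - X m" and "v = f - X n"
    have uv: "u \<in> H" "v \<in> H"
      using XH f by (auto simp: u_def v_def diff_in)
    have mid: "scale_fun (1/2) (X m + X n) \<in> M"
      using X sub by auto
    have "u + v = scale_fun 2 (f - scale_fun (1/2) (X m + X n))"
      by (auto simp: u_def v_def scale_fun_def fun_eq_iff field_simps)
    then have "nrm (u + v) = 2 * nrm (f - scale_fun (1/2) (X m + X n))"
      using mid sub f by (simp add: nrm_scale diff_in subset_iff)
    then have "2 * d \<le> nrm (u + v)"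
      using d_le[OF mid] by simp
    then have "(2 * d)\<^sup>2 \<le> (nrm (u + v))\<^sup>2"
      using d0 by (intro power_mono) auto
    moreover have "v - u = X m - X n"
      by (auto simp: u_def v_def fun_eq_iff)
    moreover have "(nrm (u + v))\<^sup>2 + (nrm (v - u))\<^sup>2 = 2 * (nrm u)\<^sup>2 + 2 * (nrm v)\<^sup>2"
      using uv ip_commute[OF uv] by (simp add: nrm_add_sq nrm_diff_sq)
    ultimately show ?thesis
      by (simp add: u_def v_def power2_eq_square)
  qed
  have lim: "(\<lambda>n. nrm (f - X n)) \<longlonglongrightarrow> d"
  proof (rule tendsto_sandwich[where f = "\<lambda>_. d"])
    show "(\<lambda>n. d + 1 / real (Suc n)) \<longlonglongrightarrow> d"
      using tendsto_add[OF tendsto_const[of d] LIMSEQ_inverse_real_of_nat] by (simp add: inverse_eq_divide)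
    show "\<forall>\<^sub>F n in sequentially. nrm (f - X n) \<le> d + 1 / real (Suc n)"
      using X(2) less_imp_le by (intro always_eventually) blast
    show "\<forall>\<^sub>F n in sequentially. d \<le> nrm (f - X n)"
      using X(1) d_le by (intro always_eventually) blast
  qed simp
  have "\<exists>g\<in>H. (\<lambda>n. nrm (X n - g)) \<longlonglongrightarrow> 0"
  proof (rule complete[OF XH])
    fix e :: real assume "0 < e"
    have "(\<lambda>n. (nrm (f - X n))\<^sup>2) \<longlonglongrightarrow> d\<^sup>2"
      by (intro tendsto_power lim)
    moreover have "d\<^sup>2 < d\<^sup>2 + e\<^sup>2 / 4"
      using \<open>0 < e\<close> by simp
    ultimately have "\<forall>\<^sub>F n in sequentially. (nrm (f - X n))\<^sup>2 < d\<^sup>2 + e\<^sup>2 / 4"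
      by (rule order_tendstoD)
    then obtain N where N: "\<And>n. n \<ge> N \<Longrightarrow> (nrm (f - X n))\<^sup>2 < d\<^sup>2 + e\<^sup>2 / 4"
      by (auto simp: eventually_sequentially)
    have "nrm (X m - X n) < e" if "m \<ge> N" "n \<ge> N" for m n
    proof (rule power2_less_imp_less)
      show "(nrm (X m - X n))\<^sup>2 < e\<^sup>2"
        using par[of m n] N[OF that(1)] N[OF that(2)] by linarith
    qed (use \<open>0 < e\<close> in auto)
    then show "\<exists>N. \<forall>m\<ge>N. \<forall>n\<ge>N. nrm (X m - X n) < e"
      by blast
  qed
  then obtain g where g: "g \<in> H" "(\<lambda>n. nrm (X n - g)) \<longlonglongrightarrow> 0"
    by blast
  have orth: "ip (f - g) h = 0" if h: "h \<in> M" for h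
  proof -
    have hH: "h \<in> H" using h sub by auto
    define b where "b = ip (f - g) h"
    have fg: "f - g \<in> H" using f g diff_in by auto
    have dle: "d \<le> nrm (f - g - scale_fun c h)" for c
    proof -
      have "d \<le> nrm (f - g - scale_fun c h) + nrm (X n - g)" for n
      proof -
        have eq: "f - (X n + scale_fun c h) = (f - g - scale_fun c h) + (g - X n)"
          by (auto simp: fun_eq_iff)
        have "f - g - scale_fun c h \<in> H" "g - X n \<in> H"
          using fg g XH hH by (auto intro!: diff_in scale_in)
        then have "nrm (f - (X n + scale_fun c h)) \<le> nrm (f - g - scale_fun c h) + nrm (X n - g)"
          unfolding eq using nrm_triangle nrm_minus_commute[OF g(1) XH] by metis
        then show ?thesis
          using d_le[of "X n + scale_fun c h"] X h sub by force
      qed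
      then have "d \<le> nrm (f - g - scale_fun c h) + 0"
        by (intro LIMSEQ_le_const[OF tendsto_add[OF tendsto_const g(2)]]) auto
      then show ?thesis by simp
    qed
    have nd: "nrm (f - g) = d"
    proof -
      have "(\<lambda>n. nrm (f - X n)) \<longlonglongrightarrow> nrm (f - g)"
      proof (rule nrm_tendsto)
        have "f - X n - (f - g) = g - X n" for n by (auto simp: fun_eq_iff)
        then show "(\<lambda>n. nrm (f - X n - (f - g))) \<longlonglongrightarrow> 0"
          using g nrm_minus_commute[OF g(1) XH] by simp
      qed (use XH f g diff_in in auto)
      then show ?thesis using lim LIMSEQ_unique by blast
    qed
    \<comment> \<open>First variation: moving from g by \<open>t * b\<close> times h cannot come
      closer to f than d, for any real t.\<close>
    have "2 * t * (cmod b)\<^sup>2 \<le> t\<^sup>2 * (cmod b)\<^sup>2 * (nrm h)\<^sup>2" for t :: real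
    proof -
      define c where "c = of_real t * b"
      have "d\<^sup>2 \<le> (nrm (f - g - scale_fun c h))\<^sup>2"
        using dle[of c] d0 by (intro power_mono) auto
      also have "\<dots> = d\<^sup>2 - 2 * Re (cnj c * b) + (cmod c)\<^sup>2 * (nrm h)\<^sup>2"
        using fg hH by (subst nrm_diff_sq) (auto simp: scale_in nd ip_scale_right b_def nrm_scale power_mult_distrib)
      also have "Re (cnj c * b) = t * (cmod b)\<^sup>2"
        by (simp only: c_def cmod_power2) (simp add: power2_eq_square algebra_simps)
      finally show ?thesis
        by (simp add: c_def norm_mult power_mult_distrib)
    qed
    note q = this
    have "b = 0"
    proof (rule ccontr)
      assume "b \<noteq> 0"
      then have pos: "0 < (cmod b)\<^sup>2" by simp
      \<comment> \<open>The summand 1 keeps t defined for \<open>h = 0\<close> while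
        \<open>t * (nrm h)\<^sup>2\<close> stays below 2.\<close>
      define t where "t = 1 / ((nrm h)\<^sup>2 + 1)"
      have t: "0 < t" "t * (nrm h)\<^sup>2 \<le> 1"
        by (simp_all add: t_def divide_simps add_nonneg_pos)
      have "2 * (t * (cmod b)\<^sup>2) \<le> (t * (nrm h)\<^sup>2) * (t * (cmod b)\<^sup>2)"
        using q[of t] by (simp add: power2_eq_square mult_ac)
      then have "2 \<le> t * (nrm h)\<^sup>2"
        using t(1) pos mult_le_cancel_right_pos[of "t * (cmod b)\<^sup>2"] by (simp add: mult.commute)
      with t(2) show False by simp
    qed
    then show ?thesis by (simp add: b_def)
  qed
  show ?thesis
    by (rule that[OF X(1) g orth])
qed

text \<open>A vector u orthogonal to the kernel of L spans a complement of it, so L is a multiple of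
  the inner product with u. The bound enters through the closure of the kernel, on which L still
  vanishes.\<close>

lemma Riesz:
  assumes add: "\<And>f g. f \<in> H \<Longrightarrow> g \<in> H \<Longrightarrow> L (f + g) = L f + L g"
    and scale: "\<And>c f. f \<in> H \<Longrightarrow> L (scale_fun c f) = c * L f"
    and bound: "\<And>f. f \<in> H \<Longrightarrow> cmod (L f) \<le> C * nrm f"
  obtains k where "k \<in> H" "\<And>f. f \<in> H \<Longrightarrow> L f = ip f k"
proof (cases "\<forall>f\<in>H. L f = 0")
  case True
  then show ?thesis
    using that[of 0] by (simp add: zero_in ip_zero_right)
next
  case False
  then obtain f where f: "f \<in> H" "L f \<noteq> 0" by blast
  define M where "M = {h \<in> H. L h = 0}"
  have L0: "L 0 = 0"
    using scale[OF zero_in, of 0] by (simp add: scale_fun_def zero_fun_def)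
  obtain X g where X: "\<And>n::nat. X n \<in> M" and g: "g \<in> H" "(\<lambda>n. nrm (X n - g)) \<longlonglongrightarrow> 0"
    and orth: "\<And>h. h \<in> M \<Longrightarrow> ip (f - g) h = 0"
    by (rule projection_exists[of M f]) (use f L0 zero_in in \<open>auto simp: M_def add scale add_in scale_in\<close>)
  have Ld: "L (u - v) = L u - L v" if "u \<in> H" "v \<in> H" for u v
    using that by (simp only: minus_eq_add_scale add scale scale_in) simp
  have "L g = 0"
  proof -
    have "cmod (L g) \<le> C * nrm (X n - g)" for n
    proof -
      have "X n \<in> H" "L (X n) = 0" using X[of n] by (auto simp: M_def)
      then show ?thesis
        using bound[of "X n - g"] g by (simp add: Ld diff_in norm_minus_commute)
    qed
    then have "cmod (L g) \<le> C * 0"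
      by (intro LIMSEQ_le_const[OF tendsto_mult[OF tendsto_const g(2)]]) auto
    then show ?thesis by simp
  qed
  define u where "u = f - g"
  have u: "u \<in> H" "L u \<noteq> 0"
    using f g \<open>L g = 0\<close> by (auto simp: u_def diff_in Ld)
  have "u \<noteq> 0" using u L0 by auto
  then have nu: "nrm u \<noteq> 0" using nrm_eq_0 u by auto
  define k where "k = scale_fun (cnj (L u) / of_real ((nrm u)\<^sup>2)) u"
  have "L h = ip h k" if h: "h \<in> H" for h
  proof -
    define w where "w = h - scale_fun (L h / L u) u"
    have w: "w \<in> M"
      using h u by (simp add: w_def M_def diff_in scale_in Ld scale)
    then have "ip u w = 0"
      using orth by (simp add: u_def)
    then have "ip w u = 0"
      using w u ip_commute[of u w] by (simp add: M_def)
    then have "ip h u = L h / L u * of_real ((nrm u)\<^sup>2)"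
      using h u by (simp add: w_def ip_diff_left ip_scale_left scale_in ip_self)
    then show ?thesis
      using h u nu by (simp add: k_def ip_scale_right)
  qed
  moreover have "k \<in> H" by (simp add: k_def scale_in u)
  ultimately show ?thesis using that by blast
qed

end

text \<open>Gaussian elimination, one equation per induction step. In both halves of the min-max
  principle it supplies a nonzero combination that satisfies fewer linear conditions than it has
  coefficients.\<close>

lemma underdetermined_homogeneous_system:
  fixes A :: "'i \<Rightarrow> 'j \<Rightarrow> complex"
  assumes "finite I" "finite J" "card I < card J"
  shows "\<exists>c. (\<exists>j\<in>J. c j \<noteq> 0) \<and> (\<forall>i\<in>I. (\<Sum>j\<in>J. c j * A i j) = 0)"
  using assms
proof (induction I arbitrary: J A rule: finite_induct)
  case empty
  then obtain j where "j \<in> J" by fastforce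
  then show ?case
    by (intro exI[of _ "\<lambda>_. 1"]) auto
next
  case (insert i I)
  show ?case
  proof (cases "\<forall>j\<in>J. A i j = 0")
    case True
    obtain c where "\<exists>j\<in>J. c j \<noteq> 0" "\<forall>i\<in>I. (\<Sum>j\<in>J. c j * A i j) = 0"
      using insert.IH[of J A] insert.prems insert.hyps by auto
    then show ?thesis
      using True by (intro exI[of _ c]) auto
  next
    case False
    then obtain k where k: "k \<in> J" "A i k \<noteq> 0" by auto
    define A' where "A' = (\<lambda>l j. A l j - A l k * A i j / A i k)"
    have "card I < card (J - {k})"
      using insert.prems insert.hyps k by (simp add: card_Diff_singleton)
    then obtain c where c: "\<exists>j\<in>J - {k}. c j \<noteq> 0" "\<forall>l\<in>I. (\<Sum>j\<in>J - {k}. c j * A' l j) = 0"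
      using insert.IH[of "J - {k}" A'] insert.prems by auto
    define S where "S = (\<Sum>j\<in>J - {k}. c j * A i j)"
    \<comment> \<open>The eliminated unknown is solved from the pivot equation i; the reduced matrix
      \<open>A'\<close> is made so that the other equations survive this choice.\<close>
    define d where "d = c(k := - S / A i k)"
    have sum_d: "(\<Sum>j\<in>J. d j * B j) = (\<Sum>j\<in>J - {k}. c j * B j) - S / A i k * B k" for B
      using k insert.prems by (simp add: sum.remove[of J k] d_def)
    have "(\<Sum>j\<in>J. d j * A l j) = 0" if "l \<in> I" for l
    proof -
      have "0 = (\<Sum>j\<in>J - {k}. c j * A l j) - (\<Sum>j\<in>J - {k}. A l k / A i k * (c j * A i j))"
        using c(2) that by (simp add: A'_def algebra_simps sum_subtractf)
      also have "(\<Sum>j\<in>J - {k}. A l k / A i k * (c j * A i j)) = A l k / A i k * S"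
        by (simp add: S_def sum_distrib_left)
      finally show ?thesis
        by (simp add: sum_d)
    qed
    moreover have "(\<Sum>j\<in>J. d j * A i j) = 0"
      using k by (simp add: sum_d S_def[symmetric])
    moreover have "\<exists>j\<in>J. d j \<noteq> 0"
      using c(1) by (auto simp: d_def)
    ultimately show ?thesis
      by (intro exI[of _ d]) auto
  qed
qed

section \<open>Compact positive operators and their spectral sequence\<close>

locale compact_positive = fun_hilbert +
  fixes T :: "('a \<Rightarrow> complex) \<Rightarrow> ('a \<Rightarrow> complex)"
  assumes compact: "compact_operator_on H ip T"
    and selfadjoint: "f \<in> H \<Longrightarrow> g \<in> H \<Longrightarrow> ip (T f) g = ip f (T g)"
    and positive: "f \<in> H \<Longrightarrow> 0 \<le> Re (ip (T f) f)"

text \<open>\<open>compact_operator_on\<close> does not mention boundedness. It follows because unit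
  vectors \<open>G n\<close> with \<open>nrm (T (G n)) > n\<close> have no subsequence with
  convergent, hence bounded, images.\<close>

lemma (in fun_hilbert) compact_operator_bounded:
  assumes "compact_operator_on H ip T"
  obtains C where "0 \<le> C" "\<And>f. f \<in> H \<Longrightarrow> nrm (T f) \<le> C * nrm f"
proof -
  have lin: "f \<in> H \<Longrightarrow> T f \<in> H" "f \<in> H \<Longrightarrow> T (scale_fun c f) = scale_fun c (T f)" for f c
    using assms by (auto simp: compact_operator_on_def linear_operator_on_def)
  have "\<exists>C\<ge>0. \<forall>f\<in>H. nrm (T f) \<le> C * nrm f"
  proof (rule ccontr)
    assume "\<not> (\<exists>C\<ge>0. \<forall>f\<in>H. nrm (T f) \<le> C * nrm f)"
    then have "\<exists>f\<in>H. real n * nrm f < nrm (T f)" for n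
      by (metis not_le of_nat_0_le_iff)
    then obtain F where F: "\<And>n. F n \<in> H" "\<And>n. real n * nrm (F n) < nrm (T (F n))"
      by metis
    have pos: "0 < nrm (F n)" for n
    proof (rule ccontr)
      assume "\<not> 0 < nrm (F n)"
      then have "F n = 0" using nrm_ge_0[OF F(1)] nrm_eq_0[OF F(1)] by (simp add: order.antisym)
      then have "T (F n) = scale_fun 0 (T (F n))"
        using lin(2)[OF F(1)[of n], of 0] by simp
      then have "nrm (T (F n)) = 0"
        by (metis nrm_scale lin(1) F(1) norm_zero mult_zero_left)
      then show False using F(2)[of n] \<open>F n = 0\<close> nrm_zero by simp
    qed
    define G where "G n = scale_fun (of_real (1 / nrm (F n))) (F n)" for n
    have G: "G n \<in> H" "nrm (G n) = 1" for n
      using pos[of n] F(1) by (auto simp: G_def scale_in nrm_scale simp del: of_real_divide)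
    have TG: "real n < nrm (T (G n))" for n
      using pos[of n] F by (simp add: G_def lin nrm_scale divide_simps mult.commute del: of_real_divide)
    have "\<forall>n. G n \<in> H \<and> nrm (G n) \<le> 1"
      using G by auto
    then obtain r g where rg: "strict_mono r" "g \<in> H" "(\<lambda>n. nrm (T (G (r n)) - g)) \<longlonglongrightarrow> 0"
      using assms unfolding compact_operator_on_def by blast
    have "(\<lambda>n. nrm (T (G (r n)))) \<longlonglongrightarrow> nrm g"
      by (intro nrm_tendsto) (use rg G lin in auto)
    then obtain K where "\<And>n. norm (nrm (T (G (r n)))) \<le> K"
      using convergent_imp_Bseq BseqE by (metis convergent_def)
    then have "real (r n) \<le> K" for n
      using TG[of "r n"] by (smt (verit) real_norm_def)
    moreover obtain n where "K < real n" using reals_Archimedean2 by blast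
    moreover have "n \<le> r n" using rg(1) by (rule seq_suble)
    ultimately show False
      by (meson not_le of_nat_mono order_trans)
  qed
  then show ?thesis using that by blast
qed

context compact_positive
begin

lemma T_in: "f \<in> H \<Longrightarrow> T f \<in> H"
  and T_add: "f \<in> H \<Longrightarrow> g \<in> H \<Longrightarrow> T (f + g) = T f + T g"
  and T_scale: "f \<in> H \<Longrightarrow> T (scale_fun c f) = scale_fun c (T f)"
  using compact by (auto simp: compact_operator_on_def linear_operator_on_def)

lemma T_diff: "f \<in> H \<Longrightarrow> g \<in> H \<Longrightarrow> T (f - g) = T f - T g"
  by (simp only: minus_eq_add_scale T_add T_scale scale_in)

lemma T_zero: "T 0 = 0"
  using T_diff[OF zero_in zero_in] by simp

lemma T_sum: "(\<And>i. i \<in> A \<Longrightarrow> f i \<in> H) \<Longrightarrow> T (\<Sum>i\<in>A. f i) = (\<Sum>i\<in>A. T (f i))"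
  by (induction A rule: infinite_finite_induct)
    (auto simp: T_zero[unfolded zero_fun_def] T_zero T_add sum_in)

definition qf :: "('a \<Rightarrow> complex) \<Rightarrow> real" where
  "qf f = Re (ip (T f) f)"

lemma ip_T_self: "f \<in> H \<Longrightarrow> ip (T f) f = of_real (qf f)"
proof -
  assume f: "f \<in> H"
  have "cnj (ip (T f) f) = ip (T f) f"
    using selfadjoint[OF f f] ip_commute[OF T_in[OF f] f] by simp
  then show ?thesis
    by (simp add: qf_def complex_eq_iff)
qed

lemma qf_ge_0: "f \<in> H \<Longrightarrow> 0 \<le> qf f"
  by (simp add: qf_def positive)

lemma form_Cauchy_Schwarz:
  assumes "f \<in> H" "g \<in> H"
  shows "(cmod (ip (T f) g))\<^sup>2 \<le> qf f * qf g"
  unfolding qf_def[of f] qf_def[of g]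
proof (rule semidefinite_Cauchy_Schwarz[where V = H and q = "\<lambda>f g. ip (T f) g"])
  fix c d
  show "ip (T (scale_fun c f + scale_fun d g)) (scale_fun c f + scale_fun d g) =
     c * cnj c * ip (T f) f + c * cnj d * ip (T f) g + d * cnj c * ip (T g) f + d * cnj d * ip (T g) g"
    using assms by (simp add: T_add T_scale ip_add_left ip_add_right ip_scale_left ip_scale_right T_in add_in scale_in algebra_simps)
  show "ip (T g) f = cnj (ip (T f) g)"
    using assms selfadjoint[of f g] ip_commute[of f "T g"] T_in by simp
qed (use assms in \<open>auto simp: add_in scale_in ip_T_self qf_ge_0\<close>)

lemma T_tendsto:
  assumes "\<And>n. X n \<in> H" "g \<in> H" "(\<lambda>n. nrm (X n - g)) \<longlonglongrightarrow> 0"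
  shows "(\<lambda>n. nrm (T (X n) - T g)) \<longlonglongrightarrow> 0"
proof -
  obtain C where C: "0 \<le> C" "\<And>f. f \<in> H \<Longrightarrow> nrm (T f) \<le> C * nrm f"
    using compact_operator_bounded[OF compact] by blast
  show ?thesis
  proof (rule Lim_null_comparison)
    show "\<forall>\<^sub>F n in sequentially. norm (nrm (T (X n) - T g)) \<le> C * nrm (X n - g)"
      using assms C by (intro always_eventually) (auto simp: nrm_ge_0 diff_in T_in T_diff[symmetric])
    show "(\<lambda>n. C * nrm (X n - g)) \<longlonglongrightarrow> 0"
      using tendsto_mult_left[OF assms(3), of C] by simp
  qed
qed

lemma nrm_limit_unique:
  assumes "\<And>n. X n \<in> H" "f \<in> H" "g \<in> H"
    "(\<lambda>n. nrm (X n - f)) \<longlonglongrightarrow> 0" "(\<lambda>n. nrm (X n - g)) \<longlonglongrightarrow> 0"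
  shows "f = g"
proof -
  have "nrm (f - g) \<le> nrm (X n - f) + nrm (X n - g)" for n
    using nrm_triangle_diff[of f "X n" g] nrm_minus_commute[of f "X n"] assms by simp
  then have "nrm (f - g) \<le> 0 + 0"
    by (intro LIMSEQ_le_const[OF tendsto_add[OF assms(4,5)]]) auto
  then have "f - g = 0"
    using assms nrm_ge_0 nrm_eq_0 by (metis add_0 diff_in order_antisym)
  then show ?thesis by simp
qed

text \<open>A maximizing sequence for the Rayleigh quotient consists of approximate eigenvectors because
  \<open>\<parallel>T f\<parallel>\<^sup>2 \<le> M \<langle>T f, f\<rangle>\<close> on \<open>V\<close>; compactness makes it converge.\<close>

lemma top_eigenvector:
  fixes W :: "('a \<Rightarrow> complex) set"
  defines "V \<equiv> {f \<in> H. \<forall>w\<in>W. ip f w = 0}"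
  assumes W: "W \<subseteq> H" "\<And>f. f \<in> V \<Longrightarrow> T f \<in> V"
    and ex: "f \<in> V" "0 < qf f"
  obtains e M where "e \<in> V" "nrm e = 1" "0 < M" "T e = scale_fun (of_real M) e"
    "\<And>h. h \<in> V \<Longrightarrow> qf h \<le> M * (nrm h)\<^sup>2"
proof -
  have VH: "V \<subseteq> H" by (auto simp: V_def)
  have Vscale: "scale_fun c h \<in> V" if "h \<in> V" for c h
    using that W by (auto simp: V_def scale_in ip_scale_left subset_iff)
  obtain C where C: "0 \<le> C" "\<And>f. f \<in> H \<Longrightarrow> nrm (T f) \<le> C * nrm f"
    using compact_operator_bounded[OF compact] by blast
  define Q where "Q = qf ` {h \<in> V. nrm h = 1}"
  define M where "M = Sup Q"
  have qf_scale: "qf (scale_fun c h) = (cmod c)\<^sup>2 * qf h" if "h \<in> H" for c h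
    using that ip_T_self[OF that]
    by (simp only: qf_def T_scale ip_scale_left ip_scale_right T_in scale_in)
       (simp only: cmod_power2, simp add: power2_eq_square algebra_simps)
  have bdd: "bdd_above Q"
  proof (rule bdd_aboveI)
    fix x assume "x \<in> Q"
    then obtain h where h: "h \<in> H" "nrm h = 1" "x = qf h" using VH by (auto simp: Q_def)
    have "qf h \<le> cmod (ip (T h) h)"
      by (simp add: qf_def complex_Re_le_cmod)
    also have "\<dots> \<le> nrm (T h) * nrm h"
      using h by (intro Cauchy_Schwarz T_in)
    also have "\<dots> \<le> C" using C(2)[OF h(1)] h by simp
    finally show "x \<le> C" using h by simp
  qed
  have nf: "0 < nrm f"
  proof (rule ccontr)
    assume "\<not> 0 < nrm f"
    then have "f = 0" using ex VH nrm_ge_0[of f] nrm_eq_0[of f] by auto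
    then show False using ex by (simp add: qf_def T_zero ip_zero_left zero_in)
  qed
  have normalize: "scale_fun (of_real (1 / nrm h)) h \<in> {h \<in> V. nrm h = 1}" if "h \<in> V" "0 < nrm h" for h
    using that VH Vscale by (auto simp: nrm_scale subset_iff simp del: of_real_divide)
  have qM: "qf h \<le> M * (nrm h)\<^sup>2" if h: "h \<in> V" for h
  proof (cases "nrm h = 0")
    case True
    then have "h = 0" using h VH nrm_eq_0 by auto
    then show ?thesis by (simp add: qf_def T_zero ip_zero_left zero_in nrm_zero)
  next
    case False
    then have n: "0 < nrm h" using h VH nrm_ge_0[of h] by auto
    have "qf (scale_fun (of_real (1 / nrm h)) h) \<le> M"
      unfolding M_def using normalize[OF h n] by (intro cSup_upper bdd) (auto simp: Q_def)
    then have "(1 / nrm h)\<^sup>2 * qf h \<le> M"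
      using h VH n by (subst (asm) qf_scale) (auto simp del: of_real_divide)
    then show ?thesis using n by (simp add: field_simps)
  qed
  have M: "0 < M"
    using qM[OF ex(1)] ex(2) nf by (smt (verit) zero_less_mult_iff zero_le_power2 mult_nonneg_nonneg mult_nonpos_nonneg)
  \<comment> \<open>Cauchy-Schwarz for the form, applied to h and \<open>T h\<close>, bounds the
    fourth power of \<open>nrm (T h)\<close> by \<open>qf h * qf (T h)\<close>; as
    \<open>T h\<close> stays in V, the last factor is at most M times its squared norm.\<close>
  have TM: "(nrm (T h))\<^sup>2 \<le> M * qf h" if h: "h \<in> V" for h
  proof -
    have hH: "h \<in> H" "T h \<in> H" using h VH T_in by auto
    have "((nrm (T h))\<^sup>2)\<^sup>2 = (cmod (ip (T h) (T h)))\<^sup>2"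
      using hH by (simp add: ip_self norm_power)
    also have "\<dots> \<le> qf h * qf (T h)"
      using hH by (intro form_Cauchy_Schwarz)
    also have "\<dots> \<le> qf h * (M * (nrm (T h))\<^sup>2)"
      using qM[OF W(2)[OF h]] qf_ge_0 hH by (intro mult_left_mono) auto
    finally have le: "(nrm (T h))\<^sup>2 * (nrm (T h))\<^sup>2 \<le> (M * qf h) * (nrm (T h))\<^sup>2"
      by (simp add: power2_eq_square mult_ac)
    show ?thesis
    proof (cases "nrm (T h) = 0")
      case False
      then show ?thesis by (intro mult_right_le_imp_le[OF le]) simp
    qed (use M qf_ge_0[OF hH(1)] in simp)
  qed
  have "\<exists>h\<in>V. nrm h = 1 \<and> M - 1 / real (Suc n) < qf h" for n
  proof -
    have "Q \<noteq> {}" using normalize[OF ex(1) nf] by (auto simp: Q_def)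
    moreover have "M - 1 / real (Suc n) < Sup Q" by (simp add: M_def[symmetric])
    ultimately show ?thesis
      using less_cSupE[of "M - 1 / real (Suc n)" Q] by (auto simp: Q_def)
  qed
  then obtain F where F: "\<And>n. F n \<in> V" "\<And>n. nrm (F n) = 1" "\<And>n. M - 1 / real (Suc n) < qf (F n)"
    by metis
  have FH: "F n \<in> H" for n using F VH by auto
  have "\<forall>n. F n \<in> H \<and> nrm (F n) \<le> 1" using F FH by auto
  then obtain r g where rg: "strict_mono r" "g \<in> H" "(\<lambda>n. nrm (T (F (r n)) - g)) \<longlonglongrightarrow> 0"
    using compact unfolding compact_operator_on_def by blast
  have approx: "nrm (T (F n) - scale_fun (of_real M) (F n)) \<le> sqrt (M / real (Suc n))" for n
  proof (rule real_le_rsqrt)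
    have "(nrm (T (F n) - scale_fun (of_real M) (F n)))\<^sup>2 = (nrm (T (F n)))\<^sup>2 - 2 * (M * qf (F n)) + M\<^sup>2"
      using FH F(2) by (subst nrm_diff_sq) (auto simp: T_in scale_in ip_scale_right nrm_scale ip_T_self power_mult_distrib)
    also have "\<dots> \<le> M * M - M * qf (F n)"
      using TM[OF F(1)[of n]] by (simp add: power2_eq_square)
    also have "\<dots> \<le> M * (1 / real (Suc n))"
      unfolding right_diff_distrib[symmetric] using F(3)[of n] M by (intro mult_left_mono) auto
    finally show "(nrm (T (F n) - scale_fun (of_real M) (F n)))\<^sup>2 \<le> M / real (Suc n)"
      by simp
  qed
  have lim0: "(\<lambda>n. sqrt (M / real (Suc n))) \<longlonglongrightarrow> 0"
  proof -
    have "(\<lambda>n. M * inverse (real (Suc n))) \<longlonglongrightarrow> M * 0"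
      by (intro tendsto_mult tendsto_const LIMSEQ_inverse_real_of_nat)
    then have "(\<lambda>n. sqrt (M / real (Suc n))) \<longlonglongrightarrow> sqrt 0"
      by (intro tendsto_real_sqrt) (simp add: divide_inverse)
    then show ?thesis by simp
  qed
  \<comment> \<open>\<open>T (F (r n))\<close> tends to g and differs from M times
    \<open>F (r n)\<close> by a null sequence, which leaves g / M as the only possible limit of
    \<open>F (r n)\<close>.\<close>
  define e where "e = scale_fun (of_real (1 / M)) g"
  have eH: "e \<in> H" using rg by (simp add: e_def scale_in)
  have conv: "(\<lambda>n. nrm (F (r n) - e)) \<longlonglongrightarrow> 0"
  proof (rule Lim_null_comparison)
    have "nrm (F (r n) - e) \<le> 1 / M * (sqrt (M / real (Suc (r n))) + nrm (T (F (r n)) - g))" for n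
    proof -
      have eq: "F (r n) - e = scale_fun (of_real (1 / M)) (scale_fun (of_real M) (F (r n)) - g)"
        using M by (auto simp: e_def scale_fun_def fun_eq_iff field_simps)
      have "nrm (scale_fun (of_real M) (F (r n)) - g) \<le>
          nrm (scale_fun (of_real M) (F (r n)) - T (F (r n))) + nrm (T (F (r n)) - g)"
        by (intro nrm_triangle_diff) (auto simp: scale_in T_in FH rg)
      moreover have "nrm (scale_fun (of_real M) (F (r n)) - T (F (r n))) \<le> sqrt (M / real (Suc (r n)))"
        using approx[of "r n"] by (subst nrm_minus_commute) (auto simp: scale_in T_in FH)
      ultimately have le: "nrm (scale_fun (of_real M) (F (r n)) - g) \<le>
          sqrt (M / real (Suc (r n))) + nrm (T (F (r n)) - g)"
        by linarith
      have "nrm (F (r n) - e) = 1 / M * nrm (scale_fun (of_real M) (F (r n)) - g)"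
        unfolding eq using M by (subst nrm_scale) (auto simp: diff_in scale_in FH rg simp del: of_real_divide)
      also have "\<dots> \<le> 1 / M * (sqrt (M / real (Suc (r n))) + nrm (T (F (r n)) - g))"
        using M by (intro mult_left_mono[OF le]) simp
      finally show ?thesis .
    qed
    then show "\<forall>\<^sub>F n in sequentially. norm (nrm (F (r n) - e)) \<le>
        1 / M * (sqrt (M / real (Suc (r n))) + nrm (T (F (r n)) - g))"
      by (intro always_eventually) (auto simp: nrm_ge_0 diff_in FH eH)
    have "(\<lambda>n. 1 / M * (sqrt (M / real (Suc (r n))) + nrm (T (F (r n)) - g))) \<longlonglongrightarrow> 1 / M * (0 + 0)"
      by (intro tendsto_intros rg(3) LIMSEQ_subseq_LIMSEQ[OF lim0 rg(1), unfolded o_def])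
    then show "(\<lambda>n. 1 / M * (sqrt (M / real (Suc (r n))) + nrm (T (F (r n)) - g))) \<longlonglongrightarrow> 0"
      by simp
  qed
  have "e \<in> V"
  proof -
    have "ip e w = 0" if "w \<in> W" for w
    proof -
      have "(\<lambda>n. ip (F (r n)) w) \<longlonglongrightarrow> ip e w"
        using that W by (intro ip_tendsto conv FH eH) auto
      moreover have "ip (F (r n)) w = 0" for n
        using F(1)[of "r n"] that by (auto simp: V_def)
      ultimately show ?thesis by (simp add: LIMSEQ_const_iff)
    qed
    then show ?thesis using eH by (simp add: V_def)
  qed
  moreover have "nrm e = 1"
    using nrm_tendsto[OF FH eH conv] F(2) by (simp add: LIMSEQ_const_iff)
  moreover have "T e = scale_fun (of_real M) e"
  proof -
    have "T e = g"
      by (rule nrm_limit_unique[OF T_in[OF FH] T_in[OF eH] rg(2) T_tendsto[OF FH eH conv] rg(3)])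
    also have "g = scale_fun (of_real M) e"
      using M by (auto simp: e_def scale_fun_def fun_eq_iff)
    finally show ?thesis .
  qed
  ultimately show ?thesis
    using that M qM by blast
qed

text \<open>The fourth conjunct is the variational description of \<open>s n\<close>. Once the
  positive eigenvalues are exhausted the sequence is padded with \<open>s n = 0\<close>, where the
  norm of \<open>e n\<close> is left free, so operators of finite rank are not a separate
  case.\<close>

definition spectral_sequence :: "(nat \<Rightarrow> 'a \<Rightarrow> complex) \<Rightarrow> (nat \<Rightarrow> real) \<Rightarrow> bool" where
  "spectral_sequence e s \<longleftrightarrow>
     (\<forall>n. e n \<in> H \<and> 0 \<le> s n \<and> T (e n) = scale_fun (of_real (s n)) (e n)) \<and>
     (\<forall>n. 0 < s n \<longrightarrow> nrm (e n) = 1) \<and>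
     (\<forall>m n. m \<noteq> n \<longrightarrow> ip (e m) (e n) = 0) \<and>
     (\<forall>n. \<forall>h\<in>H. (\<forall>k<n. ip h (e k) = 0) \<longrightarrow> qf h \<le> s n * (nrm h)\<^sup>2) \<and>
     decseq s \<and> s \<longlonglongrightarrow> 0"

text \<open>Repeatedly take a top eigenvector on the orthogonal complement of the previous ones. The
  complements shrink, so s decreases; a positive limit would give infinitely many orthonormal
  eigenvectors whose images keep a positive distance, against compactness.\<close>

lemma spectral_sequence_exists: "\<exists>e s. spectral_sequence e s"
proof -
  define V where "V = (\<lambda>(f :: nat \<Rightarrow> 'a \<Rightarrow> complex) (n :: nat). {h \<in> H. \<forall>k<n. ip h (f k) = 0})"
  define P where "P = (\<lambda>f n x. x \<in> V f n \<and> (\<exists>M\<ge>0. T x = scale_fun (of_real M) x \<and>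
      (0 < M \<longrightarrow> nrm x = 1) \<and> (M = 0 \<longrightarrow> x = 0) \<and> (\<forall>h\<in>V f n. qf h \<le> M * (nrm h)\<^sup>2)))"
  have "\<exists>e. \<forall>n::nat. P e n (e n)"
  proof (rule dependent_wellorder_choice)
    fix r and f g :: "nat \<Rightarrow> 'a \<Rightarrow> complex" and n :: nat
    assume "\<And>k. k < n \<Longrightarrow> f k = g k"
    then have "V f n = V g n" by (auto simp: V_def)
    then show "P f n r = P g n r" by (simp add: P_def)
  next
    fix n :: nat and f :: "nat \<Rightarrow> 'a \<Rightarrow> complex"
    assume IH: "\<And>k. k < n \<Longrightarrow> P f k (f k)"
    have fH: "f k \<in> H" if "k < n" for k
      using IH[OF that] by (auto simp: P_def V_def)
    have V_eq: "V f n = {h \<in> H. \<forall>w\<in>f ` {..<n}. ip h w = 0}"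
      by (auto simp: V_def)
    show "\<exists>x. P f n x"
    proof (cases "\<exists>h\<in>V f n. 0 < qf h")
      case True
      then obtain h where h: "h \<in> V f n" "0 < qf h" by auto
      have inv: "T u \<in> V f n" if u: "u \<in> V f n" for u
      proof -
        have "ip (T u) (f k) = 0" if k: "k < n" for k
        proof -
          obtain M where "T (f k) = scale_fun (of_real M) (f k)"
            using IH[OF k] by (auto simp: P_def)
          then show ?thesis
            using u k fH[OF k] by (simp add: selfadjoint V_def ip_scale_right)
        qed
        then show ?thesis using u T_in by (auto simp: V_def)
      qed
      obtain e M where "e \<in> V f n" "nrm e = 1" "0 < M" "T e = scale_fun (of_real M) e"
          "\<And>h. h \<in> V f n \<Longrightarrow> qf h \<le> M * (nrm h)\<^sup>2"
        by (rule top_eigenvector[of "f ` {..<n}" h]) (use fH inv h in \<open>auto simp: V_eq\<close>)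
      then show ?thesis
        by (intro exI[of _ e]) (auto simp: P_def intro!: exI[of _ M])
    next
      case False
      then have "qf h \<le> 0" if "h \<in> V f n" for h
        using that by force
      \<comment> \<open>No positive value of the form is left on the complement: the padding by the
        zero vector starts here.\<close>
      then have "P f n 0"
        using fH by (auto simp: P_def V_def zero_in ip_zero_left T_zero intro!: exI[of _ 0])
      then show ?thesis by (rule exI[of "P f n"])
    qed
  qed
  then obtain e where e: "\<And>n. P e n (e n)" by blast
  then have "\<exists>s. \<forall>n. 0 \<le> s n \<and> T (e n) = scale_fun (of_real (s n)) (e n) \<and>
      (0 < s n \<longrightarrow> nrm (e n) = 1) \<and> (s n = 0 \<longrightarrow> e n = 0) \<and> (\<forall>h\<in>V e n. qf h \<le> s n * (nrm h)\<^sup>2)"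
    by (intro choice) (use e[unfolded P_def] in metis)
  then obtain s where s: "\<And>n. 0 \<le> s n" "\<And>n. T (e n) = scale_fun (of_real (s n)) (e n)"
      "\<And>n. 0 < s n \<Longrightarrow> nrm (e n) = 1" "\<And>n. s n = 0 \<Longrightarrow> e n = 0"
      "\<And>n h. h \<in> V e n \<Longrightarrow> qf h \<le> s n * (nrm h)\<^sup>2"
    by metis
  have eV: "e n \<in> V e n" for n using e by (simp add: P_def)
  have eH: "e n \<in> H" for n using eV by (auto simp: V_def)
  have orth: "ip (e m) (e n) = 0" if "m \<noteq> n" for m n
    using that
  proof (induction m n rule: linorder_wlog)
    case (le m n)
    then have "ip (e n) (e m) = 0" using eV[of n] by (auto simp: V_def)
    then show ?case using ip_commute[OF eH eH, of m n] by simp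
  next
    case (sym m n)
    then show ?case using ip_commute[OF eH eH, of n m] by simp
  qed
  have qf_e: "qf (e n) = s n * (nrm (e n))\<^sup>2" for n
    by (simp add: qf_def s(2) ip_scale_left eH nrm_sq)
  have dec: "decseq s"
  proof (rule decseq_SucI)
    fix n
    have "e (Suc n) \<in> V e n" using eV[of "Suc n"] by (auto simp: V_def)
    then have "s (Suc n) * (nrm (e (Suc n)))\<^sup>2 \<le> s n * (nrm (e (Suc n)))\<^sup>2"
      using s(5) qf_e by metis
    then show "s (Suc n) \<le> s n"
      using s(1)[of n] s(1)[of "Suc n"] s(3)[of "Suc n"] by (cases "s (Suc n) = 0") auto
  qed
  have lim: "s \<longlonglongrightarrow> 0"
  proof (rule ccontr)
    assume nlim: "\<not> s \<longlonglongrightarrow> 0"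
    obtain l where l: "s \<longlonglongrightarrow> l" "\<And>n. l \<le> s n"
      using decseq_convergent[OF dec, of 0] s(1) by blast
    have "0 \<le> l" using l s(1) by (simp add: LIMSEQ_le_const)
    with nlim l have "0 < l" by (cases "l = 0") auto
    have ne: "nrm (e n) = 1" for n
      using s(3)[of n] l(2)[of n] \<open>0 < l\<close> by linarith
    have "\<forall>n. e n \<in> H \<and> nrm (e n) \<le> 1" using eH ne by simp
    then obtain r g where rg: "strict_mono r" "g \<in> H" "(\<lambda>n. nrm (T (e (r n)) - g)) \<longlonglongrightarrow> 0"
      using compact unfolding compact_operator_on_def by blast
    have "\<forall>\<^sub>F n in sequentially. nrm (T (e (r n)) - g) < l / 2"
      using rg(3) \<open>0 < l\<close> by (intro order_tendstoD) auto
    then obtain N where N: "\<And>n. n \<ge> N \<Longrightarrow> nrm (T (e (r n)) - g) < l / 2"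
      by (auto simp: eventually_sequentially)
    define a b where "a = r N" and "b = r (Suc N)"
    have ab: "a \<noteq> b" using rg(1) by (auto simp: a_def b_def strict_mono_eq)
    have "nrm (T (e a) - T (e b)) \<le> nrm (T (e a) - g) + nrm (T (e b) - g)"
      using nrm_triangle_diff[of "T (e a)" g "T (e b)"] nrm_minus_commute[of g "T (e b)"] eH rg(2) T_in by simp
    also have "\<dots> < l" using N[of N] N[of "Suc N"] by (simp add: a_def b_def)
    finally have lt: "nrm (T (e a) - T (e b)) < l" .
    \<comment> \<open>Orthogonality of \<open>e a\<close> and \<open>e b\<close> makes this
      Pythagoras, so the images are at distance at least l.\<close>
    have "(nrm (T (e a) - T (e b)))\<^sup>2 = (s a)\<^sup>2 + (s b)\<^sup>2"
      using eH orth[OF ab] ne s(1)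
      by (subst nrm_diff_sq) (auto simp: T_in s(2) scale_in ip_scale_left ip_scale_right nrm_scale)
    also have "\<dots> \<ge> l\<^sup>2" using l(2)[of a] \<open>0 < l\<close> by (simp add: add_increasing2 power_mono)
    finally have "l \<le> nrm (T (e a) - T (e b))"
      using eH T_in by (intro power2_le_imp_le[OF _ nrm_ge_0]) (auto simp: diff_in)
    with lt show False by simp
  qed
  have "spectral_sequence e s"
    unfolding spectral_sequence_def using s eH orth dec lim by (auto simp: V_def)
  then show ?thesis by blast
qed

section \<open>Min-max bounds for the eigenvalues\<close>

lemma qf_orthogonal_sum:
  assumes "spectral_sequence e s" "finite J" "\<And>j. j \<in> J \<Longrightarrow> 0 < s j"
  defines "h \<equiv> \<lambda>c. \<Sum>j\<in>J. scale_fun (c j) (e j)"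
  shows "h c \<in> H" "qf (h c) = (\<Sum>j\<in>J. s j * (cmod (c j))\<^sup>2)" "(nrm (h c))\<^sup>2 = (\<Sum>j\<in>J. (cmod (c j))\<^sup>2)"
proof -
  have eH: "e n \<in> H" and Te: "T (e n) = scale_fun (of_real (s n)) (e n)"
    and orth: "m \<noteq> n \<Longrightarrow> ip (e m) (e n) = 0" for m n
    using assms(1) by (auto simp: spectral_sequence_def)
  have one: "ip (e j) (e j) = 1" if "j \<in> J" for j
    using assms(1) assms(3)[OF that] ip_self[OF eH, of j] by (auto simp: spectral_sequence_def)
  show hH: "h c \<in> H" for c
    unfolding h_def by (intro sum_in scale_in eH)
  have ip_h: "ip (h c) (h d) = (\<Sum>j\<in>J. c j * cnj (d j))" for c d
  proof -
    have "ip (h c) (h d) = (\<Sum>j\<in>J. c j * (\<Sum>i\<in>J. cnj (d i) * ip (e j) (e i)))"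
      unfolding h_def by (simp add: ip_sum_left scale_in eH sum_in ip_scale_left)
        (simp add: ip_sum_right scale_in eH ip_scale_right)
    also have "\<dots> = (\<Sum>j\<in>J. c j * (\<Sum>i\<in>J. if i = j then cnj (d j) else 0))"
      using one orth by (intro sum.cong arg_cong2[where f = "(*)"] refl) auto
    finally show ?thesis using assms(2) by simp
  qed
  show "(nrm (h c))\<^sup>2 = (\<Sum>j\<in>J. (cmod (c j))\<^sup>2)" for c
    using ip_h[of c c] by (simp add: nrm_sq hH complex_norm_square[symmetric] flip: of_real_power of_real_sum)
  have "T (h c) = h (\<lambda>j. of_real (s j) * c j)"
    by (simp add: h_def T_sum scale_in eH T_scale Te mult.commute)
  then show "qf (h c) = (\<Sum>j\<in>J. s j * (cmod (c j))\<^sup>2)"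
    using ip_h[of "\<lambda>j. of_real (s j) * c j" c]
    by (simp add: qf_def mult.assoc complex_norm_square[symmetric] flip: of_real_power of_real_mult of_real_sum)
qed

text \<open>With n = card I, the span of \<open>e 0, ..., e n\<close> has one dimension more than
  there are functionals, so it meets their common kernel; on that span the form is at least
  \<open>s n\<close> times the squared norm.\<close>

lemma spectral_sequence_upper:
  assumes sp: "spectral_sequence e s" and "finite I" "0 \<le> t"
    and add: "\<And>i f g. i \<in> I \<Longrightarrow> f \<in> H \<Longrightarrow> g \<in> H \<Longrightarrow> L i (f + g) = L i f + L i g"
    and scale: "\<And>i c f. i \<in> I \<Longrightarrow> f \<in> H \<Longrightarrow> L i (scale_fun c f) = c * (L i f :: complex)"
    and bound: "\<And>h. h \<in> H \<Longrightarrow> \<forall>i\<in>I. L i h = 0 \<Longrightarrow> qf h \<le> t * (nrm h)\<^sup>2"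
  shows "s (card I) \<le> t"
proof (rule ccontr)
  assume "\<not> s (card I) \<le> t"
  then have st: "t < s (card I)" by simp
  \<comment> \<open>Closed at the top: card I + 1 indices against card I conditions.\<close>
  define J where "J = {..card I}"
  have dec: "decseq s" using sp by (simp add: spectral_sequence_def)
  have eH: "e n \<in> H" for n using sp by (auto simp: spectral_sequence_def)
  have sJ: "s (card I) \<le> s j" if "j \<in> J" for j
    using that dec by (auto simp: J_def decseq_def)
  have pos: "0 < s j" if "j \<in> J" for j
    using sJ[OF that] st \<open>0 \<le> t\<close> by linarith
  obtain c where c: "\<exists>j\<in>J. c j \<noteq> 0" "\<forall>i\<in>I. (\<Sum>j\<in>J. c j * L i (e j)) = 0"
    using underdetermined_homogeneous_system[of I J "\<lambda>i j. L i (e j)"] \<open>finite I\<close> by (auto simp: J_def)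
  define h where "h = (\<Sum>j\<in>J. scale_fun (c j) (e j))"
  have "L i (\<Sum>j\<in>K. scale_fun (c j) (e j)) = (\<Sum>j\<in>K. c j * L i (e j))" if "finite K" "i \<in> I" for K i
    using that(1)
  proof (induction K rule: finite_induct)
    case empty
    show ?case
      using scale[OF \<open>i \<in> I\<close> zero_in, of 0] by (simp add: zero_fun_def)
  next
    case (insert j K)
    then show ?case
      unfolding sum.insert[OF insert.hyps] using that(2)
      by (subst add) (auto simp: scale eH intro!: scale_in sum_in)
  qed
  then have "\<forall>i\<in>I. L i h = 0"
    using c(2) by (simp add: h_def J_def)
  note fin = sp finite_atMost[of "card I", folded J_def] pos
  have hH: "h \<in> H" and qh: "qf h = (\<Sum>j\<in>J. s j * (cmod (c j))\<^sup>2)"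
    and nh: "(nrm h)\<^sup>2 = (\<Sum>j\<in>J. (cmod (c j))\<^sup>2)"
    using qf_orthogonal_sum[OF fin, of c] by (simp_all add: h_def)
  have n0: "0 < (nrm h)\<^sup>2"
  proof -
    obtain j where "j \<in> J" "c j \<noteq> 0" using c(1) by auto
    then show ?thesis
      unfolding nh by (intro sum_pos2[of J j]) (auto simp: J_def)
  qed
  have "s (card I) * (nrm h)\<^sup>2 \<le> qf h"
    unfolding qh nh sum_distrib_left by (intro sum_mono mult_right_mono sJ) auto
  also have "\<dots> \<le> t * (nrm h)\<^sup>2"
    by (rule bound[OF hH]) fact
  finally show False
    using st n0 by simp
qed

text \<open>Some combination of the \<open>F j\<close> with nonzero coefficients is orthogonal to
  all \<open>e i\<close> with i < k, and there the form is at most \<open>s k\<close> times the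
  squared norm. That such combinations do not vanish is part of \<open>bound\<close>, which thereby
  contains the linear independence of F.\<close>

lemma spectral_sequence_lower:
  assumes sp: "spectral_sequence e s" and "finite J" "k < card J"
    and F: "\<And>j. j \<in> J \<Longrightarrow> F j \<in> H"
    and bound: "\<And>c. \<exists>j\<in>J. c j \<noteq> 0 \<Longrightarrow> (\<Sum>j\<in>J. scale_fun (c j) (F j)) \<noteq> 0 \<and>
       t * (nrm (\<Sum>j\<in>J. scale_fun (c j) (F j)))\<^sup>2 \<le> qf (\<Sum>j\<in>J. scale_fun (c j) (F j))"
  shows "t \<le> s k"
proof -
  have eH: "e n \<in> H" for n using sp by (auto simp: spectral_sequence_def)
  obtain c where c: "\<exists>j\<in>J. c j \<noteq> 0" "\<forall>i\<in>{..<k}. (\<Sum>j\<in>J. c j * ip (F j) (e i)) = 0"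
    using underdetermined_homogeneous_system[of "{..<k}" J "\<lambda>i j. ip (F j) (e i)"] assms by auto
  define h where "h = (\<Sum>j\<in>J. scale_fun (c j) (F j))"
  have hH: "h \<in> H" unfolding h_def by (intro sum_in scale_in F)
  have "ip h (e i) = 0" if "i < k" for i
    using c(2) that F eH by (simp add: h_def ip_sum_left scale_in ip_scale_left)
  then have "qf h \<le> s k * (nrm h)\<^sup>2"
    using sp hH by (auto simp: spectral_sequence_def)
  moreover have "h \<noteq> 0" "t * (nrm h)\<^sup>2 \<le> qf h"
    using bound[OF c(1)] by (auto simp: h_def)
  moreover have "0 < (nrm h)\<^sup>2"
    using \<open>h \<noteq> 0\<close> nrm_eq_0[OF hH] by auto
  ultimately show ?thesis
    by (smt (verit) mult_less_cancel_right_pos)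
qed

end

section \<open>Singular numbers of a positive operator as its eigenvalues\<close>

context compact_positive
begin

lemma adjoint_on_eq: "g \<in> H \<Longrightarrow> adjoint_on H ip T g = T g"
  unfolding adjoint_on_def
proof (rule the_equality)
  assume g: "g \<in> H"
  show "T g \<in> H \<and> (\<forall>f\<in>H. ip (T f) g = ip f (T g))"
    using g T_in selfadjoint by auto
  fix h assume h: "h \<in> H \<and> (\<forall>f\<in>H. ip (T f) g = ip f h)"
  have hT: "h - T g \<in> H" using h g by (auto intro: diff_in T_in)
  have "ip (h - T g) (h - T g) = 0"
    using h hT g selfadjoint[OF hT g] T_in by (auto simp: ip_diff_right)
  then have "h - T g = 0"
    by (rule ip_self_eq_0[OF hT])
  then show "h = T g" by simp
qed

text \<open>The square of T minus l factors into \<open>T - sqrt l\<close> and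
  \<open>T + sqrt l\<close>, and positivity of T makes the second factor injective. Thus the
  singular numbers of T are its eigenvalues with the same multiplicities.\<close>

lemma eigenspace_square:
  assumes "0 < l"
  shows "eigenspace H (adjoint_on H ip T \<circ> T) (of_real l) = {f \<in> H. T f = scale_fun (of_real (sqrt l)) f}"
proof (intro set_eqI iffI)
  fix f assume "f \<in> eigenspace H (adjoint_on H ip T \<circ> T) (of_real l)"
  then have f: "f \<in> H" "T (T f) = scale_fun (of_real l) f"
    by (auto simp: eigenspace_def adjoint_on_eq T_in)
  define u where "u = T f - scale_fun (of_real (sqrt l)) f"
  have u: "u \<in> H" using f by (simp add: u_def diff_in T_in scale_in)
  have "(of_real l :: complex) = of_real (sqrt l) * of_real (sqrt l)"
    using assms by (simp flip: of_real_mult)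
  then have "T u = scale_fun (- of_real (sqrt l)) u"
    using f by (simp only: u_def T_diff T_in scale_in T_scale) (auto simp: scale_fun_def fun_eq_iff algebra_simps)
  then have "qf u = - sqrt l * (nrm u)\<^sup>2"
    using u by (simp only: qf_def ip_scale_left nrm_sq) (simp add: ip_self)
  then have "nrm u = 0"
    using qf_ge_0[OF u] assms by (smt (verit) mult_minus_left mult_pos_pos real_sqrt_gt_zero zero_less_power2)
  then have "u = 0" using nrm_eq_0[OF u] by simp
  then show "f \<in> {f \<in> H. T f = scale_fun (of_real (sqrt l)) f}"
    using f by (simp add: u_def)
next
  fix f assume "f \<in> {f \<in> H. T f = scale_fun (of_real (sqrt l)) f}"
  then have f: "f \<in> H" "T f = scale_fun (of_real (sqrt l)) f" by auto
  have "(of_real l :: complex) = of_real (sqrt l) * of_real (sqrt l)"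
    using assms by (simp flip: of_real_mult)
  then have "T (T f) = scale_fun (of_real l) f"
    using f by (simp only: T_scale f(2)) (simp add: scale_fun_def fun_eq_iff)
  then show "f \<in> eigenspace H (adjoint_on H ip T \<circ> T) (of_real l)"
    using f(1) by (auto simp: eigenspace_def adjoint_on_eq T_in)
qed

text \<open>The part of an eigenvector f outside the span of the \<open>e j\<close> with
  \<open>s j = l\<close> is again an eigenvector for l, orthogonal to every \<open>e k\<close>. Its
  form equals l times the squared norm but is at most \<open>s N\<close> times it, and
  \<open>s N < l\<close> for large N.\<close>

lemma spectral_sequence_eigenspace:
  assumes sp: "spectral_sequence e s" and l: "0 < l"
  shows "finite {n. s n = l}"
    and "card {n. s n = l} = fun_space.dim {f \<in> H. T f = scale_fun (of_real l) f}"
proof -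
  have eH: "e n \<in> H" and Te: "T (e n) = scale_fun (of_real (s n)) (e n)"
    and s0: "0 \<le> s n" and ne: "0 < s n \<Longrightarrow> nrm (e n) = 1"
    and orth: "m \<noteq> n \<Longrightarrow> ip (e m) (e n) = 0"
    and upper: "h \<in> H \<Longrightarrow> \<forall>k<n. ip h (e k) = 0 \<Longrightarrow> qf h \<le> s n * (nrm h)\<^sup>2" for m n h
    using sp by (auto simp: spectral_sequence_def)
  have dec: "decseq s" and lim: "s \<longlonglongrightarrow> 0" using sp by (auto simp: spectral_sequence_def)
  define E where "E = {f \<in> H. T f = scale_fun (of_real l) f}"
  define J where "J = {n. s n = l}"
  obtain N where N: "s N < l"
    using order_tendstoD(2)[OF lim l] by (auto simp: eventually_sequentially)
  have lt: "s n < l" if "n \<ge> N" for n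
    using N dec that by (metis decseqD le_less_trans)
  have JN: "J \<subseteq> {..<N}"
  proof
    fix n assume "n \<in> J"
    then show "n \<in> {..<N}" using lt[of n] by (cases "N \<le> n") (auto simp: J_def)
  qed
  then show "finite {n. s n = l}"
    unfolding J_def[symmetric] by (rule finite_subset) simp
  have finJ: "finite J" using JN finite_subset by auto
  have one: "ip (e j) (e j) = 1" if "j \<in> J" for j
    using ne[of j] that l ip_self[OF eH, of j] by (simp add: J_def)
  have inj: "inj_on e J"
    using one orth by (intro inj_onI) (metis zero_neq_one)
  have indep: "fun_space.independent (e ` J)"
  proof (rule fun_space.independent_if_scalars_zero)
    fix c x assume sum0: "(\<Sum>x\<in>e ` J. scale_fun (c x) x) = 0" and x: "x \<in> e ` J"
    then obtain j where j: "j \<in> J" "x = e j" by auto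
    have "(\<Sum>x\<in>e ` J. scale_fun (c x) x) = (\<Sum>i\<in>J. scale_fun (c (e i)) (e i))"
      by (simp add: sum.reindex[OF inj])
    then have "0 = ip (\<Sum>i\<in>J. scale_fun (c (e i)) (e i)) (e j)"
      using sum0 ip_zero_left[OF eH] by metis
    also have "\<dots> = (\<Sum>i\<in>J. c (e i) * ip (e i) (e j))"
      by (simp add: ip_sum_left scale_in eH ip_scale_left)
    also have "\<dots> = (\<Sum>i\<in>J. if i = j then c (e i) else 0)"
      using orth one j by (intro sum.cong) auto
    also have "\<dots> = c x" using finJ j by simp
    finally show "c x = 0" by simp
  qed (use finJ in auto)
  have subset: "e ` J \<subseteq> E" using eH Te by (auto simp: E_def J_def)
  have ip_other: "ip f (e n) = 0" if f: "f \<in> E" and n: "s n \<noteq> l" for f n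
  proof -
    have fH: "f \<in> H" and Tf: "T f = scale_fun (of_real l) f" using f by (auto simp: E_def)
    have "of_real l * ip f (e n) = ip (T f) (e n)"
      using fH eH by (simp add: Tf ip_scale_left)
    also have "\<dots> = of_real (s n) * ip f (e n)"
      using fH eH by (simp add: selfadjoint Te ip_scale_right)
    finally show ?thesis using n by simp
  qed
  have span: "E \<subseteq> fun_space.span (e ` J)"
  proof
    fix f assume f: "f \<in> E"
    then have fH: "f \<in> H" and Tf: "T f = scale_fun (of_real l) f" by (auto simp: E_def)
    define p where "p = (\<Sum>j\<in>J. scale_fun (ip f (e j)) (e j))"
    have pH: "p \<in> H" unfolding p_def by (intro sum_in scale_in eH)
    have Tp: "T p = scale_fun (of_real l) p"
    proof -
      have "T p = (\<Sum>j\<in>J. scale_fun (of_real l) (scale_fun (ip f (e j)) (e j)))"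
        unfolding p_def by (subst T_sum) (auto intro!: sum.cong simp: scale_in eH T_scale Te J_def mult.commute)
      also have "\<dots> = scale_fun (of_real l) p"
        unfolding p_def by (rule fun_space.scale_sum_right[symmetric])
      finally show ?thesis .
    qed
    define u where "u = f - p"
    have uH: "u \<in> H" using fH pH by (simp add: u_def diff_in)
    have Tu: "T u = scale_fun (of_real l) u"
      using fH pH by (simp add: u_def T_diff Tf Tp fun_space.scale_right_diff_distrib)
    then have uE: "u \<in> E" using uH by (simp add: E_def)
    have "ip u (e k) = 0" for k
    proof (cases "k \<in> J")
      case True
      have "ip p (e k) = (\<Sum>j\<in>J. ip f (e j) * ip (e j) (e k))"
        unfolding p_def by (simp add: ip_sum_left scale_in eH ip_scale_left)
      also have "\<dots> = (\<Sum>j\<in>J. if j = k then ip f (e j) else 0)"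
        using orth one True by (intro sum.cong) auto
      finally show ?thesis
        using True finJ fH pH eH by (simp add: u_def ip_diff_left)
    next
      case False
      then show ?thesis using ip_other[OF uE] by (simp add: J_def)
    qed
    then have "qf u \<le> s N * (nrm u)\<^sup>2"
      by (intro upper uH) auto
    moreover have "qf u = l * (nrm u)\<^sup>2"
      using uH by (simp add: qf_def Tu ip_scale_left nrm_sq)
    ultimately have "nrm u = 0"
      using N by (smt (verit) mult_less_cancel_right_pos zero_less_power2)
    then have "f = p" using nrm_eq_0[OF uH] by (simp add: u_def)
    moreover have "p \<in> fun_space.span (e ` J)"
      unfolding p_def by (intro fun_space.span_sum fun_space.span_scale fun_space.span_base imageI)
    ultimately show "f \<in> fun_space.span (e ` J)" by simp
  qed
  have "fun_space.dim E = card (e ` J)"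
    by (rule fun_space.dim_unique[OF subset span indep]) simp
  then show "card {n. s n = l} = fun_space.dim {f \<in> H. T f = scale_fun (of_real l) f}"
    using inj by (simp add: card_image E_def[symmetric] J_def[symmetric])
qed

text \<open>The definition counts the values \<open>sqrt l\<close> over eigenvalues l of the square
  of T; substituting l for its root leaves a comparison of multiplicities with s.\<close>

lemma singular_numbers_iff:
  assumes "spectral_sequence e s"
  shows "singular_numbers H ip T s' \<longleftrightarrow> decseq s' \<and> (\<forall>n. 0 \<le> s' n) \<and>
     (\<forall>l>0. finite {n. s' n = l} \<and> card {n. s' n = l} = card {n. s n = l})"
proof -
  have "(\<forall>l>0. finite {n. s' n = sqrt l} \<and> card {n. s' n = sqrt l} =
          fun_space.dim (eigenspace H (adjoint_on H ip T \<circ> T) (of_real l))) \<longleftrightarrow>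
        (\<forall>l>0. finite {n. s' n = sqrt l} \<and> card {n. s' n = sqrt l} = card {n. s n = sqrt l})"
    using spectral_sequence_eigenspace(2)[OF assms] by (simp add: eigenspace_square)
  also have "\<dots> \<longleftrightarrow> (\<forall>l>0. finite {n. s' n = l} \<and> card {n. s' n = l} = card {n. s n = l})"
    by (metis real_sqrt_gt_zero real_sqrt_pow2 less_imp_le real_sqrt_unique zero_less_power)
  finally show ?thesis by (simp add: singular_numbers_def)
qed

text \<open>\<open>schatten_class\<close> only asserts that some sequence of singular numbers is
  summable. Any such \<open>s'\<close> has the multiplicities of s at positive values, so the
  positive part of s embeds into it by an injection of the indices.\<close>

lemma singular_numbers_summable:
  assumes sp: "spectral_sequence e s" and s': "singular_numbers H ip T s'" "summable (\<lambda>n. s' n powr p)"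
  shows "summable (\<lambda>n. s n powr p)"
proof -
  have s0: "0 \<le> s n" for n using sp by (auto simp: spectral_sequence_def)
  have fin: "finite {n. s' n = l}" "finite {n. s n = l}" "card {n. s n = l} = card {n. s' n = l}" if "0 < l" for l
    using s'(1) spectral_sequence_eigenspace(1)[OF sp that] that by (auto simp: singular_numbers_iff[OF sp])
  have "\<forall>l. \<exists>b. 0 < l \<longrightarrow> bij_betw b {n. s n = l} {n. s' n = l}"
    using fin by (auto intro: finite_same_card_bij)
  then obtain b where b: "\<And>l. 0 < l \<Longrightarrow> bij_betw (b l) {n. s n = l} {n. s' n = l}"
    by metis
  define \<sigma> where "\<sigma> n = b (s n) n" for n
  have \<sigma>: "s' (\<sigma> n) = s n" if "0 < s n" for n
    using bij_betwE[OF b[OF that]] by (auto simp: \<sigma>_def)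
  have inj: "inj_on \<sigma> {n. 0 < s n}"
  proof (rule inj_onI)
    fix m n assume mn: "m \<in> {n. 0 < s n}" "n \<in> {n. 0 < s n}" "\<sigma> m = \<sigma> n"
    then have "s m = s n" using \<sigma> by (metis mem_Collect_eq)
    then show "m = n"
      using mn bij_betw_imp_inj_on[OF b[of "s n"]] by (auto simp: \<sigma>_def dest: inj_onD)
  qed
  have "(\<lambda>n. s' n powr p) summable_on UNIV"
    by (subst summable_on_UNIV_nonneg_real_iff) (use s'(2) in auto)
  then have "(\<lambda>n. s' n powr p) summable_on (\<sigma> ` {n. 0 < s n})"
    by (rule summable_on_subset_banach) simp
  then have "((\<lambda>n. s' n powr p) \<circ> \<sigma>) summable_on {n. 0 < s n}"
    by (simp add: summable_on_reindex[OF inj])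
  then have "(\<lambda>n. s n powr p) summable_on {n. 0 < s n}"
    by (rule summable_on_cong[THEN iffD1, rotated]) (use \<sigma> in auto)
  then have "(\<lambda>n. s n powr p) summable_on UNIV"
    by (rule summable_on_cong_neutral[THEN iffD1, rotated 3]) (use s0 in \<open>auto simp: not_less order.antisym\<close>)
  then show ?thesis
    by (subst (asm) summable_on_UNIV_nonneg_real_iff) auto
qed

lemma schatten_class_iff:
  assumes "spectral_sequence e s"
  shows "T \<in> schatten_class H ip p \<longleftrightarrow> summable (\<lambda>n. s n powr p)"
proof
  assume "T \<in> schatten_class H ip p"
  then show "summable (\<lambda>n. s n powr p)"
    using singular_numbers_summable[OF assms] by (auto simp: schatten_class_def)
next
  assume "summable (\<lambda>n. s n powr p)"
  moreover have "singular_numbers H ip T s"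
    using assms spectral_sequence_eigenspace(1)[OF assms]
    by (auto simp: singular_numbers_iff[OF assms]) (auto simp: spectral_sequence_def)
  ultimately show "T \<in> schatten_class H ip p"
    using compact by (auto simp: schatten_class_def)
qed

end

section \<open>Mean values and zeros of holomorphic functions\<close>

lemma measurable_Complex [measurable (raw)]:
  assumes "f \<in> borel_measurable M" "g \<in> borel_measurable M"
  shows "(\<lambda>x. Complex (f x) (g x)) \<in> borel_measurable M"
  by (subst borel_measurable_complex_iff) (use assms in simp)

text \<open>Identifies the measure on the complex numbers with the product measure of real and
  imaginary parts. The disc mean value below needs rotation invariance, which is derived from
  iterated integrals by shears.\<close>

lemma lborel_complex_eq_distr:
  "(lborel :: complex measure) = distr (lborel \<Otimes>\<^sub>M lborel) borel (\<lambda>(x, y). Complex x y)"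
proof (rule lborel_eqI)
  fix l u :: complex
  assume lu: "\<And>b. b \<in> Basis \<Longrightarrow> l \<bullet> b \<le> u \<bullet> b"
  have le: "Re l \<le> Re u" "Im l \<le> Im u"
    using lu[of 1] lu[of \<i>] by (auto simp: Basis_complex_def)
  have vim: "(\<lambda>(x, y). Complex x y) -` box l u = {Re l<..<Re u} \<times> {Im l<..<Im u}"
    by (auto simp: box_def Basis_complex_def)
  have meas: "(\<lambda>(x, y). Complex x y) \<in> measurable (lborel \<Otimes>\<^sub>M lborel) borel"
    by (simp add: case_prod_unfold)
  have "emeasure (distr (lborel \<Otimes>\<^sub>M lborel) borel (\<lambda>(x, y). Complex x y)) (box l u) =
      emeasure (lborel \<Otimes>\<^sub>M lborel) ({Re l<..<Re u} \<times> {Im l<..<Im u})"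
    by (subst emeasure_distr[OF meas]) (auto simp: vim space_pair_measure)
  also have "\<dots> = ennreal (Re u - Re l) * ennreal (Im u - Im l)"
    using le by (subst lborel.emeasure_pair_measure_Times) auto
  also have "\<dots> = ennreal (\<Prod>b\<in>Basis. (u - l) \<bullet> b)"
    using le by (simp add: Basis_complex_def ennreal_mult)
  finally show "emeasure (distr (lborel \<Otimes>\<^sub>M lborel) borel (\<lambda>(x, y). Complex x y)) (box l u) =
      ennreal (\<Prod>b\<in>Basis. (u - l) \<bullet> b)" .
qed simp

lemma nn_integral_complex_pair:
  assumes [measurable]: "f \<in> borel_measurable borel"
  shows "(\<integral>\<^sup>+z. f z \<partial>lborel) = (\<integral>\<^sup>+p. f (Complex (fst p) (snd p)) \<partial>(lborel \<Otimes>\<^sub>M lborel))"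
  by (subst lborel_complex_eq_distr) (simp add: nn_integral_distr case_prod_unfold)

lemma nn_integral_complex_iterated:
  assumes [measurable]: "f \<in> borel_measurable borel"
  shows "(\<integral>\<^sup>+z. f z \<partial>lborel) = (\<integral>\<^sup>+x. \<integral>\<^sup>+y. f (Complex x y) \<partial>lborel \<partial>lborel)"
    and "(\<integral>\<^sup>+z. f z \<partial>lborel) = (\<integral>\<^sup>+y. \<integral>\<^sup>+x. f (Complex x y) \<partial>lborel \<partial>lborel)"
proof -
  show 1: "(\<integral>\<^sup>+z. f z \<partial>lborel) = (\<integral>\<^sup>+x. \<integral>\<^sup>+y. f (Complex x y) \<partial>lborel \<partial>lborel)"
    by (subst nn_integral_complex_pair) (simp_all flip: lborel.nn_integral_fst)
  show "(\<integral>\<^sup>+z. f z \<partial>lborel) = (\<integral>\<^sup>+y. \<integral>\<^sup>+x. f (Complex x y) \<partial>lborel \<partial>lborel)"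
    by (subst 1, rule lborel_pair.Fubini'[symmetric]) (simp add: case_prod_unfold)
qed

text \<open>On each line on which the fixed coordinate is constant a shear is a translation, so the
  inner integral does not change.\<close>

lemma nn_integral_shear:
  fixes \<alpha> :: real
  assumes [measurable]: "f \<in> borel_measurable borel"
  shows "(\<integral>\<^sup>+z. f (Complex (Re z + \<alpha> * Im z) (Im z)) \<partial>lborel) = (\<integral>\<^sup>+z. f z \<partial>lborel)"
    and "(\<integral>\<^sup>+z. f (Complex (Re z) (Im z + \<alpha> * Re z)) \<partial>lborel) = (\<integral>\<^sup>+z. f z \<partial>lborel)"
proof -
  have "(\<integral>\<^sup>+x. g (x + t) \<partial>lborel) = (\<integral>\<^sup>+x. g x \<partial>lborel)" if [measurable]: "g \<in> borel_measurable borel"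
    for g :: "real \<Rightarrow> ennreal" and t
    using nn_integral_real_affine[of g 1 t] by (simp add: add.commute)
  note shift = this
  show "(\<integral>\<^sup>+z. f (Complex (Re z + \<alpha> * Im z) (Im z)) \<partial>lborel) = (\<integral>\<^sup>+z. f z \<partial>lborel)"
    by (subst (1 2) nn_integral_complex_iterated(2)) (simp_all add: shift[of "\<lambda>x. f (Complex x _)"])
  show "(\<integral>\<^sup>+z. f (Complex (Re z) (Im z + \<alpha> * Re z)) \<partial>lborel) = (\<integral>\<^sup>+z. f z \<partial>lborel)"
    by (subst (1 2) nn_integral_complex_iterated(1)) (simp_all add: shift[of "\<lambda>y. f (Complex _ y)"])
qed

text \<open>A rotation that is not \<open>\<plusminus>1\<close> is a product of three shears.\<close>

lemma nn_integral_rotate: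
  fixes u :: complex
  assumes f [measurable]: "f \<in> borel_measurable borel" and u: "cmod u = 1"
  shows "(\<integral>\<^sup>+z. f (u * z) \<partial>lborel) = (\<integral>\<^sup>+z. f z \<partial>lborel)"
proof -
  have main: "(\<integral>\<^sup>+z. f (u * z) \<partial>lborel) = (\<integral>\<^sup>+z. f z \<partial>lborel)"
    if f [measurable]: "f \<in> borel_measurable borel" and u: "cmod u = 1" "Im u \<noteq> 0"
    for f :: "complex \<Rightarrow> ennreal" and u :: complex
  proof -
    define c s where "c = Re u" and "s = Im u"
    have cs: "c * c + s * s = 1"
      using u by (simp add: c_def s_def cmod_def power2_eq_square)
    \<comment> \<open>Minus the tangent of half the rotation angle; shears with parameters a, s, a
      compose to the rotation.\<close>
    define a where "a = (c - 1) / s"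
    define S1 where "S1 = (\<lambda>z. Complex (Re z + a * Im z) (Im z))"
    define S2 where "S2 = (\<lambda>z. Complex (Re z) (Im z + s * Re z))"
    have [measurable]: "S1 \<in> borel_measurable borel" "S2 \<in> borel_measurable borel"
      by (simp_all add: S1_def S2_def)
    have as: "a * s = c - 1" using u by (simp add: a_def s_def)
    have ac: "a * (c + 1) = - s"
    proof -
      have "a * (c + 1) * s = (a * s) * (c + 1)" by (simp add: mult_ac)
      also have "\<dots> = - s * s" unfolding as using cs by (simp add: algebra_simps)
      finally have "a * (c + 1) * s = - s * s" .
      then show ?thesis using u(2) mult_right_cancel[of s "a * (c + 1)" "- s"] by (simp add: s_def)
    qed
    have "S1 (S2 (S1 z)) = u * z" for z
    proof (rule complex_eqI)
      have "Re (S1 (S2 (S1 z))) = (1 + a * s) * Re z + (a * (1 + (1 + a * s))) * Im z"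
        by (simp add: S1_def S2_def algebra_simps)
      also have "\<dots> = Re (u * z)"
        unfolding as using ac by (simp add: c_def s_def add.commute)
      finally show "Re (S1 (S2 (S1 z))) = Re (u * z)" .
      have "Im (S1 (S2 (S1 z))) = s * Re z + (1 + a * s) * Im z"
        by (simp add: S1_def S2_def algebra_simps)
      then show "Im (S1 (S2 (S1 z))) = Im (u * z)"
        unfolding as by (simp add: c_def s_def)
    qed
    then have "(\<integral>\<^sup>+z. f (u * z) \<partial>lborel) = (\<integral>\<^sup>+z. f (S1 (S2 (S1 z))) \<partial>lborel)"
      by simp
    also have "\<dots> = (\<integral>\<^sup>+z. f (S1 (S2 z)) \<partial>lborel)"
      using nn_integral_shear(1)[of "\<lambda>z. f (S1 (S2 z))" a] by (simp add: S1_def[abs_def])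
    also have "\<dots> = (\<integral>\<^sup>+z. f (S1 z) \<partial>lborel)"
      using nn_integral_shear(2)[of "\<lambda>z. f (S1 z)" s] by (simp add: S2_def[abs_def])
    also have "\<dots> = (\<integral>\<^sup>+z. f z \<partial>lborel)"
      using nn_integral_shear(1)[of "\<lambda>z. f z" a] by (simp add: S1_def[abs_def])
    finally show ?thesis .
  qed
  show ?thesis
  proof (cases "Im u = 0")
    case False
    then show ?thesis using main[OF f u] by simp
  next
    case True
    \<comment> \<open>For real u the factorization of u into \<open>u * \<i>\<close> and
      \<open>- \<i>\<close> has two non-real factors of modulus 1.\<close>
    then have u_eq: "u * (\<i> * (- \<i>)) = u" "cmod (u * \<i>) = 1" "Im (u * \<i>) \<noteq> 0"
      using u by (auto simp: norm_mult cmod_def)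
    have "(\<integral>\<^sup>+z. f (u * z) \<partial>lborel) = (\<integral>\<^sup>+z. f (u * \<i> * (- \<i> * z)) \<partial>lborel)"
      by (simp add: algebra_simps)
    also have "\<dots> = (\<integral>\<^sup>+z. f (u * \<i> * z) \<partial>lborel)"
      by (rule main[of "\<lambda>z. f (u * \<i> * z)" "- \<i>"]) auto
    also have "\<dots> = (\<integral>\<^sup>+z. f z \<partial>lborel)"
      using u_eq by (intro main) auto
    finally show ?thesis .
  qed
qed

section \<open>Means over circles and discs, and the gain from zeros\<close>

lemma circle_mean_value:
  assumes F: "F holomorphic_on ball 0 R" and R: "1 < R"
  shows "((\<lambda>t. F (exp (2 * of_real pi * \<i> * of_real t))) has_integral F 0) {0..1}"
proof -
  have "((\<lambda>u. F u / (u - 0)) has_contour_integral (2 * of_real pi * \<i> * F 0)) (circlepath 0 1)"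
    using F R by (intro Cauchy_integral_circlepath_simple holomorphic_on_subset[OF F]) auto
  then have "((\<lambda>t. F (circlepath 0 1 t) / circlepath 0 1 t *
      vector_derivative (circlepath 0 1) (at t within {0..1})) has_integral (2 * of_real pi * \<i> * F 0)) {0..1}"
    by (simp add: has_contour_integral_def)
  then have "((\<lambda>t. (2 * of_real pi * \<i>) * F (exp (2 * of_real pi * \<i> * of_real t)))
      has_integral (2 * of_real pi * \<i> * F 0)) {0..1}"
    by (rule has_integral_eq[rotated]) (simp add: vector_derivative_circlepath01, simp add: circlepath)
  then have "((\<lambda>t. (1 / (2 * of_real pi * \<i>)) * ((2 * of_real pi * \<i>) * F (exp (2 * of_real pi * \<i> * of_real t))))
      has_integral (1 / (2 * of_real pi * \<i>)) * (2 * of_real pi * \<i> * F 0)) {0..1}"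
    by (rule has_integral_mult_right)
  then show ?thesis by simp
qed

lemma circle_sub_mean_value:
  assumes F: "F holomorphic_on ball 0 R" and R: "1 < R"
  shows "ennreal (cmod (F 0)) \<le>
    (\<integral>\<^sup>+t. ennreal (cmod (F (exp (2 * of_real pi * \<i> * of_real t)))) * indicator {0..1::real} t \<partial>lborel)"
proof -
  define g where "g = (\<lambda>t::real. F (exp (2 * of_real pi * \<i> * of_real t)))"
  have cont: "continuous_on {0..1} g"
    unfolding g_def using R
    by (intro continuous_on_compose2[OF holomorphic_on_imp_continuous_on[OF F]] continuous_intros)
       (auto simp: norm_exp_eq_Re)
  then have contn: "continuous_on {0..1} (\<lambda>t. cmod (g t))" by (intro continuous_intros)
  have "integral {0..1} g = F 0"
    using circle_mean_value[OF assms] by (simp add: g_def integral_unique)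
  then have "cmod (F 0) \<le> integral {0..1} (\<lambda>t. cmod (g t))"
    by (metis integral_norm_bound_integral cont contn integrable_continuous_real order_refl)
  also have "ennreal (integral {0..1} (\<lambda>t. cmod (g t))) =
      (\<integral>\<^sup>+t. ennreal (indicator {0..1} t *\<^sub>R cmod (g t)) \<partial>lborel)"
  proof (rule nn_integral_has_integral_lborel[symmetric])
    show "(\<lambda>t. indicator {0..1} t *\<^sub>R cmod (g t)) \<in> borel_measurable borel"
      by (rule borel_measurable_continuous_on_indicator) (use contn in auto)
    have "((\<lambda>t. cmod (g t)) has_integral integral {0..1} (\<lambda>t. cmod (g t))) {0..1}"
      using contn integrable_continuous_real integrable_integral by blast
    then have "((\<lambda>t. if t \<in> {0..1} then cmod (g t) else 0) has_integral integral {0..1} (\<lambda>t. cmod (g t))) UNIV"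
      by (subst has_integral_restrict_UNIV)
    then show "((\<lambda>t. indicator {0..1} t *\<^sub>R cmod (g t)) has_integral integral {0..1} (\<lambda>t. cmod (g t))) UNIV"
      by (rule has_integral_eq[rotated]) auto
  qed auto
  also have "\<dots> = (\<integral>\<^sup>+t. ennreal (cmod (g t)) * indicator {0..1} t \<partial>lborel)"
    by (intro nn_integral_cong) (auto split: split_indicator)
  finally show ?thesis by (simp add: g_def ennreal_leI)
qed

lemma emeasure_lborel_ball_complex: "0 \<le> r \<Longrightarrow> emeasure lborel (ball (z::complex) r) = ennreal (pi * r\<^sup>2)"
  using unit_ball_vol_even[of 1] by (simp add: emeasure_ball)

lemma nn_integral_translate_complex:
  fixes w :: complex
  assumes [measurable]: "f \<in> borel_measurable borel"
  shows "(\<integral>\<^sup>+z. f (w + z) \<partial>lborel) = (\<integral>\<^sup>+z. f z \<partial>lborel)"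
proof -
  have "(\<integral>\<^sup>+z. f z \<partial>lborel) = (\<integral>\<^sup>+z. f z \<partial>distr lborel borel ((+) w))"
    by (simp add: lborel_distr_plus)
  also have "\<dots> = (\<integral>\<^sup>+z. f (w + z) \<partial>lborel)"
    by (subst nn_integral_distr) auto
  finally show ?thesis by simp
qed

text \<open>This avoids polar coordinates: for each z in the centred disc, the circle through w + z
  bounds |G w|^2 by a mean over rotations of z. After integrating in z and exchanging the integrals,
  each fixed rotation leaves the area integral unchanged.\<close>

lemma sub_mean_value_disc:
  assumes G: "G holomorphic_on ball w r" and r: "0 < r"
  shows "ennreal (pi * r\<^sup>2 * (cmod (G w))\<^sup>2) \<le> (\<integral>\<^sup>+z. ennreal ((cmod (G z))\<^sup>2) * indicator (ball w r) z \<partial>lborel)"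
proof -
  define h where "h = (\<lambda>z. ennreal (indicator (ball w r) z *\<^sub>R (cmod (G z))\<^sup>2))"
  have h_alt: "h z = ennreal ((cmod (G z))\<^sup>2) * indicator (ball w r) z" for z
    by (auto simp: h_def split: split_indicator)
  have [measurable]: "h \<in> borel_measurable borel"
    unfolding h_def
    by (intro measurable_compose[OF borel_measurable_continuous_on_indicator measurable_ennreal])
       (auto intro!: continuous_intros holomorphic_on_imp_continuous_on[OF G])
  define E where "E = (\<lambda>t::real. exp (2 * of_real pi * \<i> * of_real t) :: complex)"
  have [measurable]: "E \<in> borel_measurable borel"
    unfolding E_def by (intro borel_measurable_continuous_onI continuous_intros)
  have E1: "cmod (E t) = 1" for t by (simp add: E_def norm_exp_eq_Re)
  have inner: "ennreal ((cmod (G w))\<^sup>2) * indicator (ball 0 r) z \<le>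
      (\<integral>\<^sup>+t. h (w + E t * z) * indicator {0..1::real} t \<partial>lborel)" for z
  proof (cases "z \<in> ball 0 r")
    case True
    \<comment> \<open>A radius above 1 for which \<open>u * z\<close> stays in the disc whenever
      \<open>cmod u < R\<close>, so that the circle mean value applies on the unit circle; for z = 0
      an arbitrary one.\<close>
    define R where "R = (if z = 0 then 2 else r / cmod z)"
    have R: "1 < R" using True by (auto simp: R_def)
    have Rz: "cmod (u * z) < r" if "cmod u < R" for u
      using that r by (auto simp: R_def norm_mult field_simps split: if_splits)
    define F where "F = (\<lambda>u. (G (w + u * z))\<^sup>2)"
    have hol: "F holomorphic_on ball 0 R"
      unfolding F_def
      by (intro holomorphic_intros holomorphic_on_compose_gen[OF _ G, unfolded o_def])
         (use Rz in \<open>auto simp: dist_norm\<close>)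
    have "ennreal ((cmod (G w))\<^sup>2) \<le> (\<integral>\<^sup>+t. ennreal (cmod (F (E t))) * indicator {0..1::real} t \<partial>lborel)"
      using circle_sub_mean_value[OF hol R] by (simp add: F_def E_def norm_power)
    also have "\<dots> = (\<integral>\<^sup>+t. h (w + E t * z) * indicator {0..1::real} t \<partial>lborel)"
      using Rz E1 R by (intro nn_integral_cong arg_cong2[where f = "(*)"] refl)
        (auto simp: h_def F_def norm_power dist_norm)
    finally show ?thesis using True by simp
  qed auto
  have "ennreal (pi * r\<^sup>2 * (cmod (G w))\<^sup>2) = ennreal ((cmod (G w))\<^sup>2) * emeasure lborel (ball (0::complex) r)"
    using r by (simp add: emeasure_lborel_ball_complex ennreal_mult' mult.commute)
  also have "\<dots> = (\<integral>\<^sup>+z. ennreal ((cmod (G w))\<^sup>2) * indicator (ball (0::complex) r) z \<partial>lborel)"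
    by (subst nn_integral_cmult_indicator) auto
  also have "\<dots> \<le> (\<integral>\<^sup>+z. \<integral>\<^sup>+t. h (w + E t * z) * indicator {0..1::real} t \<partial>lborel \<partial>lborel)"
    by (intro nn_integral_mono inner)
  also have "\<dots> = (\<integral>\<^sup>+t. \<integral>\<^sup>+z. h (w + E t * z) * indicator {0..1::real} t \<partial>lborel \<partial>lborel)"
    by (intro lborel_pair.Fubini') (simp add: case_prod_unfold)
  also have "\<dots> = (\<integral>\<^sup>+t. (\<integral>\<^sup>+z. h z \<partial>lborel) * indicator {0..1::real} t \<partial>lborel)"
  proof (rule nn_integral_cong)
    fix t :: real
    have "(\<integral>\<^sup>+z. h (w + E t * z) * indicator {0..1} t \<partial>lborel) = (\<integral>\<^sup>+z. h (w + E t * z) \<partial>lborel) * indicator {0..1} t"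
      by (rule nn_integral_multc) simp
    also have "(\<integral>\<^sup>+z. h (w + E t * z) \<partial>lborel) = (\<integral>\<^sup>+z. h (w + z) \<partial>lborel)"
      by (rule nn_integral_rotate[of "\<lambda>z. h (w + z)"]) (simp_all add: E1)
    also have "\<dots> = (\<integral>\<^sup>+z. h z \<partial>lborel)"
      by (rule nn_integral_translate_complex) simp
    finally show "(\<integral>\<^sup>+z. h (w + E t * z) * indicator {0..1} t \<partial>lborel) = (\<integral>\<^sup>+z. h z \<partial>lborel) * indicator {0..1} t" .
  qed
  also have "\<dots> = (\<integral>\<^sup>+z. h z \<partial>lborel)"
    by (subst nn_integral_cmult_indicator) auto
  finally show ?thesis by (simp add: h_alt)
qed

text \<open>The Cauchy estimates turn a zero of order \<open>k\<close> at the centre into a gain of \<open>2\<^sup>-\<^sup>k\<close>.\<close>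

lemma vanishing_order_bound:
  assumes G: "G holomorphic_on ball a (2 * r)" and r: "0 < r"
    and B: "\<And>w. w \<in> ball a (2 * r) \<Longrightarrow> cmod (G w) \<le> B"
    and zero: "\<And>j. j < k \<Longrightarrow> (deriv ^^ j) G a = 0"
    and z: "z \<in> ball a r"
  shows "cmod (G z) \<le> 2 * B / 2 ^ k"
proof -
  define q where "q = cmod (z - a)"
  have q: "0 \<le> q" "q < r" using z by (auto simp: q_def dist_norm norm_minus_commute)
  have B0: "0 \<le> B" using B[of a] r norm_ge_zero order_trans by (metis centre_in_ball mult_pos_pos zero_less_numeral)
  have coeff: "cmod ((deriv ^^ j) G a / fact j * (z - a) ^ j) \<le> (if j < k then 0 else B * (1/2) ^ j)" for j
  proof (cases "j < k")
    case False
    \<comment> \<open>Cauchy's inequality on the circle of radius 2 q' with q' strictly between q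
      and r: the circle must lie inside the open disc where G is holomorphic, and
      \<open>q / (2 * q')\<close> is then at most 1/2.\<close>
    have "cmod ((deriv ^^ j) G a) \<le> fact j * B / (2 * q') ^ j" if q': "q < q'" "q' < r" for q'
    proof (rule Cauchy_inequality)
      have sub: "cball a (2 * q') \<subseteq> ball a (2 * r)" "ball a (2 * q') \<subseteq> ball a (2 * r)" using q' by auto
      show "G holomorphic_on ball a (2 * q')" "continuous_on (cball a (2 * q')) G"
        using G sub by (auto intro: holomorphic_on_subset holomorphic_on_imp_continuous_on continuous_on_subset)
      show "0 < 2 * q'" using q q' by simp
      show "cmod (G x) \<le> B" if "cmod (a - x) = 2 * q'" for x
        using that q' by (intro B) (auto simp: dist_norm)
    qed
    note C = this
    define q' where "q' = (q + r) / 2"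
    have q': "q < q'" "q' < r" using q by (auto simp: q'_def)
    have "cmod ((deriv ^^ j) G a / fact j * (z - a) ^ j) = cmod ((deriv ^^ j) G a) / fact j * q ^ j"
      by (simp add: norm_mult norm_divide norm_power q_def)
    also have "\<dots> \<le> (fact j * B / (2 * q') ^ j) / fact j * q' ^ j"
      using C[OF q'] q q' B0 by (intro mult_mono divide_right_mono power_mono) auto
    also have "\<dots> = B * (1/2) ^ j"
      using q q' by (simp add: power_mult_distrib field_simps)
    finally show ?thesis using False by simp
  qed (use zero in simp)
  have sums: "(\<lambda>j. (deriv ^^ j) G a / fact j * (z - a) ^ j) sums G z"
    using z r by (intro holomorphic_power_series[OF G]) auto
  have tail: "(\<lambda>j. if j < k then 0 else B * (1/2) ^ j) sums (2 * B / 2 ^ k)"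
  proof -
    have "(\<lambda>j. B * (1/2) ^ k * (1/2) ^ j) sums (B * (1/2) ^ k * 2)"
      using geometric_sums[of "1/2::real"] by (intro sums_mult) auto
    then have "(\<lambda>j. (if j + k < k then 0 else B * (1/2) ^ (j + k))) sums (2 * B / 2 ^ k)"
      by (simp add: power_add mult_ac power_one_over)
    then show ?thesis
      by (subst (asm) sums_zero_iff_shift) simp_all
  qed
  show ?thesis
    by (rule norm_sums_le[OF sums tail coeff])
qed

section \<open>The weight\<close>

text \<open>\<open>\<psi> t\<close> stands for \<open>\<phi>(e\<^sup>t)\<close>: in the variable \<open>t = ln |z|\<close> real parts of holomorphic functions
  \<open>c Ln z\<close> are linear and the Laplacian is \<open>e\<^sup>-\<^sup>2\<^sup>t \<psi>''\<close>.\<close>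

locale W_profile =
  fixes \<omega> \<tau> :: "complex \<Rightarrow> real" and \<psi> \<psi>1 \<psi>2 :: "real \<Rightarrow> real" and c1 c2 K :: real
  assumes \<omega>_psi: "\<And>z. z \<in> \<D> \<Longrightarrow> z \<noteq> 0 \<Longrightarrow> \<omega> z = exp (- 2 * \<psi> (ln (cmod z)))"
    and \<omega>_pos: "\<And>z. z \<in> \<D> \<Longrightarrow> 0 < \<omega> z"
    and \<omega>_antimono: "\<And>z w. z \<in> \<D> \<Longrightarrow> w \<in> \<D> \<Longrightarrow> cmod z \<le> cmod w \<Longrightarrow> \<omega> w \<le> \<omega> z"
    and \<omega>_integrable: "integrable area \<omega>"
    and psi_deriv: "\<And>t. t < 0 \<Longrightarrow> (\<psi> has_real_derivative \<psi>1 t) (at t)"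
    and psi1_deriv: "\<And>t. t < 0 \<Longrightarrow> (\<psi>1 has_real_derivative \<psi>2 t) (at t)"
    and psi1_nonneg: "\<And>t. t < 0 \<Longrightarrow> 0 \<le> \<psi>1 t"
    and psi2_lower: "\<And>t. t < 0 \<Longrightarrow> exp (2 * t) / (K * (\<tau> (of_real (exp t)))\<^sup>2) \<le> \<psi>2 t"
    and psi2_upper: "\<And>t. t < 0 \<Longrightarrow> \<psi>2 t \<le> K * exp (2 * t) / (\<tau> (of_real (exp t)))\<^sup>2"
    and K_pos: "0 < K"
    and c_pos: "0 < c1" "0 < c2"
    and \<tau>_pos: "\<And>z. z \<in> \<D> \<Longrightarrow> 0 < \<tau> z"
    and \<tau>_radial: "\<And>z. z \<in> \<D> \<Longrightarrow> \<tau> z = \<tau> (of_real (cmod z))"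
    and \<tau>_antimono: "\<And>z w. z \<in> \<D> \<Longrightarrow> w \<in> \<D> \<Longrightarrow> cmod z \<le> cmod w \<Longrightarrow> \<tau> w \<le> \<tau> z"
    and \<tau>_le: "\<And>z. z \<in> \<D> \<Longrightarrow> \<tau> z \<le> c1 * (1 - cmod z)"
    and \<tau>_Lipschitz: "\<And>z w. z \<in> \<D> \<Longrightarrow> w \<in> \<D> \<Longrightarrow> \<bar>\<tau> z - \<tau> w\<bar> \<le> c2 * cmod (z - w)"
    and \<tau>_flat: "\<And>\<epsilon>. 0 < \<epsilon> \<Longrightarrow> \<exists>r0<1. \<forall>z\<in>\<D>. \<forall>w\<in>\<D>. r0 \<le> cmod z \<longrightarrow> r0 \<le> cmod w \<longrightarrow>
        \<bar>\<tau> z - \<tau> w\<bar> \<le> \<epsilon> * \<bar>cmod z - cmod w\<bar>"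

text \<open>\<open>C2_on\<close> speaks of partial derivatives only. The second one in direction
  \<i> is computed along the vertical line through r, where \<phi> is the profile at
  \<open>\<rho> s\<close>; this gives the polar form of the Laplacian of a radial function.\<close>

lemma radial_C2_profile:
  assumes C2: "C2_on \<D> \<phi>" and rad: "radial \<phi>"
  obtains \<Phi>1 \<Phi>2 where
    "\<And>r. 0 < r \<Longrightarrow> r < 1 \<Longrightarrow> ((\<lambda>r. \<phi> (of_real r)) has_real_derivative \<Phi>1 r) (at r)"
    "\<And>r. 0 < r \<Longrightarrow> r < 1 \<Longrightarrow> (\<Phi>1 has_real_derivative \<Phi>2 r) (at r)"
    "\<And>r. 0 < r \<Longrightarrow> r < 1 \<Longrightarrow> laplacian \<phi> (of_real r) = \<Phi>2 r + \<Phi>1 r / r"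
proof -
  define \<Phi> where "\<Phi> = (\<lambda>r::real. \<phi> (of_real r))"
  define \<Phi>1 where "\<Phi>1 = (\<lambda>r::real. partial_deriv 1 \<phi> (of_real r))"
  define \<Phi>2 where "\<Phi>2 = (\<lambda>r::real. partial_deriv 1 (partial_deriv 1 \<phi>) (of_real r))"
  have basis: "(1::complex) \<in> Basis" "\<i> \<in> Basis" by (auto simp: Basis_complex_def)
  have deriv_along: "((\<lambda>r::real. f (of_real r)) has_real_derivative partial_deriv 1 f (of_real r)) (at r)"
    if "C1_on \<D> f" "0 < r" "r < 1" for f and r :: real
  proof -
    have "of_real r \<in> \<D>" using that by simp
    then have "(\<lambda>t::real. f (of_real r + t *\<^sub>R 1)) differentiable (at 0)"
      using that(1) basis by (auto simp: C1_on_def)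
    then have "((\<lambda>t::real. f (of_real r + t *\<^sub>R 1)) has_real_derivative partial_deriv 1 f (of_real r)) (at 0)"
      by (simp add: partial_deriv_def DERIV_deriv_iff_real_differentiable)
    then have "((\<lambda>t::real. f (of_real (r + t))) has_real_derivative partial_deriv 1 f (of_real r)) (at 0)"
      by (simp add: scaleR_conv_of_real)
    then show ?thesis
      using DERIV_shift[of "\<lambda>r. f (of_real r)" "partial_deriv 1 f (of_real r)" 0 r] by (simp add: add.commute)
  qed
  have d1: "(\<Phi> has_real_derivative \<Phi>1 r) (at r)" if "0 < r" "r < 1" for r
    unfolding \<Phi>_def \<Phi>1_def using C2 that by (intro deriv_along) (auto simp: C2_on_def)
  have d2: "(\<Phi>1 has_real_derivative \<Phi>2 r) (at r)" if "0 < r" "r < 1" for r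
    unfolding \<Phi>1_def \<Phi>2_def using C2 that basis by (intro deriv_along) (auto simp: C2_on_def)
  have "laplacian \<phi> (of_real r) = \<Phi>2 r + \<Phi>1 r / r" if r: "0 < r" "r < 1" for r
  proof -
    define \<rho> where "\<rho> = (\<lambda>s. sqrt (r\<^sup>2 + s\<^sup>2))"
    have \<rho>_deriv: "(\<rho> has_real_derivative s / \<rho> s) (at s)" for s
    proof -
      have "0 < r\<^sup>2 + s\<^sup>2" using r by (intro add_pos_nonneg) auto
      then show ?thesis
        unfolding \<rho>_def by (auto intro!: derivative_eq_intros simp: field_simps)
    qed
    have \<rho>_pos: "0 < \<rho> s" for s
      unfolding \<rho>_def using r by (simp add: add_pos_nonneg)
    have \<rho>0: "\<rho> 0 = r" using r by (simp add: \<rho>_def)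
    have norm_\<rho>: "cmod (of_real r + s *\<^sub>R \<i>) = \<rho> s" for s
      by (simp add: \<rho>_def cmod_def)
    have near: "\<forall>\<^sub>F s in nhds 0. \<rho> s < 1"
    proof -
      have "isCont \<rho> 0" using \<rho>_deriv DERIV_isCont by blast
      then have "(\<rho> \<longlongrightarrow> \<rho> 0) (nhds 0)"
        unfolding isCont_def tendsto_at_iff_tendsto_nhds .
      then have "(\<rho> \<longlongrightarrow> r) (nhds 0)" unfolding \<rho>0 .
      then show ?thesis using r by (intro order_tendstoD)
    qed
    have phi_\<rho>: "\<phi> (of_real r + s *\<^sub>R \<i>) = \<Phi> (\<rho> s)" if "\<rho> s < 1" for s
    proof -
      have "of_real r + s *\<^sub>R \<i> \<in> \<D>" using that norm_\<rho>[of s] by simp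
      then have "\<phi> (of_real r + s *\<^sub>R \<i>) = \<phi> (of_real (cmod (of_real r + s *\<^sub>R \<i>)))"
        using rad unfolding radial_def by blast
      then show ?thesis unfolding norm_\<rho> \<Phi>_def .
    qed
    \<comment> \<open>Required for all s near 0 and not only at s = 0, since it is differentiated
      once more.\<close>
    have pd: "partial_deriv \<i> \<phi> (of_real r + s *\<^sub>R \<i>) = s * (\<Phi>1 (\<rho> s) / \<rho> s)" if s: "\<rho> s < 1" for s
    proof -
      have "((\<lambda>s. \<Phi> (\<rho> s)) has_real_derivative \<Phi>1 (\<rho> s) * (s / \<rho> s)) (at s)"
        by (rule DERIV_chain2[OF d1 \<rho>_deriv]) (use s \<rho>_pos in auto)
      moreover have "\<forall>\<^sub>F u in nhds s. \<phi> (of_real r + u *\<^sub>R \<i>) = \<Phi> (\<rho> u)"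
      proof -
        have "isCont \<rho> s" using \<rho>_deriv DERIV_isCont by blast
        then have "(\<rho> \<longlongrightarrow> \<rho> s) (nhds s)"
          unfolding isCont_def tendsto_at_iff_tendsto_nhds .
        then have "\<forall>\<^sub>F u in nhds s. \<rho> u < 1" using s by (intro order_tendstoD)
        then show ?thesis by (rule eventually_mono) (rule phi_\<rho>)
      qed
      ultimately have "((\<lambda>s. \<phi> (of_real r + s *\<^sub>R \<i>)) has_real_derivative \<Phi>1 (\<rho> s) * (s / \<rho> s)) (at s)"
        by (subst DERIV_cong_ev[OF refl _ refl])
      then have "((\<lambda>t. \<phi> (of_real r + (t + s) *\<^sub>R \<i>)) has_real_derivative \<Phi>1 (\<rho> s) * (s / \<rho> s)) (at 0)"
        using DERIV_shift[of "\<lambda>s. \<phi> (of_real r + s *\<^sub>R \<i>)" _ 0 s] by simp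
      then have "deriv (\<lambda>t. \<phi> (of_real r + s *\<^sub>R \<i> + t *\<^sub>R \<i>)) 0 = \<Phi>1 (\<rho> s) * (s / \<rho> s)"
        by (intro DERIV_imp_deriv) (simp add: scaleR_add_left add_ac)
      then show ?thesis by (simp add: partial_deriv_def)
    qed
    have "((\<lambda>s. s * (\<Phi>1 (\<rho> s) / \<rho> s)) has_real_derivative \<Phi>1 r / r) (at 0)"
    proof -
      have "((\<lambda>s. \<Phi>1 (\<rho> s)) has_real_derivative \<Phi>2 (\<rho> 0) * (0 / \<rho> 0)) (at 0)"
        by (rule DERIV_chain2[OF d2 \<rho>_deriv]) (use r \<rho>0 in auto)
      then have "((\<lambda>s. \<Phi>1 (\<rho> s) / \<rho> s) has_real_derivative
          (\<Phi>2 (\<rho> 0) * (0 / \<rho> 0) * \<rho> 0 - \<Phi>1 (\<rho> 0) * (0 / \<rho> 0)) / (\<rho> 0 * \<rho> 0)) (at 0)"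
        by (rule DERIV_divide[OF _ \<rho>_deriv]) (use \<rho>_pos[of 0] in auto)
      from DERIV_mult[OF DERIV_ident this] show ?thesis
        using \<rho>0 by simp
    qed
    then have "((\<lambda>s. partial_deriv \<i> \<phi> (of_real r + s *\<^sub>R \<i>)) has_real_derivative \<Phi>1 r / r) (at 0)"
      by (subst DERIV_cong_ev[OF refl _ refl]) (rule eventually_mono[OF near], rule pd)
    then have "partial_deriv \<i> (partial_deriv \<i> \<phi>) (of_real r) = \<Phi>1 r / r"
      by (simp add: partial_deriv_def[of \<i> "partial_deriv \<i> \<phi>"] DERIV_imp_deriv)
    then show ?thesis
      by (simp add: laplacian_def Basis_complex_def \<Phi>2_def)
  qed
  then show ?thesis
    using that[of \<Phi>1 \<Phi>2] d1 d2 by (simp add: \<Phi>_def)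
qed

text \<open>Under r = exp t the second derivative of the profile becomes \<open>exp (2 * t)\<close>
  times \<open>\<Phi>2 r + \<Phi>1 r / r\<close>, which is how the two bounds on the Laplacian turn
  into bounds on \<open>\<psi>2\<close> with one constant K.\<close>

lemma class_W_profile:
  assumes W: "class_W \<omega> \<tau>" and L: "class_L_with \<tau> c1 c2"
  obtains \<psi> \<psi>1 \<psi>2 K where "W_profile \<omega> \<tau> \<psi> \<psi>1 \<psi>2 c1 c2 K"
proof -
  obtain \<phi> C C' where \<phi>: "C2_on \<D> \<phi>" "radial \<phi>" "\<And>z. z \<in> \<D> \<Longrightarrow> \<omega> z = exp (- 2 * \<phi> z)"
      "\<And>z. z \<in> \<D> \<Longrightarrow> 0 < laplacian \<phi> z"
      and C: "0 < C" "\<And>z. z \<in> \<D> \<Longrightarrow> laplacian \<phi> z powr (-1/2) \<le> C * \<tau> z"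
      and C': "0 < C'" "\<And>z. z \<in> \<D> \<Longrightarrow> \<tau> z \<le> C' * laplacian \<phi> z powr (-1/2)"
    using W unfolding class_W_def by blast
  obtain \<Phi>1 \<Phi>2 where d1: "\<And>r. 0 < r \<Longrightarrow> r < 1 \<Longrightarrow> ((\<lambda>r. \<phi> (of_real r)) has_real_derivative \<Phi>1 r) (at r)"
    and d2: "\<And>r. 0 < r \<Longrightarrow> r < 1 \<Longrightarrow> (\<Phi>1 has_real_derivative \<Phi>2 r) (at r)"
    and lap: "\<And>r. 0 < r \<Longrightarrow> r < 1 \<Longrightarrow> laplacian \<phi> (of_real r) = \<Phi>2 r + \<Phi>1 r / r"
    using radial_C2_profile[OF \<phi>(1,2)] by blast
  have \<tau>pos: "0 < \<tau> z" if "z \<in> \<D>" for z using W that unfolding class_W_def by blast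
  have "weight \<omega>" using W unfolding class_W_def by blast
  have rd: "radial_decreasing \<tau>" "radial_decreasing \<omega>" using W by (simp_all add: class_W_def)
  then have \<tau>rad: "\<tau> z = \<tau> (of_real (cmod z))" if "z \<in> \<D>" for z
    using that unfolding radial_decreasing_def radial_def by blast
  have antimono: "f w \<le> f z" if "radial_decreasing f" "z \<in> \<D>" "w \<in> \<D>" "cmod z \<le> cmod w" for f z w
  proof -
    have "profile f (cmod w) \<le> profile f (cmod z)"
      using that by (intro monotone_onD[of "{0..<1}" "(\<le>)" "(\<ge>)" "profile f"]) (auto simp: radial_decreasing_def)
    moreover have "f z = f (of_real (cmod z))" "f w = f (of_real (cmod w))"
      using that(1-3) unfolding radial_decreasing_def radial_def by blast+
    ultimately show ?thesis by (metis profile_def)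
  qed
  define K where "K = max (C\<^sup>2) (C'\<^sup>2)"
  have K: "0 < K" "C\<^sup>2 \<le> K" "C'\<^sup>2 \<le> K" using C(1) by (auto simp: K_def less_max_iff_disj)
  have lap_bounds: "1 / (K * (\<tau> z)\<^sup>2) \<le> laplacian \<phi> z" "laplacian \<phi> z \<le> K / (\<tau> z)\<^sup>2" if z: "z \<in> \<D>" for z
  proof -
    define l where "l = laplacian \<phi> z"
    have l: "0 < l" using \<phi>(4)[OF z] by (simp add: l_def)
    have sq: "(l powr (-1/2))\<^sup>2 = 1 / l"
      using l by (simp add: power2_eq_square powr_minus_divide flip: powr_add)
    have "1 / l \<le> (C * \<tau> z)\<^sup>2"
      unfolding sq[symmetric] using C(2)[OF z] by (intro power_mono) (auto simp: l_def)
    also have "\<dots> \<le> K * (\<tau> z)\<^sup>2" using K by (simp add: power_mult_distrib mult_right_mono)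
    finally show "1 / (K * (\<tau> z)\<^sup>2) \<le> laplacian \<phi> z"
      using l K \<tau>pos[OF z] by (simp add: l_def field_simps)
    have "(\<tau> z)\<^sup>2 \<le> (C' * l powr (-1/2))\<^sup>2"
      using C'(2)[OF z] \<tau>pos[OF z] by (intro power_mono) (auto simp: l_def)
    also have "\<dots> = C'\<^sup>2 * (1 / l)" by (simp only: power_mult_distrib sq)
    also have "\<dots> \<le> K * (1 / l)" using K l by (intro mult_right_mono) auto
    finally show "laplacian \<phi> z \<le> K / (\<tau> z)\<^sup>2"
      using l K \<tau>pos[OF z] by (simp add: l_def field_simps)
  qed
  \<comment> \<open>\<phi> increases along radii because the weight decreases; a negative derivative
    would lower it just to the right of r.\<close>
  have \<Phi>1_nonneg: "0 \<le> \<Phi>1 r" if r: "0 < r" "r < 1" for r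
  proof (rule ccontr)
    assume "\<not> 0 \<le> \<Phi>1 r"
    then have "\<Phi>1 r < 0" by simp
    then obtain d where d: "0 < d" "\<And>h. 0 < h \<Longrightarrow> h < d \<Longrightarrow> \<phi> (of_real (r + h)) < \<phi> (of_real r)"
      using DERIV_neg_dec_right[OF d1[OF r]] by auto
    define h where "h = min (d / 2) ((1 - r) / 2)"
    have h: "0 < h" "h < d" "r + h < 1" using d(1) r by (auto simp: h_def min_def field_simps)
    have in_D: "of_real r \<in> \<D>" "of_real (r + h) \<in> \<D>" using r h by (simp_all del: of_real_add)
    have "\<omega> (of_real (r + h)) \<le> \<omega> (of_real r)"
      by (rule antimono[OF rd(2) in_D]) (use r h in \<open>simp del: of_real_add\<close>)
    then have "\<phi> (of_real r) \<le> \<phi> (of_real (r + h))"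
      unfolding \<phi>(3)[OF in_D(1)] \<phi>(3)[OF in_D(2)] by simp
    then show False using d(2)[OF h(1,2)] by linarith
  qed
  define \<psi> where "\<psi> t = \<phi> (of_real (exp t))" for t
  define \<psi>1 where "\<psi>1 t = \<Phi>1 (exp t) * exp t" for t
  define \<psi>2 where "\<psi>2 t = exp (2 * t) * laplacian \<phi> (of_real (exp t))" for t
  have "W_profile \<omega> \<tau> \<psi> \<psi>1 \<psi>2 c1 c2 K"
  proof
    fix z assume z: "z \<in> \<D>" "z \<noteq> 0"
    then have "\<phi> z = \<phi> (of_real (cmod z))" using \<phi>(2) unfolding radial_def by blast
    then have "\<phi> z = \<psi> (ln (cmod z))" using z by (metis \<psi>_def exp_ln zero_less_norm_iff)
    then show "\<omega> z = exp (- 2 * \<psi> (ln (cmod z)))"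
      using \<phi>(3)[OF z(1)] by simp
  next
    fix t :: real assume t: "t < 0"
    then have e: "0 < exp t" "exp t < 1" by auto
    show "(\<psi> has_real_derivative \<psi>1 t) (at t)"
      unfolding \<psi>_def \<psi>1_def by (rule DERIV_chain2[OF d1[OF e] DERIV_exp])
    have "(\<psi>1 has_real_derivative \<Phi>2 (exp t) * exp t * exp t + exp t * \<Phi>1 (exp t)) (at t)"
      unfolding \<psi>1_def by (rule DERIV_mult[OF DERIV_chain2[OF d2[OF e] DERIV_exp] DERIV_exp])
    moreover have "\<psi>2 t = \<Phi>2 (exp t) * exp t * exp t + exp t * \<Phi>1 (exp t)"
      unfolding \<psi>2_def lap[OF e] exp_double by (simp add: power2_eq_square distrib_left)
    ultimately show "(\<psi>1 has_real_derivative \<psi>2 t) (at t)" by simp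
    show "0 \<le> \<psi>1 t" using \<Phi>1_nonneg[OF e] by (simp add: \<psi>1_def)
    have in_D: "of_real (exp t) \<in> \<D>" using e by simp
    show "exp (2 * t) / (K * (\<tau> (of_real (exp t)))\<^sup>2) \<le> \<psi>2 t"
      using mult_left_mono[OF lap_bounds(1)[OF in_D], of "exp (2 * t)"] by (simp add: \<psi>2_def)
    show "\<psi>2 t \<le> K * exp (2 * t) / (\<tau> (of_real (exp t)))\<^sup>2"
      using mult_left_mono[OF lap_bounds(2)[OF in_D], of "exp (2 * t)"] by (simp add: \<psi>2_def mult.commute)
  next
    fix z w assume "z \<in> \<D>" "w \<in> \<D>" "cmod z \<le> cmod w"
    then show "\<omega> w \<le> \<omega> z" "\<tau> w \<le> \<tau> z"
      by (auto intro: antimono rd)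
  next
    fix \<epsilon> :: real assume \<epsilon>: "0 < \<epsilon>"
    have "\<forall>\<^sub>F r in at_left 1. profile \<tau> differentiable (at r)"
      and "(deriv (profile \<tau>) \<longlongrightarrow> 0) (at_left 1)"
      using W unfolding class_W_def by blast+
    moreover have "\<forall>\<^sub>F r in at_left 1. \<bar>deriv (profile \<tau>) r\<bar> < \<epsilon>"
      using tendstoD[OF calculation(2) \<epsilon>] by (simp add: dist_norm)
    ultimately have "\<forall>\<^sub>F r in at_left 1. profile \<tau> differentiable (at r) \<and> \<bar>deriv (profile \<tau>) r\<bar> < \<epsilon>"
      by (simp add: eventually_conj_iff)
    then obtain b where b: "b < 1" "\<And>r. b < r \<Longrightarrow> r < 1 \<Longrightarrow>
        profile \<tau> differentiable (at r) \<and> \<bar>deriv (profile \<tau>) r\<bar> < \<epsilon>"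
      by (auto simp: eventually_at_left[of 0 "1::real"])
    \<comment> \<open>Mean value theorem: near the boundary the derivative of the profile is below
      \<epsilon>, so there \<tau> is Lipschitz in the modulus with constant \<epsilon>.\<close>
    have flat: "\<bar>profile \<tau> x - profile \<tau> y\<bar> \<le> \<epsilon> * \<bar>x - y\<bar>" if "b < x" "b < y" "x < 1" "y < 1" for x y
      using that
    proof (induction x y rule: linorder_wlog)
      case (le x y)
      show ?case
      proof (cases "x = y")
        case False
        then have "x < y" using le by simp
        moreover have "(profile \<tau> has_real_derivative deriv (profile \<tau>) r) (at r)" if "x \<le> r" "r \<le> y" for r
          using b(2)[of r] that le by (auto simp: DERIV_deriv_iff_real_differentiable)
        ultimately obtain r where r: "x < r" "r < y" "profile \<tau> y - profile \<tau> x = (y - x) * deriv (profile \<tau>) r"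
          using MVT2[of x y "profile \<tau>" "deriv (profile \<tau>)"] by blast
        have "\<bar>profile \<tau> x - profile \<tau> y\<bar> = \<bar>x - y\<bar> * \<bar>deriv (profile \<tau>) r\<bar>"
          using r(3) by (metis abs_minus_commute abs_mult)
        also have "\<dots> \<le> \<bar>x - y\<bar> * \<epsilon>"
          using b(2)[of r] r le by (intro mult_left_mono) auto
        finally show ?thesis by (simp add: mult.commute)
      qed simp
    next
      case (sym x y)
      then show ?case by (simp add: abs_minus_commute)
    qed
    define r0 where "r0 = (max b 0 + 1) / 2"
    have r0: "r0 < 1" "b < r0" using b(1) by (auto simp: r0_def)
    have "\<bar>\<tau> z - \<tau> w\<bar> \<le> \<epsilon> * \<bar>cmod z - cmod w\<bar>" if "z \<in> \<D>" "w \<in> \<D>" "r0 \<le> cmod z" "r0 \<le> cmod w" for z w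
      using flat[of "cmod z" "cmod w"] that r0
      unfolding profile_def \<tau>rad[OF that(1), symmetric] \<tau>rad[OF that(2), symmetric] by auto
    then show "\<exists>r0<1. \<forall>z\<in>\<D>. \<forall>w\<in>\<D>. r0 \<le> cmod z \<longrightarrow> r0 \<le> cmod w \<longrightarrow>
        \<bar>\<tau> z - \<tau> w\<bar> \<le> \<epsilon> * \<bar>cmod z - cmod w\<bar>"
      using r0 by blast
  next
    show "\<tau> z = \<tau> (of_real (cmod z))" if "z \<in> \<D>" for z by (rule \<tau>rad) fact
  qed (use \<open>weight \<omega>\<close> L K \<tau>pos in \<open>auto simp: weight_def class_L_with_def\<close>)
  then show ?thesis by (rule that)
qed

section \<open>Comparability of \<tau> on discs of radius \<open>m * \<tau> z\<close>\<close>

context W_profile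
begin

abbreviation m :: real where "m \<equiv> m_tau c1 c2"

lemma m_bounds: "0 < m" "m \<le> 1/4" "m * c1 \<le> 1/4" "m * c2 \<le> 1/4"
proof -
  show "0 < m" using c_pos by (simp add: m_tau_def)
  show "m \<le> 1/4" by (simp add: m_tau_def)
  have "m \<le> inverse c1 / 4" "m \<le> inverse c2 / 4" by (auto simp: m_tau_def)
  then show "m * c1 \<le> 1/4" "m * c2 \<le> 1/4" using c_pos by (auto simp: field_simps)
qed

lemma \<tau>_near:
  assumes "z \<in> \<D>" "w \<in> \<D>" "cmod (z - w) \<le> m * \<tau> z"
  shows "3/4 * \<tau> z \<le> \<tau> w" "\<tau> w \<le> 5/4 * \<tau> z"
proof -
  have "\<bar>\<tau> z - \<tau> w\<bar> \<le> c2 * cmod (z - w)" using \<tau>_Lipschitz assms by auto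
  also have "\<dots> \<le> c2 * (m * \<tau> z)" using assms c_pos by (intro mult_left_mono) auto
  also have "\<dots> = (m * c2) * \<tau> z" by (simp add: mult_ac)
  also have "\<dots> \<le> 1/4 * \<tau> z" using m_bounds(4) \<tau>_pos[OF assms(1)] by (intro mult_right_mono) auto
  finally show "3/4 * \<tau> z \<le> \<tau> w" "\<tau> w \<le> 5/4 * \<tau> z" by linarith+
qed

lemma m_\<tau>_le:
  assumes "z \<in> \<D>"
  shows "m * \<tau> z \<le> (1 - cmod z) / 4"
proof -
  have "m * \<tau> z \<le> m * (c1 * (1 - cmod z))" using \<tau>_le[OF assms] m_bounds by (intro mult_left_mono) auto
  also have "\<dots> = (m * c1) * (1 - cmod z)" by (simp add: mult_ac)
  also have "\<dots> \<le> 1/4 * (1 - cmod z)" using m_bounds(3) assms by (intro mult_right_mono) auto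
  finally show ?thesis by simp
qed

lemma ball_subset_disc:
  assumes "z \<in> \<D>" "\<delta> \<le> m"
  shows "ball z (\<delta> * \<tau> z) \<subseteq> ball z ((1 - cmod z) / 4)" "ball z (\<delta> * \<tau> z) \<subseteq> \<D>"
proof -
  have "\<delta> * \<tau> z \<le> m * \<tau> z" using assms \<tau>_pos[OF assms(1)] by (intro mult_right_mono) auto
  then have le: "\<delta> * \<tau> z \<le> (1 - cmod z) / 4" using m_\<tau>_le[OF assms(1)] by simp
  then show "ball z (\<delta> * \<tau> z) \<subseteq> ball z ((1 - cmod z) / 4)" by auto
  have "ball z (1 - cmod z) \<subseteq> \<D>"
    by (auto simp: dist_norm) (metis add.commute less_diff_eq norm_minus_commute norm_triangle_sub order_le_less_trans)
  moreover have "\<delta> * \<tau> z \<le> 1 - cmod z" using le assms by auto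
  ultimately show "ball z (\<delta> * \<tau> z) \<subseteq> \<D>" by (meson subset_ball subset_trans)
qed

end

section \<open>Convexity of the profile, test functions and local models of the weight\<close>

context W_profile
begin

text \<open>Bregman distance of the convex function \<psi>. Powers of z have a log-modulus that is
  linear in t = ln |z| and can absorb the tangent of \<psi> at a; the gap is what is left of the
  weight.\<close>

definition gap :: "real \<Rightarrow> real \<Rightarrow> real" where
  "gap a t = \<psi> t - \<psi> a - \<psi>1 a * (t - a)"

lemma gap_Taylor:
  assumes "a < 0" "t < 0"
  obtains s where "min a t \<le> s" "s \<le> max a t" "gap a t = \<psi>2 s / 2 * (t - a)\<^sup>2"
proof (cases "t = a")
  case True
  then show ?thesis using that[of a] by (simp add: gap_def)
next
  case False
  define diff where "diff = (\<lambda>n::nat. if n = 0 then \<psi> else if n = 1 then \<psi>1 else \<psi>2)"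
  have "\<exists>s. (if t < a then t < s \<and> s < a else a < s \<and> s < t) \<and>
     \<psi> t = (\<Sum>m<2. diff m a / fact m * (t - a) ^ m) + diff 2 s / fact 2 * (t - a) ^ 2"
  proof (rule Taylor[where a = "min a t" and b = "max a t"])
    show "\<forall>m s. m < 2 \<and> min a t \<le> s \<and> s \<le> max a t \<longrightarrow> (diff m has_real_derivative diff (Suc m) s) (at s)"
    proof (intro allI impI)
      fix m :: nat and s assume "m < 2 \<and> min a t \<le> s \<and> s \<le> max a t"
      then have "s < 0" "m = 0 \<or> m = 1" using assms by auto
      then show "(diff m has_real_derivative diff (Suc m) s) (at s)"
        using psi_deriv[of s] psi1_deriv[of s] by (auto simp: diff_def)
    qed
  qed (use False in \<open>auto simp: diff_def\<close>)
  then obtain s where s: "if t < a then t < s \<and> s < a else a < s \<and> s < t"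
      "\<psi> t = (\<Sum>m<2. diff m a / fact m * (t - a) ^ m) + diff 2 s / fact 2 * (t - a) ^ 2"
    by blast
  have "gap a t = \<psi>2 s / 2 * (t - a)\<^sup>2"
    using s(2) by (simp add: gap_def diff_def numeral_2_eq_2)
  then show ?thesis using that[of s] s(1) by (auto split: if_splits)
qed

lemma psi2_pos: "t < 0 \<Longrightarrow> 0 < \<psi>2 t"
proof -
  assume t: "t < 0"
  then have "0 < \<tau> (of_real (exp t))" by (intro \<tau>_pos) simp
  then have "0 < exp (2 * t) / (K * (\<tau> (of_real (exp t)))\<^sup>2)" using K_pos by simp
  then show ?thesis using psi2_lower[OF t] by linarith
qed

lemma gap_nonneg: "a < 0 \<Longrightarrow> t < 0 \<Longrightarrow> 0 \<le> gap a t"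
  using gap_Taylor[of a t] psi2_pos by (smt (verit) divide_nonneg_nonneg mult_nonneg_nonneg zero_le_power2)

lemma norm_ln_facts:
  assumes "z \<in> \<D>" "z \<noteq> 0"
  shows "ln (cmod z) < 0" "exp (ln (cmod z)) = cmod z"
  using assms by auto

text \<open>Within \<open>m * \<tau> a\<close> of a the function \<tau> varies by a bounded factor,
  so \<open>\<psi>2\<close> is at most of order \<open>1 / (\<tau> a)\<^sup>2\<close> while ln |z|
  moves at most by order \<open>m * \<tau> a\<close>; the product is bounded. The condition
  \<open>1/2 \<le> cmod a\<close> makes the logarithm Lipschitz.\<close>

lemma gap_upper:
  assumes a: "a \<in> \<D>" "1/2 \<le> cmod a" and z: "z \<in> ball a (m * \<tau> a)"
  shows "z \<in> \<D>" "3/8 \<le> cmod z" "gap (ln (cmod a)) (ln (cmod z)) \<le> 8 * K"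
    "\<bar>ln (cmod z) - ln (cmod a)\<bar> \<le> 1"
proof -
  show zD: "z \<in> \<D>" using ball_subset_disc(2)[OF a(1) order_refl] z by blast
  have d: "cmod (a - z) < m * \<tau> a" using z by (simp add: dist_norm)
  have m\<tau>: "m * \<tau> a \<le> 1/8" using m_\<tau>_le[OF a(1)] a(2) by simp
  have dn: "\<bar>cmod z - cmod a\<bar> < m * \<tau> a" using d norm_triangle_ineq3[of a z] by linarith
  show z38: "3/8 \<le> cmod z" using dn m\<tau> a(2) by linarith
  have a0: "a \<noteq> 0" "z \<noteq> 0" using a z38 by auto
  have ln_diff: "\<bar>ln (cmod z) - ln (cmod a)\<bar> \<le> \<bar>cmod z - cmod a\<bar> / (3/8)"
  proof -
    have "ln y - ln x \<le> (y - x) / (3/8)" if "3/8 \<le> x" "x \<le> y" for x y :: real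
    proof -
      have "ln y - ln x \<le> (y - x) / x" using that by (intro ln_diff_le) auto
      also have "\<dots> \<le> (y - x) / (3/8)" using that by (intro divide_left_mono) auto
      finally show ?thesis .
    qed
    note * = this
    show ?thesis
    proof (cases "cmod z \<le> cmod a")
      case True
      moreover have "ln (cmod z) \<le> ln (cmod a)" using True a0 by simp
      ultimately show ?thesis using *[of "cmod z" "cmod a"] z38 by simp
    next
      case False
      moreover have "ln (cmod a) \<le> ln (cmod z)" using False a0 by simp
      ultimately show ?thesis using *[of "cmod a" "cmod z"] a(2) by simp
    qed
  qed
  moreover have "\<bar>cmod z - cmod a\<bar> / (3/8) \<le> 1" using dn m\<tau> by simp
  ultimately show "\<bar>ln (cmod z) - ln (cmod a)\<bar> \<le> 1" by linarith
  obtain s where s: "min (ln (cmod a)) (ln (cmod z)) \<le> s" "s \<le> max (ln (cmod a)) (ln (cmod z))"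
    "gap (ln (cmod a)) (ln (cmod z)) = \<psi>2 s / 2 * (ln (cmod z) - ln (cmod a))\<^sup>2"
    using gap_Taylor norm_ln_facts a(1) zD a0 by metis
  define r where "r = exp s"
  have sn: "s < 0" using s(2) norm_ln_facts(1)[OF a(1) a0(1)] norm_ln_facts(1)[OF zD a0(2)] by linarith
  then have r: "0 < r" "r < 1" by (auto simp: r_def)
  have "exp (min (ln (cmod a)) (ln (cmod z))) \<le> r" "r \<le> exp (max (ln (cmod a)) (ln (cmod z)))"
    using s unfolding r_def by simp_all
  then have rb: "min (cmod a) (cmod z) \<le> r" "r \<le> max (cmod a) (cmod z)"
    using norm_ln_facts[OF a(1) a0(1)] norm_ln_facts[OF zD a0(2)]
    by (auto simp: min_def max_def split: if_splits)
  have rdist: "\<bar>r - cmod a\<bar> \<le> m * \<tau> a" using rb dn by linarith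
  have "3/4 * \<tau> (of_real (cmod a)) \<le> \<tau> (of_real r)"
  proof (rule \<tau>_near(1))
    show "cmod (of_real (cmod a) - of_real r) \<le> m * \<tau> (of_real (cmod a))"
      using rdist \<tau>_radial[OF a(1)] by (simp add: abs_minus_commute flip: of_real_diff)
  qed (use a r in auto)
  then have \<tau>r: "3/4 * \<tau> a \<le> \<tau> (of_real r)" using \<tau>_radial[OF a(1)] by simp
  have "\<psi>2 s \<le> K * exp (2 * s) / (\<tau> (of_real r))\<^sup>2" unfolding r_def by (rule psi2_upper[OF sn])
  also have "\<dots> \<le> K * 1 / (3/4 * \<tau> a)\<^sup>2"
    using \<tau>r sn K_pos \<tau>_pos[OF a(1)] by (intro frac_le mult_left_mono power_mono) auto
  finally have p2: "\<psi>2 s \<le> K / (3/4 * \<tau> a)\<^sup>2" by simp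
  have sq: "(ln (cmod z) - ln (cmod a))\<^sup>2 \<le> (m * \<tau> a / (3/8))\<^sup>2"
    unfolding power2_abs[symmetric, of "ln (cmod z) - ln (cmod a)"]
    using ln_diff dn by (intro power_mono) auto
  have "gap (ln (cmod a)) (ln (cmod z)) \<le> K / (3/4 * \<tau> a)\<^sup>2 / 2 * (m * \<tau> a / (3/8))\<^sup>2"
    unfolding s(3) using p2 sq psi2_pos[OF sn] by (intro mult_mono divide_right_mono) auto
  \<comment> \<open>The constant is half of (4/3)^2 times (8/3)^2, that is 512 / 81, which is below
    8.\<close>
  also have "\<dots> = K * (m\<^sup>2 * (512 / 81))"
    using \<tau>_pos[OF a(1)] by (simp add: field_simps)
  also have "\<dots> \<le> K * (1 * 8)"
    using m_bounds K_pos by (intro mult_left_mono mult_mono power_le_one) auto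
  finally show "gap (ln (cmod a)) (ln (cmod z)) \<le> 8 * K" by simp
qed

text \<open>Between |a| and |z| the function \<tau> is at most \<open>\<tau> a\<close>, and
  \<open>exp (2 * s)\<close> is at least 1/4, hence \<open>\<psi>2 s\<close> is at least
  \<open>1 / (4 * K * (\<tau> a)\<^sup>2)\<close>.\<close>

lemma gap_lower_quadratic:
  assumes a: "a \<in> \<D>" "1/2 \<le> cmod a" and z: "z \<in> \<D>" "cmod a \<le> cmod z"
  shows "((ln (cmod z) - ln (cmod a)) / \<tau> a)\<^sup>2 / (8 * K) \<le> gap (ln (cmod a)) (ln (cmod z))"
proof -
  have a0: "a \<noteq> 0" "z \<noteq> 0" using a z by auto
  obtain s where s: "min (ln (cmod a)) (ln (cmod z)) \<le> s" "s \<le> max (ln (cmod a)) (ln (cmod z))"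
    "gap (ln (cmod a)) (ln (cmod z)) = \<psi>2 s / 2 * (ln (cmod z) - ln (cmod a))\<^sup>2"
    using gap_Taylor norm_ln_facts a(1) z(1) a0 by metis
  have s': "ln (cmod a) \<le> s" "s \<le> ln (cmod z)" using s a0 z by (auto simp: min_def max_def)
  have sn: "s < 0" using s' norm_ln_facts[OF z(1) a0(2)] by linarith
  have as: "cmod a \<le> exp s" using s'(1) a0 by (metis exp_le_cancel_iff exp_ln zero_less_norm_iff)
  have "\<tau> (of_real (exp s)) \<le> \<tau> a" using as sn a by (intro \<tau>_antimono) auto
  moreover have "0 < \<tau> (of_real (exp s))" using sn by (intro \<tau>_pos) auto
  ultimately have "(1/4) / (K * (\<tau> a)\<^sup>2) \<le> exp (2 * s) / (K * (\<tau> (of_real (exp s)))\<^sup>2)"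
  proof (intro frac_le mult_left_mono power_mono)
    have "(1/2)\<^sup>2 \<le> (exp s)\<^sup>2" using as a by (intro power_mono) auto
    then show "1/4 \<le> exp (2 * s)" by (simp add: exp_double power2_eq_square)
  qed (use K_pos in auto)
  also have "\<dots> \<le> \<psi>2 s" by (rule psi2_lower[OF sn])
  finally have "(1/4) / (K * (\<tau> a)\<^sup>2) / 2 * (ln (cmod z) - ln (cmod a))\<^sup>2 \<le> gap (ln (cmod a)) (ln (cmod z))"
    unfolding s(3) by (intro mult_right_mono divide_right_mono) auto
  then show ?thesis by (simp add: power_divide mult_ac)
qed

text \<open>Integrating \<open>\<psi>'' \<ge> 1/(4K\<tau>\<^sup>2)\<close> against \<open>t - s\<close>, with the bound \<open>\<tau>(e\<^sup>s) \<le> \<tau>(e\<^sup>t) + \<epsilon>(t - s)\<close>.\<close>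

lemma gap_lower_log:
  assumes a: "a \<in> \<D>" "1/2 \<le> cmod a" and z: "z \<in> \<D>" "cmod a \<le> cmod z"
    and \<epsilon>: "0 < \<epsilon>"
    and flat: "\<And>u v. u \<in> \<D> \<Longrightarrow> v \<in> \<D> \<Longrightarrow> cmod a \<le> cmod u \<Longrightarrow> cmod a \<le> cmod v \<Longrightarrow>
        \<bar>\<tau> u - \<tau> v\<bar> \<le> \<epsilon> * \<bar>cmod u - cmod v\<bar>"
  shows "(ln (\<tau> a / \<tau> z) - 1) / (4 * K * \<epsilon>\<^sup>2) \<le> gap (ln (cmod a)) (ln (cmod z))"
proof -
  define ta t where "ta = ln (cmod a)" and "t = ln (cmod z)"
  have a0: "a \<noteq> 0" "z \<noteq> 0" using a z by auto
  have tt: "ta \<le> t" "t < 0" using norm_ln_facts[OF z(1) a0(2)] z a0 by (auto simp: ta_def t_def)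
  define c where "c = 1 / (4 * K)"
  have c: "0 < c" using K_pos by (simp add: c_def)
  have \<tau>z: "0 < \<tau> z" using \<tau>_pos z by auto
  define D where "D = (\<lambda>s. \<tau> z + \<epsilon> * (t - s))"
  have Dpos: "0 < D s" if "s \<le> t" for s
    using that \<tau>z \<epsilon> by (simp add: D_def add_pos_nonneg)
  have D_le: "\<tau> (of_real (exp s)) \<le> D s" if "ta \<le> s" "s \<le> t" for s
  proof -
    have "cmod a \<le> exp s" using that a0 by (metis exp_le_cancel_iff exp_ln ta_def zero_less_norm_iff)
    moreover have "exp t = cmod z" using a0 by (simp add: t_def)
    ultimately have "\<bar>\<tau> (of_real (exp s)) - \<tau> z\<bar> \<le> \<epsilon> * \<bar>exp s - exp t\<bar>"
      using flat[of "of_real (exp s)" z] that tt z by simp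
    moreover have "\<bar>exp s - exp t\<bar> \<le> t - s"
    proof -
      have "exp t * (1 + (s - t)) \<le> exp t * exp (s - t)" by (intro mult_left_mono exp_ge_add_one_self) auto
      then have "exp t - exp s \<le> exp t * (t - s)" by (simp add: algebra_simps flip: exp_add)
      also have "\<dots> \<le> 1 * (t - s)" using that tt by (intro mult_right_mono) auto
      finally show ?thesis using that by simp
    qed
    then have "\<epsilon> * \<bar>exp s - exp t\<bar> \<le> \<epsilon> * (t - s)" using \<epsilon> by (intro mult_left_mono) auto
    ultimately show ?thesis by (simp add: D_def)
  qed
  \<comment> \<open>The term with the logarithm differentiates to
    \<open>c * (t - s) / (D s)\<^sup>2\<close>, the others to \<open>- \<psi>2 s * (t - s)\<close>.
    Thus F decreases, and comparing its values at \<open>ta\<close> and t gives the claim.\<close>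
  define F where "F = (\<lambda>s. \<psi> t - \<psi> s - \<psi>1 s * (t - s) - c / \<epsilon>\<^sup>2 * (ln (D s) + \<tau> z / D s))"
  have F_deriv: "(F has_real_derivative (- \<psi>2 s * (t - s) + c * (t - s) / (D s)\<^sup>2)) (at s)"
    if s: "s \<le> t" for s
  proof -
    have sn: "s < 0" using s tt by simp
    have D': "(D has_real_derivative - \<epsilon>) (at s)"
      unfolding D_def by (auto intro!: derivative_eq_intros)
    have "(F has_real_derivative (0 - \<psi>1 s - (\<psi>2 s * (t - s) + (0 - 1) * \<psi>1 s)
        - c / \<epsilon>\<^sup>2 * (1 / D s * - \<epsilon> + (0 * D s - \<tau> z * - \<epsilon>) / (D s * D s)))) (at s)"
      unfolding F_def using Dpos[OF s]
      by (intro DERIV_diff DERIV_const psi_deriv[OF sn] DERIV_mult psi1_deriv[OF sn] DERIV_ident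
          DERIV_cmult DERIV_add DERIV_divide D' DERIV_chain2[OF DERIV_ln_divide]) auto
    note X = this
    have Y: "c / \<epsilon>\<^sup>2 * (1 / D s * - \<epsilon> + (0 * D s - \<tau> z * - \<epsilon>) / (D s * D s)) = - c * (t - s) / (D s)\<^sup>2"
    proof -
      have "1 / D s * - \<epsilon> + (0 * D s - \<tau> z * - \<epsilon>) / (D s * D s) = - \<epsilon> * (D s - \<tau> z) / (D s)\<^sup>2"
        using Dpos[OF s] by (simp add: field_simps power2_eq_square)
      also have "\<dots> = - (\<epsilon>\<^sup>2 * (t - s)) / (D s)\<^sup>2" by (simp add: D_def power2_eq_square)
      finally show ?thesis using \<epsilon> by simp
    qed
    show ?thesis
      using X[unfolded Y] by (rule DERIV_cong) (simp add: algebra_simps diff_divide_distrib)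
  qed
  have "F t \<le> F ta"
  proof (rule DERIV_nonpos_imp_nonincreasing[OF tt(1)])
    fix s assume s: "ta \<le> s" "s \<le> t"
    then have sn: "s < 0" using tt by simp
    have \<tau>s: "0 < \<tau> (of_real (exp s))" using sn by (intro \<tau>_pos) auto
    have "c / (D s)\<^sup>2 \<le> \<psi>2 s"
    proof -
      have "cmod a \<le> exp s" using s a0 by (metis exp_le_cancel_iff exp_ln ta_def zero_less_norm_iff)
      then have "(1/2)\<^sup>2 \<le> (exp s)\<^sup>2" using a by (intro power_mono) auto
      then have "1/4 \<le> exp (2 * s)" by (simp add: exp_double power2_eq_square)
      then have "(1/4) / (K * (D s)\<^sup>2) \<le> exp (2 * s) / (K * (\<tau> (of_real (exp s)))\<^sup>2)"
        using \<tau>s D_le[OF s] K_pos by (intro frac_le mult_left_mono power_mono) auto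
      also have "\<dots> \<le> \<psi>2 s" by (rule psi2_lower[OF sn])
      finally show ?thesis by (simp add: c_def)
    qed
    then have "c / (D s)\<^sup>2 * (t - s) \<le> \<psi>2 s * (t - s)" using s by (intro mult_right_mono) auto
    then have "- \<psi>2 s * (t - s) + c * (t - s) / (D s)\<^sup>2 \<le> 0" by simp
    then show "\<exists>y. (F has_real_derivative y) (at s) \<and> y \<le> 0"
      using F_deriv[OF s(2)] by blast
  qed
  moreover have "F t = - c / \<epsilon>\<^sup>2 * (ln (\<tau> z) + 1)"
    using \<tau>z by (simp add: F_def D_def)
  moreover have "F ta = gap ta t - c / \<epsilon>\<^sup>2 * (ln (D ta) + \<tau> z / D ta)"
    by (simp add: F_def gap_def)
  ultimately have "c / \<epsilon>\<^sup>2 * (ln (D ta) + \<tau> z / D ta - ln (\<tau> z) - 1) \<le> gap ta t"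
    by (simp add: algebra_simps)
  moreover have "c / \<epsilon>\<^sup>2 * (ln (\<tau> a / \<tau> z) - 1) \<le> c / \<epsilon>\<^sup>2 * (ln (D ta) + \<tau> z / D ta - ln (\<tau> z) - 1)"
  proof (rule mult_left_mono)
    have "\<tau> a \<le> D ta"
      using D_le[OF order_refl tt(1)] \<tau>_radial[OF a(1)] a0 by (simp add: ta_def)
    then have "ln (\<tau> a) \<le> ln (D ta)" using \<tau>_pos[OF a(1)] by simp
    moreover have "0 \<le> \<tau> z / D ta" using \<tau>z Dpos[OF tt(1)] by simp
    ultimately show "ln (\<tau> a / \<tau> z) - 1 \<le> ln (D ta) + \<tau> z / D ta - ln (\<tau> z) - 1"
      using \<tau>z \<tau>_pos[OF a(1)] by (simp add: ln_div)
  qed (use c in simp)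
  ultimately have "c / \<epsilon>\<^sup>2 * (ln (\<tau> a / \<tau> z) - 1) \<le> gap ta t" by linarith
  then show ?thesis by (simp add: c_def ta_def t_def)
qed

text \<open>The geometric mean of N terms is concentrated at distance 1 / N from u = 1, so this N
  gives concentration on the scale \<open>\<tau> a\<close>.\<close>

definition trunc_order :: "complex \<Rightarrow> nat" where
  "trunc_order a = nat \<lfloor>1 / \<tau> a\<rfloor>"

text \<open>An integer exponent keeps the power single-valued. Rounding the slope up costs at most
  one factor |z / a| beyond |a|, which is at most 2 when |a| is at least 1/2.\<close>

definition freq :: "complex \<Rightarrow> nat" where
  "freq a = nat \<lceil>\<psi>1 (ln (cmod a))\<rceil>"

definition dirichlet_mean :: "nat \<Rightarrow> complex \<Rightarrow> complex" where
  "dirichlet_mean N u = (\<Sum>k<N. u ^ k) / of_nat N"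

text \<open>The power cancels the slope of \<open>\<psi>\<close> at \<open>ln |a|\<close>, and the mean is \<open>O(\<tau> a / |z - a|)\<close>.
  Elements of the Bergman space are functions extended by \<open>0\<close> off the disc.\<close>

definition test_fun :: "complex \<Rightarrow> complex \<Rightarrow> complex" where
  "test_fun a z = (if z \<in> \<D> then
     of_real (exp (\<psi> (ln (cmod a)))) * (z / a) ^ freq a * dirichlet_mean (trunc_order a) (z / a) ^ 4 else 0)"

text \<open>The first bound counts terms, the second uses the closed form of the geometric sum, and
  the third holds because every \<open>u ^ k\<close> with k < N stays within 3/4 of 1.\<close>

lemma dirichlet_mean_bounds:
  assumes "0 < N"
  shows "cmod (dirichlet_mean N u) \<le> (max 1 (cmod u)) ^ N"
    and "cmod (dirichlet_mean N u) * cmod (u - 1) \<le> 2 * (max 1 (cmod u)) ^ N / N"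
    and "real N * cmod (u - 1) \<le> 1/2 \<Longrightarrow> 1/4 \<le> cmod (dirichlet_mean N u)"
proof -
  define M where "M = max 1 (cmod u)"
  have M: "1 \<le> M" "cmod u \<le> M" by (auto simp: M_def)
  have pw: "cmod u ^ k \<le> M ^ N" if "k \<le> N" for k
  proof -
    have "cmod u ^ k \<le> M ^ k" using M by (intro power_mono) auto
    also have "\<dots> \<le> M ^ N" using M that by (intro power_increasing) auto
    finally show ?thesis .
  qed
  have "cmod (\<Sum>k<N. u ^ k) \<le> (\<Sum>k<N. M ^ N)"
    by (intro sum_norm_le) (auto simp: norm_power intro: pw)
  then show "cmod (dirichlet_mean N u) \<le> M ^ N"
    using assms by (simp add: dirichlet_mean_def norm_divide field_simps)
  have "cmod (\<Sum>k<N. u ^ k) * cmod (u - 1) = cmod (u ^ N - 1)"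
    using power_diff_1_eq[of u N] by (cases "u = 1") (auto simp: norm_mult mult.commute)
  also have "\<dots> \<le> cmod u ^ N + 1" by (metis norm_one norm_power norm_triangle_ineq4)
  also have "\<dots> \<le> 2 * M ^ N" using pw[of N] M one_le_power[OF M(1), of N] by linarith
  finally show "cmod (dirichlet_mean N u) * cmod (u - 1) \<le> 2 * M ^ N / N"
    using assms by (simp add: dirichlet_mean_def norm_divide field_simps)
  assume small: "real N * cmod (u - 1) \<le> 1/2"
  have "cmod (u ^ k - 1) \<le> 3/4" if "k < N" for k
  proof -
    define d where "d = cmod (u - 1)"
    have "cmod (u ^ k - 1) \<le> (1 + d) ^ k - 1"
    proof (induction k)
      case (Suc k)
      have "u ^ Suc k - 1 = u * (u ^ k - 1) + (u - 1)" by (simp add: algebra_simps)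
      then have "cmod (u ^ Suc k - 1) \<le> cmod u * cmod (u ^ k - 1) + d"
        by (metis d_def norm_mult norm_triangle_ineq)
      also have "cmod u \<le> 1 + d" unfolding d_def using norm_triangle_ineq[of 1 "u - 1"] by simp
      then have "cmod u * cmod (u ^ k - 1) \<le> (1 + d) * ((1 + d) ^ k - 1)"
        using Suc by (intro mult_mono) (auto simp: d_def)
      finally show ?case by (simp add: algebra_simps)
    qed simp
    also have "(1 + d) ^ k \<le> exp d ^ k" using exp_ge_add_one_self[of d] by (intro power_mono) (auto simp: d_def)
    also have "\<dots> = exp (k * d)" by (simp add: exp_of_nat_mult)
    also have "\<dots> \<le> exp (1/2)"
    proof -
      have "k * d \<le> N * d" using that by (intro mult_right_mono) (auto simp: d_def)
      then show ?thesis using small by (simp add: d_def)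
    qed
    \<comment> \<open>From exp x \<le> 1 + x + x^2 at x = 1/2.\<close>
    also have "exp (1/2) \<le> (7/4::real)"
      using exp_bound[of "1/2::real"] by (simp add: power2_eq_square)
    finally show ?thesis by simp
  qed
  then have "cmod (\<Sum>k<N. u ^ k - 1) \<le> (\<Sum>k<N. 3/4)"
    by (intro sum_norm_le) auto
  then have "cmod ((\<Sum>k<N. u ^ k) - of_nat N) \<le> 3/4 * N" by (simp add: sum_subtractf)
  moreover have "real N \<le> cmod (\<Sum>k<N. u ^ k) + cmod ((\<Sum>k<N. u ^ k) - of_nat N)"
    using norm_triangle_ineq4[of "\<Sum>k<N. u ^ k" "(\<Sum>k<N. u ^ k) - of_nat N"] by simp
  ultimately show "1/4 \<le> cmod (dirichlet_mean N u)"
    using assms by (simp add: dirichlet_mean_def norm_divide field_simps)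
qed

text \<open>Positivity of \<open>freq a\<close> comes from strict convexity: the nonnegative slope
  \<open>\<psi>1\<close> is strictly increasing, so it cannot vanish. It makes the test function
  vanish at the origin, where \<open>ln (cmod z)\<close> carries no information.\<close>

lemma freq_bounds:
  assumes "a \<in> \<D>" "a \<noteq> 0"
  shows "\<psi>1 (ln (cmod a)) \<le> freq a" "freq a < \<psi>1 (ln (cmod a)) + 1" "0 < freq a"
proof -
  have n: "0 \<le> \<psi>1 (ln (cmod a))" using psi1_nonneg norm_ln_facts[OF assms] by simp
  then show "\<psi>1 (ln (cmod a)) \<le> freq a" "freq a < \<psi>1 (ln (cmod a)) + 1"
    unfolding freq_def by linarith+
  have "\<psi>1 (ln (cmod a) - 1) < \<psi>1 (ln (cmod a))"
  proof (rule DERIV_pos_imp_increasing[where f = \<psi>1])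
    fix t assume "t \<le> ln (cmod a)"
    then have "t < 0" using norm_ln_facts(1)[OF assms] by linarith
    then show "\<exists>y. DERIV \<psi>1 t :> y \<and> 0 < y"
      using psi1_deriv psi2_pos by blast
  qed simp
  moreover have "0 \<le> \<psi>1 (ln (cmod a) - 1)"
    by (rule psi1_nonneg) (use norm_ln_facts(1)[OF assms] in linarith)
  ultimately show "0 < freq a" by (simp add: freq_def)
qed

text \<open>The exponents of the weight, of the power and of the normalizing factor
  \<open>exp (\<psi> (ln (cmod a)))\<close> add up to the tangent minus \<psi>, apart from the
  rounding error of the slope.\<close>

lemma test_fun_weighted:
  assumes a: "a \<in> \<D>" "a \<noteq> 0" and z: "z \<in> \<D>" "z \<noteq> 0"
  shows "cmod (test_fun a z) * sqrt (\<omega> z) =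
     exp ((freq a - \<psi>1 (ln (cmod a))) * (ln (cmod z) - ln (cmod a)) - gap (ln (cmod a)) (ln (cmod z))) *
     cmod (dirichlet_mean (trunc_order a) (z / a)) ^ 4"
proof -
  have "sqrt (\<omega> z) = exp (- \<psi> (ln (cmod z)))"
    unfolding \<omega>_psi[OF z] by (rule real_sqrt_unique) (simp_all add: power2_eq_square flip: exp_add)
  moreover have "cmod (z / a) ^ freq a = exp (freq a * (ln (cmod z) - ln (cmod a)))"
  proof -
    have "cmod (z / a) = exp (ln (cmod z) - ln (cmod a))"
      using a z by (simp add: norm_divide exp_diff)
    then show ?thesis by (simp add: exp_of_nat_mult)
  qed
  ultimately have "cmod (test_fun a z) * sqrt (\<omega> z) =
      (exp (\<psi> (ln (cmod a))) * exp (freq a * (ln (cmod z) - ln (cmod a))) * exp (- \<psi> (ln (cmod z)))) *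
      cmod (dirichlet_mean (trunc_order a) (z / a)) ^ 4"
    using z by (simp add: test_fun_def norm_mult norm_power mult_ac)
  also have "exp (\<psi> (ln (cmod a))) * exp (freq a * (ln (cmod z) - ln (cmod a))) * exp (- \<psi> (ln (cmod z))) =
      exp ((freq a - \<psi>1 (ln (cmod a))) * (ln (cmod z) - ln (cmod a)) - gap (ln (cmod a)) (ln (cmod z)))"
    by (simp add: gap_def algebra_simps flip: exp_add)
  finally show ?thesis .
qed

lemma \<tau>_small_near_boundary: "0 < e \<Longrightarrow> \<exists>r0<1. \<forall>z\<in>\<D>. r0 \<le> cmod z \<longrightarrow> \<tau> z < e"
proof -
  assume e: "0 < e"
  define r0 where "r0 = 1 - e / (2 * c1)"
  have "\<tau> z < e" if "z \<in> \<D>" "r0 \<le> cmod z" for z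
  proof -
    have "\<tau> z \<le> c1 * (1 - cmod z)" using \<tau>_le that by simp
    also have "\<dots> \<le> c1 * (e / (2 * c1))" using that c_pos by (intro mult_left_mono) (auto simp: r0_def)
    also have "\<dots> < e" using c_pos e by simp
    finally show ?thesis .
  qed
  moreover have "r0 < 1" using e c_pos by (simp add: r0_def)
  ultimately show ?thesis by blast
qed

lemma trunc_order_bounds:
  assumes "a \<in> \<D>" "\<tau> a \<le> 1/2"
  shows "0 < trunc_order a" "real (trunc_order a) \<le> 1 / \<tau> a" "1 / real (trunc_order a) \<le> 2 * \<tau> a"
proof -
  have t: "0 < \<tau> a" using \<tau>_pos assms by simp
  have t2: "2 \<le> 1 / \<tau> a" using t assms by (simp add: field_simps)
  have N: "real (trunc_order a) \<le> 1 / \<tau> a" "1 / \<tau> a - 1 < real (trunc_order a)"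
    using t2 unfolding trunc_order_def by linarith+
  then show "real (trunc_order a) \<le> 1 / \<tau> a" "0 < trunc_order a" using t2 by linarith+
  have "1 / (2 * \<tau> a) \<le> real (trunc_order a)" using N(2) t2 by simp
  then show "1 / real (trunc_order a) \<le> 2 * \<tau> a"
    using t \<open>0 < trunc_order a\<close> by (simp add: field_simps)
qed

text \<open>For |z| \<le> |a| the exponential factor is at most 1, the mean supplies the decay, and
  the minimum is \<open>\<tau> a\<close>. For |z| > |a| the mean may grow like
  \<open>exp (x / \<tau> a)\<close>; the gap must absorb the fourth power of this and also supply
  \<open>(\<tau> z / \<tau> a) ^ 4\<close>. Its quadratic lower bound does the first, its
  logarithmic one the second.\<close>

lemma test_fun_upper:
  obtains r1 C where "1/2 \<le> r1" "r1 < 1" "0 < C"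
    "\<And>a z. a \<in> \<D> \<Longrightarrow> r1 \<le> cmod a \<Longrightarrow> z \<in> \<D> \<Longrightarrow> cmod (test_fun a z) * sqrt (\<omega> z) \<le> C"
    "\<And>a z. a \<in> \<D> \<Longrightarrow> r1 \<le> cmod a \<Longrightarrow> z \<in> \<D> \<Longrightarrow>
       cmod (test_fun a z) * sqrt (\<omega> z) * cmod (z - a) ^ 4 \<le> C * (min (\<tau> a) (\<tau> z)) ^ 4"
    "\<And>a. a \<in> \<D> \<Longrightarrow> r1 \<le> cmod a \<Longrightarrow> \<tau> a \<le> 1/2"
proof -
  \<comment> \<open>Chosen so that the logarithmic bound on the gap has coefficient 8; averaging
    with the quadratic bound keeps half of it.\<close>
  define \<epsilon> where "\<epsilon> = sqrt (1 / (32 * K))"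
  have \<epsilon>: "0 < \<epsilon>" "4 * K * \<epsilon>\<^sup>2 = 1/8" using K_pos by (auto simp: \<epsilon>_def)
  obtain ra where ra: "ra < 1" "\<And>z w. z \<in> \<D> \<Longrightarrow> w \<in> \<D> \<Longrightarrow> ra \<le> cmod z \<Longrightarrow> ra \<le> cmod w \<Longrightarrow>
      \<bar>\<tau> z - \<tau> w\<bar> \<le> \<epsilon> * \<bar>cmod z - cmod w\<bar>"
    using \<tau>_flat[OF \<epsilon>(1)] by blast
  obtain rb where rb: "rb < 1" "\<And>z. z \<in> \<D> \<Longrightarrow> rb \<le> cmod z \<Longrightarrow> \<tau> z < 1/2"
    using \<tau>_small_near_boundary[of "1/2"] by auto
  define r1 where "r1 = max (1/2) (max ra rb)"
  have r1: "1/2 \<le> r1" "r1 < 1" "ra \<le> r1" "rb \<le> r1" using ra rb by (auto simp: r1_def)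
  \<comment> \<open>The average of \<open>8 * X - 128 * K\<close> and
    \<open>8 * (ln (\<tau> a / \<tau> z) - 1)\<close> loses exactly this constant.\<close>
  define C2 where "C2 = 64 * K + 4"
  \<comment> \<open>512 is 4^4 from the decay of the mean times 2 from rounding the slope.\<close>
  define C where "C = 512 * exp C2"
  have C2: "0 < C2" using K_pos by (simp add: C2_def)
  then have C512: "512 \<le> C" using one_le_exp_iff[of C2] unfolding C_def by linarith
  have main: "cmod (test_fun a z) * sqrt (\<omega> z) \<le> C \<and>
      cmod (test_fun a z) * sqrt (\<omega> z) * cmod (z - a) ^ 4 \<le> C * (min (\<tau> a) (\<tau> z)) ^ 4"
    if a: "a \<in> \<D>" "r1 \<le> cmod a" and z: "z \<in> \<D>" for a z
  proof (cases "z = 0")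
    case True
    have "a \<noteq> 0" using a r1 by auto
    then have "test_fun a z = 0" using True freq_bounds(3)[OF a(1)] by (simp add: test_fun_def)
    then show ?thesis
      using C_def \<tau>_pos[OF a(1)] \<tau>_pos[OF z] by simp
  next
    case False
    have a0: "a \<noteq> 0" "1/2 \<le> cmod a" using a r1 by auto
    have \<tau>a: "0 < \<tau> a" "\<tau> a \<le> 1/2" using \<tau>_pos[OF a(1)] rb(2)[OF a(1)] a r1 by auto
    have \<tau>z: "0 < \<tau> z" using \<tau>_pos[OF z] .
    define N where "N = trunc_order a"
    have N: "0 < N" "real N \<le> 1 / \<tau> a" "1 / real N \<le> 2 * \<tau> a"
      unfolding N_def using trunc_order_bounds[OF a(1) \<tau>a(2)] by auto
    define u where "u = z / a"
    define Q where "Q = cmod (dirichlet_mean N u)"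
    define x where "x = ln (cmod z) - ln (cmod a)"
    define g where "g = gap (ln (cmod a)) (ln (cmod z))"
    have g0: "0 \<le> g" unfolding g_def using norm_ln_facts a(1) a0 z False by (intro gap_nonneg) auto
    have dist: "cmod (z - a) \<le> cmod (u - 1)"
    proof -
      have "u - 1 = (z - a) / a" using a0 by (simp add: u_def field_simps)
      then have "cmod (u - 1) = cmod (z - a) / cmod a" by (simp add: norm_divide)
      moreover have "cmod (z - a) * cmod a \<le> cmod (z - a) * 1" using a by (intro mult_left_mono) auto
      ultimately show ?thesis using a0 by (simp add: pos_le_divide_eq)
    qed
    have eq: "cmod (test_fun a z) * sqrt (\<omega> z) =
        exp ((freq a - \<psi>1 (ln (cmod a))) * x - g) * Q ^ 4"
      using test_fun_weighted[OF a(1) a0(1) z False] by (simp add: x_def g_def Q_def u_def N_def)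
    have Q0: "0 \<le> Q" by (simp add: Q_def)
    have fr: "0 \<le> freq a - \<psi>1 (ln (cmod a))" "freq a - \<psi>1 (ln (cmod a)) \<le> 1"
      using freq_bounds[OF a(1) a0(1)] by auto
    have Qd: "Q * cmod (z - a) \<le> 4 * \<tau> a * (max 1 (cmod u)) ^ N"
    proof -
      have "Q * cmod (z - a) \<le> Q * cmod (u - 1)" using dist Q0 by (intro mult_left_mono)
      also have "\<dots> \<le> 2 * (max 1 (cmod u)) ^ N / N" unfolding Q_def by (rule dirichlet_mean_bounds[OF N(1)])
      also have "\<dots> = 2 * (max 1 (cmod u)) ^ N * (1 / N)" by simp
      also have "\<dots> \<le> 2 * (max 1 (cmod u)) ^ N * (2 * \<tau> a)" using N by (intro mult_left_mono) auto
      finally show ?thesis by (simp add: mult_ac)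
    qed
    have Q1: "Q \<le> (max 1 (cmod u)) ^ N" unfolding Q_def by (rule dirichlet_mean_bounds[OF N(1)])
    show ?thesis
    proof (cases "cmod z \<le> cmod a")
      case True
      then have x: "x \<le> 0" using \<open>z \<noteq> 0\<close> a0 by (simp add: x_def)
      have u1: "max 1 (cmod u) = 1" using True a0 by (simp add: u_def norm_divide max_def)
      have E: "exp ((freq a - \<psi>1 (ln (cmod a))) * x - g) \<le> 1"
        using mult_nonneg_nonpos[OF fr(1) x] g0 by simp
      have "cmod (test_fun a z) * sqrt (\<omega> z) \<le> 1 * 1 ^ 4"
        unfolding eq using E Q1 u1 Q0 by (intro mult_mono power_mono) auto
      also have "\<dots> \<le> C" using C512 by simp
      finally have 1: "cmod (test_fun a z) * sqrt (\<omega> z) \<le> C" .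
      have P: "(Q * cmod (z - a)) ^ 4 \<le> (4 * \<tau> a) ^ 4"
        by (rule power_mono) (use Qd u1 Q0 in auto)
      have "cmod (test_fun a z) * sqrt (\<omega> z) * cmod (z - a) ^ 4 =
          exp ((freq a - \<psi>1 (ln (cmod a))) * x - g) * (Q * cmod (z - a)) ^ 4"
        unfolding eq by (simp add: power_mult_distrib)
      also have "\<dots> \<le> 1 * (4 * \<tau> a) ^ 4"
        by (rule mult_mono[OF E P]) (use Q0 in auto)
      also have "\<dots> = 256 * \<tau> a ^ 4" by (simp add: power_mult_distrib)
      also have "\<dots> \<le> C * \<tau> a ^ 4"
        using C512 \<tau>a by (intro mult_right_mono) auto
      also have "\<tau> a = min (\<tau> a) (\<tau> z)" using \<tau>_antimono[OF z a(1) True] by simp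
      finally show ?thesis using 1 by simp
    next
      case False
      then have az: "cmod a \<le> cmod z" by simp
      then have x: "0 \<le> x" using a0 \<open>z \<noteq> 0\<close> by (simp add: x_def)
      have u1: "max 1 (cmod u) = cmod u" using az a0 by (simp add: u_def norm_divide max_def field_simps)
      have uN: "cmod u ^ N \<le> exp (x / \<tau> a)"
      proof -
        have "cmod u = exp x" using a0 \<open>z \<noteq> 0\<close> by (simp add: u_def norm_divide x_def exp_diff)
        then have "cmod u ^ N = exp (N * x)" by (simp add: exp_of_nat_mult)
        also have "\<dots> \<le> exp (1 / \<tau> a * x)"
          unfolding exp_le_cancel_iff using N x by (intro mult_right_mono) auto
        finally show ?thesis by simp
      qed
      have x2: "exp x \<le> 2"
      proof -
        have "exp x = cmod z / cmod a" using a0 \<open>z \<noteq> 0\<close> by (simp add: x_def exp_diff)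
        also have "\<dots> \<le> 1 / (1/2)" using z a0 by (intro frac_le) auto
        finally show ?thesis by simp
      qed
      have \<tau>za: "\<tau> z \<le> \<tau> a" using \<tau>_antimono[OF a(1) z az] .
      have gap_lower: "4 * (x / \<tau> a) + 4 * ln (\<tau> a / \<tau> z) - C2 \<le> g"
      proof -
        define X where "X = x / \<tau> a"
        have g1: "X\<^sup>2 / (8 * K) \<le> g"
          unfolding X_def x_def g_def by (rule gap_lower_quadratic[OF a(1) a0(2) z az])
        have "8 * X - 128 * K \<le> X\<^sup>2 / (8 * K)"
        proof -
          have "0 \<le> (X - 32 * K)\<^sup>2" by simp
          then have "(8 * X - 128 * K) * (8 * K) \<le> X\<^sup>2" by (simp add: power2_eq_square algebra_simps)
          then show ?thesis using K_pos by (simp add: pos_le_divide_eq)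
        qed
        then have "8 * X - 128 * K \<le> g" using g1 by linarith
        moreover have "8 * (ln (\<tau> a / \<tau> z) - 1) \<le> g"
        proof -
          have "(ln (\<tau> a / \<tau> z) - 1) / (4 * K * \<epsilon>\<^sup>2) \<le> g"
            unfolding g_def using a r1 ra(2) by (intro gap_lower_log[OF a(1) a0(2) z az \<epsilon>(1)]) auto
          then show ?thesis unfolding \<epsilon>(2) by simp
        qed
        ultimately have "4 * X + 4 * ln (\<tau> a / \<tau> z) - (64 * K + 4) \<le> g"
          by (simp add: algebra_simps)
        then show ?thesis by (simp add: X_def C2_def)
      qed
      have E: "exp ((freq a - \<psi>1 (ln (cmod a))) * x - g) * exp (x / \<tau> a) ^ 4 \<le> 2 * (exp C2 * (\<tau> z / \<tau> a) ^ 4)"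
      proof -
        have "exp (4 * (x / \<tau> a) - g) \<le> exp (C2 + 4 * ln (\<tau> z / \<tau> a))"
          using gap_lower \<tau>z \<tau>a by (simp add: ln_div)
        also have "\<dots> = exp C2 * (\<tau> z / \<tau> a) ^ 4"
          using \<tau>z \<tau>a exp_of_nat_mult[of 4 "ln (\<tau> z / \<tau> a)"] by (simp add: exp_add)
        finally have e1: "exp (4 * (x / \<tau> a) - g) \<le> exp C2 * (\<tau> z / \<tau> a) ^ 4" .
        have "(freq a - \<psi>1 (ln (cmod a))) * x \<le> 1 * x" using fr x by (intro mult_right_mono) auto
        then have "exp ((freq a - \<psi>1 (ln (cmod a))) * x) \<le> 2" using x2 exp_le_cancel_iff order_trans
          by (metis mult_1)
        then have "exp ((freq a - \<psi>1 (ln (cmod a))) * x) * exp (4 * (x / \<tau> a) - g) \<le> 2 * (exp C2 * (\<tau> z / \<tau> a) ^ 4)"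
          using e1 by (intro mult_mono) auto
        moreover have "exp (x / \<tau> a) ^ 4 = exp (4 * (x / \<tau> a))"
          using exp_of_nat_mult[of 4 "x / \<tau> a"] by simp
        moreover have "exp (y - g) * exp (4 * (x / \<tau> a)) = exp y * exp (4 * (x / \<tau> a) - g)" for y
          by (simp flip: exp_add)
        ultimately show ?thesis by simp
      qed
      have "cmod (test_fun a z) * sqrt (\<omega> z) \<le> exp ((freq a - \<psi>1 (ln (cmod a))) * x - g) * exp (x / \<tau> a) ^ 4"
        unfolding eq using Q1 u1 uN Q0 by (intro mult_left_mono power_mono) auto
      also have "\<dots> \<le> 2 * (exp C2 * (\<tau> z / \<tau> a) ^ 4)" by (rule E)
      also have "\<dots> \<le> 2 * (exp C2 * 1)"
        using \<tau>za \<tau>z \<tau>a by (intro mult_left_mono power_le_one) auto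
      also have "\<dots> \<le> C" by (simp add: C_def)
      finally have 1: "cmod (test_fun a z) * sqrt (\<omega> z) \<le> C" .
      have "cmod (test_fun a z) * sqrt (\<omega> z) * cmod (z - a) ^ 4 =
          exp ((freq a - \<psi>1 (ln (cmod a))) * x - g) * (Q * cmod (z - a)) ^ 4"
        unfolding eq by (simp add: power_mult_distrib)
      also have "\<dots> \<le> exp ((freq a - \<psi>1 (ln (cmod a))) * x - g) * (4 * \<tau> a * exp (x / \<tau> a)) ^ 4"
      proof (intro mult_left_mono power_mono)
        show "Q * cmod (z - a) \<le> 4 * \<tau> a * exp (x / \<tau> a)"
          using Qd uN \<tau>a unfolding u1 by (meson mult_left_mono order_trans less_imp_le mult_pos_pos zero_less_numeral)
      qed (use Q0 in auto)
      also have "\<dots> = 256 * \<tau> a ^ 4 * (exp ((freq a - \<psi>1 (ln (cmod a))) * x - g) * exp (x / \<tau> a) ^ 4)"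
        by (simp add: power_mult_distrib mult_ac)
      also have "\<dots> \<le> 256 * \<tau> a ^ 4 * (2 * (exp C2 * (\<tau> z / \<tau> a) ^ 4))"
        using E \<tau>a by (intro mult_left_mono) auto
      also have "\<dots> = C * \<tau> z ^ 4" using \<tau>a by (simp add: C_def power_divide)
      also have "\<tau> z = min (\<tau> a) (\<tau> z)" using \<tau>za by simp
      finally show ?thesis using 1 by simp
    qed
  qed
  show ?thesis
    by (rule that[of r1 C]) (use r1 main rb in \<open>auto simp: C_def intro: less_imp_le\<close>)
qed

text \<open>On the disc the mean is at least 1/4 since
  \<open>real N * cmod (z / a - 1) \<le> 1/2\<close>, the gap is at most \<open>8 * K\<close>, and
  rounding the slope costs at most a factor e.\<close>

lemma test_fun_lower:
  assumes a: "a \<in> \<D>" "1/2 \<le> cmod a" "\<tau> a \<le> 1/2" and z: "z \<in> ball a (m * \<tau> a)"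
  shows "exp (- 1 - 8 * K) / 4 ^ 4 \<le> cmod (test_fun a z) * sqrt (\<omega> z)"
proof -
  note gu = gap_upper[OF a(1,2) z]
  have a0: "a \<noteq> 0" "z \<noteq> 0" using a gu by auto
  define N where "N = trunc_order a"
  have N: "0 < N" "real N \<le> 1 / \<tau> a"
    unfolding N_def using trunc_order_bounds[OF a(1,3)] by auto
  have \<tau>a: "0 < \<tau> a" using \<tau>_pos a by auto
  have "real N * cmod (z / a - 1) \<le> 1 / \<tau> a * (\<tau> a / 2)"
  proof (intro mult_mono N)
    have "z / a - 1 = (z - a) / a" using a0 by (simp add: field_simps)
    then have "cmod (z / a - 1) = cmod (z - a) / cmod a" by (simp add: norm_divide)
    also have "\<dots> \<le> (m * \<tau> a) / (1/2)"
      using z a m_bounds \<tau>a by (intro frac_le) (auto simp: dist_norm norm_minus_commute)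
    also have "\<dots> \<le> (1/4 * \<tau> a) / (1/2)"
      using m_bounds \<tau>a by (intro divide_right_mono mult_right_mono) auto
    finally show "cmod (z / a - 1) \<le> \<tau> a / 2" by simp
  qed (use \<tau>a in auto)
  then have Q: "1/4 \<le> cmod (dirichlet_mean N (z / a))"
    using \<tau>a by (intro dirichlet_mean_bounds(3)[OF N(1)]) simp
  define x where "x = ln (cmod z) - ln (cmod a)"
  have "\<bar>(freq a - \<psi>1 (ln (cmod a))) * x\<bar> \<le> 1 * 1"
    unfolding abs_mult using freq_bounds[OF a(1) a0(1)] gu(4) by (intro mult_mono) (auto simp: x_def)
  then have "exp (- 1 - 8 * K) \<le> exp ((freq a - \<psi>1 (ln (cmod a))) * x - gap (ln (cmod a)) (ln (cmod z)))"
    using gu(3) by simp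
  then have "exp (- 1 - 8 * K) * (1/4) ^ 4 \<le> cmod (test_fun a z) * sqrt (\<omega> z)"
    unfolding test_fun_weighted[OF a(1) a0(1) gu(1) a0(2)] x_def N_def[symmetric]
    using Q by (intro mult_mono power_mono) auto
  then show ?thesis by (simp add: power_divide)
qed

text \<open>For |a| \<ge> 1/2 the function
  \<open>exp (- \<psi> ta - \<psi>1 ta * Ln (z / a))\<close> has the modulus prescribed by the
  tangent of \<psi>, so the weight is its square times the exponential of minus twice the gap, a
  bounded factor. For |a| < 1/2 the disc stays in |z| \<le> 5/8, where the weight lies between
  \<open>\<omega> (5/8)\<close> and \<open>\<omega> 0\<close>, and the constant 1 serves.\<close>

lemma local_weight:
  obtains C where "1 \<le> C" "\<And>a. a \<in> \<D> \<Longrightarrow> \<exists>W. W holomorphic_on ball a (m * \<tau> a) \<and>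
     (\<forall>z\<in>ball a (m * \<tau> a). (cmod (W z))\<^sup>2 \<le> C * \<omega> z \<and> \<omega> z \<le> C * (cmod (W z))\<^sup>2)"
proof -
  define C where "C = max (exp (16 * K)) (max (\<omega> 0) (max 1 (1 / \<omega> (5/8))))"
  have C: "exp (16 * K) \<le> C" "\<omega> 0 \<le> C" "1 \<le> C" "1 / \<omega> (5/8) \<le> C" by (auto simp: C_def)
  have "\<exists>W. W holomorphic_on ball a (m * \<tau> a) \<and>
     (\<forall>z\<in>ball a (m * \<tau> a). (cmod (W z))\<^sup>2 \<le> C * \<omega> z \<and> \<omega> z \<le> C * (cmod (W z))\<^sup>2)" if a: "a \<in> \<D>" for a
  proof (cases "1/2 \<le> cmod a")
    case True
    define ta where "ta = ln (cmod a)"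
    define W where "W = (\<lambda>z. exp (- of_real (\<psi> ta) - of_real (\<psi>1 ta) * Ln (z / a)))"
    have a0: "a \<noteq> 0" using True by auto
    have near1: "cmod (z / a - 1) < 1" if z: "z \<in> ball a (m * \<tau> a)" for z
    proof -
      have "z / a - 1 = (z - a) / a" using a0 by (simp add: field_simps)
      then have "cmod (z / a - 1) = cmod (z - a) / cmod a" by (simp add: norm_divide)
      also have "\<dots> \<le> (1/8) / (1/2)"
        using z True m_\<tau>_le[OF a] by (intro frac_le) (auto simp: dist_norm norm_minus_commute)
      finally show ?thesis by simp
    qed
    have not_neg: "z / a \<notin> \<real>\<^sub>\<le>\<^sub>0" if z: "z \<in> ball a (m * \<tau> a)" for z
    proof
      assume "z / a \<in> \<real>\<^sub>\<le>\<^sub>0"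
      then have "Re (z / a) \<le> 0" by (auto simp: complex_nonpos_Reals_iff)
      moreover have "\<bar>Re (z / a - 1)\<bar> \<le> cmod (z / a - 1)" by (rule abs_Re_le_cmod)
      ultimately show False using near1[OF z] by simp
    qed
    have "W holomorphic_on ball a (m * \<tau> a)"
      unfolding W_def using a0 not_neg by (intro holomorphic_intros) auto
    moreover have "(cmod (W z))\<^sup>2 \<le> C * \<omega> z \<and> \<omega> z \<le> C * (cmod (W z))\<^sup>2" if z: "z \<in> ball a (m * \<tau> a)" for z
    proof -
      note gu = gap_upper[OF a True z]
      define t where "t = ln (cmod z)"
      have z0: "z \<noteq> 0" using gu(2) by auto
      have "Re (Ln (z / a)) = t - ta"
        using a0 z0 by (simp add: norm_divide ln_div t_def ta_def)
      then have "cmod (W z) = exp (- \<psi> ta - \<psi>1 ta * (t - ta))"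
        by (simp add: W_def)
      then have W2: "(cmod (W z))\<^sup>2 = exp (2 * (- \<psi> ta - \<psi>1 ta * (t - ta)))"
        by (simp only: exp_double)
      then have eq: "\<omega> z = (cmod (W z))\<^sup>2 * exp (- 2 * gap ta t)" "(cmod (W z))\<^sup>2 = \<omega> z * exp (2 * gap ta t)"
        unfolding \<omega>_psi[OF gu(1) z0] t_def[symmetric] by (simp_all add: gap_def algebra_simps flip: exp_add)
      have g: "0 \<le> gap ta t" "gap ta t \<le> 8 * K"
        unfolding ta_def t_def using gu(3) gap_nonneg norm_ln_facts a a0 gu(1) z0 by auto
      have "exp (2 * gap ta t) \<le> C" using g C(1) by (smt (verit) exp_le_cancel_iff)
      then have "(cmod (W z))\<^sup>2 \<le> \<omega> z * C"
        unfolding eq(2) using \<omega>_pos[OF gu(1)] by (intro mult_left_mono) auto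
      moreover have "exp (- 2 * gap ta t) \<le> C" using g C(3) by (smt (verit) exp_le_one_iff)
      then have "(cmod (W z))\<^sup>2 * exp (- 2 * gap ta t) \<le> (cmod (W z))\<^sup>2 * C"
        by (intro mult_left_mono) auto
      then have "\<omega> z \<le> (cmod (W z))\<^sup>2 * C" using eq(1) by simp
      ultimately show ?thesis by (simp add: mult.commute)
    qed
    ultimately show ?thesis by blast
  next
    case False
    have "(cmod 1)\<^sup>2 \<le> C * \<omega> z \<and> \<omega> z \<le> C * (cmod 1)\<^sup>2" if z: "z \<in> ball a (m * \<tau> a)" for z
    proof -
      have zD: "z \<in> \<D>" using ball_subset_disc(2)[OF a order_refl] z by blast
      have "cmod (z - a) < (1 - cmod a) / 4"
        using z m_\<tau>_le[OF a] by (simp add: dist_norm norm_minus_commute)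
      moreover have "cmod z \<le> cmod a + cmod (z - a)" by (metis norm_triangle_sub)
      ultimately have "cmod z \<le> 5/8" using False by simp
      then have w1: "\<omega> (5/8) \<le> \<omega> z" using zD by (intro \<omega>_antimono) auto
      have w2: "\<omega> z \<le> \<omega> 0" using zD by (intro \<omega>_antimono) auto
      have w58: "0 < \<omega> (5/8)" by (intro \<omega>_pos) simp
      have "1 = 1 / \<omega> (5/8) * \<omega> (5/8)" using w58 by simp
      also have "\<dots> \<le> C * \<omega> z" using C w1 w58 by (intro mult_mono) auto
      finally have "1 \<le> C * \<omega> z" .
      then show ?thesis using w2 C(2) by simp
    qed
    then show ?thesis by (intro exI[of _ "\<lambda>_. 1"]) auto
  qed
  then show ?thesis using that C(3) by blast
qed

end

section \<open>The Bergman space\<close>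

lemma space_area [simp]: "space area = \<D>"
  by (simp add: area_def space_scale_measure space_restrict_space)

lemma sets_area: "sets area = sets (restrict_space borel \<D>)"
  by (simp add: area_def sets_restrict_space_cong[OF sets_lborel])

lemma borel_measurable_area_iff: "f \<in> borel_measurable area \<longleftrightarrow> f \<in> borel_measurable (restrict_space borel \<D>)"
  by (simp add: measurable_cong_sets[OF sets_area refl])

lemma continuous_on_measurable_area: "continuous_on \<D> f \<Longrightarrow> f \<in> borel_measurable area"
  unfolding borel_measurable_area_iff by (rule borel_measurable_continuous_on_restrict)

lemma nn_integral_area:
  "f \<in> borel_measurable area \<Longrightarrow> (\<integral>\<^sup>+z. f z \<partial>area) = ennreal (1 / pi) * (\<integral>\<^sup>+z. f z * indicator \<D> z \<partial>lborel)"
proof -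
  assume f: "f \<in> borel_measurable area"
  then have "f \<in> borel_measurable (restrict_space lborel \<D>)"
    by (simp add: area_def)
  then show ?thesis
    by (simp add: area_def nn_integral_scale_measure nn_integral_restrict_space)
qed

lemma emeasure_area_ball:
  assumes "ball a r \<subseteq> \<D>" "0 \<le> r"
  shows "emeasure area (ball a r) = ennreal (r\<^sup>2)"
proof -
  have "emeasure area (ball a r) = ennreal (1 / pi) * emeasure lborel (ball a r)"
    using assms by (simp add: area_def emeasure_restrict_space)
  also have "\<dots> = ennreal (r\<^sup>2)"
    using assms by (simp add: emeasure_lborel_ball_complex flip: ennreal_mult)
  finally show ?thesis .
qed

lemma ball_in_sets_area: "ball a r \<subseteq> \<D> \<Longrightarrow> ball a r \<in> sets area"
  by (simp add: sets_area sets_restrict_space_iff)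

text \<open>Fatou's lemma for pointwise convergent sequences. It serves for completeness of the
  space, for the extension of an estimate from the span of kernels, and for membership of Montel
  limits.\<close>

lemma nn_integral_limit_le:
  fixes f :: "nat \<Rightarrow> 'a \<Rightarrow> ennreal"
  assumes "\<And>n. f n \<in> borel_measurable M" "\<And>x. x \<in> space M \<Longrightarrow> (\<lambda>n. f n x) \<longlonglongrightarrow> g x"
    and "\<forall>\<^sub>F n in sequentially. (\<integral>\<^sup>+x. f n x \<partial>M) \<le> c"
  shows "(\<integral>\<^sup>+x. g x \<partial>M) \<le> c"
proof -
  have "(\<integral>\<^sup>+x. g x \<partial>M) = (\<integral>\<^sup>+x. liminf (\<lambda>n. f n x) \<partial>M)"
    using assms(2) by (intro nn_integral_cong lim_imp_Liminf[symmetric]) auto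
  also have "\<dots> \<le> liminf (\<lambda>n. \<integral>\<^sup>+x. f n x \<partial>M)"
    by (rule nn_integral_liminf) (rule assms)
  also have "\<dots> \<le> c"
    by (rule Liminf_le[OF trivial_limit_sequentially assms(3)])
  finally show ?thesis .
qed

text \<open>Young's inequality with a free parameter: integrated with a suitable t it takes the
  place of the Cauchy-Schwarz inequality for pairings over \<mu>.\<close>

lemma mult_le_weighted_squares:
  fixes a b t :: real
  assumes "0 < t"
  shows "a * b \<le> (t * a\<^sup>2 + b\<^sup>2 / t) / 2"
proof -
  have "0 \<le> (t * a - b)\<^sup>2 / t" using assms by simp
  also have "\<dots> = t * a\<^sup>2 - 2 * (a * b) + b\<^sup>2 / t"
    using assms by (simp add: power2_eq_square field_simps)
  finally show ?thesis by simp
qed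

context W_profile
begin

lemma \<omega>_measurable [measurable]: "\<omega> \<in> borel_measurable area"
  using \<omega>_integrable by (rule borel_measurable_integrable)

lemma \<omega>_nonneg: "z \<in> \<D> \<Longrightarrow> 0 \<le> \<omega> z"
  using \<omega>_pos by (simp add: less_imp_le)

definition dens :: "(complex \<Rightarrow> complex) \<Rightarrow> complex \<Rightarrow> real" where
  "dens f z = (cmod (f z))\<^sup>2 * \<omega> z"

lemma dens_nonneg: "z \<in> \<D> \<Longrightarrow> 0 \<le> dens f z"
  by (simp add: dens_def \<omega>_nonneg)

lemma holomorphic_measurable: "f holomorphic_on \<D> \<Longrightarrow> f \<in> borel_measurable area"
  by (intro continuous_on_measurable_area holomorphic_on_imp_continuous_on)

lemma dens_measurable: "f holomorphic_on \<D> \<Longrightarrow> dens f \<in> borel_measurable area"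
  using holomorphic_measurable[of f] unfolding dens_def by measurable

text \<open>Valued in \<open>ennreal\<close>, so that the local estimates hold for every holomorphic
  function, whether or not it lies in the Bergman space.\<close>

definition local_mass :: "(complex \<Rightarrow> complex) \<Rightarrow> complex \<Rightarrow> real \<Rightarrow> ennreal" where
  "local_mass f a r = (\<integral>\<^sup>+z. ennreal (dens f z) * indicator (ball a r) z \<partial>area)"

text \<open>\<open>L j f\<close> is the j-th derivative at a of f times the local model W of the
  weight. These functionals depend on a and j alone, so they can serve as conditions in the min-max
  principle. The sub-mean-value property on discs of radius \<open>2 * \<rho> * \<tau> a\<close>
  bounds f W near a, and vanishing to order k improves the bound by \<open>2 ^ k\<close>, which is
  squared to \<open>4 ^ k\<close>.\<close>

lemma local_estimate:
  obtains C where "1 \<le> C" "\<And>a. a \<in> \<D> \<Longrightarrow> \<exists>L :: nat \<Rightarrow> (complex \<Rightarrow> complex) \<Rightarrow> complex.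
     (\<forall>j f g. f holomorphic_on \<D> \<longrightarrow> g holomorphic_on \<D> \<longrightarrow> L j (f + g) = L j f + L j g) \<and>
     (\<forall>j c f. f holomorphic_on \<D> \<longrightarrow> L j (scale_fun c f) = c * L j f) \<and>
     (\<forall>f k \<rho> z. f holomorphic_on \<D> \<longrightarrow> 0 < \<rho> \<longrightarrow> 4 * \<rho> \<le> m \<longrightarrow> (\<forall>j<k. L j f = 0) \<longrightarrow> z \<in> ball a (\<rho> * \<tau> a) \<longrightarrow>
        ennreal (dens f z) \<le> ennreal (C / (4 ^ k * (\<rho> * \<tau> a)\<^sup>2)) * local_mass f a (4 * \<rho> * \<tau> a))"
proof -
  obtain C where C: "1 \<le> C" "\<And>a. a \<in> \<D> \<Longrightarrow> \<exists>W. W holomorphic_on ball a (m * \<tau> a) \<and>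
     (\<forall>z\<in>ball a (m * \<tau> a). (cmod (W z))\<^sup>2 \<le> C * \<omega> z \<and> \<omega> z \<le> C * (cmod (W z))\<^sup>2)"
    using local_weight by blast
  have "\<exists>L :: nat \<Rightarrow> (complex \<Rightarrow> complex) \<Rightarrow> complex.
     (\<forall>j f g. f holomorphic_on \<D> \<longrightarrow> g holomorphic_on \<D> \<longrightarrow> L j (f + g) = L j f + L j g) \<and>
     (\<forall>j c f. f holomorphic_on \<D> \<longrightarrow> L j (scale_fun c f) = c * L j f) \<and>
     (\<forall>f k \<rho> z. f holomorphic_on \<D> \<longrightarrow> 0 < \<rho> \<longrightarrow> 4 * \<rho> \<le> m \<longrightarrow> (\<forall>j<k. L j f = 0) \<longrightarrow> z \<in> ball a (\<rho> * \<tau> a) \<longrightarrow>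
        ennreal (dens f z) \<le> ennreal (C\<^sup>2 / (4 ^ k * (\<rho> * \<tau> a)\<^sup>2)) * local_mass f a (4 * \<rho> * \<tau> a))"
    if a: "a \<in> \<D>" for a
  proof -
    obtain W where W: "W holomorphic_on ball a (m * \<tau> a)"
      "\<And>z. z \<in> ball a (m * \<tau> a) \<Longrightarrow> (cmod (W z))\<^sup>2 \<le> C * \<omega> z"
      "\<And>z. z \<in> ball a (m * \<tau> a) \<Longrightarrow> \<omega> z \<le> C * (cmod (W z))\<^sup>2"
      using C(2)[OF a] by blast
    have \<tau>a: "0 < \<tau> a" using \<tau>_pos a by simp
    have sub: "ball a (m * \<tau> a) \<subseteq> \<D>" using ball_subset_disc(2)[OF a order_refl] .
    have ac: "a \<in> ball a (m * \<tau> a)" using m_bounds \<tau>a by simp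
    define L where "L = (\<lambda>j f. (deriv ^^ j) (\<lambda>z. f z * W z) a :: complex)"
    have hol: "(\<lambda>z. f z * W z) holomorphic_on ball a (m * \<tau> a)" if "f holomorphic_on \<D>" for f
      using that sub W(1) by (intro holomorphic_intros) (auto intro: holomorphic_on_subset)
    have add: "L j (f + g) = L j f + L j g" if "f holomorphic_on \<D>" "g holomorphic_on \<D>" for j f g
    proof -
      have "L j (f + g) = (deriv ^^ j) (\<lambda>z. f z * W z + g z * W z) a"
        by (simp add: L_def distrib_right)
      then show ?thesis
        using higher_deriv_add[OF hol hol open_ball ac] that by (simp add: L_def)
    qed
    have scale: "L j (scale_fun c f) = c * L j f" if "f holomorphic_on \<D>" for j c f
    proof -
      have "L j (scale_fun c f) = (deriv ^^ j) (\<lambda>z. c * (f z * W z)) a"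
        by (simp add: L_def scale_fun_def mult.assoc)
      then show ?thesis
        using higher_deriv_cmult[OF hol ac open_ball] that by (simp add: L_def)
    qed
    have est: "ennreal (dens f z) \<le> ennreal (C\<^sup>2 / (4 ^ k * (\<rho> * \<tau> a)\<^sup>2)) * local_mass f a (4 * \<rho> * \<tau> a)"
      if f: "f holomorphic_on \<D>" and \<rho>: "0 < \<rho>" "4 * \<rho> \<le> m" and zero: "\<forall>j<k. L j f = 0"
        and z: "z \<in> ball a (\<rho> * \<tau> a)" for f k \<rho> z
    proof -
      define G where "G = (\<lambda>z. f z * W z)"
      define r where "r = \<rho> * \<tau> a"
      have r: "0 < r" "4 * r \<le> m * \<tau> a" using \<rho> \<tau>a by (auto simp: r_def mult_right_mono)
      have ball4: "ball a (4 * r) \<subseteq> ball a (m * \<tau> a)" using r by auto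
      have Ghol: "G holomorphic_on ball a (m * \<tau> a)" unfolding G_def by (rule hol[OF f])
      define I where "I = local_mass f a (4 * r)"
      show ?thesis
      proof (cases "I = top")
        case True
        have "0 < C\<^sup>2 / (4 ^ k * r\<^sup>2)" using C(1) r by (intro divide_pos_pos mult_pos_pos) auto
        then have "ennreal (C\<^sup>2 / (4 ^ k * r\<^sup>2)) \<noteq> 0" by (simp only: ennreal_eq_0_iff not_le)
        then have "ennreal (C\<^sup>2 / (4 ^ k * r\<^sup>2)) * I = top" using True by (simp only: ennreal_mult_top if_False)
        then show ?thesis by (simp add: I_def r_def mult.assoc)
      next
        case False
        then obtain J where J: "0 \<le> J" "I = ennreal J" by (cases I) auto
        have point: "(cmod (G w))\<^sup>2 \<le> C * J / (4 * r\<^sup>2)" if w: "w \<in> ball a (2 * r)" for w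
        proof -
          have sub_w: "ball w (2 * r) \<subseteq> ball a (4 * r)"
          proof
            fix x assume "x \<in> ball w (2 * r)"
            then show "x \<in> ball a (4 * r)" using w dist_triangle[of a x w] by auto
          qed
          have "ennreal (pi * (2 * r)\<^sup>2 * (cmod (G w))\<^sup>2) \<le>
              (\<integral>\<^sup>+x. ennreal ((cmod (G x))\<^sup>2) * indicator (ball w (2 * r)) x \<partial>lborel)"
            using r sub_w ball4 by (intro sub_mean_value_disc holomorphic_on_subset[OF Ghol]) auto
          also have "\<dots> \<le> (\<integral>\<^sup>+x. ennreal C * (ennreal (dens f x) * indicator (ball a (4 * r)) x * indicator \<D> x) \<partial>lborel)"
          proof (rule nn_integral_mono)
            fix x
            show "ennreal ((cmod (G x))\<^sup>2) * indicator (ball w (2 * r)) x \<le>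
                ennreal C * (ennreal (dens f x) * indicator (ball a (4 * r)) x * indicator \<D> x)"
            proof (cases "x \<in> ball w (2 * r)")
              case True
              then have x: "x \<in> ball a (4 * r)" "x \<in> ball a (m * \<tau> a)" "x \<in> \<D>"
                using sub_w ball4 sub by blast+
              have "(cmod (G x))\<^sup>2 = (cmod (f x))\<^sup>2 * (cmod (W x))\<^sup>2"
                by (simp add: G_def norm_mult power_mult_distrib)
              also have "\<dots> \<le> (cmod (f x))\<^sup>2 * (C * \<omega> x)" using W(2)[OF x(2)] by (intro mult_left_mono) auto
              also have "\<dots> = C * dens f x" by (simp add: dens_def)
              finally have "ennreal ((cmod (G x))\<^sup>2) \<le> ennreal C * ennreal (dens f x)"
                using C dens_nonneg[OF x(3)] by (simp add: ennreal_leI flip: ennreal_mult)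
              then show ?thesis using True x by simp
            qed simp
          qed
          also have "\<dots> = ennreal C * (ennreal pi * I)"
          proof -
            have meas: "(\<lambda>x. ennreal (dens f x) * indicator (ball a (4 * r)) x) \<in> borel_measurable area"
            proof -
              have "ball a (4 * r) \<in> sets area" using ball4 sub by (intro ball_in_sets_area) blast
              then show ?thesis using dens_measurable[OF f] by measurable
            qed
            have "I = ennreal (1 / pi) * (\<integral>\<^sup>+x. ennreal (dens f x) * indicator (ball a (4 * r)) x * indicator \<D> x \<partial>lborel)"
              unfolding I_def local_mass_def by (rule nn_integral_area[OF meas])
            then have "ennreal pi * I = (\<integral>\<^sup>+x. ennreal (dens f x) * indicator (ball a (4 * r)) x * indicator \<D> x \<partial>lborel)"
              by (simp flip: mult.assoc ennreal_mult)
            moreover have "(\<lambda>x. ennreal (dens f x) * indicator (ball a (4 * r)) x * indicator \<D> x) \<in> borel_measurable lborel"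
              using meas unfolding borel_measurable_area_iff by (simp add: borel_measurable_restrict_space_iff_ennreal)
            ultimately show ?thesis by (simp add: nn_integral_cmult)
          qed
          also have "\<dots> = ennreal (C * (pi * J))" using J C by (simp add: ennreal_mult)
          finally have "pi * (2 * r)\<^sup>2 * (cmod (G w))\<^sup>2 \<le> C * (pi * J)"
            using J C by (subst (asm) ennreal_le_iff) auto
          then show ?thesis using r by (simp add: field_simps power2_eq_square)
        qed
        define B where "B = sqrt (C * J / (4 * r\<^sup>2))"
        have B2: "B\<^sup>2 = C * J / (4 * r\<^sup>2)" using J C by (simp add: B_def)
        have "cmod (G z) \<le> 2 * B / 2 ^ k"
        proof (rule vanishing_order_bound[where G = G and a = a and r = r and z = z])
          show "G holomorphic_on ball a (2 * r)" using Ghol r by (auto intro: holomorphic_on_subset)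
          show "cmod (G w) \<le> B" if "w \<in> ball a (2 * r)" for w
            unfolding B_def using point[OF that] by (rule real_le_rsqrt)
          show "(deriv ^^ j) G a = 0" if "j < k" for j
            using zero that by (simp add: L_def G_def)
          show "z \<in> ball a r" using z by (simp add: r_def)
        qed (rule r)
        then have "(cmod (G z))\<^sup>2 \<le> (2 * B / 2 ^ k)\<^sup>2" by (intro power_mono) auto
        also have "\<dots> = C * J / (4 ^ k * r\<^sup>2)"
        proof -
          have "(2 ^ k)\<^sup>2 = (4 ^ k :: real)" by (simp add: power2_eq_square flip: power_mult_distrib)
          then show ?thesis by (simp add: power_divide power_mult_distrib B2)
        qed
        finally have G2: "(cmod (G z))\<^sup>2 \<le> C * J / (4 ^ k * r\<^sup>2)" .
        have z4: "z \<in> ball a (m * \<tau> a)" using z r by (auto simp: r_def)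
        have "dens f z \<le> (cmod (f z))\<^sup>2 * (C * (cmod (W z))\<^sup>2)"
          unfolding dens_def using W(3)[OF z4] by (intro mult_left_mono) auto
        also have "\<dots> = C * (cmod (G z))\<^sup>2" by (simp add: G_def norm_mult power_mult_distrib)
        also have "\<dots> \<le> C * (C * J / (4 ^ k * r\<^sup>2))" using G2 C by (intro mult_left_mono) auto
        also have "\<dots> = C\<^sup>2 / (4 ^ k * r\<^sup>2) * J" by (simp add: power2_eq_square)
        finally have "ennreal (dens f z) \<le> ennreal (C\<^sup>2 / (4 ^ k * r\<^sup>2)) * ennreal J"
          using J by (simp add: ennreal_leI flip: ennreal_mult)
        then show ?thesis using J by (simp add: I_def r_def mult.assoc)
      qed
    qed
    show ?thesis
      by (rule exI[of _ L]) (use add scale est in blast)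
  qed
  \<comment> \<open>The square arises because one factor C passes from |f|^2 \<omega> to |f W|^2 and
    another passes back.\<close>
  moreover have "1 \<le> C\<^sup>2" using C(1) by (simp add: one_le_power)
  ultimately show ?thesis using that by blast
qed

end

section \<open>Point evaluations, completeness and the reproducing kernel\<close>

context W_profile
begin

abbreviation A2 :: "(complex \<Rightarrow> complex) set" where
  "A2 \<equiv> bergman \<omega>"

abbreviation ip2 :: "(complex \<Rightarrow> complex) \<Rightarrow> (complex \<Rightarrow> complex) \<Rightarrow> complex" where
  "ip2 \<equiv> bergman_inner \<omega>"

abbreviation nrm2 :: "(complex \<Rightarrow> complex) \<Rightarrow> real" where
  "nrm2 \<equiv> ip_norm ip2"

lemma A2_holomorphic: "f \<in> A2 \<Longrightarrow> f holomorphic_on \<D>"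
  and A2_outside: "f \<in> A2 \<Longrightarrow> z \<notin> \<D> \<Longrightarrow> f z = 0"
  and A2_integrable: "f \<in> A2 \<Longrightarrow> integrable area (dens f)"
  by (auto simp: bergman_def dens_def[abs_def])

lemma dens_add_le: "z \<in> \<D> \<Longrightarrow> dens (f + g) z \<le> 2 * dens f z + 2 * dens g z"
proof -
  assume z: "z \<in> \<D>"
  have "(cmod (f z + g z))\<^sup>2 \<le> (cmod (f z) + cmod (g z))\<^sup>2"
    by (intro power_mono norm_triangle_ineq) auto
  also have "\<dots> \<le> 2 * (cmod (f z))\<^sup>2 + 2 * (cmod (g z))\<^sup>2"
    using sum_squares_bound[of "cmod (f z)" "cmod (g z)"] by (simp add: power2_sum)
  finally have "(cmod (f z + g z))\<^sup>2 * \<omega> z \<le> (2 * (cmod (f z))\<^sup>2 + 2 * (cmod (g z))\<^sup>2) * \<omega> z"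
    using \<omega>_nonneg[OF z] by (intro mult_right_mono)
  then show ?thesis by (simp add: dens_def algebra_simps)
qed

lemma dens_scale: "dens (scale_fun c f) z = (cmod c)\<^sup>2 * dens f z"
  by (simp add: dens_def scale_fun_def norm_mult power_mult_distrib)

text \<open>M is any measure on the Borel sets of the disc because both \<open>area\<close> and
  \<mu> are inserted for it.\<close>

lemma pairing_integrable:
  assumes M: "sets M = sets area" and f: "f holomorphic_on \<D>" "integrable M (dens f)"
    and g: "g holomorphic_on \<D>" "integrable M (dens g)"
  shows "integrable M (\<lambda>z. f z * cnj (g z) * of_real (\<omega> z))"
    and "0 < t \<Longrightarrow> cmod (LINT z|M. f z * cnj (g z) * of_real (\<omega> z)) \<le> (t * (LINT z|M. dens f z) + (LINT z|M. dens g z) / t) / 2"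
proof -
  have sp: "space M = \<D>" using sets_eq_imp_space_eq[OF M] by simp
  note mc = measurable_cong_sets[OF M refl]
  have meas: "(\<lambda>z. f z * cnj (g z) * of_real (\<omega> z)) \<in> borel_measurable M"
  proof -
    have "(\<lambda>z. cnj (g z)) \<in> borel_measurable area"
      by (intro continuous_on_measurable_area continuous_intros holomorphic_on_imp_continuous_on g)
    then show ?thesis
      using holomorphic_measurable[OF f(1)] \<omega>_measurable unfolding mc by measurable
  qed
  have bound: "cmod (f z * cnj (g z) * of_real (\<omega> z)) \<le> (t * dens f z + dens g z / t) / 2"
    if "z \<in> \<D>" "0 < t" for z t
  proof -
    have "cmod (f z * cnj (g z) * of_real (\<omega> z)) = (cmod (f z) * cmod (g z)) * \<omega> z"
      using \<omega>_nonneg[OF that(1)] by (simp add: norm_mult)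
    also have "\<dots> \<le> ((t * (cmod (f z))\<^sup>2 + (cmod (g z))\<^sup>2 / t) / 2) * \<omega> z"
      using mult_le_weighted_squares[OF that(2)] \<omega>_nonneg[OF that(1)] by (intro mult_right_mono)
    also have "\<dots> = (t * dens f z + dens g z / t) / 2" by (simp add: dens_def algebra_simps)
    finally show ?thesis .
  qed
  have int: "integrable M (\<lambda>z. (t * dens f z + dens g z / t) / 2)" for t
    using f(2) g(2) by auto
  show int2: "integrable M (\<lambda>z. f z * cnj (g z) * of_real (\<omega> z))"
    by (rule Bochner_Integration.integrable_bound[OF int[of 1] meas])
      (use bound[of _ 1] sp in \<open>auto intro!: AE_I2 intro: order_trans[OF _ abs_ge_self]\<close>)
  assume t: "0 < t"
  have "cmod (LINT z|M. f z * cnj (g z) * of_real (\<omega> z)) \<le> (LINT z|M. cmod (f z * cnj (g z) * of_real (\<omega> z)))"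
    by (rule integral_norm_bound)
  also have "\<dots> \<le> (LINT z|M. (t * dens f z + dens g z / t) / 2)"
    using int2 int bound[OF _ t] sp by (intro integral_mono) auto
  also have "\<dots> = (t * (LINT z|M. dens f z) + (LINT z|M. dens g z) / t) / 2"
    using f(2) g(2) by simp
  finally show "cmod (LINT z|M. f z * cnj (g z) * of_real (\<omega> z)) \<le> (t * (LINT z|M. dens f z) + (LINT z|M. dens g z) / t) / 2" .
qed

lemma A2_pairing_integrable:
  "f \<in> A2 \<Longrightarrow> g \<in> A2 \<Longrightarrow> integrable area (\<lambda>z. f z * cnj (g z) * of_real (\<omega> z))"
  by (intro pairing_integrable) (auto intro: A2_holomorphic A2_integrable)

lemma A2_I:
  assumes "f holomorphic_on \<D>" "\<And>z. z \<notin> \<D> \<Longrightarrow> f z = 0" "(\<integral>\<^sup>+z. ennreal (dens f z) \<partial>area) < top"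
  shows "f \<in> A2"
proof -
  have "integrable area (dens f)"
    using assms(3) dens_measurable[OF assms(1)] dens_nonneg by (intro integrableI_nonneg) auto
  then show ?thesis using assms by (auto simp: bergman_def dens_def[abs_def])
qed

lemma A2_add: "f \<in> A2 \<Longrightarrow> g \<in> A2 \<Longrightarrow> f + g \<in> A2"
proof -
  assume f: "f \<in> A2" and g: "g \<in> A2"
  have hol: "(f + g) holomorphic_on \<D>"
    using A2_holomorphic[OF f] A2_holomorphic[OF g] unfolding plus_fun_def by (intro holomorphic_intros)
  have "integrable area (dens (f + g))"
  proof (rule Bochner_Integration.integrable_bound)
    show "integrable area (\<lambda>z. 2 * dens f z + 2 * dens g z)"
      using A2_integrable f g by auto
    show "AE z in area. norm (dens (f + g) z) \<le> norm (2 * dens f z + 2 * dens g z)"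
      using dens_add_le dens_nonneg by (intro AE_I2) auto
  qed (rule dens_measurable[OF hol])
  then show ?thesis
    using hol A2_outside[OF f] A2_outside[OF g] by (auto simp: bergman_def dens_def[abs_def])
qed

lemma A2_scale: "f \<in> A2 \<Longrightarrow> scale_fun c f \<in> A2"
proof -
  assume f: "f \<in> A2"
  have "scale_fun c f holomorphic_on \<D>"
    using A2_holomorphic[OF f] unfolding scale_fun_def by (intro holomorphic_intros)
  moreover have "integrable area (dens (scale_fun c f))"
    using A2_integrable[OF f] unfolding dens_scale by auto
  ultimately show ?thesis
    using A2_outside[OF f] by (auto simp: bergman_def dens_def[abs_def] scale_fun_def)
qed

lemma ip2_self: "f \<in> A2 \<Longrightarrow> ip2 f f = of_real (LINT z|area. dens f z)"
proof -
  have "f z * cnj (f z) * of_real (\<omega> z) = of_real (dens f z)" for z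
    by (simp add: dens_def flip: complex_norm_square)
  then show ?thesis by (simp add: bergman_inner_def)
qed

lemma nrm2_sq: "f \<in> A2 \<Longrightarrow> (nrm2 f)\<^sup>2 = (LINT z|area. dens f z)"
proof -
  assume f: "f \<in> A2"
  have "0 \<le> (LINT z|area. dens f z)" using dens_nonneg by (intro integral_nonneg_AE AE_I2) auto
  then show ?thesis using f by (simp add: ip_norm_def ip2_self)
qed

lemma nn_integral_dens: "f \<in> A2 \<Longrightarrow> (\<integral>\<^sup>+z. ennreal (dens f z) \<partial>area) = ennreal ((nrm2 f)\<^sup>2)"
  unfolding nrm2_sq using A2_integrable dens_nonneg by (intro nn_integral_eq_integral AE_I2) auto

lemma local_mass_le: "f \<in> A2 \<Longrightarrow> local_mass f a r \<le> ennreal ((nrm2 f)\<^sup>2)"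
  unfolding local_mass_def nn_integral_dens[symmetric]
  by (intro nn_integral_mono) (auto split: split_indicator)

text \<open>The local estimate at z without vanishing conditions; it is uniform on |z| \<le> R
  because \<tau> and \<omega> take their smallest values there on the circle |z| = R.\<close>

lemma point_evaluation:
  assumes "R < 1"
  obtains B where "0 < B" "\<And>f z. f \<in> A2 \<Longrightarrow> cmod z \<le> R \<Longrightarrow> cmod (f z) \<le> B * nrm2 f"
proof (cases "0 \<le> R")
  case False
  then show ?thesis using that[of 1] norm_ge_zero order_trans by (metis zero_less_one)
next
  case R0: True
  obtain C where C: "1 \<le> C" "\<And>a. a \<in> \<D> \<Longrightarrow> \<exists>L :: nat \<Rightarrow> (complex \<Rightarrow> complex) \<Rightarrow> complex.
     (\<forall>j f g. f holomorphic_on \<D> \<longrightarrow> g holomorphic_on \<D> \<longrightarrow> L j (f + g) = L j f + L j g) \<and>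
     (\<forall>j c f. f holomorphic_on \<D> \<longrightarrow> L j (scale_fun c f) = c * L j f) \<and>
     (\<forall>f k \<rho> z. f holomorphic_on \<D> \<longrightarrow> 0 < \<rho> \<longrightarrow> 4 * \<rho> \<le> m \<longrightarrow> (\<forall>j<k. L j f = 0) \<longrightarrow> z \<in> ball a (\<rho> * \<tau> a) \<longrightarrow>
        ennreal (dens f z) \<le> ennreal (C / (4 ^ k * (\<rho> * \<tau> a)\<^sup>2)) * local_mass f a (4 * \<rho> * \<tau> a))"
    using local_estimate by blast
  define \<rho> where "\<rho> = m / 4"
  have \<rho>: "0 < \<rho>" "4 * \<rho> \<le> m" using m_bounds by (auto simp: \<rho>_def)
  have RD: "of_real R \<in> \<D>" using assms R0 by simp
  define t w where "t = \<tau> (of_real R)" and "w = \<omega> (of_real R)"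
  have tw: "0 < t" "0 < w" using \<tau>_pos \<omega>_pos RD by (auto simp: t_def w_def)
  define B where "B = sqrt (C / (\<rho> * t)\<^sup>2 / w)"
  have B: "0 < B" using C tw \<rho> by (simp add: B_def)
  have "cmod (f z) \<le> B * nrm2 f" if f: "f \<in> A2" and z: "cmod z \<le> R" for f z
  proof -
    have zD: "z \<in> \<D>" using z assms by simp
    have tz: "t \<le> \<tau> z" "w \<le> \<omega> z"
      unfolding t_def w_def using z zD RD R0 by (auto intro!: \<tau>_antimono \<omega>_antimono)
    have "z \<in> ball z (\<rho> * \<tau> z)" using \<rho> \<tau>_pos[OF zD] by simp
    then have "ennreal (dens f z) \<le> ennreal (C / (4 ^ 0 * (\<rho> * \<tau> z)\<^sup>2)) * local_mass f z (4 * \<rho> * \<tau> z)"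
      using C(2)[OF zD] A2_holomorphic[OF f] \<rho> by blast
    also have "\<dots> \<le> ennreal (C / (4 ^ 0 * (\<rho> * \<tau> z)\<^sup>2)) * ennreal ((nrm2 f)\<^sup>2)"
      by (intro mult_left_mono local_mass_le f) auto
    finally have "ennreal (dens f z) \<le> ennreal (C / (\<rho> * \<tau> z)\<^sup>2 * (nrm2 f)\<^sup>2)"
      using C(1) by (subst ennreal_mult) auto
    then have "dens f z \<le> C / (\<rho> * \<tau> z)\<^sup>2 * (nrm2 f)\<^sup>2"
      by (subst (asm) ennreal_le_iff) (use C(1) in auto)
    also have "\<dots> \<le> C / (\<rho> * t)\<^sup>2 * (nrm2 f)\<^sup>2"
      using tz \<rho> tw C by (intro mult_right_mono divide_left_mono power_mono mult_left_mono) auto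
    finally have 1: "(cmod (f z))\<^sup>2 * \<omega> z \<le> C / (\<rho> * t)\<^sup>2 * (nrm2 f)\<^sup>2" by (simp add: dens_def)
    have "(cmod (f z))\<^sup>2 * w \<le> (cmod (f z))\<^sup>2 * \<omega> z" using tz by (intro mult_left_mono) auto
    with 1 have "(cmod (f z))\<^sup>2 * w \<le> C / (\<rho> * t)\<^sup>2 * (nrm2 f)\<^sup>2" by linarith
    then have "(cmod (f z))\<^sup>2 \<le> C / (\<rho> * t)\<^sup>2 * (nrm2 f)\<^sup>2 / w"
      by (subst pos_le_divide_eq[OF tw(2)])
    also have "\<dots> = (B * nrm2 f)\<^sup>2"
      using C tw \<rho> by (simp add: B_def power_mult_distrib)
    finally show ?thesis
      by (rule power2_le_imp_le) (use B in \<open>auto simp: ip_norm_def ip2_self[OF f] intro!: mult_nonneg_nonneg integral_nonneg_AE AE_I2 dens_nonneg\<close>)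
  qed
  then show ?thesis using that B by blast
qed

text \<open>Norm convergence implies locally uniform convergence by point evaluation, so a Cauchy
  sequence has a holomorphic pointwise limit; Fatou's lemma shows that it is also the limit in
  norm.\<close>

sublocale A2: fun_hilbert A2 ip2
proof
  show "0 \<in> A2" by (auto simp: bergman_def zero_fun_def)
  show "f + g \<in> A2" if "f \<in> A2" "g \<in> A2" for f g using A2_add that .
  show "scale_fun c f \<in> A2" if "f \<in> A2" for c f using A2_scale that .
  show "ip2 (f + g) h = ip2 f h + ip2 g h" if "f \<in> A2" "g \<in> A2" "h \<in> A2" for f g h
    using A2_pairing_integrable[OF that(1,3)] A2_pairing_integrable[OF that(2,3)]
    by (simp add: bergman_inner_def algebra_simps)
  show "ip2 (scale_fun c f) h = c * ip2 f h" if "f \<in> A2" "h \<in> A2" for c f h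
    using A2_pairing_integrable[OF that] by (simp add: bergman_inner_def scale_fun_def mult.assoc)
  show "ip2 g f = cnj (ip2 f g)" if "f \<in> A2" "g \<in> A2" for f g
  proof -
    have "(\<lambda>z. g z * cnj (f z) * of_real (\<omega> z)) = (\<lambda>z. cnj (f z * cnj (g z) * of_real (\<omega> z)))"
      by (auto simp: fun_eq_iff)
    then show ?thesis unfolding bergman_inner_def by (metis Bochner_Integration.integral_cnj)
  qed
  show "0 \<le> Re (ip2 f f)" if "f \<in> A2" for f
    unfolding ip2_self[OF that] using dens_nonneg by (auto intro!: integral_nonneg_AE AE_I2)
  show "f = 0" if f: "f \<in> A2" "ip2 f f = 0" for f
  proof
    fix z
    show "f z = 0 z"
    proof (cases "z \<in> \<D>")
      case True
      then have "cmod z < 1" by simp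
      then obtain B where "0 < B" "\<And>f z'. f \<in> A2 \<Longrightarrow> cmod z' \<le> cmod z \<Longrightarrow> cmod (f z') \<le> B * nrm2 f"
        using point_evaluation by blast
      moreover have "nrm2 f = 0" using f by (simp add: ip_norm_def)
      ultimately show ?thesis using f(1) by (metis mult_zero_right norm_le_zero_iff order_refl zero_fun_apply)
    qed (use A2_outside f in auto)
  qed
next
  fix X assume X: "\<And>n::nat. X n \<in> A2"
    and Cauchy: "\<And>e. 0 < e \<Longrightarrow> \<exists>N. \<forall>m\<ge>N. \<forall>n\<ge>N. nrm2 (X m - X n) < e"
  have diff: "f - g \<in> A2" if "f \<in> A2" "g \<in> A2" for f g
    using A2_add[OF that(1) A2_scale[OF that(2), of "-1"]] by (simp only: minus_eq_add_scale)
  have conv: "\<exists>l. (\<lambda>n. X n z) \<longlonglongrightarrow> l" for z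
  proof (cases "z \<in> \<D>")
    case True
    then have "cmod z < 1" by simp
    then obtain B where B: "0 < B" "\<And>f z'. f \<in> A2 \<Longrightarrow> cmod z' \<le> cmod z \<Longrightarrow> cmod (f z') \<le> B * nrm2 f"
      using point_evaluation by blast
    have "Cauchy (\<lambda>n. X n z)"
    proof (rule CauchyI)
      fix e :: real assume "0 < e"
      then obtain N where N: "\<And>m n. m \<ge> N \<Longrightarrow> n \<ge> N \<Longrightarrow> nrm2 (X m - X n) < e / B"
        using Cauchy[of "e / B"] B(1) by (meson divide_pos_pos)
      have "cmod (X m z - X n z) < e" if "m \<ge> N" "n \<ge> N" for m n
      proof -
        have "cmod ((X m - X n) z) \<le> B * nrm2 (X m - X n)" by (intro B diff X) simp
        also have "\<dots> < B * (e / B)" using N[OF that] B by (intro mult_strict_left_mono) auto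
        finally show ?thesis using B by simp
      qed
      then show "\<exists>N. \<forall>m\<ge>N. \<forall>n\<ge>N. norm (X m z - X n z) < e" by blast
    qed
    then show ?thesis by (simp add: Cauchy_convergent_iff convergent_def)
  next
    case False
    then show ?thesis using A2_outside[OF X] by (intro exI[of _ 0]) simp
  qed
  then obtain g where g: "\<And>z. (\<lambda>n. X n z) \<longlonglongrightarrow> g z" by metis
  have g_out: "g z = 0" if "z \<notin> \<D>" for z
    using g[of z] A2_outside[OF X that] by (simp add: LIMSEQ_const_iff)
  have hol: "g holomorphic_on \<D>"
  proof (rule holomorphic_uniform_sequence[OF open_ball A2_holomorphic[OF X]])
    fix z :: complex assume z: "z \<in> \<D>"
    define d where "d = (1 - cmod z) / 2"
    have d: "0 < d" using z by (simp add: d_def)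
    define R where "R = cmod z + d"
    have R: "R < 1" using z by (simp add: R_def d_def field_simps)
    have inR: "cmod w \<le> R" if "w \<in> cball z d" for w
      using that norm_triangle_sub[of w z] by (simp add: R_def dist_norm norm_minus_commute)
    obtain B where B: "0 < B" "\<And>f w. f \<in> A2 \<Longrightarrow> cmod w \<le> R \<Longrightarrow> cmod (f w) \<le> B * nrm2 f"
      using point_evaluation[OF R] by blast
    have "uniform_limit (cball z d) X g sequentially"
    proof (rule uniform_limitI)
      fix e :: real assume "0 < e"
      then obtain N where N: "\<And>m n. m \<ge> N \<Longrightarrow> n \<ge> N \<Longrightarrow> nrm2 (X m - X n) < e / (2 * B)"
        using Cauchy[of "e / (2 * B)"] B(1) by (meson divide_pos_pos mult_pos_pos zero_less_numeral)
      have "dist (X n w) (g w) < e" if n: "n \<ge> N" and w: "w \<in> cball z d" for n w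
      proof -
        have "cmod (X n w - X k w) \<le> e / 2" if "k \<ge> N" for k
        proof -
          have "cmod ((X n - X k) w) \<le> B * nrm2 (X n - X k)" using inR[OF w] by (intro B diff X)
          also have "\<dots> \<le> B * (e / (2 * B))" using N[OF n that] B by (intro mult_left_mono) auto
          finally show ?thesis using B by simp
        qed
        moreover have "(\<lambda>k. cmod (X n w - X k w)) \<longlonglongrightarrow> cmod (X n w - g w)"
          by (intro tendsto_intros g)
        ultimately have "cmod (X n w - g w) \<le> e / 2"
          by (intro LIMSEQ_le_const2) auto
        then show ?thesis using \<open>0 < e\<close> by (simp add: dist_norm)
      qed
      then show "\<forall>\<^sub>F n in sequentially. \<forall>w\<in>cball z d. dist (X n w) (g w) < e"
        unfolding eventually_sequentially by blast
    qed
    moreover have "cball z d \<subseteq> \<D>" using inR R by force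
    ultimately show "\<exists>d>0. cball z d \<subseteq> \<D> \<and> uniform_limit (cball z d) X g sequentially"
      using d by blast
  qed
  \<comment> \<open>For fixed n the bound on \<open>X n - X k\<close> passes to the limit in
    k.\<close>
  have close: "(\<integral>\<^sup>+z. ennreal (dens (X n - g) z) \<partial>area) \<le> ennreal (e\<^sup>2)"
    if e: "0 < e" and N: "\<And>k. k \<ge> N \<Longrightarrow> nrm2 (X n - X k) < e" for n N e
  proof (rule nn_integral_limit_le)
    show "(\<lambda>z. ennreal (dens (X n - X k) z)) \<in> borel_measurable area" for k
      using dens_measurable[OF A2_holomorphic[OF diff[OF X X]]] by measurable
    show "(\<lambda>k. ennreal (dens (X n - X k) z)) \<longlonglongrightarrow> ennreal (dens (X n - g) z)" for z
      unfolding dens_def minus_apply by (intro tendsto_intros g)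
    have "(\<integral>\<^sup>+z. ennreal (dens (X n - X k) z) \<partial>area) \<le> ennreal (e\<^sup>2)" if "k \<ge> N" for k
    proof -
      have "0 \<le> nrm2 (X n - X k)" using nrm2_sq[OF diff[OF X X]] 
        by (simp add: ip_norm_def ip2_self[OF diff[OF X X]] integral_nonneg_AE dens_nonneg)
      then have "(nrm2 (X n - X k))\<^sup>2 \<le> e\<^sup>2" using N[OF that] by (intro power_mono) auto
      then show ?thesis unfolding nn_integral_dens[OF diff[OF X X]] by (rule ennreal_leI)
    qed
    then show "\<forall>\<^sub>F k in sequentially. (\<integral>\<^sup>+z. ennreal (dens (X n - X k) z) \<partial>area) \<le> ennreal (e\<^sup>2)"
      by (auto simp: eventually_sequentially)
  qed
  have hol_diff: "(X n - g) holomorphic_on \<D>" for n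
    using A2_holomorphic[OF X] hol unfolding fun_diff_def by (intro holomorphic_intros)
  have gA: "g \<in> A2"
  proof -
    obtain N where N: "\<And>m n. m \<ge> N \<Longrightarrow> n \<ge> N \<Longrightarrow> nrm2 (X m - X n) < 1"
      using Cauchy[of 1] by (meson zero_less_one)
    have "(\<integral>\<^sup>+z. ennreal (dens (X N - g) z) \<partial>area) \<le> ennreal (1\<^sup>2)"
      by (rule close[of 1 N]) (use N in auto)
    then have "X N - g \<in> A2"
      using hol_diff A2_outside[OF X] g_out by (intro A2_I) (auto simp: le_less_trans)
    then have "X N - (X N - g) \<in> A2" by (rule diff[OF X])
    moreover have "X N - (X N - g) = g" by (auto simp: fun_eq_iff)
    ultimately show ?thesis by simp
  qed
  have "(\<lambda>n. nrm2 (X n - g)) \<longlonglongrightarrow> 0"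
  proof (rule LIMSEQ_I)
    fix e :: real assume e: "0 < e"
    obtain N where N: "\<And>m n. m \<ge> N \<Longrightarrow> n \<ge> N \<Longrightarrow> nrm2 (X m - X n) < e / 2"
      using Cauchy[of "e / 2"] e by (meson half_gt_zero)
    have "norm (nrm2 (X n - g) - 0) < e" if "n \<ge> N" for n
    proof -
      have "ennreal ((nrm2 (X n - g))\<^sup>2) \<le> ennreal ((e / 2)\<^sup>2)"
        unfolding nn_integral_dens[OF diff[OF X gA], symmetric] using e N[OF that] by (intro close) auto
      then have "(nrm2 (X n - g))\<^sup>2 \<le> (e / 2)\<^sup>2" by (simp add: ennreal_le_iff)
      then have "\<bar>nrm2 (X n - g)\<bar> \<le> \<bar>e / 2\<bar>" by (simp only: abs_le_square_iff)
      then show ?thesis using e by simp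
    qed
    then show "\<exists>N. \<forall>n\<ge>N. norm (nrm2 (X n - g) - 0) < e" by blast
  qed
  then show "\<exists>g\<in>A2. (\<lambda>n. nrm2 (X n - g)) \<longlonglongrightarrow> 0" using gA by blast
qed

text \<open>Riesz applied to the evaluation at z; definiteness of the inner product gives the
  uniqueness that the description operator in \<open>bergman_kernel\<close> asks for.\<close>

lemma kernel_reproducing:
  assumes "z \<in> \<D>"
  shows "bergman_kernel \<omega> z \<in> A2" "f \<in> A2 \<Longrightarrow> f z = ip2 f (bergman_kernel \<omega> z)"
proof -
  have "cmod z < 1" using assms by simp
  then obtain B where B: "\<And>f z'. f \<in> A2 \<Longrightarrow> cmod z' \<le> cmod z \<Longrightarrow> cmod (f z') \<le> B * nrm2 f"
    using point_evaluation by blast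
  obtain k where k: "k \<in> A2" "\<And>f. f \<in> A2 \<Longrightarrow> f z = ip2 f k"
    by (rule A2.Riesz[of "\<lambda>f. f z" B]) (use B in \<open>auto simp: scale_fun_def\<close>)
  have "bergman_kernel \<omega> z = k"
    unfolding bergman_kernel_def
  proof (rule the_equality)
    show "k \<in> A2 \<and> (\<forall>f\<in>A2. f z = ip2 f k)" using k by blast
    fix k' assume k': "k' \<in> A2 \<and> (\<forall>f\<in>A2. f z = ip2 f k')"
    have d: "k' - k \<in> A2" using k k' A2.diff_in by blast
    have "ip2 (k' - k) (k' - k) = ip2 (k' - k) k' - ip2 (k' - k) k"
      using d k k' by (intro A2.ip_diff_right) auto
    also have "\<dots> = 0" using k(2)[OF d] k' d by simp
    finally have "k' - k = 0" by (rule A2.ip_self_eq_0[OF d])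
    then show "k' = k" by simp
  qed
  then show "bergman_kernel \<omega> z \<in> A2" "f \<in> A2 \<Longrightarrow> f z = ip2 f (bergman_kernel \<omega> z)" using k by auto
qed

end

section \<open>Toeplitz operators\<close>

locale W_measure = W_profile +
  fixes \<mu> :: "complex measure"
  assumes finite_borel: "finite_borel_on_disc \<mu>"
begin

lemma sets_\<mu>: "sets \<mu> = sets area"
  using finite_borel by (simp add: finite_borel_on_disc_def sets_area)

lemma space_\<mu> [simp]: "space \<mu> = \<D>"
  using sets_eq_imp_space_eq[OF sets_\<mu>] by simp

lemma finite_\<mu>: "finite_measure \<mu>"
  using finite_borel by (simp add: finite_borel_on_disc_def)

lemma measurable_\<mu>: "f \<in> borel_measurable \<mu> \<longleftrightarrow> f \<in> borel_measurable area"
  by (simp add: measurable_cong_sets[OF sets_\<mu> refl])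

definition energy :: "(complex \<Rightarrow> complex) \<Rightarrow> ennreal" where
  "energy f = (\<integral>\<^sup>+z. ennreal (dens f z) \<partial>\<mu>)"

text \<open>Carleson measures for the Bergman space: the embedding into L2 of \<omega> \<mu> is
  bounded, with squared norm at most C.\<close>

definition Carleson :: "real \<Rightarrow> bool" where
  "Carleson C \<longleftrightarrow> 0 \<le> C \<and> (\<forall>f\<in>A2. energy f \<le> ennreal (C * (nrm2 f)\<^sup>2))"

abbreviation T\<mu> :: "(complex \<Rightarrow> complex) \<Rightarrow> complex \<Rightarrow> complex" where
  "T\<mu> \<equiv> toeplitz \<omega> \<mu>"

lemma Carleson_integrable: "Carleson C \<Longrightarrow> f \<in> A2 \<Longrightarrow> integrable \<mu> (dens f)"
proof -
  assume C: "Carleson C" and f: "f \<in> A2"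
  have "(\<integral>\<^sup>+z. ennreal (dens f z) \<partial>\<mu>) < top"
    using C f unfolding Carleson_def energy_def by (meson ennreal_less_top order_le_less_trans)
  then show ?thesis
    using dens_measurable[OF A2_holomorphic[OF f]] dens_nonneg
    by (intro integrableI_nonneg) (auto simp: measurable_\<mu>)
qed

lemma pairing_\<mu>_integrable:
  "Carleson C \<Longrightarrow> f \<in> A2 \<Longrightarrow> g \<in> A2 \<Longrightarrow> integrable \<mu> (\<lambda>z. f z * cnj (g z) * of_real (\<omega> z))"
  by (rule pairing_integrable(1)[OF sets_\<mu>]) (auto intro: Carleson_integrable A2_holomorphic)

lemma Carleson_converges: "Carleson C \<Longrightarrow> toeplitz_converges \<omega> \<mu>"
  unfolding toeplitz_converges_def using pairing_\<mu>_integrable kernel_reproducing(1) by blast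

lemma integral_dens_\<mu>: "Carleson C \<Longrightarrow> f \<in> A2 \<Longrightarrow> energy f = ennreal (LINT z|\<mu>. dens f z)"
  unfolding energy_def using Carleson_integrable dens_nonneg by (intro nn_integral_eq_integral AE_I2) auto

text \<open>The pairing over \<mu> with f is a bounded functional, so Riesz gives a representative
  k; evaluating k through the reproducing kernel recovers the integral that defines
  \<open>T\<mu> f\<close>.\<close>

lemma Carleson_toeplitz:
  assumes C: "Carleson C" and f: "f \<in> A2"
  shows "T\<mu> f \<in> A2"
    and "g \<in> A2 \<Longrightarrow> ip2 (T\<mu> f) g = (LINT z|\<mu>. f z * cnj (g z) * of_real (\<omega> z))"
proof -
  define L where "L = (\<lambda>g. LINT z|\<mu>. g z * cnj (f z) * of_real (\<omega> z))"
  note int = pairing_\<mu>_integrable[OF C]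
  have C0: "0 \<le> C" using C by (simp add: Carleson_def)
  have bound: "cmod (L g) \<le> (C + (LINT z|\<mu>. dens f z)) / 2 * nrm2 g" if g: "g \<in> A2" for g
  proof (cases "nrm2 g = 0")
    case True
    then show ?thesis using A2.nrm_eq_0[OF g] by (simp add: L_def)
  next
    case False
    then have n: "0 < nrm2 g" using A2.nrm_ge_0[OF g] by simp
    have "ennreal (LINT z|\<mu>. dens g z) \<le> ennreal (C * (nrm2 g)\<^sup>2)"
      using C g unfolding integral_dens_\<mu>[OF C g, symmetric] by (simp add: Carleson_def)
    then have le: "(LINT z|\<mu>. dens g z) \<le> C * (nrm2 g)\<^sup>2"
      using C0 by (subst (asm) ennreal_le_iff) auto
    \<comment> \<open>With parameter \<open>1 / nrm2 g\<close> both terms become linear in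
      \<open>nrm2 g\<close>.\<close>
    have "cmod (L g) \<le> (1 / nrm2 g * (LINT z|\<mu>. dens g z) + (LINT z|\<mu>. dens f z) / (1 / nrm2 g)) / 2"
      unfolding L_def using n f g
      by (intro pairing_integrable(2)[OF sets_\<mu>]) (auto intro: A2_holomorphic Carleson_integrable[OF C])
    also have "\<dots> \<le> (1 / nrm2 g * (C * (nrm2 g)\<^sup>2) + (LINT z|\<mu>. dens f z) / (1 / nrm2 g)) / 2"
      using le n by (intro divide_right_mono add_right_mono mult_left_mono) auto
    also have "\<dots> = (C + (LINT z|\<mu>. dens f z)) / 2 * nrm2 g"
      using n by (simp add: power2_eq_square field_simps)
    finally show ?thesis .
  qed
  have add: "L (g + h) = L g + L h" if "g \<in> A2" "h \<in> A2" for g h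
    using int[OF that(1) f] int[OF that(2) f] by (simp add: L_def algebra_simps)
  have scale: "L (scale_fun c g) = c * L g" if "g \<in> A2" for c g
    using int[OF that f] by (simp add: L_def scale_fun_def mult.assoc)
  obtain k where k: "k \<in> A2" "\<And>g. g \<in> A2 \<Longrightarrow> L g = ip2 g k"
    using A2.Riesz[OF add scale bound] by blast
  have Lcnj: "(LINT z|\<mu>. f z * cnj (g z) * of_real (\<omega> z)) = cnj (L g)" for g
  proof -
    have "(\<lambda>z. f z * cnj (g z) * of_real (\<omega> z)) = (\<lambda>z. cnj (g z * cnj (f z) * of_real (\<omega> z)))"
      by (auto simp: fun_eq_iff)
    then show ?thesis unfolding L_def by (simp only: Bochner_Integration.integral_cnj)
  qed
  have eq: "(LINT z|\<mu>. f z * cnj (g z) * of_real (\<omega> z)) = ip2 k g" if "g \<in> A2" for g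
    using Lcnj[of g] k(2)[OF that] A2.ip_commute[OF k(1) that] by simp
  have "T\<mu> f = k"
  proof
    fix z
    show "T\<mu> f z = k z"
    proof (cases "z \<in> \<D>")
      case True
      then have "T\<mu> f z = (LINT \<xi>|\<mu>. f \<xi> * cnj (bergman_kernel \<omega> z \<xi>) * of_real (\<omega> \<xi>))"
        by (simp add: toeplitz_def)
      also have "\<dots> = k z"
        using eq[OF kernel_reproducing(1)[OF True]] kernel_reproducing(2)[OF True k(1)] by simp
      finally show ?thesis .
    next
      case False
      then show ?thesis using A2_outside[OF k(1)] by (simp add: toeplitz_def)
    qed
  qed
  then show "T\<mu> f \<in> A2" "g \<in> A2 \<Longrightarrow> ip2 (T\<mu> f) g = (LINT z|\<mu>. f z * cnj (g z) * of_real (\<omega> z))"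
    using k eq by auto
qed

lemma toeplitz_form:
  assumes "Carleson C" "f \<in> A2"
  shows "ip2 (T\<mu> f) f = of_real (LINT z|\<mu>. dens f z)"
    and "energy f = ennreal (Re (ip2 (T\<mu> f) f))"
proof -
  have "f z * cnj (f z) * of_real (\<omega> z) = of_real (dens f z)" for z
    by (simp add: dens_def flip: complex_norm_square)
  then show "ip2 (T\<mu> f) f = of_real (LINT z|\<mu>. dens f z)"
    using Carleson_toeplitz(2)[OF assms assms(2)] by simp
  then show "energy f = ennreal (Re (ip2 (T\<mu> f) f))"
    using integral_dens_\<mu>[OF assms] by simp
qed

lemma toeplitz_linear:
  assumes C: "Carleson C"
  shows "linear_operator_on A2 T\<mu>"
proof -
  have int: "integrable \<mu> (\<lambda>\<xi>. f \<xi> * cnj (bergman_kernel \<omega> z \<xi>) * of_real (\<omega> \<xi>))" if "f \<in> A2" "z \<in> \<D>" for f z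
    using pairing_\<mu>_integrable[OF C that(1) kernel_reproducing(1)[OF that(2)]] .
  have "T\<mu> (f + g) = T\<mu> f + T\<mu> g" if "f \<in> A2" "g \<in> A2" for f g
    using int[OF that(1)] int[OF that(2)] by (auto simp: toeplitz_def fun_eq_iff algebra_simps)
  moreover have "T\<mu> (scale_fun c f) = scale_fun c (T\<mu> f)" if "f \<in> A2" for c f
    using int[OF that] by (auto simp: toeplitz_def scale_fun_def fun_eq_iff mult.assoc)
  ultimately show ?thesis
    using Carleson_toeplitz(1)[OF C] by (simp add: linear_operator_on_def)
qed

lemma toeplitz_compact_positive:
  assumes C: "Carleson C" and compact: "compact_operator_on A2 ip2 T\<mu>"
  shows "compact_positive A2 ip2 T\<mu>"
proof
  show "compact_operator_on A2 ip2 T\<mu>" by fact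
  fix f g assume f: "f \<in> A2" and g: "g \<in> A2"
  have "(\<lambda>z. f z * cnj (g z) * of_real (\<omega> z)) = (\<lambda>z. cnj (g z * cnj (f z) * of_real (\<omega> z)))"
    by (auto simp: fun_eq_iff)
  then have "ip2 (T\<mu> f) g = cnj (ip2 (T\<mu> g) f)"
    unfolding Carleson_toeplitz(2)[OF C f g] Carleson_toeplitz(2)[OF C g f]
    by (metis Bochner_Integration.integral_cnj)
  then show "ip2 (T\<mu> f) g = ip2 f (T\<mu> g)"
    using A2.ip_commute[OF Carleson_toeplitz(1)[OF C g] f] by simp
next
  fix f assume f: "f \<in> A2"
  show "0 \<le> Re (ip2 (T\<mu> f) f)"
    unfolding toeplitz_form(1)[OF C f] using dens_nonneg by (auto intro!: integral_nonneg_AE AE_I2)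
qed

text \<open>On the span of the kernels \<open>\<langle>T f, f\<rangle>\<close> is the energy by definition of \<open>T\<close>; the span is dense
  and Fatou's lemma carries the estimate over to the whole space.\<close>

lemma compact_toeplitz_Carleson:
  assumes conv: "toeplitz_converges \<omega> \<mu>" and compact: "compact_operator_on A2 ip2 T\<mu>"
  obtains C where "Carleson C"
proof -
  define K where "K = bergman_kernel \<omega>"
  define S where "S = fun_space.span (K ` \<D>)"
  obtain C where C: "0 \<le> C" "\<And>f. f \<in> A2 \<Longrightarrow> nrm2 (T\<mu> f) \<le> C * nrm2 f"
    using A2.compact_operator_bounded[OF compact] by blast
  have T_in: "T\<mu> f \<in> A2" if "f \<in> A2" for f
    using compact that by (simp add: compact_operator_on_def linear_operator_on_def)
  have S: "f \<in> A2 \<and> (\<forall>g\<in>A2. integrable \<mu> (\<lambda>z. g z * cnj (f z) * of_real (\<omega> z)) \<and>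
      ip2 (T\<mu> g) f = (LINT z|\<mu>. g z * cnj (f z) * of_real (\<omega> z)))" if "f \<in> S" for f
    using that unfolding S_def
  proof (induction rule: fun_space.span_induct_alt)
    case base
    then show ?case using A2.zero_in A2.ip_zero_right T_in by (auto simp: zero_fun_def)
  next
    case (step c x y)
    then obtain w where w: "w \<in> \<D>" "x = K w" by auto
    have xA: "x \<in> A2" using kernel_reproducing(1)[OF w(1)] by (simp add: w K_def)
    have x: "integrable \<mu> (\<lambda>z. g z * cnj (x z) * of_real (\<omega> z))"
      "ip2 (T\<mu> g) x = (LINT z|\<mu>. g z * cnj (x z) * of_real (\<omega> z))" if "g \<in> A2" for g
    proof -
      show "integrable \<mu> (\<lambda>z. g z * cnj (x z) * of_real (\<omega> z))"
        using conv that w by (simp add: toeplitz_converges_def K_def)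
      have "ip2 (T\<mu> g) x = T\<mu> g w"
        using kernel_reproducing(2)[OF w(1) T_in[OF that]] by (simp add: w K_def)
      then show "ip2 (T\<mu> g) x = (LINT z|\<mu>. g z * cnj (x z) * of_real (\<omega> z))"
        using w by (simp add: toeplitz_def K_def)
    qed
    have alt: "(\<lambda>z. g z * cnj ((scale_fun c x + y) z) * of_real (\<omega> z)) =
        (\<lambda>z. cnj c * (g z * cnj (x z) * of_real (\<omega> z)) + g z * cnj (y z) * of_real (\<omega> z))" for g
      by (auto simp: fun_eq_iff scale_fun_def algebra_simps)
    show ?case
    proof (intro conjI ballI)
      have yA: "y \<in> A2" using step.IH by blast
      have cx: "scale_fun c x \<in> A2" using xA by (rule A2.scale_in)
      show "scale_fun c x + y \<in> A2" using cx yA by (rule A2.add_in)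
      fix g assume g: "g \<in> A2"
      have y: "integrable \<mu> (\<lambda>z. g z * cnj (y z) * of_real (\<omega> z))"
        "ip2 (T\<mu> g) y = (LINT z|\<mu>. g z * cnj (y z) * of_real (\<omega> z))"
        using step.IH g by blast+
      show "integrable \<mu> (\<lambda>z. g z * cnj ((scale_fun c x + y) z) * of_real (\<omega> z))"
        unfolding alt using x(1)[OF g] y(1) by (intro Bochner_Integration.integrable_add integrable_mult_right) auto
      have "ip2 (T\<mu> g) (scale_fun c x + y) = cnj c * ip2 (T\<mu> g) x + ip2 (T\<mu> g) y"
        using A2.ip_add_right[OF cx yA T_in[OF g]] A2.ip_scale_right[OF xA T_in[OF g]] by simp
      also have "\<dots> = (LINT z|\<mu>. g z * cnj ((scale_fun c x + y) z) * of_real (\<omega> z))"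
        unfolding alt x(2)[OF g] y(2) using x(1)[OF g] y(1)
        by (subst Bochner_Integration.integral_add) auto
      finally show "ip2 (T\<mu> g) (scale_fun c x + y) = (LINT z|\<mu>. g z * cnj ((scale_fun c x + y) z) * of_real (\<omega> z))" .
    qed
  qed
  have energy_S: "energy f \<le> ennreal (C * (nrm2 f)\<^sup>2)" if f: "f \<in> S" for f
  proof -
    have fA: "f \<in> A2" using S[OF f] by blast
    have eq: "(\<lambda>z. f z * cnj (f z) * of_real (\<omega> z)) = (\<lambda>z. of_real (dens f z))"
      by (auto simp: dens_def fun_eq_iff simp flip: complex_norm_square)
    have int: "integrable \<mu> (\<lambda>z. complex_of_real (dens f z))"
      and ip: "ip2 (T\<mu> f) f = (LINT z|\<mu>. complex_of_real (dens f z))"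
      using S[OF f] fA unfolding eq[symmetric] by auto
    have "integrable \<mu> (dens f)" using integrable_Re[OF int] by simp
    then have "energy f = ennreal (Re (ip2 (T\<mu> f) f))"
      unfolding energy_def ip using dens_nonneg by (subst nn_integral_eq_integral) auto
    also have "Re (ip2 (T\<mu> f) f) \<le> nrm2 (T\<mu> f) * nrm2 f"
      using A2.Cauchy_Schwarz[OF T_in[OF fA] fA] complex_Re_le_cmod order_trans by blast
    also have "\<dots> \<le> C * nrm2 f * nrm2 f" using C(2)[OF fA] A2.nrm_ge_0[OF fA] by (intro mult_right_mono)
    finally show ?thesis by (simp add: power2_eq_square mult.assoc ennreal_leI)
  qed
  \<comment> \<open>The factor 2 leaves room for \<open>nrm2 (X n)\<close> to exceed
    \<open>nrm2 f\<close>; this works when \<open>nrm2 f\<close> is positive, and f = 0 is treated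
    apart.\<close>
  have "energy f \<le> ennreal (2 * C * (nrm2 f)\<^sup>2)" if f: "f \<in> A2" for f
  proof (cases "nrm2 f = 0")
    case True
    then have "f = 0" using A2.nrm_eq_0[OF f] by simp
    then show ?thesis by (simp add: energy_def dens_def)
  next
    case False
    then have nf: "0 < nrm2 f" using A2.nrm_ge_0[OF f] by simp
    have "0 \<in> S" unfolding S_def by (rule fun_space.span_zero)
    obtain X g where X: "\<And>n::nat. X n \<in> S" and g: "g \<in> A2" "(\<lambda>n. nrm2 (X n - g)) \<longlonglongrightarrow> 0"
      and orth: "\<And>h. h \<in> S \<Longrightarrow> ip2 (f - g) h = 0"
      by (rule A2.projection_exists[of S f])
        (use S f \<open>0 \<in> S\<close> in \<open>auto simp: S_def intro: fun_space.span_add fun_space.span_scale\<close>)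
    have XA: "X n \<in> A2" for n using S[OF X] by blast
    have fg: "f - g \<in> A2" using f g A2.diff_in by blast
    \<comment> \<open>f - g is orthogonal to every kernel, that is, it vanishes at every point of
      the disc.\<close>
    have "f = g"
    proof
      fix z
      show "f z = g z"
      proof (cases "z \<in> \<D>")
        case True
        have "K z \<in> S" unfolding S_def using True by (intro fun_space.span_base imageI)
        then have "(f - g) z = 0"
          using orth kernel_reproducing(2)[OF True fg] by (simp add: K_def)
        then show ?thesis by simp
      next
        case False
        then show ?thesis using A2_outside[OF f] A2_outside[OF g(1)] by simp
      qed
    qed
    have point: "(\<lambda>n. X n z) \<longlonglongrightarrow> f z" if z: "z \<in> \<D>" for z
      using A2.ip_tendsto[OF XA g(1) kernel_reproducing(1)[OF z] g(2)]
        kernel_reproducing(2)[OF z XA] kernel_reproducing(2)[OF z f] \<open>f = g\<close> by simp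
    show ?thesis
      unfolding energy_def
    proof (rule nn_integral_limit_le)
      show "(\<lambda>z. ennreal (dens (X n) z)) \<in> borel_measurable \<mu>" for n
        using dens_measurable[OF A2_holomorphic[OF XA]] unfolding measurable_\<mu> by measurable
      show "(\<lambda>n. ennreal (dens (X n) z)) \<longlonglongrightarrow> ennreal (dens f z)" if "z \<in> space \<mu>" for z
        unfolding dens_def using point[of z] that by (intro tendsto_intros) auto
      have "(\<lambda>n. (nrm2 (X n))\<^sup>2) \<longlonglongrightarrow> (nrm2 f)\<^sup>2"
        using A2.nrm_tendsto[OF XA g] \<open>f = g\<close> by (intro tendsto_power) simp
      moreover have "(nrm2 f)\<^sup>2 < 2 * (nrm2 f)\<^sup>2" using nf by simp
      ultimately have "\<forall>\<^sub>F n in sequentially. (nrm2 (X n))\<^sup>2 < 2 * (nrm2 f)\<^sup>2"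
        by (rule order_tendstoD)
      then show "\<forall>\<^sub>F n in sequentially. (\<integral>\<^sup>+z. ennreal (dens (X n) z) \<partial>\<mu>) \<le> ennreal (2 * C * (nrm2 f)\<^sup>2)"
      proof (rule eventually_mono)
        fix n assume n: "(nrm2 (X n))\<^sup>2 < 2 * (nrm2 f)\<^sup>2"
        have "energy (X n) \<le> ennreal (C * (nrm2 (X n))\<^sup>2)" by (rule energy_S[OF X])
        also have "\<dots> \<le> ennreal (C * (2 * (nrm2 f)\<^sup>2))"
          using n C by (intro ennreal_leI mult_left_mono) auto
        finally show "(\<integral>\<^sup>+z. ennreal (dens (X n) z) \<partial>\<mu>) \<le> ennreal (2 * C * (nrm2 f)\<^sup>2)"
          by (simp add: energy_def mult_ac)
      qed
    qed
  qed
  then have "Carleson (2 * C)" using C(1) by (simp add: Carleson_def)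
  then show ?thesis by (rule that)
qed

end

section \<open>Separated sets and sufficiency\<close>

lemma packing_bound:
  fixes r :: "complex \<Rightarrow> real"
  assumes "finite F" and disj: "\<And>a b. a \<in> F \<Longrightarrow> b \<in> F \<Longrightarrow> a \<noteq> b \<Longrightarrow> ball a (r a) \<inter> ball b (r b) = {}"
    and r: "\<And>a. a \<in> F \<Longrightarrow> 0 \<le> r a" and sub: "\<And>a. a \<in> F \<Longrightarrow> ball a (r a) \<subseteq> ball z \<rho>" and "0 \<le> \<rho>"
  shows "(\<Sum>a\<in>F. (r a)\<^sup>2) \<le> \<rho>\<^sup>2"
proof -
  have "ennreal (pi * (\<Sum>a\<in>F. (r a)\<^sup>2)) = (\<Sum>a\<in>F. ennreal (pi * (r a)\<^sup>2))"
    by (simp add: sum_distrib_left sum_ennreal)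
  also have "\<dots> = (\<Sum>a\<in>F. emeasure lborel (ball a (r a)))"
    using r by (intro sum.cong) (auto simp: emeasure_lborel_ball_complex)
  also have "\<dots> = emeasure lborel (\<Union>a\<in>F. ball a (r a))"
    using disj assms(1) by (intro sum_emeasure) (auto simp: disjoint_family_on_def)
  also have "\<dots> \<le> emeasure lborel (ball z \<rho>)"
    using sub by (intro emeasure_mono) auto
  also have "\<dots> = ennreal (pi * \<rho>\<^sup>2)" using \<open>0 \<le> \<rho>\<close> by (simp add: emeasure_lborel_ball_complex)
  finally have "pi * (\<Sum>a\<in>F. (r a)\<^sup>2) \<le> pi * \<rho>\<^sup>2"
    by (subst (asm) ennreal_le_iff) auto
  then show ?thesis by simp
qed

text \<open>Replaces the inverse fourth power by a step function of dyadic balls, so that sums and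
  integrals reduce to areas. The relevant j is the dyadic ring containing x; the condition with
  \<open>Suc j\<close> describes the whole ball bounded by that ring.\<close>

lemma dyadic_majorant:
  fixes x s :: real
  assumes "0 < s" "s \<le> x" "x < 2 ^ n * s"
  shows "1 / x ^ 4 \<le> (\<Sum>j<n. if x < 2 ^ Suc j * s then 1 / (2 ^ j * s) ^ 4 else 0)"
proof -
  define j where "j = (LEAST j. x < 2 ^ Suc j * s)"
  have "n \<noteq> 0" using assms by (intro notI) simp
  then obtain n' where n': "n = Suc n'" using not0_implies_Suc by blast
  have ex: "x < 2 ^ Suc n' * s" using assms n' by simp
  have j: "x < 2 ^ Suc j * s" unfolding j_def by (rule LeastI[of _ n']) (rule ex)
  have jn: "j < n" using Least_le[of "\<lambda>j. x < 2 ^ Suc j * s", OF ex] n' by (simp add: j_def)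
  have low: "2 ^ j * s \<le> x"
  proof (cases j)
    case (Suc i)
    then have "\<not> x < 2 ^ Suc i * s" using not_less_Least[of i "\<lambda>j. x < 2 ^ Suc j * s"] by (simp add: j_def)
    then show ?thesis using Suc by simp
  qed (use assms in simp)
  have "1 / x ^ 4 \<le> 1 / (2 ^ j * s) ^ 4"
    using low assms by (intro divide_left_mono power_mono) auto
  also have "\<dots> = (if x < 2 ^ Suc j * s then 1 / (2 ^ j * s) ^ 4 else 0)" using j by simp
  also have "\<dots> \<le> (\<Sum>j<n. if x < 2 ^ Suc j * s then 1 / (2 ^ j * s) ^ 4 else 0)"
    using jn assms by (intro member_le_sum) auto
  finally show ?thesis .
qed

lemma exists_dyadic_bound: "0 < (s::real) \<Longrightarrow> \<exists>n. x < 2 ^ n * s"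
  using real_arch_pow[of 2 "x / s"] by (auto simp: field_simps)

lemma geometric_sum_le: "(\<Sum>j<n. (1/4::real) ^ j) \<le> 4/3"
proof -
  have "(\<Sum>j<n. (1/4::real) ^ j) = (1 - (1/4) ^ n) / (1 - 1/4)" by (subst sum_gp_strict) auto
  also have "\<dots> \<le> 4/3" by simp
  finally show ?thesis .
qed

text \<open>Discs centred in the ball of radius \<open>2 ^ Suc j * s\<close> lie in the ball of
  radius \<open>3 * 2 ^ j * s\<close>, since their radii are at most half the distance to z. Packing
  bounds the contribution of index j by \<open>9 / s\<^sup>2 * (1/4) ^ j\<close>, and 9 times 4/3 is
  12.\<close>

lemma quartic_sum_bound:
  fixes r :: "complex \<Rightarrow> real"
  assumes F: "finite F" and disj: "\<And>a b. a \<in> F \<Longrightarrow> b \<in> F \<Longrightarrow> a \<noteq> b \<Longrightarrow> ball a (r a) \<inter> ball b (r b) = {}"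
    and r: "\<And>a. a \<in> F \<Longrightarrow> 0 \<le> r a" "\<And>a. a \<in> F \<Longrightarrow> 2 * r a \<le> cmod (a - z)"
    and s: "0 < s" "\<And>a. a \<in> F \<Longrightarrow> s \<le> cmod (a - z)"
  shows "(\<Sum>a\<in>F. (r a)\<^sup>2 / cmod (a - z) ^ 4) \<le> 12 / s\<^sup>2"
proof -
  obtain n where n: "\<And>a. a \<in> F \<Longrightarrow> cmod (a - z) < 2 ^ n * s"
  proof -
    obtain n where n: "(\<Sum>a\<in>F. cmod (a - z)) < 2 ^ n * s" using exists_dyadic_bound[OF s(1)] by blast
    have "cmod (a - z) < 2 ^ n * s" if "a \<in> F" for a
      using member_le_sum[of a F "\<lambda>a. cmod (a - z)"] that F n by (auto intro: le_less_trans)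
    then show ?thesis using that by blast
  qed
  have "(\<Sum>a\<in>F. (r a)\<^sup>2 / cmod (a - z) ^ 4) \<le>
      (\<Sum>a\<in>F. (r a)\<^sup>2 * (\<Sum>j<n. if cmod (a - z) < 2 ^ Suc j * s then 1 / (2 ^ j * s) ^ 4 else 0))"
  proof (rule sum_mono)
    fix a assume a: "a \<in> F"
    show "(r a)\<^sup>2 / cmod (a - z) ^ 4 \<le>
        (r a)\<^sup>2 * (\<Sum>j<n. if cmod (a - z) < 2 ^ Suc j * s then 1 / (2 ^ j * s) ^ 4 else 0)"
      using mult_left_mono[OF dyadic_majorant[OF s(1) s(2)[OF a] n[OF a]], of "(r a)\<^sup>2"] by simp
  qed
  also have "\<dots> = (\<Sum>j<n. \<Sum>a\<in>F. if cmod (a - z) < 2 ^ Suc j * s then (r a)\<^sup>2 / (2 ^ j * s) ^ 4 else 0)"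
    by (subst sum.swap) (auto simp: sum_distrib_left intro!: sum.cong)
  also have "\<dots> \<le> (\<Sum>j<n. 9 / s\<^sup>2 * (1/4) ^ j)"
  proof (rule sum_mono)
    fix j
    define F' where "F' = {a \<in> F. cmod (a - z) < 2 ^ Suc j * s}"
    have pack: "(\<Sum>a\<in>F'. (r a)\<^sup>2) \<le> (3 * 2 ^ j * s)\<^sup>2"
    proof (rule packing_bound)
      show "finite F'" using F by (simp add: F'_def)
      fix a assume "a \<in> F'"
      then have a: "2 * r a \<le> cmod (a - z)" "cmod (a - z) < 2 ^ Suc j * s" using r by (auto simp: F'_def)
      show "ball a (r a) \<subseteq> ball z (3 * 2 ^ j * s)"
      proof
        fix w assume "w \<in> ball a (r a)"
        then have "dist z w < dist z a + r a" using dist_triangle[of z w a] by auto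
        then show "w \<in> ball z (3 * 2 ^ j * s)" using a by (simp add: dist_norm norm_minus_commute)
      qed
    qed (use disj r s in \<open>auto simp: F'_def\<close>)
    have "(\<Sum>a\<in>F. if cmod (a - z) < 2 ^ Suc j * s then (r a)\<^sup>2 / (2 ^ j * s) ^ 4 else 0) =
        (\<Sum>a\<in>F'. (r a)\<^sup>2) / (2 ^ j * s) ^ 4"
      unfolding F'_def sum_divide_distrib by (rule sum.inter_filter[symmetric, OF F])
    also have "\<dots> \<le> (3 * 2 ^ j * s)\<^sup>2 / (2 ^ j * s) ^ 4" using pack by (intro divide_right_mono) auto
    also have "\<dots> = 9 / s\<^sup>2 * (1/4) ^ j"
    proof -
      have "(2 ^ j)\<^sup>2 = (4 ^ j :: real)" by (simp add: power2_eq_square flip: power_mult_distrib)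
      then have "(3 * 2 ^ j * s)\<^sup>2 = 9 * 4 ^ j * s\<^sup>2" "(2 ^ j * s) ^ 4 = (4 ^ j * s\<^sup>2)\<^sup>2"
        by (simp_all add: power_mult_distrib power4_eq_xxxx power2_eq_square mult_ac)
      then show ?thesis using s(1) by (simp add: power2_eq_square power_one_over field_simps)
    qed
    finally show "(\<Sum>a\<in>F. if cmod (a - z) < 2 ^ Suc j * s then (r a)\<^sup>2 / (2 ^ j * s) ^ 4 else 0) \<le> 9 / s\<^sup>2 * (1/4) ^ j" .
  qed
  also have "\<dots> = 9 / s\<^sup>2 * (\<Sum>j<n. (1/4) ^ j)" by (simp add: sum_distrib_left)
  also have "\<dots> \<le> 9 / s\<^sup>2 * (4/3)" by (intro mult_left_mono geometric_sum_le) auto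
  finally show ?thesis by simp
qed

lemma emeasure_area_ball_le: "0 \<le> r \<Longrightarrow> emeasure area (ball a r \<inter> \<D>) \<le> ennreal (r\<^sup>2)"
proof -
  assume r: "0 \<le> r"
  have "emeasure area (ball a r \<inter> \<D>) = ennreal (1 / pi) * emeasure lborel (ball a r \<inter> \<D>)"
    by (simp add: area_def emeasure_restrict_space)
  also have "\<dots> \<le> ennreal (1 / pi) * emeasure lborel (ball a r)"
    by (intro mult_left_mono emeasure_mono) auto
  also have "\<dots> = ennreal (r\<^sup>2)"
    using r by (simp add: emeasure_lborel_ball_complex flip: ennreal_mult)
  finally show ?thesis .
qed

text \<open>Continuous counterpart of \<open>quartic_sum_bound\<close>: the ball of radius t
  contributes \<open>C * t\<^sup>2\<close>, the dyadic balls at most 4/3 times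
  \<open>4 * C * t\<^sup>2\<close>, rounded up to 6.\<close>

lemma nn_integral_quartic_bound:
  fixes k :: "complex \<Rightarrow> real"
  assumes t: "0 < t" and C: "0 \<le> C" and a: "a \<in> \<D>"
    and k: "\<And>z. z \<in> \<D> \<Longrightarrow> k z \<le> C" "\<And>z. z \<in> \<D> \<Longrightarrow> k z * cmod (z - a) ^ 4 \<le> C * t ^ 4"
  shows "(\<integral>\<^sup>+z. ennreal (k z) \<partial>area) \<le> ennreal (7 * C * t\<^sup>2)"
proof -
  \<comment> \<open>The disc has diameter 2, so finitely many dyadic balls around a reach all of
    it.\<close>
  obtain n where n: "2 < 2 ^ n * t" using exists_dyadic_bound[OF t] by blast
  define B where "B = (\<lambda>r. ball a r \<inter> \<D>)"
  have [measurable]: "B r \<in> sets area" for r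
    by (auto simp: B_def sets_area sets_restrict_space_iff)
  have "(\<integral>\<^sup>+z. ennreal (k z) \<partial>area) \<le>
      (\<integral>\<^sup>+z. ennreal C * indicator (B t) z + (\<Sum>j<n. ennreal (C * (1/16) ^ j) * indicator (B (2 ^ Suc j * t)) z) \<partial>area)"
  proof (rule nn_integral_mono)
    fix z assume "z \<in> space area"
    then have z: "z \<in> \<D>" by simp
    show "ennreal (k z) \<le> ennreal C * indicator (B t) z + (\<Sum>j<n. ennreal (C * (1/16) ^ j) * indicator (B (2 ^ Suc j * t)) z)"
    proof (cases "z \<in> ball a t")
      case True
      then have "ennreal (k z) \<le> ennreal C * indicator (B t) z"
        using k(1)[OF z] z by (simp add: B_def ennreal_leI)
      then show ?thesis by (simp add: add_increasing2)
    next
      case False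
      define x where "x = cmod (z - a)"
      have x: "t \<le> x" using False by (simp add: x_def dist_norm norm_minus_commute)
      have "x < 2" using z a norm_triangle_ineq4[of z a] by (simp add: x_def)
      then have xn: "x < 2 ^ n * t" using n by simp
      have "k z \<le> C * t ^ 4 * (1 / x ^ 4)"
        using k(2)[OF z] x t by (simp add: x_def[symmetric] field_simps)
      also have "\<dots> \<le> C * t ^ 4 * (\<Sum>j<n. if x < 2 ^ Suc j * t then 1 / (2 ^ j * t) ^ 4 else 0)"
        using C t by (intro mult_left_mono dyadic_majorant[OF t x xn]) auto
      also have "\<dots> = (\<Sum>j<n. C * (1/16) ^ j * indicator (B (2 ^ Suc j * t)) z)"
        unfolding sum_distrib_left
      proof (rule sum.cong[OF refl])
        fix j
        have "t ^ 4 / (2 ^ j * t) ^ 4 = (1/16) ^ j"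
        proof -
          have "(2 ^ j) ^ 4 = (16 ^ j :: real)" by (simp add: power4_eq_xxxx flip: power_mult_distrib)
          then show ?thesis using t by (simp add: power_mult_distrib power_one_over)
        qed
        then show "C * t ^ 4 * (if x < 2 ^ Suc j * t then 1 / (2 ^ j * t) ^ 4 else 0) =
            C * (1/16) ^ j * indicator (B (2 ^ Suc j * t)) z"
          using z by (auto simp: B_def x_def dist_norm norm_minus_commute split: split_indicator)
      qed
      finally have "ennreal (k z) \<le> ennreal (\<Sum>j<n. C * (1/16) ^ j * indicator (B (2 ^ Suc j * t)) z)"
        by (rule ennreal_leI)
      also have "\<dots> = (\<Sum>j<n. ennreal (C * (1/16) ^ j) * indicator (B (2 ^ Suc j * t)) z)"
        using C by (subst sum_ennreal[symmetric]) (auto intro!: sum.cong simp: ennreal_mult ennreal_indicator)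
      finally show ?thesis by (simp add: add_increasing)
    qed
  qed
  also have "\<dots> = ennreal C * emeasure area (B t) + (\<Sum>j<n. ennreal (C * (1/16) ^ j) * emeasure area (B (2 ^ Suc j * t)))"
    by (subst nn_integral_add, measurable, subst nn_integral_sum, measurable)
      (simp add: nn_integral_cmult_indicator del: power_Suc)
  also have "\<dots> \<le> ennreal C * ennreal (t\<^sup>2) + (\<Sum>j<n. ennreal (C * (1/16) ^ j) * ennreal ((2 ^ Suc j * t)\<^sup>2))"
    unfolding B_def using t by (intro add_mono sum_mono mult_left_mono emeasure_area_ball_le) auto
  also have "\<dots> = ennreal (C * t\<^sup>2 + (\<Sum>j<n. C * (1/16) ^ j * (2 ^ Suc j * t)\<^sup>2))"
  proof -
    have "ennreal (C * (1/16) ^ j) * ennreal ((2 ^ Suc j * t)\<^sup>2) = ennreal (C * (1/16) ^ j * (2 ^ Suc j * t)\<^sup>2)" for j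
      using C by (intro ennreal_mult[symmetric]) auto
    then have "(\<Sum>j<n. ennreal (C * (1/16) ^ j) * ennreal ((2 ^ Suc j * t)\<^sup>2)) =
        ennreal (\<Sum>j<n. C * (1/16) ^ j * (2 ^ Suc j * t)\<^sup>2)"
      using C by (subst sum_ennreal[symmetric]) auto
    then show ?thesis
      using C by (simp add: sum_nonneg ennreal_plus ennreal_mult del: power_Suc)
  qed
  also have "\<dots> \<le> ennreal (7 * C * t\<^sup>2)"
  proof (rule ennreal_leI)
    have "C * (1/16) ^ j * (2 ^ Suc j * t)\<^sup>2 = 4 * C * t\<^sup>2 * (1/4) ^ j" for j
    proof -
      have "(2 ^ j)\<^sup>2 = (4 ^ j :: real)" "(16 :: real) ^ j = 4 ^ j * 4 ^ j"
        by (simp_all add: power2_eq_square flip: power_mult_distrib)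
      then show ?thesis by (simp add: power_mult_distrib power_one_over)
    qed
    then have "(\<Sum>j<n. C * (1/16) ^ j * (2 ^ Suc j * t)\<^sup>2) = 4 * C * t\<^sup>2 * (\<Sum>j<n. (1/4) ^ j)"
      unfolding sum_distrib_left by (intro sum.cong refl)
    also have "\<dots> \<le> 4 * C * t\<^sup>2 * (4/3)" using C by (intro mult_left_mono geometric_sum_le) auto
    also have "\<dots> \<le> 6 * C * t\<^sup>2" using C by simp
    finally show "C * t\<^sup>2 + (\<Sum>j<n. C * (1/16) ^ j * (2 ^ Suc j * t)\<^sup>2) \<le> 7 * C * t\<^sup>2" by simp
  qed
  finally show ?thesis .
qed

section \<open>Separated sets and bounded overlap\<close>

context W_profile
begin

text \<open>With the maximum, the distance dominates the scales of both points, and the discs of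
  radius \<open>R / 2 * \<tau> a\<close> around the points are disjoint.\<close>

definition separated :: "real \<Rightarrow> complex set \<Rightarrow> bool" where
  "separated R S \<longleftrightarrow> S \<subseteq> \<D> \<and> (\<forall>a\<in>S. \<forall>b\<in>S. a \<noteq> b \<longrightarrow> R * max (\<tau> a) (\<tau> b) \<le> cmod (a - b))"

lemma separated_disjoint:
  assumes "separated R S" "0 \<le> R" "a \<in> S" "b \<in> S" "a \<noteq> b"
  shows "ball a (R / 2 * \<tau> a) \<inter> ball b (R / 2 * \<tau> b) = {}"
proof (rule ccontr)
  assume "ball a (R / 2 * \<tau> a) \<inter> ball b (R / 2 * \<tau> b) \<noteq> {}"
  then obtain z where "dist a z < R / 2 * \<tau> a" "dist b z < R / 2 * \<tau> b" by auto
  then have "dist a b < R / 2 * \<tau> a + R / 2 * \<tau> b" using dist_triangle2[of a b z] by linarith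
  also have "\<dots> \<le> R / 2 * max (\<tau> a) (\<tau> b) + R / 2 * max (\<tau> a) (\<tau> b)"
    using assms(2) by (intro add_mono mult_left_mono) auto
  also have "\<dots> \<le> dist a b" using assms by (auto simp: separated_def dist_norm)
  finally show False by simp
qed

lemma separated_countable:
  assumes "separated R S" "0 < R"
  shows "countable S"
proof -
  have \<tau>S: "0 < \<tau> a" if "a \<in> S" for a using assms that \<tau>_pos by (auto simp: separated_def)
  have inj: "inj_on (\<lambda>a. ball a (R / 2 * \<tau> a)) S"
  proof (rule inj_onI, rule ccontr)
    fix a b assume "a \<in> S" "b \<in> S" "ball a (R / 2 * \<tau> a) = ball b (R / 2 * \<tau> b)" "a \<noteq> b"
    then have "ball a (R / 2 * \<tau> a) = {}" using separated_disjoint[OF assms(1) _ \<open>a \<in> S\<close> \<open>b \<in> S\<close>] assms(2) by auto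
    then show False using mult_pos_pos[OF assms(2) \<tau>S[OF \<open>a \<in> S\<close>]] by (simp add: ball_eq_empty)
  qed
  have "countable ((\<lambda>a. ball a (R / 2 * \<tau> a)) ` S)"
  proof (rule countable_disjoint_open_subsets)
    show "pairwise disjnt ((\<lambda>a. ball a (R / 2 * \<tau> a)) ` S)"
      using separated_disjoint[OF assms(1)] assms(2)
      by (auto simp: pairwise_def disjnt_def)
  qed auto
  then show ?thesis using inj by (simp add: countable_image_inj_eq)
qed

text \<open>Zorn's lemma; maximality is the covering property, since a point violating it could be
  added.\<close>

lemma maximal_separated_exists:
  assumes "0 < R"
  obtains S where "separated R S" "\<And>z. z \<in> \<D> \<Longrightarrow> \<exists>a\<in>S. cmod (z - a) < R * max (\<tau> a) (\<tau> z)"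
proof -
  have "\<exists>M\<in>Collect (separated R). \<forall>X\<in>Collect (separated R). M \<subseteq> X \<longrightarrow> X = M"
  proof (rule subset_Zorn')
    fix C assume C: "subset.chain (Collect (separated R)) C"
    have "R * max (\<tau> a) (\<tau> b) \<le> cmod (a - b)" if ab: "a \<in> \<Union>C" "b \<in> \<Union>C" "a \<noteq> b" for a b
    proof -
      obtain A B where AB: "A \<in> C" "B \<in> C" "a \<in> A" "b \<in> B" using ab by auto
      then have "A \<subseteq> B \<or> B \<subseteq> A" using C by (auto simp: subset_chain_def)
      then obtain D where "D \<in> C" "a \<in> D" "b \<in> D" using AB by auto
      moreover then have "separated R D" using C by (auto simp: subset_chain_def)
      ultimately show ?thesis using ab by (auto simp: separated_def)
    qed
    moreover have "\<Union>C \<subseteq> \<D>" using C unfolding subset_chain_def separated_def by blast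
    ultimately show "\<Union>C \<in> Collect (separated R)" by (auto simp: separated_def)
  qed
  then obtain S where S: "separated R S" "\<And>X. separated R X \<Longrightarrow> S \<subseteq> X \<Longrightarrow> X = S" by auto
  have "\<exists>a\<in>S. cmod (z - a) < R * max (\<tau> a) (\<tau> z)" if z: "z \<in> \<D>" for z
  proof (rule ccontr)
    assume "\<not> (\<exists>a\<in>S. cmod (z - a) < R * max (\<tau> a) (\<tau> z))"
    then have far: "R * max (\<tau> a) (\<tau> z) \<le> cmod (z - a)" if "a \<in> S" for a using that by force
    then have "separated R (insert z S)"
      using S(1) z far by (auto simp: separated_def max.commute norm_minus_commute)
    then have "z \<in> S" using S(2) by blast
    then have "R * \<tau> z \<le> 0" using far[of z] by simp
    then show False using assms \<tau>_pos[OF z] by (simp add: mult_le_0_iff)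
  qed
  then show ?thesis using that S by blast
qed

text \<open>Every centre counted has \<tau> comparable to \<open>\<tau> z\<close>, so disjoint discs
  of radius at least \<open>R / 2 * (4/5 * \<tau> z)\<close> are packed into one of radius
  \<open>(Q + R / 2) * (4/3 * \<tau> z)\<close>. The factors 4/5 and 4/3 invert those of
  \<open>\<tau>_near\<close>.\<close>

lemma overlap_bound:
  assumes sep: "separated R S" and R: "0 < R" "R \<le> m" and Q: "0 < Q" "Q \<le> m" and z: "z \<in> \<D>"
  shows "finite {a \<in> S. z \<in> ball a (Q * \<tau> a)}"
    and "card {a \<in> S. z \<in> ball a (Q * \<tau> a)} \<le> (5 * (Q + R) / R)\<^sup>2"
proof -
  define A where "A = {a \<in> S. z \<in> ball a (Q * \<tau> a)}"
  have \<tau>z: "0 < \<tau> z" using \<tau>_pos z .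
  have bound: "card F \<le> (5 * (Q + R) / R)\<^sup>2" if F: "finite F" "F \<subseteq> A" for F
  proof -
    have comp: "4/5 * \<tau> z \<le> \<tau> a" "\<tau> a \<le> 4/3 * \<tau> z" "a \<in> S" "cmod (z - a) < Q * \<tau> a" if "a \<in> F" for a
    proof -
      have a: "a \<in> S" "cmod (a - z) < Q * \<tau> a" using that F by (auto simp: A_def dist_norm)
      have aD: "a \<in> \<D>" using a sep by (auto simp: separated_def)
      have "cmod (a - z) \<le> m * \<tau> a"
        using a Q mult_right_mono[OF Q(2), of "\<tau> a"] \<tau>_pos[OF aD] by linarith
      from \<tau>_near[OF aD z this] show "4/5 * \<tau> z \<le> \<tau> a" "\<tau> a \<le> 4/3 * \<tau> z" by linarith+
      show "a \<in> S" "cmod (z - a) < Q * \<tau> a" using a by (auto simp: norm_minus_commute)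
    qed
    have "(\<Sum>a\<in>F. (R / 2 * \<tau> a)\<^sup>2) \<le> ((Q + R / 2) * (4/3 * \<tau> z))\<^sup>2"
    proof (rule packing_bound[OF F(1)])
      fix a assume a: "a \<in> F"
      show "0 \<le> R / 2 * \<tau> a" using comp(1)[OF a] \<tau>z R by (intro mult_nonneg_nonneg) auto
      show "ball a (R / 2 * \<tau> a) \<subseteq> ball z ((Q + R / 2) * (4/3 * \<tau> z))"
      proof
        fix w assume "w \<in> ball a (R / 2 * \<tau> a)"
        then have "dist z w < Q * \<tau> a + R / 2 * \<tau> a"
          using dist_triangle[of z w a] comp(4)[OF a] by (auto simp: dist_norm)
        also have "\<dots> = (Q + R / 2) * \<tau> a" by (simp add: algebra_simps)
        also have "\<dots> \<le> (Q + R / 2) * (4/3 * \<tau> z)" using comp(2)[OF a] Q R by (intro mult_left_mono) auto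
        finally show "w \<in> ball z ((Q + R / 2) * (4/3 * \<tau> z))" by simp
      qed
    next
      show "ball a (R / 2 * \<tau> a) \<inter> ball b (R / 2 * \<tau> b) = {}" if "a \<in> F" "b \<in> F" "a \<noteq> b" for a b
        using separated_disjoint[OF sep] comp(3) that R by simp
      show "0 \<le> (Q + R / 2) * (4/3 * \<tau> z)" using Q R \<tau>z by simp
    qed
    moreover have "(\<Sum>a\<in>F. (R / 2 * (4/5 * \<tau> z))\<^sup>2) \<le> (\<Sum>a\<in>F. (R / 2 * \<tau> a)\<^sup>2)"
      using comp R \<tau>z by (intro sum_mono power_mono mult_left_mono) auto
    ultimately have "card F * (R / 2 * (4/5 * \<tau> z))\<^sup>2 \<le> ((Q + R / 2) * (4/3 * \<tau> z))\<^sup>2" by simp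
    moreover have "card F * (R / 2 * (4/5 * \<tau> z))\<^sup>2 = 4/25 * (card F * R\<^sup>2 * (\<tau> z)\<^sup>2)"
      by (simp add: power2_eq_square)
    moreover have "((Q + R / 2) * (4/3 * \<tau> z))\<^sup>2 = 4/25 * ((10/3 * (Q + R / 2))\<^sup>2 * (\<tau> z)\<^sup>2)"
      by (simp only: power_mult_distrib) (simp add: power2_eq_square)
    ultimately have "card F * R\<^sup>2 * (\<tau> z)\<^sup>2 \<le> (10/3 * (Q + R / 2))\<^sup>2 * (\<tau> z)\<^sup>2"
      by linarith
    then have "card F * R\<^sup>2 \<le> (10/3 * (Q + R / 2))\<^sup>2"
      by (rule mult_right_le_imp_le) (use \<tau>z in simp)
    also have "\<dots> \<le> (5 * (Q + R))\<^sup>2" using Q R by (intro power_mono) auto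
    finally show ?thesis using R by (simp add: power_divide pos_le_divide_eq)
  qed
  obtain N where N: "(5 * (Q + R) / R)\<^sup>2 \<le> real N" using real_arch_simple by blast
  show fin: "finite {a \<in> S. z \<in> ball a (Q * \<tau> a)}"
    unfolding A_def[symmetric]
  proof (rule ccontr)
    assume "infinite A"
    then obtain F where "F \<subseteq> A" "finite F" "card F = Suc N" using infinite_arbitrarily_large by metis
    then show False using bound[of F] N by simp
  qed
  show "card {a \<in> S. z \<in> ball a (Q * \<tau> a)} \<le> (5 * (Q + R) / R)\<^sup>2"
    using bound[of A] fin by (simp add: A_def)
qed

end

text \<open>When index k is served at most k elements have been taken, and \<open>I k\<close> has
  more than k.\<close>

lemma greedy_injection:
  fixes I :: "nat \<Rightarrow> 'a set"
  assumes "\<And>k. P k \<Longrightarrow> finite (I k) \<and> k < card (I k)"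
  shows "\<exists>\<sigma>. inj_on \<sigma> {k. k < K \<and> P k} \<and> (\<forall>k<K. P k \<longrightarrow> \<sigma> k \<in> I k)"
proof (induction K)
  case (Suc K)
  then obtain \<sigma> where \<sigma>: "inj_on \<sigma> {k. k < K \<and> P k}" "\<And>k. k < K \<Longrightarrow> P k \<Longrightarrow> \<sigma> k \<in> I k" by blast
  show ?case
  proof (cases "P K")
    case True
    have "card (\<sigma> ` {k. k < K \<and> P k}) \<le> card {k. k < K \<and> P k}" by (rule card_image_le) simp
    also have "\<dots> \<le> card {..<K}" by (rule card_mono) auto
    also have "\<dots> < card (I K)" using assms[OF True] by simp
    finally have "\<not> I K \<subseteq> \<sigma> ` {k. k < K \<and> P k}"
      using card_mono[of "\<sigma> ` {k. k < K \<and> P k}" "I K"] by auto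
    then obtain x where x: "x \<in> I K" "x \<notin> \<sigma> ` {k. k < K \<and> P k}" by auto
    have eq: "{k. k < Suc K \<and> P k} = insert K {k. k < K \<and> P k}"
      using True by (auto simp: less_Suc_eq)
    have "inj_on (\<sigma>(K := x)) {k. k < Suc K \<and> P k}"
      unfolding eq using \<sigma>(1) x(2) by (auto simp: inj_on_def)
    moreover have "\<forall>k<Suc K. P k \<longrightarrow> (\<sigma>(K := x)) k \<in> I k"
      using \<sigma>(2) x(1) by (auto simp: less_Suc_eq)
    ultimately show ?thesis by blast
  next
    case False
    then have eq: "{k. k < Suc K \<and> P k} = {k. k < K \<and> P k}" by (auto simp: less_Suc_eq)
    show ?thesis
      unfolding eq using \<sigma> False by (intro exI[of _ \<sigma>]) (auto simp: less_Suc_eq)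
  qed
qed simp

text \<open>Counting at level \<open>s k / 2\<close> gives \<open>s (card (I k)) < s k\<close>, so
  \<open>I k\<close> has more than k elements by monotonicity; distinct representatives then
  dominate s termwise up to the factor 2. The halving produces the strict inequality.\<close>

lemma summable_powr_of_counting:
  fixes s :: "nat \<Rightarrow> real" and b :: "'i \<Rightarrow> real"
  assumes s: "decseq s" "\<And>k. 0 \<le> s k" and p: "0 < p"
    and fin: "\<And>t. 0 < t \<Longrightarrow> finite {i \<in> X. t < b i}"
    and count: "\<And>t. 0 < t \<Longrightarrow> s (card {i \<in> X. t < b i}) \<le> t"
    and bound: "\<And>F. finite F \<Longrightarrow> F \<subseteq> X \<Longrightarrow> (\<Sum>i\<in>F. b i powr p) \<le> M"
  shows "summable (\<lambda>k. s k powr p)"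
proof (rule summableI_nonneg_bounded)
  fix K
  define I where "I = (\<lambda>k. {i \<in> X. s k / 2 < b i})"
  have I: "finite (I k) \<and> k < card (I k)" if "0 < s k" for k
  proof -
    have "s (card (I k)) \<le> s k / 2" unfolding I_def using that by (intro count) simp
    then have "s (card (I k)) < s k" using that by simp
    then have "k < card (I k)" using decseqD[OF s(1), of "card (I k)" k] by (cases "k < card (I k)") auto
    then show ?thesis using fin[of "s k / 2"] that by (simp add: I_def)
  qed
  obtain \<sigma> where \<sigma>: "inj_on \<sigma> {k. k < K \<and> 0 < s k}" "\<And>k. k < K \<Longrightarrow> 0 < s k \<Longrightarrow> \<sigma> k \<in> I k"
    using greedy_injection[of "\<lambda>k. 0 < s k" I K] I by blast
  define J where "J = {k. k < K \<and> 0 < s k}"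
  have "(\<Sum>k<K. s k powr p) = (\<Sum>k\<in>J. s k powr p)"
  proof (rule sum.mono_neutral_right)
    show "\<forall>k\<in>{..<K} - J. s k powr p = 0"
    proof
      fix k assume "k \<in> {..<K} - J"
      then have "s k = 0" using s(2)[of k] by (auto simp: J_def)
      then show "s k powr p = 0" by simp
    qed
  qed (auto simp: J_def)
  also have "\<dots> \<le> (\<Sum>k\<in>J. 2 powr p * b (\<sigma> k) powr p)"
  proof (rule sum_mono)
    fix k assume "k \<in> J"
    then have "0 < s k" "s k \<le> 2 * b (\<sigma> k)" using \<sigma>(2)[of k] by (auto simp: J_def I_def)
    then have "s k powr p \<le> (2 * b (\<sigma> k)) powr p" using p by (intro powr_mono2) auto
    also have "\<dots> = 2 powr p * b (\<sigma> k) powr p"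
      using \<open>0 < s k\<close> \<open>s k \<le> 2 * b (\<sigma> k)\<close> by (simp add: powr_mult)
    finally show "s k powr p \<le> 2 powr p * b (\<sigma> k) powr p" .
  qed
  also have "\<dots> = 2 powr p * (\<Sum>i\<in>\<sigma> ` J. b i powr p)"
    using \<sigma>(1) by (simp add: J_def sum.reindex sum_distrib_left)
  also have "\<dots> \<le> 2 powr p * M"
    using \<sigma>(2) by (intro mult_left_mono bound) (auto simp: J_def I_def)
  finally show "(\<Sum>k<K. s k powr p) \<le> 2 powr p * M" .
qed simp

text \<open>Three radii in units of \<tau>: separation \<delta>/8, cells of radius \<delta>/4 that
  cover the disc, and balls of radius \<delta> carrying the local mass. The last is four times the
  cell radius, as in \<open>L_estimate\<close>, and stays within m.\<close>

locale W_lattice = W_measure +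
  fixes \<delta> C :: real and S :: "complex set" and L :: "complex \<Rightarrow> nat \<Rightarrow> (complex \<Rightarrow> complex) \<Rightarrow> complex"
  assumes \<delta>: "0 < \<delta>" "\<delta> \<le> m"
    and sep: "separated (\<delta> / 8) S"
    and maximal: "\<And>z. z \<in> \<D> \<Longrightarrow> \<exists>a\<in>S. cmod (z - a) < \<delta> / 8 * max (\<tau> a) (\<tau> z)"
    and C: "1 \<le> C"
    and L_add: "\<And>a j f g. a \<in> S \<Longrightarrow> f holomorphic_on \<D> \<Longrightarrow> g holomorphic_on \<D> \<Longrightarrow> L a j (f + g) = L a j f + L a j g"
    and L_scale: "\<And>a j c f. a \<in> S \<Longrightarrow> f holomorphic_on \<D> \<Longrightarrow> L a j (scale_fun c f) = c * L a j f"
    and L_estimate: "\<And>a f k \<rho> z. a \<in> S \<Longrightarrow> f holomorphic_on \<D> \<Longrightarrow> 0 < \<rho> \<Longrightarrow> 4 * \<rho> \<le> m \<Longrightarrow>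
       \<forall>j<k. L a j f = 0 \<Longrightarrow> z \<in> ball a (\<rho> * \<tau> a) \<Longrightarrow>
       ennreal (dens f z) \<le> ennreal (C / (4 ^ k * (\<rho> * \<tau> a)\<^sup>2)) * local_mass f a (4 * \<rho> * \<tau> a)"
begin

definition cell :: "complex \<Rightarrow> complex set" where
  "cell a = ball a (\<delta> / 4 * \<tau> a)"

definition avg :: "complex \<Rightarrow> real" where
  "avg a = measure \<mu> (cell a) / (\<tau> a)\<^sup>2"

text \<open>The overlap bound for balls of radius \<delta> and separation \<delta>/8. The quotient
  does not depend on \<delta>: it is 45, so N is 45 squared.\<close>

definition N :: nat where
  "N = nat \<lceil>(5 * (\<delta> + \<delta> / 8) / (\<delta> / 8))\<^sup>2\<rceil>"

text \<open>The factor N compensates the overlap of the balls carrying local mass, so that cells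
  controlled by t add up to t times the squared norm; 16 comes from squaring the cell radius
  \<delta>/4.\<close>

definition const :: real where
  "const = 16 * C / \<delta>\<^sup>2 * N"

definition cell_energy :: "complex \<Rightarrow> (complex \<Rightarrow> complex) \<Rightarrow> ennreal" where
  "cell_energy a f = (\<integral>\<^sup>+z. ennreal (dens f z) * indicator (cell a) z \<partial>\<mu>)"

lemma S_disc: "a \<in> S \<Longrightarrow> a \<in> \<D>"
  using sep by (auto simp: separated_def)

lemma countable_S: "countable S"
  using separated_countable[OF sep] \<delta> by simp

lemma cell_subset: "a \<in> S \<Longrightarrow> cell a \<subseteq> \<D>"
  unfolding cell_def using ball_subset_disc(2)[OF S_disc, of a "\<delta> / 4"] \<delta> m_bounds by simp

lemma cell_sets: "a \<in> S \<Longrightarrow> cell a \<in> sets \<mu>"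
  unfolding sets_\<mu> cell_def using cell_subset[of a] by (intro ball_in_sets_area) (simp add: cell_def)

lemma cell_sets_area: "a \<in> S \<Longrightarrow> cell a \<in> sets area"
  using cell_sets sets_\<mu> by simp

text \<open>If \<open>\<tau> z\<close> is the larger value, replacing it by \<open>\<tau> a\<close>
  costs a factor 4/3, for which the step from \<delta>/8 to \<delta>/4 leaves room.\<close>

lemma covered: "z \<in> \<D> \<Longrightarrow> \<exists>a\<in>S. z \<in> cell a"
proof -
  assume z: "z \<in> \<D>"
  obtain a where a: "a \<in> S" "cmod (z - a) < \<delta> / 8 * max (\<tau> a) (\<tau> z)" using maximal[OF z] by blast
  have \<tau>a: "0 < \<tau> a" using \<tau>_pos S_disc[OF a(1)] by simp
  have "cmod (z - a) < \<delta> / 4 * \<tau> a"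
  proof (cases "\<tau> z \<le> \<tau> a")
    case True
    then have "cmod (z - a) < \<delta> / 8 * \<tau> a" using a(2) by (simp add: max_def split: if_splits)
    also have "\<dots> \<le> \<delta> / 4 * \<tau> a" using \<tau>a \<delta> by (intro mult_right_mono) auto
    finally show ?thesis .
  next
    case False
    then have lt: "cmod (z - a) < \<delta> / 8 * \<tau> z" using a(2) by (simp add: max_def split: if_splits)
    also have "\<dots> \<le> m * \<tau> z" using \<delta> m_bounds \<tau>_pos[OF z] by (intro mult_right_mono) auto
    finally have "3/4 * \<tau> z \<le> \<tau> a" using \<tau>_near(1)[OF z S_disc[OF a(1)]] by simp
    then have "\<delta> / 8 * \<tau> z \<le> \<delta> / 8 * (4/3 * \<tau> a)" using \<delta> by (intro mult_left_mono) auto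
    also have "\<dots> \<le> \<delta> / 4 * \<tau> a" using \<delta> \<tau>a by simp
    finally show ?thesis using lt by simp
  qed
  then have "z \<in> cell a" by (simp add: cell_def dist_norm norm_minus_commute)
  then show ?thesis using a(1) by blast
qed

lemma N_pos: "0 < N" and overlap: "z \<in> \<D> \<Longrightarrow> finite {a \<in> S. z \<in> ball a (\<delta> * \<tau> a)} \<and> card {a \<in> S. z \<in> ball a (\<delta> * \<tau> a)} \<le> N"
proof -
  have pos: "0 < (5 * (\<delta> + \<delta> / 8) / (\<delta> / 8))\<^sup>2" using \<delta> by simp
  then show "0 < N" unfolding N_def by linarith
  assume "z \<in> \<D>"
  then have "finite {a \<in> S. z \<in> ball a (\<delta> * \<tau> a)} \<and> card {a \<in> S. z \<in> ball a (\<delta> * \<tau> a)} \<le> (5 * (\<delta> + \<delta> / 8) / (\<delta> / 8))\<^sup>2"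
    using overlap_bound[OF sep _ _ \<delta>, of z] \<delta> m_bounds by simp
  then show "finite {a \<in> S. z \<in> ball a (\<delta> * \<tau> a)} \<and> card {a \<in> S. z \<in> ball a (\<delta> * \<tau> a)} \<le> N"
    unfolding N_def by linarith
qed

lemma avg_nonneg: "0 \<le> avg a"
  by (simp add: avg_def)

lemma const_pos: "0 < const"
  unfolding const_def using C \<delta> N_pos by simp

lemma cell_energy_le:
  assumes a: "a \<in> S" and f: "f holomorphic_on \<D>" and k: "\<forall>j<k. L a j f = 0" and t: "const * avg a / 4 ^ k \<le> t"
  shows "cell_energy a f \<le> ennreal (t / N) * local_mass f a (\<delta> * \<tau> a)"
proof -
  interpret \<mu>: finite_measure \<mu> by (rule finite_\<mu>)
  have \<tau>a: "0 < \<tau> a" using \<tau>_pos S_disc[OF a] by simp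
  define c where "c = C / (4 ^ k * (\<delta> / 4 * \<tau> a)\<^sup>2)"
  define lm where "lm = local_mass f a (\<delta> * \<tau> a)"
  have c0: "0 \<le> c" using C by (simp add: c_def)
  have "cell_energy a f \<le> (\<integral>\<^sup>+z. ennreal c * lm * indicator (cell a) z \<partial>\<mu>)"
    unfolding cell_energy_def
  proof (rule nn_integral_mono)
    fix z
    show "ennreal (dens f z) * indicator (cell a) z \<le> ennreal c * lm * indicator (cell a) z"
    proof (cases "z \<in> cell a")
      case True
      then show ?thesis
        using L_estimate[OF a f, of "\<delta> / 4" k z] k \<delta> by (simp add: cell_def c_def lm_def)
    qed simp
  qed
  also have "\<dots> = ennreal c * lm * ennreal (measure \<mu> (cell a))"
    using cell_sets[OF a] by (simp add: nn_integral_cmult_indicator \<mu>.emeasure_eq_measure)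
  also have "\<dots> = ennreal (c * measure \<mu> (cell a)) * lm"
    using c0 by (simp add: ennreal_mult mult_ac)
  also have "\<dots> \<le> ennreal (t / N) * lm"
  proof (intro mult_right_mono ennreal_leI)
    have "c * measure \<mu> (cell a) = const * avg a / 4 ^ k / N"
      using \<tau>a \<delta> N_pos by (simp add: c_def const_def avg_def field_simps power2_eq_square)
    also have "\<dots> \<le> t / N" using t by (intro divide_right_mono) auto
    finally show "c * measure \<mu> (cell a) \<le> t / N" .
  qed simp
  finally show ?thesis by (simp add: lm_def)
qed

text \<open>Sum and integral are exchanged, and each point lies in at most N of the balls.\<close>

lemma sum_local_mass_le:
  assumes f: "f \<in> A2"
  shows "(\<integral>\<^sup>+a. local_mass f a (\<delta> * \<tau> a) \<partial>count_space S) \<le> ennreal (N * (nrm2 f)\<^sup>2)"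
proof -
  have ms: "ball a (\<delta> * \<tau> a) \<in> sets area" if "a \<in> S" for a
    using ball_subset_disc(2)[OF S_disc[OF that] \<delta>(2)] by (rule ball_in_sets_area)
  have "(\<integral>\<^sup>+a. local_mass f a (\<delta> * \<tau> a) \<partial>count_space S) =
      (\<integral>\<^sup>+z. \<integral>\<^sup>+a. ennreal (dens f z) * indicator (ball a (\<delta> * \<tau> a)) z \<partial>count_space S \<partial>area)"
    unfolding local_mass_def
  proof (rule nn_integral_count_space_nn_integral[symmetric, OF countable_S])
    fix a assume "a \<in> S"
    then show "(\<lambda>z. ennreal (dens f z) * indicator (ball a (\<delta> * \<tau> a)) z) \<in> borel_measurable area"
      using ms[of a] dens_measurable[OF A2_holomorphic[OF f]] by measurable
  qed
  also have "\<dots> \<le> (\<integral>\<^sup>+z. ennreal (dens f z) * ennreal N \<partial>area)"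
  proof (rule nn_integral_mono)
    fix z assume "z \<in> space area"
    then have z: "z \<in> \<D>" by simp
    have "(\<integral>\<^sup>+a. ennreal (dens f z) * indicator (ball a (\<delta> * \<tau> a)) z \<partial>count_space S) =
        (\<integral>\<^sup>+a. ennreal (dens f z) * indicator {a \<in> S. z \<in> ball a (\<delta> * \<tau> a)} a \<partial>count_space S)"
      by (intro nn_integral_cong) (auto split: split_indicator)
    also have "\<dots> = ennreal (dens f z) * emeasure (count_space S) {a \<in> S. z \<in> ball a (\<delta> * \<tau> a)}"
      by (rule nn_integral_cmult_indicator) auto
    also have "emeasure (count_space S) {a \<in> S. z \<in> ball a (\<delta> * \<tau> a)} = ennreal (card {a \<in> S. z \<in> ball a (\<delta> * \<tau> a)})"
      using overlap[OF z] by (subst emeasure_count_space_finite) (auto simp: ennreal_of_nat_eq_real_of_nat)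
    also have "ennreal (dens f z) * \<dots> \<le> ennreal (dens f z) * ennreal N"
      using overlap[OF z] by (intro mult_left_mono ennreal_leI) auto
    finally show "(\<integral>\<^sup>+a. ennreal (dens f z) * indicator (ball a (\<delta> * \<tau> a)) z \<partial>count_space S) \<le> ennreal (dens f z) * ennreal N" .
  qed
  also have "\<dots> = (\<integral>\<^sup>+z. ennreal (dens f z) \<partial>area) * ennreal N"
    using dens_measurable[OF A2_holomorphic[OF f]] by (intro nn_integral_multc) measurable
  also have "\<dots> = ennreal (N * (nrm2 f)\<^sup>2)"
    unfolding nn_integral_dens[OF f] by (simp add: mult.commute flip: ennreal_mult)
  finally show ?thesis .
qed

text \<open>The finite exceptional set F is empty in the min-max argument; in the proof of
  compactness it holds the lattice points whose cells are handled by uniform convergence.\<close>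

lemma energy_le_cells:
  assumes f: "f \<in> A2" and F: "finite F" "F \<subseteq> S" and t: "0 \<le> t"
    and small: "\<And>a. a \<in> S \<Longrightarrow> a \<notin> F \<Longrightarrow> \<exists>k. (\<forall>j<k. L a j f = 0) \<and> const * avg a / 4 ^ k \<le> t"
  shows "energy f \<le> (\<Sum>a\<in>F. cell_energy a f) + ennreal (t * (nrm2 f)\<^sup>2)"
proof -
  have hol: "f holomorphic_on \<D>" using A2_holomorphic[OF f] .
  have meas: "(\<lambda>z. ennreal (dens f z) * indicator (cell a) z) \<in> borel_measurable \<mu>" if "a \<in> S" for a
    using cell_sets_area[OF that] dens_measurable[OF hol] unfolding measurable_\<mu> by measurable
  have "energy f \<le> (\<integral>\<^sup>+z. \<integral>\<^sup>+a. ennreal (dens f z) * indicator (cell a) z \<partial>count_space S \<partial>\<mu>)"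
    unfolding energy_def
  proof (rule nn_integral_mono)
    fix z assume "z \<in> space \<mu>"
    then obtain a where a: "a \<in> S" "z \<in> cell a" using covered by auto
    have "ennreal (dens f z) = (\<integral>\<^sup>+x. ennreal (dens f z) * indicator {a} x \<partial>count_space S)"
      using a by (subst nn_integral_cmult_indicator) auto
    also have "\<dots> \<le> (\<integral>\<^sup>+a. ennreal (dens f z) * indicator (cell a) z \<partial>count_space S)"
      using a by (intro nn_integral_mono mult_left_mono) (auto split: split_indicator)
    finally show "ennreal (dens f z) \<le> (\<integral>\<^sup>+a. ennreal (dens f z) * indicator (cell a) z \<partial>count_space S)" .
  qed
  also have "\<dots> = (\<integral>\<^sup>+a. cell_energy a f \<partial>count_space S)"
    unfolding cell_energy_def by (rule nn_integral_count_space_nn_integral[OF countable_S meas])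
  also have "\<dots> \<le> (\<integral>\<^sup>+a. cell_energy a f * indicator F a + ennreal (t / N) * local_mass f a (\<delta> * \<tau> a) \<partial>count_space S)"
  proof (rule nn_integral_mono)
    fix a assume "a \<in> space (count_space S)"
    then have a: "a \<in> S" by simp
    show "cell_energy a f \<le> cell_energy a f * indicator F a + ennreal (t / N) * local_mass f a (\<delta> * \<tau> a)"
    proof (cases "a \<in> F")
      case False
      then obtain k where "\<forall>j<k. L a j f = 0" "const * avg a / 4 ^ k \<le> t" using small[OF a] by blast
      then show ?thesis using cell_energy_le[OF a hol] False by simp
    qed (simp add: add_increasing2)
  qed
  also have "\<dots> = (\<integral>\<^sup>+a. cell_energy a f * indicator F a \<partial>count_space S) +
      ennreal (t / N) * (\<integral>\<^sup>+a. local_mass f a (\<delta> * \<tau> a) \<partial>count_space S)"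
    by (subst nn_integral_add) (auto simp: nn_integral_cmult)
  also have "(\<integral>\<^sup>+a. cell_energy a f * indicator F a \<partial>count_space S) = (\<Sum>a\<in>F. cell_energy a f)"
    using F by (subst nn_integral_count_space'[of F]) (auto intro!: sum.cong)
  also have "ennreal (t / N) * (\<integral>\<^sup>+a. local_mass f a (\<delta> * \<tau> a) \<partial>count_space S) \<le>
      ennreal (t / N) * ennreal (N * (nrm2 f)\<^sup>2)"
    by (intro mult_left_mono sum_local_mass_le f) simp
  also have "\<dots> = ennreal (t * (nrm2 f)\<^sup>2)"
    using N_pos t by (simp flip: ennreal_mult)
  finally show ?thesis by (simp add: add_left_mono)
qed

text \<open>Bounds the energy on the cell of \<open>a\<close> relative to the local mass, for functions vanishing to order \<open>j\<close>
  at \<open>a\<close>.\<close>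

definition weight_seq :: "complex \<times> nat \<Rightarrow> real" where
  "weight_seq x = const * avg (fst x) / 4 ^ snd x"

text \<open>At each lattice point a the order of vanishing is the least k with
  \<open>const * avg a / 4 ^ k \<le> t\<close>; by minimality every pair (a, j) with j < k has
  \<open>weight_seq\<close> above t, hence imposes its condition.\<close>

lemma energy_vanishing:
  assumes f: "f \<in> A2" and t: "0 < t"
    and zero: "\<And>x. x \<in> S \<times> UNIV \<Longrightarrow> t < weight_seq x \<Longrightarrow> L (fst x) (snd x) f = 0"
  shows "energy f \<le> ennreal (t * (nrm2 f)\<^sup>2)"
proof -
  have "\<exists>k. (\<forall>j<k. L a j f = 0) \<and> const * avg a / 4 ^ k \<le> t" if a: "a \<in> S" for a
  proof -
    obtain k0 where k0: "const * avg a / t < 4 ^ k0" using real_arch_pow[of 4 "const * avg a / t"] by auto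
    have ex: "const * avg a / 4 ^ k0 \<le> t" using k0 t by (simp add: field_simps)
    define k where "k = (LEAST k. const * avg a / 4 ^ k \<le> t)"
    have "const * avg a / 4 ^ k \<le> t" unfolding k_def by (rule LeastI[of _ k0]) (rule ex)
    moreover have "L a j f = 0" if "j < k" for j
    proof -
      have "\<not> const * avg a / 4 ^ j \<le> t" using not_less_Least[OF that[unfolded k_def]] .
      then show ?thesis using zero[of "(a, j)"] a by (simp add: weight_seq_def)
    qed
    ultimately show ?thesis by blast
  qed
  then show ?thesis using energy_le_cells[OF f, of "{}" t] t by simp
qed

lemma weight_seq_powr_bound:
  assumes p: "0 < p" and M: "\<And>F. finite F \<Longrightarrow> F \<subseteq> S \<Longrightarrow> (\<Sum>a\<in>F. avg a powr p) \<le> M"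
  obtains M' where "0 \<le> M'" "\<And>F. finite F \<Longrightarrow> F \<subseteq> S \<times> UNIV \<Longrightarrow> (\<Sum>x\<in>F. weight_seq x powr p) \<le> M'"
proof -
  \<comment> \<open>Ratio of the geometric series in the order of vanishing; below 1 for every p >
    0.\<close>
  define q where "q = (1/4::real) powr p"
  have q: "0 < q" "q < 1" using p powr_less_mono2[of p "1/4" 1] by (auto simp: q_def)
  have M0: "0 \<le> M" using M[of "{}"] by simp
  define M' where "M' = const powr p * M * (1 / (1 - q))"
  have "(\<Sum>x\<in>F. weight_seq x powr p) \<le> M'" if F: "finite F" "F \<subseteq> S \<times> UNIV" for F
  proof -
    obtain n where n: "snd ` F \<subseteq> {..<n}" using finite_nat_bounded[of "snd ` F"] F by auto
    have split: "weight_seq (a, j) powr p = const powr p * avg a powr p * q ^ j" for a j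
    proof -
      have "weight_seq (a, j) = const * avg a * (1/4) ^ j" by (simp add: weight_seq_def power_one_over)
      also have "\<dots> powr p = (const * avg a) powr p * ((1/4) ^ j) powr p"
        using const_pos avg_nonneg by (simp add: powr_mult)
      also have "((1/4::real) ^ j) powr p = q ^ j"
        by (simp add: q_def powr_powr mult.commute flip: powr_realpow)
      also have "(const * avg a) powr p = const powr p * avg a powr p"
        using const_pos avg_nonneg by (simp add: powr_mult)
      finally show ?thesis .
    qed
    have "(\<Sum>x\<in>F. weight_seq x powr p) \<le> (\<Sum>x\<in>fst ` F \<times> {..<n}. weight_seq x powr p)"
    proof (rule sum_mono2)
      show "F \<subseteq> fst ` F \<times> {..<n}" using n by force
    qed (use F in auto)
    also have "\<dots> = (\<Sum>a\<in>fst ` F. \<Sum>j<n. const powr p * avg a powr p * q ^ j)"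
      by (simp add: sum.cartesian_product' split)
    also have "\<dots> = const powr p * (\<Sum>a\<in>fst ` F. avg a powr p) * (\<Sum>j<n. q ^ j)"
      unfolding sum_distrib_left[of "const powr p"] sum_product by (rule refl)
    also have "\<dots> \<le> const powr p * M * (1 / (1 - q))"
    proof (intro mult_mono M)
      show "(\<Sum>j<n. q ^ j) \<le> 1 / (1 - q)"
        using q by (subst sum_gp_strict) (auto intro!: divide_right_mono)
    qed (use F M0 q in \<open>auto intro: sum_nonneg\<close>)
    finally show ?thesis by (simp add: M'_def)
  qed
  moreover have "0 \<le> M'" using M0 q by (simp add: M'_def)
  ultimately show ?thesis using that by blast
qed

end

context W_lattice
begin

text \<open>Chebyshev: each element contributes at least \<open>t powr p\<close> to a bounded
  sum.\<close>

lemma weight_seq_finite: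
  assumes p: "0 < p" and M: "\<And>F. finite F \<Longrightarrow> F \<subseteq> S \<times> UNIV \<Longrightarrow> (\<Sum>x\<in>F. weight_seq x powr p) \<le> M"
    and t: "0 < t"
  shows "finite {x \<in> S \<times> UNIV. t < weight_seq x}"
proof (rule ccontr)
  assume inf: "infinite {x \<in> S \<times> UNIV. t < weight_seq x}"
  obtain n where n: "M < real n * t powr p"
    using reals_Archimedean3[of "t powr p"] t by auto
  obtain F where F: "F \<subseteq> {x \<in> S \<times> UNIV. t < weight_seq x}" "finite F" "card F = n"
    using infinite_arbitrarily_large[OF inf, of n] by blast
  have "real n * t powr p = (\<Sum>x\<in>F. t powr p)" using F by simp
  also have "\<dots> \<le> (\<Sum>x\<in>F. weight_seq x powr p)"
    using F t p by (intro sum_mono powr_mono2) auto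
  also have "\<dots> \<le> M" using F by (intro M) auto
  finally show False using n by simp
qed

text \<open>At level B + 1 no pair imposes a condition; the summand 1 keeps the level
  positive.\<close>

lemma Carleson_of_bounded:
  assumes "0 \<le> B" "\<And>x. x \<in> S \<times> UNIV \<Longrightarrow> weight_seq x \<le> B"
  shows "Carleson (B + 1)"
proof -
  have "energy f \<le> ennreal ((B + 1) * (nrm2 f)\<^sup>2)" if "f \<in> A2" for f
  proof (rule energy_vanishing[OF that])
    fix x assume "x \<in> S \<times> (UNIV :: nat set)" "B + 1 < weight_seq x"
    then show "L (fst x) (snd x) f = 0" using assms(2)[of x] by linarith
  qed (use assms(1) in simp)
  then show ?thesis using assms(1) by (simp add: Carleson_def)
qed

text \<open>Off a finite set of lattice points the energy is at most t times the squared norm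
  without any vanishing; the remaining cells lie in a compact set, where \<open>h n\<close> is
  uniformly small and the weight is at most \<open>\<omega> 0\<close>.\<close>

lemma energy_tendsto_0:
  assumes fin: "\<And>t. 0 < t \<Longrightarrow> finite {x \<in> S \<times> UNIV. t < weight_seq x}"
    and h: "\<And>n::nat. h n \<in> A2" "\<And>n. nrm2 (h n) \<le> B"
    and unif: "\<And>K. compact K \<Longrightarrow> K \<subseteq> \<D> \<Longrightarrow> uniform_limit K h (\<lambda>_. 0) sequentially"
    and e: "0 < e"
  shows "\<forall>\<^sub>F n in sequentially. energy (h n) \<le> ennreal e"
proof -
  interpret \<mu>: finite_measure \<mu> by (rule finite_\<mu>)
  \<comment> \<open>Half of e goes to the norm term through t and half to the cells of F through
    \<eta>; the added 1 keeps the denominator positive.\<close>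
  define t where "t = e / (2 * (B\<^sup>2 + 1))"
  have t: "0 < t" using e by (simp add: t_def add_nonneg_pos)
  define F where "F = fst ` {x \<in> S \<times> (UNIV :: nat set). t < weight_seq x}"
  have F: "finite F" "F \<subseteq> S" using fin[OF t] by (auto simp: F_def)
  have small: "\<exists>k. (\<forall>j<k. L a j (h n) = 0) \<and> const * avg a / 4 ^ k \<le> t" if "a \<in> S" "a \<notin> F" for a n
  proof (intro exI[of _ 0] conjI)
    have "(a, 0) \<notin> {x \<in> S \<times> (UNIV :: nat set). t < weight_seq x}" using that(2) by (force simp: F_def)
    then show "const * avg a / 4 ^ 0 \<le> t" using that(1) by (simp add: weight_seq_def not_less)
  qed simp
  define K where "K = (\<Union>a\<in>F. cball a (\<delta> / 4 * \<tau> a))"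
  have K: "compact K" "K \<subseteq> \<D>"
  proof -
    show "compact K" unfolding K_def using F by (intro compact_UN) auto
    have "cball a (\<delta> / 4 * \<tau> a) \<subseteq> \<D>" if "a \<in> F" for a
    proof -
      have a: "a \<in> \<D>" using that F S_disc by auto
      have "\<delta> / 4 * \<tau> a < \<delta> * \<tau> a" using \<delta> \<tau>_pos[OF a] by simp
      then have "cball a (\<delta> / 4 * \<tau> a) \<subseteq> ball a (\<delta> * \<tau> a)" by auto
      then show ?thesis using ball_subset_disc(2)[OF a \<delta>(2)] by blast
    qed
    then show "K \<subseteq> \<D>" by (auto simp: K_def)
  qed
  define V where "V = real (card F) * \<omega> 0 * measure \<mu> \<D>"
  have w0: "0 < \<omega> 0" by (intro \<omega>_pos) simp
  have V0: "0 \<le> V" using w0 by (simp add: V_def)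
  define \<eta> where "\<eta> = sqrt (e / (2 * (V + 1)))"
  have \<eta>: "0 < \<eta>" "\<eta>\<^sup>2 = e / (2 * (V + 1))" using e V0 by (auto simp: \<eta>_def)
  have "\<forall>\<^sub>F n in sequentially. \<forall>z\<in>K. dist (h n z) 0 < \<eta>"
    using uniform_limitD[OF unif[OF K] \<eta>(1)] .
  then show ?thesis
  proof (rule eventually_mono)
    fix n assume n: "\<forall>z\<in>K. dist (h n z) 0 < \<eta>"
    have cell: "cell_energy a (h n) \<le> ennreal (\<eta>\<^sup>2 * \<omega> 0 * measure \<mu> \<D>)" if a: "a \<in> F" for a
    proof -
      have "cell_energy a (h n) \<le> (\<integral>\<^sup>+z. ennreal (\<eta>\<^sup>2 * \<omega> 0) * indicator \<D> z \<partial>\<mu>)"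
        unfolding cell_energy_def
      proof (rule nn_integral_mono)
        fix z
        show "ennreal (dens (h n) z) * indicator (cell a) z \<le> ennreal (\<eta>\<^sup>2 * \<omega> 0) * indicator \<D> z"
        proof (cases "z \<in> cell a")
          case True
          then have "z \<in> cball a (\<delta> / 4 * \<tau> a)" by (simp add: cell_def)
          then have "z \<in> K" using a unfolding K_def by blast
          then have z: "z \<in> \<D>" "cmod (h n z) \<le> \<eta>" using K n by (auto simp: less_imp_le)
          have "dens (h n) z \<le> \<eta>\<^sup>2 * \<omega> 0"
            unfolding dens_def using z \<omega>_nonneg[OF z(1)] \<omega>_antimono[of 0 z]
            by (intro mult_mono power_mono) auto
          then show ?thesis using True z by (simp add: ennreal_leI)
        qed simp
      qed
      also have "\<dots> = ennreal (\<eta>\<^sup>2 * \<omega> 0) * emeasure \<mu> \<D>"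
        using sets.top[of \<mu>] by (intro nn_integral_cmult_indicator) simp
      also have "\<dots> = ennreal (\<eta>\<^sup>2 * \<omega> 0 * measure \<mu> \<D>)"
        using w0 by (simp add: \<mu>.emeasure_eq_measure ennreal_mult)
      finally show ?thesis .
    qed
    have "energy (h n) \<le> (\<Sum>a\<in>F. cell_energy a (h n)) + ennreal (t * (nrm2 (h n))\<^sup>2)"
      using t small by (intro energy_le_cells h F) auto
    also have "\<dots> \<le> (\<Sum>a\<in>F. ennreal (\<eta>\<^sup>2 * \<omega> 0 * measure \<mu> \<D>)) + ennreal (t * (nrm2 (h n))\<^sup>2)"
      by (intro add_right_mono sum_mono cell)
    also have "\<dots> = ennreal (card F * (\<eta>\<^sup>2 * \<omega> 0 * measure \<mu> \<D>) + t * (nrm2 (h n))\<^sup>2)"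
    proof -
      have "(\<Sum>a\<in>F. ennreal (\<eta>\<^sup>2 * \<omega> 0 * measure \<mu> \<D>)) = ennreal (\<Sum>a\<in>F. \<eta>\<^sup>2 * \<omega> 0 * measure \<mu> \<D>)"
        using w0 by (intro sum_ennreal) simp
      then show ?thesis using w0 t by (simp add: ennreal_plus)
    qed
    also have "\<dots> \<le> ennreal e"
    proof (rule ennreal_leI)
      have "card F * (\<eta>\<^sup>2 * \<omega> 0 * measure \<mu> \<D>) = e / (2 * (V + 1)) * V"
        by (simp add: \<eta>(2) V_def mult_ac)
      also have "\<dots> \<le> e / 2" using e V0 by (simp add: field_simps)
      finally have 1: "card F * (\<eta>\<^sup>2 * \<omega> 0 * measure \<mu> \<D>) \<le> e / 2" .
      have "(nrm2 (h n))\<^sup>2 \<le> B\<^sup>2" using h A2.nrm_ge_0 by (intro power_mono) auto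
      then have "t * (nrm2 (h n))\<^sup>2 \<le> t * (B\<^sup>2 + 1)" using t by (intro mult_left_mono) auto
      also have "\<dots> = e / 2"
      proof -
        have "0 < B\<^sup>2 + 1" by (simp add: add_nonneg_pos)
        then show ?thesis unfolding t_def by (simp add: field_simps)
      qed
      finally show "card F * (\<eta>\<^sup>2 * \<omega> 0 * measure \<mu> \<D>) + t * (nrm2 (h n))\<^sup>2 \<le> e" using 1 by simp
    qed
    finally show "energy (h n) \<le> ennreal e" .
  qed
qed

end

lemma (in W_profile) \<tau>_continuous: "continuous_on \<D> \<tau>"
proof (rule lipschitz_on_continuous_on)
  show "c2-lipschitz_on \<D> \<tau>"
    using \<tau>_Lipschitz c_pos by (intro lipschitz_onI) (auto simp: dist_norm)
qed

lemma (in W_profile) inverse_\<tau>_measurable: "(\<lambda>z. ennreal (1 / (\<tau> z)\<^sup>2)) \<in> borel_measurable area"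
  using continuous_on_measurable_area[OF \<tau>_continuous] by measurable

context W_measure
begin

text \<open>The squared norm is the pairing of f with \<open>T\<mu> f\<close> over \<mu>. In Young's
  inequality with parameter C + 1, the Carleson bound turns the energy of \<open>T\<mu> f\<close>
  into at most half of the left side, which is absorbed.\<close>

lemma toeplitz_norm_le_energy:
  assumes C: "Carleson C" and f: "f \<in> A2"
  shows "(nrm2 (T\<mu> f))\<^sup>2 \<le> (C + 1) * (LINT z|\<mu>. dens f z)"
proof -
  have T: "T\<mu> f \<in> A2" using Carleson_toeplitz(1)[OF C f] .
  have C0: "0 \<le> C" using C by (simp add: Carleson_def)
  have "energy (T\<mu> f) \<le> ennreal (C * (nrm2 (T\<mu> f))\<^sup>2)" using C T by (simp add: Carleson_def)
  then have le: "(LINT z|\<mu>. dens (T\<mu> f) z) \<le> C * (nrm2 (T\<mu> f))\<^sup>2"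
    unfolding integral_dens_\<mu>[OF C T] using C0 by (subst (asm) ennreal_le_iff) auto
  have "(nrm2 (T\<mu> f))\<^sup>2 = cmod (ip2 (T\<mu> f) (T\<mu> f))" by (simp add: A2.ip_self[OF T] norm_power)
  also have "\<dots> = cmod (LINT z|\<mu>. f z * cnj (T\<mu> f z) * of_real (\<omega> z))"
    by (simp add: Carleson_toeplitz(2)[OF C f T])
  also have "\<dots> \<le> ((C + 1) * (LINT z|\<mu>. dens f z) + (LINT z|\<mu>. dens (T\<mu> f) z) / (C + 1)) / 2"
    using C0 f T by (intro pairing_integrable(2)[OF sets_\<mu>]) (auto intro: A2_holomorphic Carleson_integrable[OF C])
  also have "\<dots> \<le> ((C + 1) * (LINT z|\<mu>. dens f z) + (nrm2 (T\<mu> f))\<^sup>2) / 2"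
  proof -
    have "(LINT z|\<mu>. dens (T\<mu> f) z) \<le> (C + 1) * (nrm2 (T\<mu> f))\<^sup>2" using le by (simp add: distrib_right add_increasing2)
    then have "(LINT z|\<mu>. dens (T\<mu> f) z) / (C + 1) \<le> (nrm2 (T\<mu> f))\<^sup>2"
      using C0 by (simp add: pos_divide_le_eq mult.commute)
    then show ?thesis by (intro divide_right_mono add_left_mono) auto
  qed
  finally show ?thesis by simp
qed

end

context W_lattice
begin

text \<open>A bounded sequence has a locally uniformly convergent subsequence by Montel, with limit
  in the space by Fatou. The differences tend to 0 locally uniformly, so their energy tends to 0,
  and the energy controls the norm of the images.\<close>

lemma toeplitz_compact:
  assumes C: "Carleson C0" and fin: "\<And>t. 0 < t \<Longrightarrow> finite {x \<in> S \<times> UNIV. t < weight_seq x}"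
  shows "compact_operator_on A2 ip2 T\<mu>"
proof -
  have "\<exists>r g. strict_mono r \<and> g \<in> A2 \<and> (\<lambda>n. nrm2 (T\<mu> (f (r n)) - g)) \<longlonglongrightarrow> 0"
    if f: "\<And>n::nat. f n \<in> A2" "\<And>n. nrm2 (f n) \<le> B" for f B
  proof -
    have B0: "0 \<le> B" using f A2.nrm_ge_0 order_trans by blast
    \<comment> \<open>All holomorphic functions obeying every bound that point evaluation gives for
      norm B: a family that contains the sequence and for which local boundedness is
      immediate.\<close>
    define \<H> where "\<H> = {h. h holomorphic_on \<D> \<and> (\<forall>R<1. \<forall>b>0. (\<forall>g z. g \<in> A2 \<longrightarrow> cmod z \<le> R \<longrightarrow> cmod (g z) \<le> b * nrm2 g) \<longrightarrow>
        (\<forall>z. cmod z \<le> R \<longrightarrow> cmod (h z) \<le> b * B))}"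
    obtain g0 r where g0: "g0 holomorphic_on \<D>" and r: "strict_mono r"
      and unif0: "\<And>K. compact K \<Longrightarrow> K \<subseteq> \<D> \<Longrightarrow> uniform_limit K (f \<circ> r) g0 sequentially"
    proof (rule Montel[of \<D> \<H> f])
      show "open \<D>" by simp
      show "h holomorphic_on \<D>" if "h \<in> \<H>" for h using that by (simp add: \<H>_def)
      show "range f \<subseteq> \<H>"
      proof
        fix h assume "h \<in> range f"
        then obtain n where h: "h = f n" by auto
        have "cmod (h z) \<le> b * B"
          if "0 < b" "\<And>g z. g \<in> A2 \<Longrightarrow> cmod z \<le> R \<Longrightarrow> cmod (g z) \<le> b * nrm2 g" "cmod z \<le> R" for R b z
        proof -
          have "cmod (h z) \<le> b * nrm2 h" using that f h by auto
          also have "\<dots> \<le> b * B" using f(2) that(1) by (intro mult_left_mono) (auto simp: h)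
          finally show ?thesis .
        qed
        moreover have "h holomorphic_on \<D>" unfolding h by (rule A2_holomorphic[OF f(1)])
        ultimately show "h \<in> \<H>" unfolding \<H>_def by blast
      qed
      show "\<exists>b. \<forall>h\<in>\<H>. \<forall>z\<in>K. cmod (h z) \<le> b" if K: "compact K" "K \<subseteq> \<D>" for K
      proof -
        obtain R where R: "R < 1" "\<And>z. z \<in> K \<Longrightarrow> cmod z \<le> R"
        proof (cases "K = {}")
          case False
          obtain z0 where "z0 \<in> K" "\<And>z. z \<in> K \<Longrightarrow> cmod z \<le> cmod z0"
            using continuous_attains_sup[OF K(1) False, of cmod] by (auto intro: continuous_intros)
          moreover have "cmod z0 < 1" using \<open>z0 \<in> K\<close> K by auto
          ultimately show ?thesis using that by blast
        qed (use that[of 0] in auto)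
        obtain b where "0 < b" "\<And>g z. g \<in> A2 \<Longrightarrow> cmod z \<le> R \<Longrightarrow> cmod (g z) \<le> b * nrm2 g"
          using point_evaluation[OF R(1)] by blast
        then have "\<forall>h\<in>\<H>. \<forall>z\<in>K. cmod (h z) \<le> b * B"
          using R unfolding \<H>_def by blast
        then show ?thesis by blast
      qed
    qed blast
    \<comment> \<open>Montel's limit is known only on the disc, while members of the space vanish
      outside it.\<close>
    define g where "g = (\<lambda>z. if z \<in> \<D> then g0 z else 0)"
    have ghol: "g holomorphic_on \<D>"
      using g0 by (rule holomorphic_transform) (simp add: g_def)
    have point: "(\<lambda>n. f (r n) z) \<longlonglongrightarrow> g z" if "z \<in> \<D>" for z
      using tendsto_uniform_limitI[OF unif0[of "{z}"], of z] that by (simp add: g_def o_def)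
    have gA: "g \<in> A2"
    proof (rule A2_I[OF ghol])
      have "(\<integral>\<^sup>+z. ennreal (dens g z) \<partial>area) \<le> ennreal (B\<^sup>2)"
      proof (rule nn_integral_limit_le)
        show "(\<lambda>z. ennreal (dens (f (r n)) z)) \<in> borel_measurable area" for n
          using dens_measurable[OF A2_holomorphic[OF f(1)]] by measurable
        show "(\<lambda>n. ennreal (dens (f (r n)) z)) \<longlonglongrightarrow> ennreal (dens g z)" if "z \<in> space area" for z
          unfolding dens_def using point[of z] that by (intro tendsto_intros) auto
        show "\<forall>\<^sub>F n in sequentially. (\<integral>\<^sup>+z. ennreal (dens (f (r n)) z) \<partial>area) \<le> ennreal (B\<^sup>2)"
          unfolding nn_integral_dens[OF f(1)] using f A2.nrm_ge_0
          by (intro always_eventually allI ennreal_leI power_mono) auto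
      qed
      then show "(\<integral>\<^sup>+z. ennreal (dens g z) \<partial>area) < top" by (simp add: le_less_trans)
    qed (simp add: g_def)
    define h where "h = (\<lambda>n. f (r n) - g)"
    have hA: "h n \<in> A2" for n unfolding h_def by (rule A2.diff_in[OF f(1) gA])
    have hB: "nrm2 (h n) \<le> B + nrm2 g" for n
    proof -
      have "nrm2 (f (r n) - g) \<le> nrm2 (f (r n) - 0) + nrm2 (0 - g)"
        by (rule A2.nrm_triangle_diff[OF f(1) A2.zero_in gA])
      moreover have "nrm2 (0 - g) = nrm2 g" using A2.nrm_minus_commute[OF A2.zero_in gA] by simp
      ultimately show ?thesis using f(2)[of "r n"] unfolding h_def by simp
    qed
    have hunif: "uniform_limit K h (\<lambda>_. 0) sequentially" if K: "compact K" "K \<subseteq> \<D>" for K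
    proof (rule uniform_limitI)
      fix e :: real assume "0 < e"
      then have "\<forall>\<^sub>F n in sequentially. \<forall>z\<in>K. dist ((f \<circ> r) n z) (g0 z) < e"
        using uniform_limitD[OF unif0[OF K]] by blast
      then show "\<forall>\<^sub>F n in sequentially. \<forall>z\<in>K. dist (h n z) 0 < e"
        by (rule eventually_mono) (use K in \<open>auto simp: h_def g_def dist_norm subset_iff\<close>)
    qed
    have "(\<lambda>n. nrm2 (T\<mu> (h n))) \<longlonglongrightarrow> 0"
    proof (rule LIMSEQ_I)
      fix e :: real assume e: "0 < e"
      have C00: "0 \<le> C0" using C by (simp add: Carleson_def)
      define e' where "e' = e\<^sup>2 / (2 * (C0 + 1))"
      have e': "0 < e'" using e C00 by (simp add: e'_def)
      have "\<forall>\<^sub>F n in sequentially. energy (h n) \<le> ennreal e'"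
        by (rule energy_tendsto_0[OF fin hA hB hunif e'])
      then obtain n0 where n0: "\<And>n. n \<ge> n0 \<Longrightarrow> energy (h n) \<le> ennreal e'"
        by (auto simp: eventually_sequentially)
      have "norm (nrm2 (T\<mu> (h n)) - 0) < e" if "n \<ge> n0" for n
      proof -
        have "(LINT z|\<mu>. dens (h n) z) \<le> e'"
          using n0[OF that] e' unfolding integral_dens_\<mu>[OF C hA] by (subst (asm) ennreal_le_iff) auto
        then have "(C0 + 1) * (LINT z|\<mu>. dens (h n) z) \<le> (C0 + 1) * e'" using C00 by (intro mult_left_mono) auto
        then have "(nrm2 (T\<mu> (h n)))\<^sup>2 \<le> (C0 + 1) * e'"
          using toeplitz_norm_le_energy[OF C hA, of n] by linarith
        also have "\<dots> = e\<^sup>2 / 2" using C00 unfolding e'_def by (simp add: field_simps)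
        also have "\<dots> < e\<^sup>2" using e by simp
        finally have "nrm2 (T\<mu> (h n)) < e" by (rule power2_less_imp_less) (use e in simp)
        then show ?thesis using A2.nrm_ge_0[OF Carleson_toeplitz(1)[OF C hA]] by simp
      qed
      then show "\<exists>n0. \<forall>n\<ge>n0. norm (nrm2 (T\<mu> (h n)) - 0) < e" by blast
    qed
    moreover have "T\<mu> (h n) = T\<mu> (f (r n)) - T\<mu> g" for n
    proof -
      have lin: "linear_operator_on A2 T\<mu>" by (rule toeplitz_linear[OF C])
      have "T\<mu> (f (r n) + scale_fun (-1) g) = T\<mu> (f (r n)) + scale_fun (-1) (T\<mu> g)"
        using lin f(1)[of "r n"] gA A2.scale_in[OF gA, of "-1"] unfolding linear_operator_on_def by metis
      then show ?thesis by (simp only: h_def minus_eq_add_scale)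
    qed
    ultimately show ?thesis
      using r Carleson_toeplitz(1)[OF C gA] by (intro exI[of _ r] exI[of _ "T\<mu> g"]) simp
  qed
  then show ?thesis
    using toeplitz_linear[OF C] unfolding compact_operator_on_def by blast
qed

text \<open>The order is forced: boundedness of \<open>weight_seq\<close> gives the Carleson
  property, through which \<open>T\<mu>\<close> maps the space into itself; finiteness of its level
  sets gives compactness; after that there is a spectral sequence to which the counting
  applies.\<close>

lemma toeplitz_schatten:
  assumes p: "0 < p" and M: "\<And>F. finite F \<Longrightarrow> F \<subseteq> S \<Longrightarrow> (\<Sum>a\<in>F. avg a powr p) \<le> M"
  shows "toeplitz_converges \<omega> \<mu>" "T\<mu> \<in> schatten_class A2 ip2 p"
proof -
  obtain M' where M': "0 \<le> M'" "\<And>F. finite F \<Longrightarrow> F \<subseteq> S \<times> UNIV \<Longrightarrow> (\<Sum>x\<in>F. weight_seq x powr p) \<le> M'"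
    using weight_seq_powr_bound[OF p M] by blast
  have fin: "finite {x \<in> S \<times> UNIV. t < weight_seq x}" if "0 < t" for t
    by (rule weight_seq_finite[OF p M'(2) that])
  have w0: "0 \<le> weight_seq x" for x using const_pos avg_nonneg by (simp add: weight_seq_def)
  have "weight_seq x \<le> M' powr (1 / p)" if "x \<in> S \<times> UNIV" for x
  proof -
    have "weight_seq x powr p \<le> M'" using M'(2)[of "{x}"] that by simp
    then have "(weight_seq x powr p) powr (1 / p) \<le> M' powr (1 / p)" using p by (intro powr_mono2) auto
    then show ?thesis using p w0 by (simp add: powr_powr)
  qed
  then have C0: "Carleson (M' powr (1 / p) + 1)" by (intro Carleson_of_bounded) auto
  then show "toeplitz_converges \<omega> \<mu>" by (rule Carleson_converges)
  interpret T: compact_positive A2 ip2 T\<mu>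
    by (rule toeplitz_compact_positive[OF C0 toeplitz_compact[OF C0 fin]])
  obtain e s where sp: "T.spectral_sequence e s" using T.spectral_sequence_exists by blast
  have "summable (\<lambda>k. s k powr p)"
  proof (rule summable_powr_of_counting[where b = weight_seq and X = "S \<times> UNIV", OF _ _ p fin _ M'(2)])
    show "decseq s" "0 \<le> s k" for k using sp by (auto simp: T.spectral_sequence_def)
    fix t :: real assume t: "0 < t"
    show "s (card {x \<in> S \<times> UNIV. t < weight_seq x}) \<le> t"
    proof (rule T.spectral_sequence_upper[OF sp fin[OF t], where L = "\<lambda>x. L (fst x) (snd x)"])
      fix h assume h: "h \<in> A2" "\<forall>x\<in>{x \<in> S \<times> UNIV. t < weight_seq x}. L (fst x) (snd x) h = 0"
      have "energy h \<le> ennreal (t * (nrm2 h)\<^sup>2)" using h t by (intro energy_vanishing) auto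
      then have "ennreal (Re (ip2 (T\<mu> h) h)) \<le> ennreal (t * (nrm2 h)\<^sup>2)"
        using toeplitz_form(2)[OF C0 h(1)] by simp
      then show "T.qf h \<le> t * (nrm2 h)\<^sup>2"
        using t by (subst (asm) ennreal_le_iff) (auto simp: T.qf_def)
    qed (use t in \<open>auto intro: L_add L_scale A2_holomorphic\<close>)
  qed
  then show "T\<mu> \<in> schatten_class A2 ip2 p"
    using T.schatten_class_iff[OF sp] by simp
qed

text \<open>For z in the disc of radius \<open>\<delta> / 16 * \<tau> a\<close> about a, the ball
  defining the averaging function at z contains the cell of a. These small discs are disjoint and
  have \<open>lambda_tau\<close> measure bounded below, so the integral dominates the sum.\<close>

lemma avg_powr_sum_le:
  assumes p: "0 < p" and int: "integrable (lambda_tau \<tau>) (\<lambda>z. \<bar>averaging \<tau> \<mu> \<delta> z\<bar> powr p)"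
  obtains M where "\<And>F. finite F \<Longrightarrow> F \<subseteq> S \<Longrightarrow> (\<Sum>a\<in>F. avg a powr p) \<le> M"
proof -
  interpret \<mu>: finite_measure \<mu> by (rule finite_\<mu>)
  define h where "h = (\<lambda>z. ennreal (\<bar>averaging \<tau> \<mu> \<delta> z\<bar> powr p))"
  define I where "I = (\<integral>\<^sup>+z. h z \<partial>lambda_tau \<tau>)"
  have hm: "h \<in> borel_measurable (lambda_tau \<tau>)"
    unfolding h_def using borel_measurable_integrable[OF int] by measurable
  have "I < top"
    using int unfolding integrable_iff_bounded I_def h_def by simp
  then obtain J where J: "0 \<le> J" "I = ennreal J" by (cases I) auto
  define D where "D = (\<lambda>a. ball a (\<delta> / 8 / 2 * \<tau> a))"
  \<comment> \<open>Both factors 16/25 come from \<open>\<tau> z \<le> 5/4 * \<tau> a\<close>, one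
    in the averages and one in the density of \<open>lambda_tau\<close>; \<delta>/16 is the radius
    of the discs in units of \<open>\<tau> a\<close>.\<close>
  define c where "c = (16/25) powr p * ((\<delta> / 16)\<^sup>2 * (16/25))"
  have c: "0 < c" using \<delta> by (simp add: c_def)
  have D_sub: "D a \<subseteq> \<D>" if "a \<in> S" for a
    unfolding D_def using ball_subset_disc(2)[OF S_disc[OF that], of "\<delta> / 8 / 2"] \<delta> m_bounds by simp
  have D_sets: "D a \<in> sets area" if "a \<in> S" for a
    using D_sub[OF that] unfolding D_def by (rule ball_in_sets_area)
  have sets_l: "sets (lambda_tau \<tau>) = sets area" by (simp add: lambda_tau_def)
  have lower: "ennreal (c * avg a powr p) \<le> (\<integral>\<^sup>+z. h z * indicator (D a) z \<partial>lambda_tau \<tau>)" if a: "a \<in> S" for a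
  proof -
    have aD: "a \<in> \<D>" using S_disc[OF a] .
    have \<tau>a: "0 < \<tau> a" using \<tau>_pos[OF aD] .
    have near: "3/4 * \<tau> a \<le> \<tau> z" "\<tau> z \<le> 5/4 * \<tau> a" "z \<in> \<D>" if "z \<in> D a" for z
    proof -
      show zD: "z \<in> \<D>" using that D_sub[OF a] by blast
      have "cmod (a - z) \<le> \<delta> / 8 / 2 * \<tau> a" using that by (simp add: D_def dist_norm)
      also have "\<dots> \<le> m * \<tau> a" using \<delta> m_bounds \<tau>a by (intro mult_right_mono) auto
      finally show "3/4 * \<tau> a \<le> \<tau> z" "\<tau> z \<le> 5/4 * \<tau> a" using \<tau>_near[OF aD zD] by auto
    qed
    have avg_le: "16/25 * avg a \<le> averaging \<tau> \<mu> \<delta> z" if z: "z \<in> D a" for z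
    proof -
      have "cell a \<subseteq> ball z (\<delta> * \<tau> z)"
      proof
        fix w assume "w \<in> cell a"
        then have "dist z w < \<delta> / 8 / 2 * \<tau> a + \<delta> / 4 * \<tau> a"
          using z dist_triangle[of z w a] by (simp add: D_def cell_def dist_commute)
        also have "\<dots> \<le> \<delta> * (3/4 * \<tau> a)" using \<delta> \<tau>a by simp
        also have "\<dots> \<le> \<delta> * \<tau> z" using near(1)[OF z] \<delta> by (intro mult_left_mono) auto
        finally show "w \<in> ball z (\<delta> * \<tau> z)" by simp
      qed
      then have "measure \<mu> (cell a) \<le> measure \<mu> (ball z (\<delta> * \<tau> z))"
        using ball_subset_disc(2)[OF near(3)[OF z] \<delta>(2)]
        by (intro \<mu>.finite_measure_mono) (auto simp: sets_\<mu> intro!: ball_in_sets_area)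
      then have "measure \<mu> (cell a) / (5/4 * \<tau> a)\<^sup>2 \<le> measure \<mu> (ball z (\<delta> * \<tau> z)) / (\<tau> z)\<^sup>2"
        using near[OF z] \<tau>a by (intro frac_le power_mono) auto
      then show ?thesis using \<tau>a by (simp add: avg_def averaging_def power_mult_distrib power_divide field_simps)
    qed
    have "ennreal (c * avg a powr p) = ennreal ((16/25 * avg a) powr p) * ennreal ((\<delta> / 16)\<^sup>2 * (16/25))"
    proof -
      have "(16/25 * avg a) powr p = (16/25) powr p * avg a powr p"
        by (intro powr_mult)
      then show ?thesis by (subst ennreal_mult[symmetric]) (simp_all add: c_def mult_ac)
    qed
    also have "\<dots> \<le> ennreal ((16/25 * avg a) powr p) * emeasure (lambda_tau \<tau>) (D a)"
    proof (rule mult_left_mono)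
      have "ennreal ((\<delta> / 16)\<^sup>2 * (16/25)) = ennreal (1 / (5/4 * \<tau> a)\<^sup>2) * ennreal ((\<delta> / 8 / 2 * \<tau> a)\<^sup>2)"
        using \<tau>a by (subst ennreal_mult[symmetric]) (auto simp: power_mult_distrib power_divide field_simps)
      also have "ennreal ((\<delta> / 8 / 2 * \<tau> a)\<^sup>2) = emeasure area (D a)"
        unfolding D_def using D_sub[OF a] \<delta> \<tau>a by (intro emeasure_area_ball[symmetric]) (auto simp: D_def)
      also have "ennreal (1 / (5/4 * \<tau> a)\<^sup>2) * emeasure area (D a) =
          (\<integral>\<^sup>+z. ennreal (1 / (5/4 * \<tau> a)\<^sup>2) * indicator (D a) z \<partial>area)"
        using D_sets[OF a] by (simp add: nn_integral_cmult_indicator)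
      also have "\<dots> \<le> (\<integral>\<^sup>+z. ennreal (1 / (\<tau> z)\<^sup>2) * indicator (D a) z \<partial>area)"
      proof (rule nn_integral_mono)
        fix z
        show "ennreal (1 / (5/4 * \<tau> a)\<^sup>2) * indicator (D a) z \<le> ennreal (1 / (\<tau> z)\<^sup>2) * indicator (D a) z"
        proof (cases "z \<in> D a")
          case True
          have "1 / (5/4 * \<tau> a)\<^sup>2 \<le> 1 / (\<tau> z)\<^sup>2"
            using near[OF True] \<tau>a by (intro divide_left_mono power_mono) auto
          then show ?thesis using True by (simp add: ennreal_leI)
        qed simp
      qed
      also have "\<dots> = emeasure (lambda_tau \<tau>) (D a)"
        unfolding lambda_tau_def using inverse_\<tau>_measurable D_sets[OF a] by (intro emeasure_density[symmetric])
      finally show "ennreal ((\<delta> / 16)\<^sup>2 * (16/25)) \<le> emeasure (lambda_tau \<tau>) (D a)" .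
    qed simp
    also have "\<dots> = (\<integral>\<^sup>+z. ennreal ((16/25 * avg a) powr p) * indicator (D a) z \<partial>lambda_tau \<tau>)"
      using D_sets[OF a] sets_l by (simp add: nn_integral_cmult_indicator)
    also have "\<dots> \<le> (\<integral>\<^sup>+z. h z * indicator (D a) z \<partial>lambda_tau \<tau>)"
    proof (rule nn_integral_mono)
      fix z
      show "ennreal ((16/25 * avg a) powr p) * indicator (D a) z \<le> h z * indicator (D a) z"
      proof (cases "z \<in> D a")
        case True
        have "(16/25 * avg a) powr p \<le> \<bar>averaging \<tau> \<mu> \<delta> z\<bar> powr p"
          using avg_le[OF True] avg_nonneg[of a] p by (intro powr_mono2) auto
        then show ?thesis using True by (simp add: h_def ennreal_leI)
      qed simp
    qed
    finally show ?thesis .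
  qed
  have "(\<Sum>a\<in>F. avg a powr p) \<le> J / c" if F: "finite F" "F \<subseteq> S" for F
  proof -
    have "ennreal (c * (\<Sum>a\<in>F. avg a powr p)) = (\<Sum>a\<in>F. ennreal (c * avg a powr p))"
      using c by (simp add: sum_distrib_left)
    also have "\<dots> \<le> (\<Sum>a\<in>F. \<integral>\<^sup>+z. h z * indicator (D a) z \<partial>lambda_tau \<tau>)"
      using F by (intro sum_mono lower) auto
    also have "\<dots> = (\<integral>\<^sup>+z. (\<Sum>a\<in>F. h z * indicator (D a) z) \<partial>lambda_tau \<tau>)"
    proof (rule nn_integral_sum[symmetric])
      fix a assume "a \<in> F"
      then have "D a \<in> sets (lambda_tau \<tau>)" using D_sets F sets_l by auto
      then show "(\<lambda>z. h z * indicator (D a) z) \<in> borel_measurable (lambda_tau \<tau>)" using hm by measurable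
    qed
    also have "\<dots> \<le> I"
      unfolding I_def
    proof (rule nn_integral_mono)
      fix z
      show "(\<Sum>a\<in>F. h z * indicator (D a) z) \<le> h z"
      proof (cases "\<exists>a\<in>F. z \<in> D a")
        case True
        then obtain a where a: "a \<in> F" "z \<in> D a" by blast
        have "z \<notin> D b" if "b \<in> F" "b \<noteq> a" for b
        proof -
          have "D a \<inter> D b = {}"
            unfolding D_def by (rule separated_disjoint[OF sep]) (use a(1) that F \<delta> in auto)
          then show ?thesis using a(2) by blast
        qed
        then have "(\<Sum>a\<in>F. h z * indicator (D a) z) = (\<Sum>b\<in>{a}. h z * indicator (D b) z)"
          using a F by (intro sum.mono_neutral_right) auto
        then show ?thesis using a by simp
      qed simp
    qed
    finally have "c * (\<Sum>a\<in>F. avg a powr p) \<le> J" using J by (simp add: ennreal_le_iff)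
    then show ?thesis using c by (simp add: pos_le_divide_eq mult.commute)
  qed
  then show ?thesis by (rule that)
qed

end

context W_measure
begin

theorem sufficiency:
  assumes \<delta>: "0 < \<delta>" "\<delta> \<le> m" and p: "0 < p" and Lp: "averaging \<tau> \<mu> \<delta> \<in> Lp_space (lambda_tau \<tau>) p"
  shows "toeplitz_converges \<omega> \<mu>" "T\<mu> \<in> schatten_class A2 ip2 p"
proof -
  obtain C where C: "1 \<le> C" "\<And>a. a \<in> \<D> \<Longrightarrow> \<exists>L :: nat \<Rightarrow> (complex \<Rightarrow> complex) \<Rightarrow> complex.
     (\<forall>j f g. f holomorphic_on \<D> \<longrightarrow> g holomorphic_on \<D> \<longrightarrow> L j (f + g) = L j f + L j g) \<and>
     (\<forall>j c f. f holomorphic_on \<D> \<longrightarrow> L j (scale_fun c f) = c * L j f) \<and>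
     (\<forall>f k \<rho> z. f holomorphic_on \<D> \<longrightarrow> 0 < \<rho> \<longrightarrow> 4 * \<rho> \<le> m \<longrightarrow> (\<forall>j<k. L j f = 0) \<longrightarrow> z \<in> ball a (\<rho> * \<tau> a) \<longrightarrow>
        ennreal (dens f z) \<le> ennreal (C / (4 ^ k * (\<rho> * \<tau> a)\<^sup>2)) * local_mass f a (4 * \<rho> * \<tau> a))"
    using local_estimate by blast
  then obtain L :: "complex \<Rightarrow> nat \<Rightarrow> (complex \<Rightarrow> complex) \<Rightarrow> complex" where L: "\<And>a. a \<in> \<D> \<Longrightarrow>
     (\<forall>j f g. f holomorphic_on \<D> \<longrightarrow> g holomorphic_on \<D> \<longrightarrow> L a j (f + g) = L a j f + L a j g) \<and>
     (\<forall>j c f. f holomorphic_on \<D> \<longrightarrow> L a j (scale_fun c f) = c * L a j f) \<and>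
     (\<forall>f k \<rho> z. f holomorphic_on \<D> \<longrightarrow> 0 < \<rho> \<longrightarrow> 4 * \<rho> \<le> m \<longrightarrow> (\<forall>j<k. L a j f = 0) \<longrightarrow> z \<in> ball a (\<rho> * \<tau> a) \<longrightarrow>
        ennreal (dens f z) \<le> ennreal (C / (4 ^ k * (\<rho> * \<tau> a)\<^sup>2)) * local_mass f a (4 * \<rho> * \<tau> a))"
    by metis
  obtain S where S: "separated (\<delta> / 8) S" "\<And>z. z \<in> \<D> \<Longrightarrow> \<exists>a\<in>S. cmod (z - a) < \<delta> / 8 * max (\<tau> a) (\<tau> z)"
    using maximal_separated_exists[of "\<delta> / 8"] \<delta> by auto
  have SD: "a \<in> \<D>" if "a \<in> S" for a using S(1) that by (auto simp: separated_def)
  interpret lat: W_lattice \<omega> \<tau> \<psi> \<psi>1 \<psi>2 c1 c2 K \<mu> \<delta> C S L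
  proof
    show "0 < \<delta>" "\<delta> \<le> m" "separated (\<delta> / 8) S" "1 \<le> C" by fact+
    show "\<exists>a\<in>S. cmod (z - a) < \<delta> / 8 * max (\<tau> a) (\<tau> z)" if "z \<in> \<D>" for z by (rule S(2)[OF that])
    show "L a j (f + g) = L a j f + L a j g" if "a \<in> S" "f holomorphic_on \<D>" "g holomorphic_on \<D>" for a j f g
      using L[OF SD[OF that(1)]] that by blast
    show "L a j (scale_fun c f) = c * L a j f" if "a \<in> S" "f holomorphic_on \<D>" for a j c f
      using L[OF SD[OF that(1)]] that by blast
    show "ennreal (dens f z) \<le> ennreal (C / (4 ^ k * (\<rho> * \<tau> a)\<^sup>2)) * local_mass f a (4 * \<rho> * \<tau> a)"
      if "a \<in> S" "f holomorphic_on \<D>" "0 < \<rho>" "4 * \<rho> \<le> m" "\<forall>j<k. L a j f = 0" "z \<in> ball a (\<rho> * \<tau> a)" for a f k \<rho> z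
      using L[OF SD[OF that(1)]] that by blast
  qed
  obtain M where M: "\<And>F. finite F \<Longrightarrow> F \<subseteq> S \<Longrightarrow> (\<Sum>a\<in>F. lat.avg a powr p) \<le> M"
    using lat.avg_powr_sum_le[OF p] Lp by (auto simp: Lp_space_def)
  show "toeplitz_converges \<omega> \<mu>" "T\<mu> \<in> schatten_class A2 ip2 p"
    using lat.toeplitz_schatten[OF p M] by auto
qed

end

section \<open>Necessity\<close>

text \<open>The pointwise half of the Schur test, used with the kernel \<open>kappa\<close> and with
  the kernel \<open>q\<close>.\<close>

lemma weighted_Cauchy_Schwarz:
  fixes x k :: "'i \<Rightarrow> real"
  assumes "\<And>a. a \<in> A \<Longrightarrow> 0 \<le> k a"
  shows "(\<Sum>a\<in>A. x a * k a)\<^sup>2 \<le> (\<Sum>a\<in>A. (x a)\<^sup>2 * k a) * (\<Sum>a\<in>A. k a)"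
proof -
  have "(\<Sum>a\<in>A. x a * k a) = (\<Sum>a\<in>A. (x a * sqrt (k a)) * sqrt (k a))"
    using assms by (intro sum.cong) (auto simp: mult.assoc)
  also have "\<dots>\<^sup>2 \<le> (\<Sum>a\<in>A. (x a * sqrt (k a))\<^sup>2) * (\<Sum>a\<in>A. (sqrt (k a))\<^sup>2)"
    by (rule Cauchy_Schwarz_ineq_sum)
  also have "\<dots> = (\<Sum>a\<in>A. (x a)\<^sup>2 * k a) * (\<Sum>a\<in>A. k a)"
    using assms by (intro arg_cong2[where f = "(*)"] sum.cong) (auto simp: power_mult_distrib)
  finally show ?thesis .
qed

lemma emeasure_area_disc: "emeasure area \<D> = 1"
  using emeasure_area_ball[of 0 1] by simp

lemma finite_area: "finite_measure area"
  by (rule finite_measureI) (simp add: emeasure_area_disc)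

section \<open>Test functions attached to a separated set\<close>

context W_profile
begin

definition kappa :: "complex \<Rightarrow> complex \<Rightarrow> real" where
  "kappa a z = cmod (test_fun a z) * sqrt (\<omega> z)"

lemma kappa_nonneg: "z \<in> \<D> \<Longrightarrow> 0 \<le> kappa a z"
  by (simp add: kappa_def \<omega>_nonneg)

lemma test_fun_holomorphic: "test_fun a holomorphic_on \<D>"
proof -
  have "(\<lambda>z. of_real (exp (\<psi> (ln (cmod a)))) * (z / a) ^ freq a * dirichlet_mean (trunc_order a) (z / a) ^ 4) holomorphic_on \<D>"
    unfolding dirichlet_mean_def divide_inverse by (intro holomorphic_intros)
  then show ?thesis
    by (rule holomorphic_transform) (simp add: test_fun_def)
qed

lemma test_fun_in_A2:
  assumes "\<And>z. z \<in> \<D> \<Longrightarrow> kappa a z \<le> B"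
  shows "test_fun a \<in> A2"
proof (rule A2_I[OF test_fun_holomorphic])
  have "(\<integral>\<^sup>+z. ennreal (dens (test_fun a) z) \<partial>area) \<le> (\<integral>\<^sup>+z. ennreal (B\<^sup>2) \<partial>area)"
  proof (intro nn_integral_mono ennreal_leI)
    fix z assume "z \<in> space area"
    then have z: "z \<in> \<D>" by simp
    have "dens (test_fun a) z = (kappa a z)\<^sup>2"
      using z \<omega>_nonneg[OF z] by (simp add: dens_def kappa_def power_mult_distrib)
    also have "\<dots> \<le> B\<^sup>2" using assms[OF z] kappa_nonneg[OF z] by (intro power_mono)
    finally show "dens (test_fun a) z \<le> B\<^sup>2" .
  qed
  also have "\<dots> < top" by (simp add: emeasure_area_disc)
  finally show "(\<integral>\<^sup>+z. ennreal (dens (test_fun a) z) \<partial>area) < top" .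
qed (simp add: test_fun_def)

end

text \<open>R is kept free; the necessity proof chooses it large in terms of B and of the lower
  bound for the test functions, so that they become nearly independent.\<close>

locale W_test = W_measure +
  fixes \<delta> r1 B R :: real and S :: "complex set"
  assumes \<delta>: "0 < \<delta>" "\<delta> \<le> m"
    and r1: "1/2 \<le> r1"
    and B: "1 \<le> B"
    and kappa_le: "\<And>a z. a \<in> \<D> \<Longrightarrow> r1 \<le> cmod a \<Longrightarrow> z \<in> \<D> \<Longrightarrow> kappa a z \<le> B"
    and kappa_decay: "\<And>a z. a \<in> \<D> \<Longrightarrow> r1 \<le> cmod a \<Longrightarrow> z \<in> \<D> \<Longrightarrow>
       kappa a z * cmod (z - a) ^ 4 \<le> B * (min (\<tau> a) (\<tau> z)) ^ 4"
    and \<tau>_half: "\<And>a. a \<in> \<D> \<Longrightarrow> r1 \<le> cmod a \<Longrightarrow> \<tau> a \<le> 1/2"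
    and R: "1 \<le> R"
    and S: "finite S" "separated R S" "\<And>a. a \<in> S \<Longrightarrow> r1 \<le> cmod a"
begin

definition c0 :: real where
  "c0 = exp (- 1 - 8 * K) / 4 ^ 4"

definition B' :: real where
  "B' = B * (1 + 192 / m\<^sup>2)"

text \<open>Size, up to a constant, of the weighted test function of a on the disc of b. The minimum
  makes it symmetric, so that sums over either variable can be bounded.\<close>

definition q :: "complex \<Rightarrow> complex \<Rightarrow> real" where
  "q a b = (min (\<tau> a) (\<tau> b)) ^ 4 / cmod (a - b) ^ 4"

lemma S_disc: "a \<in> S \<Longrightarrow> a \<in> \<D>"
  using S by (auto simp: separated_def)

lemma S_\<tau>: "a \<in> S \<Longrightarrow> 0 < \<tau> a"
  using S_disc \<tau>_pos by blast

lemma S_far: "a \<in> S \<Longrightarrow> b \<in> S \<Longrightarrow> a \<noteq> b \<Longrightarrow> R * \<tau> a \<le> cmod (a - b) \<and> R * \<tau> b \<le> cmod (a - b)"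
proof -
  assume "a \<in> S" "b \<in> S" "a \<noteq> b"
  then have "R * max (\<tau> a) (\<tau> b) \<le> cmod (a - b)" using S(2) by (auto simp: separated_def)
  moreover have "R * \<tau> a \<le> R * max (\<tau> a) (\<tau> b)" "R * \<tau> b \<le> R * max (\<tau> a) (\<tau> b)"
    using R by (auto intro!: mult_left_mono)
  ultimately show ?thesis by linarith
qed

text \<open>At most one a has z in its disc of radius \<open>R / 2 * \<tau> a\<close>, and it
  contributes at most B. For the others the fourth power of the minimum is split evenly between
  \<open>\<tau> a\<close> and \<open>\<tau> z\<close>, and the quartic sum applies with discs of
  radius \<open>R / 4 * \<tau> a\<close>.\<close>

lemma kappa_sum_le:
  assumes z: "z \<in> \<D>"
  shows "(\<Sum>a\<in>S. kappa a z) \<le> B'"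
proof -
  define S1 where "S1 = {a \<in> S. cmod (a - z) < R / 2 * \<tau> a}"
  have \<tau>z: "0 < \<tau> z" using \<tau>_pos z by simp
  have one: "a = b" if "a \<in> S1" "b \<in> S1" for a b
  proof (rule ccontr)
    assume "a \<noteq> b"
    then have "ball a (R / 2 * \<tau> a) \<inter> ball b (R / 2 * \<tau> b) = {}"
      using separated_disjoint[OF S(2)] R that by (auto simp: S1_def)
    moreover have "z \<in> ball a (R / 2 * \<tau> a)" "z \<in> ball b (R / 2 * \<tau> b)"
      using that by (auto simp: S1_def dist_norm)
    ultimately show False by blast
  qed
  have 1: "(\<Sum>a\<in>S1. kappa a z) \<le> B"
  proof (cases "S1 = {}")
    case False
    then obtain a where a: "a \<in> S1" by blast
    then have "S1 = {a}" using one by blast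
    then show ?thesis using a S_disc S(3) kappa_le[OF _ _ z] by (auto simp: S1_def)
  qed (use B in simp)
  have "(\<Sum>a\<in>S - S1. kappa a z) \<le> (\<Sum>a\<in>S - S1. B * (\<tau> z)\<^sup>2 * (16 / R\<^sup>2) * ((R / 4 * \<tau> a)\<^sup>2 / cmod (a - z) ^ 4))"
  proof (rule sum_mono)
    fix a assume a: "a \<in> S - S1"
    then have aS: "a \<in> S" and far: "R / 2 * \<tau> a \<le> cmod (a - z)" by (auto simp: S1_def)
    have pos: "0 < cmod (a - z)" using far S_\<tau>[OF aS] R by (smt (verit) half_gt_zero mult_pos_pos)
    have "kappa a z * cmod (a - z) ^ 4 \<le> B * (min (\<tau> a) (\<tau> z)) ^ 4"
      using kappa_decay[OF S_disc[OF aS] S(3)[OF aS] z] by (simp add: norm_minus_commute)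
    also have "(min (\<tau> a) (\<tau> z)) ^ 4 = (min (\<tau> a) (\<tau> z))\<^sup>2 * (min (\<tau> a) (\<tau> z))\<^sup>2"
      by (simp add: power4_eq_xxxx power2_eq_square)
    also have "\<dots> \<le> (\<tau> a)\<^sup>2 * (\<tau> z)\<^sup>2"
      using S_\<tau>[OF aS] \<tau>z by (intro mult_mono power_mono) auto
    finally have "kappa a z * cmod (a - z) ^ 4 \<le> B * ((\<tau> a)\<^sup>2 * (\<tau> z)\<^sup>2)" using B by (simp add: mult_left_mono)
    then have "kappa a z \<le> B * ((\<tau> a)\<^sup>2 * (\<tau> z)\<^sup>2) / cmod (a - z) ^ 4" using pos by (simp add: pos_le_divide_eq)
    also have "\<dots> = B * (\<tau> z)\<^sup>2 * (16 / R\<^sup>2) * ((R / 4 * \<tau> a)\<^sup>2 / cmod (a - z) ^ 4)"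
      using R by (simp add: power_mult_distrib power_divide)
    finally show "kappa a z \<le> B * (\<tau> z)\<^sup>2 * (16 / R\<^sup>2) * ((R / 4 * \<tau> a)\<^sup>2 / cmod (a - z) ^ 4)" .
  qed
  also have "\<dots> = B * (\<tau> z)\<^sup>2 * (16 / R\<^sup>2) * (\<Sum>a\<in>S - S1. (R / 4 * \<tau> a)\<^sup>2 / cmod (a - z) ^ 4)"
    by (simp add: sum_distrib_left)
  also have "\<dots> \<le> B * (\<tau> z)\<^sup>2 * (16 / R\<^sup>2) * (12 / (m * \<tau> z)\<^sup>2)"
  proof (intro mult_left_mono quartic_sum_bound)
    fix a assume a: "a \<in> S - S1"
    then have aS: "a \<in> S" and far: "R / 2 * \<tau> a \<le> cmod (a - z)" by (auto simp: S1_def)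
    show "0 \<le> R / 4 * \<tau> a" using S_\<tau>[OF aS] R by simp
    show "2 * (R / 4 * \<tau> a) \<le> cmod (a - z)" using far by simp
    \<comment> \<open>A closer point would have \<open>\<tau> a\<close> at least
      \<open>3/4 * \<tau> z\<close>, and lying outside the disc of a would then force the distance
      \<open>3/8 * \<tau> z\<close>.\<close>
    show "m * \<tau> z \<le> cmod (a - z)"
    proof (rule ccontr)
      assume "\<not> m * \<tau> z \<le> cmod (a - z)"
      then have lt: "cmod (z - a) < m * \<tau> z" by (simp add: norm_minus_commute)
      then have "3/4 * \<tau> z \<le> \<tau> a" using \<tau>_near(1)[OF z S_disc[OF aS]] by simp
      then have "1/2 * (3/4 * \<tau> z) \<le> R / 2 * \<tau> a" using R \<tau>z by (intro mult_mono) auto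
      then have "3/8 * \<tau> z \<le> cmod (a - z)" using far by simp
      moreover have "m * \<tau> z \<le> 1/4 * \<tau> z" using m_bounds \<tau>z by (intro mult_right_mono) auto
      ultimately show False using \<open>\<not> m * \<tau> z \<le> cmod (a - z)\<close> \<tau>z by linarith
    qed
  next
    fix a b assume ab: "a \<in> S - S1" "b \<in> S - S1" "a \<noteq> b"
    have "ball a (R / 2 * \<tau> a) \<inter> ball b (R / 2 * \<tau> b) = {}"
      using separated_disjoint[OF S(2)] R ab by auto
    moreover have "R / 4 * \<tau> x \<le> R / 2 * \<tau> x" if "x \<in> S" for x
      using S_\<tau>[OF that] R by (intro mult_right_mono) auto
    then have "ball x (R / 4 * \<tau> x) \<subseteq> ball x (R / 2 * \<tau> x)" if "x \<in> S" for x
      using that by (intro subset_ball) auto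
    ultimately show "ball a (R / 4 * \<tau> a) \<inter> ball b (R / 4 * \<tau> b) = {}" using ab by blast
  qed (use S(1) m_bounds \<tau>z B in auto)
  also have "\<dots> = B * (192 / m\<^sup>2) * (1 / R\<^sup>2)"
    using \<tau>z m_bounds R by (simp add: power_mult_distrib field_simps)
  also have "\<dots> \<le> B * (192 / m\<^sup>2) * 1"
    using B R by (intro mult_left_mono) (auto simp: one_le_power)
  finally have 2: "(\<Sum>a\<in>S - S1. kappa a z) \<le> B * (192 / m\<^sup>2)" by simp
  have "(\<Sum>a\<in>S. kappa a z) = (\<Sum>a\<in>S1. kappa a z) + (\<Sum>a\<in>S - S1. kappa a z)"
    using S(1) by (intro sum.subset_diff[THEN trans]) (auto simp: S1_def add.commute)
  then show ?thesis using 1 2 by (simp add: B'_def distrib_left)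
qed

text \<open>The quartic sum with discs of radius \<open>R / 2 * \<tau> a\<close> and inner radius
  \<open>R * \<tau> b\<close>. The separation enters with the total power \<open>R ^ 4\<close>, the
  source of smallness for large R.\<close>

lemma q_row_sum:
  assumes b: "b \<in> S"
  shows "(\<Sum>a\<in>S - {b}. (\<tau> a)\<^sup>2 / cmod (a - b) ^ 4) \<le> 48 / (R ^ 4 * (\<tau> b)\<^sup>2)"
proof -
  have "(\<Sum>a\<in>S - {b}. (R / 2 * \<tau> a)\<^sup>2 / cmod (a - b) ^ 4) \<le> 12 / (R * \<tau> b)\<^sup>2"
  proof (rule quartic_sum_bound)
    show "0 < R * \<tau> b" using R S_\<tau>[OF b] by simp
    fix a assume a: "a \<in> S - {b}"
    show "0 \<le> R / 2 * \<tau> a" using a S_\<tau>[of a] R by simp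
    show "2 * (R / 2 * \<tau> a) \<le> cmod (a - b)" "R * \<tau> b \<le> cmod (a - b)" using S_far[of a b] a b by auto
  next
    show "ball a (R / 2 * \<tau> a) \<inter> ball a' (R / 2 * \<tau> a') = {}" if "a \<in> S - {b}" "a' \<in> S - {b}" "a \<noteq> a'" for a a'
      using separated_disjoint[OF S(2)] R that by auto
  qed (use S in auto)
  moreover have "(\<Sum>a\<in>S - {b}. (R / 2 * \<tau> a)\<^sup>2 / cmod (a - b) ^ 4) = R\<^sup>2 / 4 * (\<Sum>a\<in>S - {b}. (\<tau> a)\<^sup>2 / cmod (a - b) ^ 4)"
    by (simp add: sum_distrib_left power_mult_distrib power_divide)
  ultimately have le: "R\<^sup>2 / 4 * (\<Sum>a\<in>S - {b}. (\<tau> a)\<^sup>2 / cmod (a - b) ^ 4) \<le> 12 / (R * \<tau> b)\<^sup>2" by simp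
  have R2: "0 < R\<^sup>2 / 4" using R by simp
  have "(\<Sum>a\<in>S - {b}. (\<tau> a)\<^sup>2 / cmod (a - b) ^ 4) \<le> 12 / (R * \<tau> b)\<^sup>2 / (R\<^sup>2 / 4)"
    by (subst pos_le_divide_eq[OF R2]) (use le in \<open>simp add: mult.commute\<close>)
  also have "\<dots> = 48 / (R ^ 4 * (\<tau> b)\<^sup>2)"
    by (simp add: power_mult_distrib power4_eq_xxxx power2_eq_square)
  finally show ?thesis .
qed

lemma q_nonneg: "a \<in> S \<Longrightarrow> b \<in> S \<Longrightarrow> 0 \<le> q a b"
  using S_\<tau> by (auto simp: q_def intro!: divide_nonneg_nonneg zero_le_power)

lemma q_sum_le: "b \<in> S \<Longrightarrow> (\<Sum>a\<in>S - {b}. q a b) \<le> 48 / R ^ 4"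
proof -
  assume b: "b \<in> S"
  have "(\<Sum>a\<in>S - {b}. q a b) \<le> (\<Sum>a\<in>S - {b}. (\<tau> b)\<^sup>2 * ((\<tau> a)\<^sup>2 / cmod (a - b) ^ 4))"
  proof (rule sum_mono)
    fix a assume a: "a \<in> S - {b}"
    have "(min (\<tau> a) (\<tau> b)) ^ 4 = (min (\<tau> a) (\<tau> b))\<^sup>2 * (min (\<tau> a) (\<tau> b))\<^sup>2"
      by (simp add: power4_eq_xxxx power2_eq_square)
    also have "\<dots> \<le> (\<tau> b)\<^sup>2 * (\<tau> a)\<^sup>2" using a b S_\<tau>[of a] S_\<tau>[of b] by (intro mult_mono power_mono) auto
    finally show "q a b \<le> (\<tau> b)\<^sup>2 * ((\<tau> a)\<^sup>2 / cmod (a - b) ^ 4)"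
      unfolding q_def by (simp add: divide_right_mono)
  qed
  also have "\<dots> = (\<tau> b)\<^sup>2 * (\<Sum>a\<in>S - {b}. (\<tau> a)\<^sup>2 / cmod (a - b) ^ 4)" by (simp add: sum_distrib_left)
  also have "\<dots> \<le> (\<tau> b)\<^sup>2 * (48 / (R ^ 4 * (\<tau> b)\<^sup>2))" by (intro mult_left_mono q_row_sum b) auto
  also have "\<dots> = 48 / R ^ 4" using S_\<tau>[OF b] by simp
  finally show ?thesis .
qed

text \<open>Here the whole fourth power of the minimum is given to \<open>\<tau> a\<close>, because
  the weight \<open>(\<tau> b)\<^sup>2\<close> already supplies the areas of the discs; in the
  unweighted sum it is split evenly.\<close>

lemma q_weighted_sum_le: "a \<in> S \<Longrightarrow> (\<Sum>b\<in>S - {a}. (\<tau> b)\<^sup>2 * q a b) \<le> 48 / R ^ 4 * (\<tau> a)\<^sup>2"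
proof -
  assume a: "a \<in> S"
  have "(\<Sum>b\<in>S - {a}. (\<tau> b)\<^sup>2 * q a b) \<le> (\<Sum>b\<in>S - {a}. \<tau> a ^ 4 * ((\<tau> b)\<^sup>2 / cmod (b - a) ^ 4))"
  proof (rule sum_mono)
    fix b assume b: "b \<in> S - {a}"
    have "(min (\<tau> a) (\<tau> b)) ^ 4 \<le> \<tau> a ^ 4" using a b S_\<tau>[of a] S_\<tau>[of b] by (intro power_mono) auto
    then have "(\<tau> b)\<^sup>2 * q a b \<le> (\<tau> b)\<^sup>2 * (\<tau> a ^ 4 / cmod (a - b) ^ 4)"
      unfolding q_def by (intro mult_left_mono divide_right_mono) auto
    then show "(\<tau> b)\<^sup>2 * q a b \<le> \<tau> a ^ 4 * ((\<tau> b)\<^sup>2 / cmod (b - a) ^ 4)"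
      by (simp add: norm_minus_commute mult.commute)
  qed
  also have "\<dots> = \<tau> a ^ 4 * (\<Sum>b\<in>S - {a}. (\<tau> b)\<^sup>2 / cmod (b - a) ^ 4)" by (simp add: sum_distrib_left)
  also have "\<dots> \<le> \<tau> a ^ 4 * (48 / (R ^ 4 * (\<tau> a)\<^sup>2))" by (intro mult_left_mono q_row_sum a) auto
  also have "\<dots> = 48 / R ^ 4 * (\<tau> a)\<^sup>2" using S_\<tau>[OF a] R by (simp add: field_simps power4_eq_xxxx power2_eq_square)
  finally show ?thesis .
qed

text \<open>On the disc of b the distance to a is at least half of |a - b|, and
  \<open>\<tau> z\<close> is at most \<open>5/4 * \<tau> b\<close>; the resulting constant (5/4)^4
  times 2^4 is 625/16, below 40.\<close>

lemma kappa_le_q: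
  assumes a: "a \<in> S" and b: "b \<in> S" "a \<noteq> b" and z: "z \<in> ball b (\<delta> * \<tau> b)"
  shows "kappa a z \<le> 40 * B * q a b"
proof -
  have zD: "z \<in> \<D>" using ball_subset_disc(2)[OF S_disc[OF b(1)] \<delta>(2)] z by blast
  have zb: "cmod (b - z) \<le> m * \<tau> b"
    using z mult_right_mono[OF \<delta>(2) less_imp_le[OF S_\<tau>[OF b(1)]]] unfolding mem_ball dist_norm by linarith
  have far: "R * \<tau> b \<le> cmod (a - b)" using S_far[OF a b] by simp
  have "m * \<tau> b \<le> 1/4 * (R * \<tau> b)"
    using m_bounds R S_\<tau>[OF b(1)] mult_mono[of m "1/4" "\<tau> b" "R * \<tau> b"] by simp
  then have "cmod (b - z) \<le> cmod (a - b) / 2" using zb far norm_ge_zero[of "a - b"] by linarith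
  moreover have "cmod (a - b) \<le> cmod (z - a) + cmod (b - z)"
    using norm_triangle_ineq[of "z - a" "b - z"] by (simp add: norm_minus_commute)
  ultimately have dist: "cmod (a - b) / 2 \<le> cmod (z - a)" by linarith
  have ab: "0 < cmod (a - b)" using b by simp
  have \<tau>z: "\<tau> z \<le> 5/4 * \<tau> b" using \<tau>_near(2)[OF S_disc[OF b(1)] zD zb] .
  have mn: "min (\<tau> a) (\<tau> z) \<le> 5/4 * min (\<tau> a) (\<tau> b)" using \<tau>z S_\<tau>[OF a] by (auto simp: min_def)
  have k0: "0 \<le> kappa a z" using kappa_nonneg[OF zD] .
  have "kappa a z * (cmod (a - b) / 2) ^ 4 \<le> kappa a z * cmod (z - a) ^ 4"
    using k0 dist by (intro mult_left_mono power_mono) auto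
  also have "\<dots> \<le> B * (min (\<tau> a) (\<tau> z)) ^ 4" by (rule kappa_decay[OF S_disc[OF a] S(3)[OF a] zD])
  also have "\<dots> \<le> B * (5/4 * min (\<tau> a) (\<tau> b)) ^ 4"
    using mn B S_\<tau>[OF a] \<tau>_pos[OF zD] by (intro mult_left_mono power_mono) auto
  finally have "kappa a z * (cmod (a - b) / 2) ^ 4 \<le> B * (5/4 * min (\<tau> a) (\<tau> b)) ^ 4" .
  then have "kappa a z * cmod (a - b) ^ 4 \<le> (625/16) * B * (min (\<tau> a) (\<tau> b)) ^ 4"
    by (simp add: power_mult_distrib power_divide)
  also have "\<dots> \<le> 40 * B * (min (\<tau> a) (\<tau> b)) ^ 4"
    using B S_\<tau>[OF a] S_\<tau>[OF b(1)] by (intro mult_right_mono zero_le_power) auto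
  finally show ?thesis using ab by (simp add: q_def pos_le_divide_eq)
qed

definition comb :: "(complex \<Rightarrow> complex) \<Rightarrow> complex \<Rightarrow> complex" where
  "comb c = (\<Sum>a\<in>S. scale_fun (c a) (test_fun a))"

text \<open>The squared norm \<open>comb c\<close> would have if the test functions were orthogonal
  with norms \<open>\<tau> a\<close>. The upper bound for the norm and the lower bound for the
  energy are both expressed by it.\<close>

definition mass :: "(complex \<Rightarrow> complex) \<Rightarrow> real" where
  "mass c = (\<Sum>a\<in>S. (cmod (c a))\<^sup>2 * (\<tau> a)\<^sup>2)"

lemma test_in: "a \<in> S \<Longrightarrow> test_fun a \<in> A2"
  using kappa_le[OF S_disc S(3)] by (intro test_fun_in_A2)

lemma comb_in: "comb c \<in> A2"
  unfolding comb_def by (intro A2.sum_in A2.scale_in test_in)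

lemma comb_apply: "comb c z = (\<Sum>a\<in>S. c a * test_fun a z)"
proof -
  have "(\<Sum>a\<in>A. scale_fun (c a) (test_fun a)) z = (\<Sum>a\<in>A. c a * test_fun a z)" if "finite A" for A
    using that by (induction A rule: finite_induct) (auto simp: scale_fun_def)
  then show ?thesis using S(1) by (simp add: comb_def)
qed

text \<open>Schur test: pointwise Cauchy-Schwarz with weights \<open>kappa a z\<close>, whose sum
  over a is at most \<open>B'\<close>, and then the integral of \<open>kappa a\<close>, which is at
  most \<open>7 * B * (\<tau> a)\<^sup>2\<close>.\<close>

lemma norm_comb_le: "(nrm2 (comb c))\<^sup>2 \<le> 7 * B * B' * mass c"
proof -
  have km: "(\<lambda>z. ennreal (kappa a z)) \<in> borel_measurable area" for a
    using holomorphic_measurable[OF test_fun_holomorphic[of a]] unfolding kappa_def by measurable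
  have B'0: "0 \<le> B'" using B by (simp add: B'_def)
  have "ennreal ((nrm2 (comb c))\<^sup>2) = (\<integral>\<^sup>+z. ennreal (dens (comb c) z) \<partial>area)"
    by (rule nn_integral_dens[OF comb_in, symmetric])
  also have "\<dots> \<le> (\<integral>\<^sup>+z. (\<Sum>a\<in>S. ennreal (B' * (cmod (c a))\<^sup>2) * ennreal (kappa a z)) \<partial>area)"
  proof (rule nn_integral_mono)
    fix z assume "z \<in> space area"
    then have z: "z \<in> \<D>" by simp
    have "cmod (comb c z) * sqrt (\<omega> z) \<le> (\<Sum>a\<in>S. cmod (c a) * cmod (test_fun a z)) * sqrt (\<omega> z)"
      unfolding comb_apply using \<omega>_nonneg[OF z]
      by (intro mult_right_mono order_trans[OF norm_sum]) (auto simp: norm_mult)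
    also have "\<dots> = (\<Sum>a\<in>S. cmod (c a) * kappa a z)" by (simp add: kappa_def sum_distrib_right mult.assoc)
    finally have le: "cmod (comb c z) * sqrt (\<omega> z) \<le> (\<Sum>a\<in>S. cmod (c a) * kappa a z)" .
    have "dens (comb c) z = (cmod (comb c z) * sqrt (\<omega> z))\<^sup>2"
      using \<omega>_nonneg[OF z] by (simp add: dens_def power_mult_distrib)
    also have "\<dots> \<le> (\<Sum>a\<in>S. cmod (c a) * kappa a z)\<^sup>2"
      using le \<omega>_nonneg[OF z] by (intro power_mono) auto
    also have "\<dots> \<le> (\<Sum>a\<in>S. (cmod (c a))\<^sup>2 * kappa a z) * (\<Sum>a\<in>S. kappa a z)"
      using kappa_nonneg[OF z] by (intro weighted_Cauchy_Schwarz)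
    also have "\<dots> \<le> (\<Sum>a\<in>S. (cmod (c a))\<^sup>2 * kappa a z) * B'"
      using kappa_nonneg[OF z] by (intro mult_left_mono kappa_sum_le z sum_nonneg) auto
    also have "\<dots> = (\<Sum>a\<in>S. B' * (cmod (c a))\<^sup>2 * kappa a z)"
      unfolding sum_distrib_right by (intro sum.cong refl) (simp add: mult_ac)
    finally have "ennreal (dens (comb c) z) \<le> ennreal (\<Sum>a\<in>S. B' * (cmod (c a))\<^sup>2 * kappa a z)"
      by (rule ennreal_leI)
    also have "\<dots> = (\<Sum>a\<in>S. ennreal (B' * (cmod (c a))\<^sup>2 * kappa a z))"
      using kappa_nonneg[OF z] B'0 by (intro sum_ennreal[symmetric]) auto
    also have "\<dots> = (\<Sum>a\<in>S. ennreal (B' * (cmod (c a))\<^sup>2) * ennreal (kappa a z))"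
      using kappa_nonneg[OF z] B'0 by (intro sum.cong ennreal_mult) auto
    finally show "ennreal (dens (comb c) z) \<le> (\<Sum>a\<in>S. ennreal (B' * (cmod (c a))\<^sup>2) * ennreal (kappa a z))" .
  qed
  also have "\<dots> = (\<Sum>a\<in>S. ennreal (B' * (cmod (c a))\<^sup>2) * (\<integral>\<^sup>+z. ennreal (kappa a z) \<partial>area))"
    using km by (subst nn_integral_sum) (auto simp: nn_integral_cmult)
  also have "\<dots> \<le> (\<Sum>a\<in>S. ennreal (B' * (cmod (c a))\<^sup>2) * ennreal (7 * B * (\<tau> a)\<^sup>2))"
  proof (intro sum_mono mult_left_mono nn_integral_quartic_bound)
    fix a z assume a: "a \<in> S" and z: "z \<in> \<D>"
    show "kappa a z \<le> B" using kappa_le[OF S_disc[OF a] S(3)[OF a] z] .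
    have "kappa a z * cmod (z - a) ^ 4 \<le> B * (min (\<tau> a) (\<tau> z)) ^ 4"
      by (rule kappa_decay[OF S_disc[OF a] S(3)[OF a] z])
    also have "\<dots> \<le> B * \<tau> a ^ 4" using B S_\<tau>[OF a] \<tau>_pos[OF z] by (intro mult_left_mono power_mono) auto
    finally show "kappa a z * cmod (z - a) ^ 4 \<le> B * \<tau> a ^ 4" .
  qed (use S_\<tau> S_disc B in auto)
  also have "\<dots> = (\<Sum>a\<in>S. ennreal (B' * (cmod (c a))\<^sup>2 * (7 * B * (\<tau> a)\<^sup>2)))"
    using B B'0 by (intro sum.cong ennreal_mult[symmetric]) auto
  also have "\<dots> = ennreal (\<Sum>a\<in>S. B' * (cmod (c a))\<^sup>2 * (7 * B * (\<tau> a)\<^sup>2))"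
    using B B'0 by (intro sum_ennreal) auto
  also have "(\<Sum>a\<in>S. B' * (cmod (c a))\<^sup>2 * (7 * B * (\<tau> a)\<^sup>2)) = 7 * B * B' * mass c"
    by (simp add: mass_def sum_distrib_left mult_ac)
  finally show ?thesis
    using B B'0 by (subst (asm) ennreal_le_iff) (auto simp: mass_def intro!: mult_nonneg_nonneg sum_nonneg)
qed

text \<open>Bound, on the disc of b, for what all the other test functions contribute to the
  weighted modulus of \<open>comb c\<close>.\<close>

definition leak :: "(complex \<Rightarrow> complex) \<Rightarrow> complex \<Rightarrow> real" where
  "leak c b = 40 * B * (\<Sum>a\<in>S - {b}. cmod (c a) * q a b)"

text \<open>Schur test for q with weights \<open>(\<tau> b)\<^sup>2\<close>: the plain sums over a
  and the weighted sums over b each supply a factor \<open>48 / R ^ 4\<close>.\<close>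

lemma leak_sum_le: "(\<Sum>b\<in>S. (\<tau> b)\<^sup>2 * (leak c b)\<^sup>2) \<le> (40 * B * 48 / R ^ 4)\<^sup>2 * mass c"
proof -
  have "(\<Sum>b\<in>S. (\<tau> b)\<^sup>2 * (leak c b)\<^sup>2) \<le>
      (\<Sum>b\<in>S. (\<tau> b)\<^sup>2 * ((40 * B)\<^sup>2 * ((\<Sum>a\<in>S - {b}. (cmod (c a))\<^sup>2 * q a b) * (48 / R ^ 4))))"
  proof (intro sum_mono mult_left_mono)
    fix b assume b: "b \<in> S"
    have "(\<Sum>a\<in>S - {b}. cmod (c a) * q a b)\<^sup>2 \<le> (\<Sum>a\<in>S - {b}. (cmod (c a))\<^sup>2 * q a b) * (\<Sum>a\<in>S - {b}. q a b)"
      using q_nonneg b by (intro weighted_Cauchy_Schwarz) auto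
    also have "\<dots> \<le> (\<Sum>a\<in>S - {b}. (cmod (c a))\<^sup>2 * q a b) * (48 / R ^ 4)"
      using q_nonneg b by (intro mult_left_mono q_sum_le b sum_nonneg) auto
    finally show "(leak c b)\<^sup>2 \<le> (40 * B)\<^sup>2 * ((\<Sum>a\<in>S - {b}. (cmod (c a))\<^sup>2 * q a b) * (48 / R ^ 4))"
      unfolding leak_def power_mult_distrib by (intro mult_left_mono) auto
  qed auto
  also have "\<dots> = (40 * B)\<^sup>2 * (48 / R ^ 4) * (\<Sum>b\<in>S. \<Sum>a\<in>S - {b}. (cmod (c a))\<^sup>2 * ((\<tau> b)\<^sup>2 * q a b))"
    unfolding sum_distrib_left sum_distrib_right by (intro sum.cong refl) (simp add: mult_ac)
  also have "(\<Sum>b\<in>S. \<Sum>a\<in>S - {b}. (cmod (c a))\<^sup>2 * ((\<tau> b)\<^sup>2 * q a b)) =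
      (\<Sum>a\<in>S. \<Sum>b\<in>S - {a}. (cmod (c a))\<^sup>2 * ((\<tau> b)\<^sup>2 * q a b))"
  proof -
    have 1: "(\<Sum>b\<in>S. \<Sum>a\<in>S - {b}. f a b) = (\<Sum>b\<in>S. \<Sum>a\<in>S. if a \<noteq> b then f a b else 0)" for f :: "complex \<Rightarrow> complex \<Rightarrow> real"
      using S(1) by (intro sum.cong[OF refl] sum.mono_neutral_cong_left) auto
    have 2: "(\<Sum>a\<in>S. \<Sum>b\<in>S - {a}. f a b) = (\<Sum>a\<in>S. \<Sum>b\<in>S. if a \<noteq> b then f a b else 0)" for f :: "complex \<Rightarrow> complex \<Rightarrow> real"
      using S(1) by (intro sum.cong[OF refl] sum.mono_neutral_cong_left) auto
    show ?thesis unfolding 1 2 by (subst sum.swap) (simp add: eq_commute)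
  qed
  also have "\<dots> = (\<Sum>a\<in>S. (cmod (c a))\<^sup>2 * (\<Sum>b\<in>S - {a}. (\<tau> b)\<^sup>2 * q a b))" by (simp add: sum_distrib_left)
  also have "(40 * B)\<^sup>2 * (48 / R ^ 4) * \<dots> \<le> (40 * B)\<^sup>2 * (48 / R ^ 4) * (\<Sum>a\<in>S. (cmod (c a))\<^sup>2 * (48 / R ^ 4 * (\<tau> a)\<^sup>2))"
    using R by (intro mult_left_mono sum_mono q_weighted_sum_le) auto
  also have "\<dots> = (40 * B * 48 / R ^ 4)\<^sup>2 * mass c"
    unfolding mass_def sum_distrib_left by (intro sum.cong refl) (simp add: power_mult_distrib power_divide power2_eq_square)
  finally show ?thesis .
qed

lemma dens_comb_lower:
  assumes b: "b \<in> S" and z: "z \<in> ball b (\<delta> * \<tau> b)"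
  shows "c0\<^sup>2 * (cmod (c b))\<^sup>2 / 2 - (leak c b)\<^sup>2 \<le> dens (comb c) z"
proof -
  have zD: "z \<in> \<D>" using ball_subset_disc(2)[OF S_disc[OF b(1)] \<delta>(2)] z by blast
  have zm: "z \<in> ball b (m * \<tau> b)"
    using z mult_right_mono[OF \<delta>(2) less_imp_le[OF S_\<tau>[OF b(1)]]] unfolding mem_ball by linarith
  have b12: "1/2 \<le> cmod b" using S(3)[OF b] r1 by simp
  have k: "c0 \<le> kappa b z"
    unfolding c0_def kappa_def by (rule test_fun_lower[OF S_disc[OF b] b12 \<tau>_half[OF S_disc[OF b] S(3)[OF b]] zm])
  define x where "x = cmod (comb c z) * sqrt (\<omega> z)"
  have w: "0 \<le> sqrt (\<omega> z)" using \<omega>_nonneg[OF zD] by simp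
  have "comb c z = c b * test_fun b z + (\<Sum>a\<in>S - {b}. c a * test_fun a z)"
    unfolding comb_apply using b S(1) by (simp add: sum.remove)
  then have "cmod (c b) * cmod (test_fun b z) \<le> cmod (comb c z) + cmod (\<Sum>a\<in>S - {b}. c a * test_fun a z)"
    using norm_triangle_ineq4[of "comb c z" "\<Sum>a\<in>S - {b}. c a * test_fun a z"] by (simp add: norm_mult)
  also have "cmod (\<Sum>a\<in>S - {b}. c a * test_fun a z) \<le> (\<Sum>a\<in>S - {b}. cmod (c a) * cmod (test_fun a z))"
    by (rule order_trans[OF norm_sum]) (simp add: norm_mult)
  finally have "cmod (c b) * cmod (test_fun b z) * sqrt (\<omega> z) \<le>
      (cmod (comb c z) + (\<Sum>a\<in>S - {b}. cmod (c a) * cmod (test_fun a z))) * sqrt (\<omega> z)"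
    using w by (intro mult_right_mono) auto
  then have "cmod (c b) * kappa b z \<le> x + (\<Sum>a\<in>S - {b}. cmod (c a) * kappa a z)"
    by (simp add: x_def kappa_def distrib_right sum_distrib_right mult.assoc)
  also have "(\<Sum>a\<in>S - {b}. cmod (c a) * kappa a z) \<le> (\<Sum>a\<in>S - {b}. cmod (c a) * (40 * B * q a b))"
    using b z by (intro sum_mono mult_left_mono kappa_le_q) auto
  also have "\<dots> = leak c b" by (simp add: leak_def sum_distrib_left mult_ac)
  finally have "cmod (c b) * kappa b z \<le> x + leak c b" by simp
  moreover have "cmod (c b) * c0 \<le> cmod (c b) * kappa b z" using k by (intro mult_left_mono) auto
  ultimately have le: "cmod (c b) * c0 \<le> x + leak c b" by linarith
  have "0 \<le> cmod (c b) * c0" by (simp add: c0_def)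
  then have "(cmod (c b) * c0)\<^sup>2 \<le> (x + leak c b)\<^sup>2" using le by (intro power_mono)
  also have "\<dots> \<le> 2 * x\<^sup>2 + 2 * (leak c b)\<^sup>2" using sum_squares_bound[of x "leak c b"] by (simp add: power2_sum)
  also have "x\<^sup>2 = dens (comb c) z" using \<omega>_nonneg[OF zD] by (simp add: x_def dens_def power_mult_distrib)
  finally show ?thesis by (simp add: power_mult_distrib mult.commute)
qed

text \<open>The disc of b has measure more than \<open>t * (\<tau> b)\<^sup>2\<close>, and the discs
  are disjoint, so the pointwise bounds add up to t times the diagonal minus the leakage.
  \<open>Rbig\<close> makes the leakage at most half of the diagonal.\<close>

lemma energy_comb_lower:
  assumes C: "Carleson C" and t: "0 < t" and big: "\<And>b. b \<in> S \<Longrightarrow> t < averaging \<tau> \<mu> \<delta> b"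
    and Rbig: "40 * B * 48 / R ^ 4 \<le> c0 / 2"
  shows "t * (c0\<^sup>2 / 4) * mass c \<le> (LINT z|\<mu>. dens (comb c) z)"
proof -
  interpret \<mu>: finite_measure \<mu> by (rule finite_\<mu>)
  define D where "D b = ball b (\<delta> * \<tau> b)" for b
  have D_sets: "D b \<in> sets \<mu>" if "b \<in> S" for b
    unfolding sets_\<mu> D_def using ball_subset_disc(2)[OF S_disc[OF that] \<delta>(2)] by (rule ball_in_sets_area)
  have int: "integrable \<mu> (dens (comb c))" by (rule Carleson_integrable[OF C comb_in])
  have intD: "integrable \<mu> (\<lambda>z. dens (comb c) z * indicator (D b) z)" if "b \<in> S" for b
    using integrable_mult_indicator[OF D_sets[OF that] int] by (simp add: mult.commute)
  have each: "t * (\<tau> b)\<^sup>2 * (c0\<^sup>2 * (cmod (c b))\<^sup>2 / 2 - (leak c b)\<^sup>2) \<le> (LINT z|\<mu>. dens (comb c) z * indicator (D b) z)"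
    if b: "b \<in> S" for b
  proof -
    define y where "y = c0\<^sup>2 * (cmod (c b))\<^sup>2 / 2 - (leak c b)\<^sup>2"
    show ?thesis
    proof (cases "0 \<le> y")
      case True
      have "t * (\<tau> b)\<^sup>2 \<le> measure \<mu> (D b)"
        using big[OF b] S_\<tau>[OF b] by (simp add: averaging_def D_def pos_less_divide_eq)
      then have "t * (\<tau> b)\<^sup>2 * y \<le> measure \<mu> (D b) * y" using True by (intro mult_right_mono)
      also have "\<dots> = (LINT z|\<mu>. y * indicator (D b) z)"
        using sets.Int_space_eq2[OF D_sets[OF b]] by simp
      also have "\<dots> \<le> (LINT z|\<mu>. dens (comb c) z * indicator (D b) z)"
      proof (rule integral_mono)
        show "integrable \<mu> (\<lambda>z. y * indicator (D b) z)"
          using D_sets[OF b] by (intro integrable_mult_right integrable_real_indicator) (auto simp: \<mu>.emeasure_eq_measure)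
        show "y * indicator (D b) z \<le> dens (comb c) z * indicator (D b) z" for z
          using dens_comb_lower[OF b, of z c] by (auto simp: y_def D_def split: split_indicator)
      qed (rule intD[OF b])
      finally show ?thesis by (simp add: y_def)
    next
      \<comment> \<open>Where the leakage dominates, enlarging \<open>t * (\<tau> b)\<^sup>2\<close>
        to the measure would reverse the inequality; but the left side is then nonpositive.\<close>
      case False
      then have "t * (\<tau> b)\<^sup>2 * y \<le> 0" using t by (simp add: mult_le_0_iff)
      also have "0 \<le> (LINT z|\<mu>. dens (comb c) z * indicator (D b) z)"
        using dens_nonneg by (intro integral_nonneg_AE AE_I2) auto
      finally show ?thesis by (simp add: y_def)
    qed
  qed
  have "t * (c0\<^sup>2 / 4) * mass c \<le> t * (c0\<^sup>2 / 2 * mass c - (40 * B * 48 / R ^ 4)\<^sup>2 * mass c)"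
  proof -
    have "0 \<le> 40 * B * 48 / R ^ 4" using B R by simp
    then have "(40 * B * 48 / R ^ 4)\<^sup>2 \<le> (c0 / 2)\<^sup>2" using Rbig by (intro power_mono)
    moreover have "0 \<le> mass c" by (auto simp: mass_def intro: sum_nonneg)
    ultimately have "(40 * B * 48 / R ^ 4)\<^sup>2 * mass c \<le> (c0 / 2)\<^sup>2 * mass c" by (intro mult_right_mono)
    then have "c0\<^sup>2 / 4 * mass c \<le> c0\<^sup>2 / 2 * mass c - (40 * B * 48 / R ^ 4)\<^sup>2 * mass c"
      by (simp add: power_divide mult.commute)
    then show ?thesis using t by (simp only: mult.assoc mult_le_cancel_left_pos)
  qed
  also have "\<dots> \<le> t * (c0\<^sup>2 / 2 * mass c - (\<Sum>b\<in>S. (\<tau> b)\<^sup>2 * (leak c b)\<^sup>2))"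
    using leak_sum_le[of c] t by (intro mult_left_mono) auto
  also have "\<dots> = (\<Sum>b\<in>S. t * (\<tau> b)\<^sup>2 * (c0\<^sup>2 * (cmod (c b))\<^sup>2 / 2 - (leak c b)\<^sup>2))"
    by (simp add: mass_def sum_distrib_left algebra_simps flip: sum_subtractf)
  also have "\<dots> \<le> (\<Sum>b\<in>S. LINT z|\<mu>. dens (comb c) z * indicator (D b) z)"
    by (intro sum_mono each)
  also have "\<dots> = (LINT z|\<mu>. (\<Sum>b\<in>S. dens (comb c) z * indicator (D b) z))"
    using intD by (intro Bochner_Integration.integral_sum[symmetric])
  also have "\<dots> \<le> (LINT z|\<mu>. dens (comb c) z)"
  proof (rule integral_mono)
    show "integrable \<mu> (\<lambda>z. \<Sum>b\<in>S. dens (comb c) z * indicator (D b) z)"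
      using intD by (intro Bochner_Integration.integrable_sum)
    fix z assume "z \<in> space \<mu>"
    then have z: "z \<in> \<D>" by simp
    show "(\<Sum>b\<in>S. dens (comb c) z * indicator (D b) z) \<le> dens (comb c) z"
    proof (cases "\<exists>b\<in>S. z \<in> D b")
      case True
      then obtain b where b: "b \<in> S" "z \<in> D b" by blast
      have "z \<notin> D a" if "a \<in> S" "a \<noteq> b" for a
      proof -
        have sub: "D x \<subseteq> ball x (R / 2 * \<tau> x)" if "x \<in> S" for x
        proof -
          have "\<delta> * \<tau> x \<le> R / 2 * \<tau> x" using \<delta> m_bounds R S_\<tau>[OF that] by (intro mult_right_mono) auto
          then show ?thesis unfolding D_def by (rule subset_ball)
        qed
        have "ball a (R / 2 * \<tau> a) \<inter> ball b (R / 2 * \<tau> b) = {}"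
          by (rule separated_disjoint[OF S(2)]) (use R b(1) that in auto)
        then show ?thesis using sub[OF that(1)] sub[OF b(1)] b(2) by blast
      qed
      then have "(\<Sum>a\<in>S. dens (comb c) z * indicator (D a) z) = (\<Sum>a\<in>{b}. dens (comb c) z * indicator (D a) z)"
        using b S(1) by (intro sum.mono_neutral_right) auto
      then show ?thesis using b by simp
    next
      case False
      then have "(\<Sum>b\<in>S. dens (comb c) z * indicator (D b) z) = 0" by (intro sum.neutral) auto
      then show ?thesis using dens_nonneg[OF z] by simp
    qed
  qed (rule int)
  finally show ?thesis .
qed

end

text \<open>A combination with a nonzero coefficient has positive energy, so it is not the zero
  function; this is the independence that the lower half of the min-max principle demands.\<close>

lemma (in W_test) sampling_singular_value:
  assumes C: "Carleson C" and compact: "compact_operator_on A2 ip2 T\<mu>"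
    and sp: "compact_positive.spectral_sequence A2 ip2 T\<mu> e s"
    and t: "0 < t" and big: "\<And>b. b \<in> S \<Longrightarrow> t < averaging \<tau> \<mu> \<delta> b"
    and Rbig: "40 * B * 48 / R ^ 4 \<le> c0 / 2" and k: "k < card S"
  shows "c0\<^sup>2 / 4 / (7 * B * B') * t \<le> s k"
proof -
  interpret T: compact_positive A2 ip2 T\<mu> by (rule toeplitz_compact_positive[OF C compact])
  have c0: "0 < c0" by (simp add: c0_def)
  have BB: "0 < 7 * B * B'" using B by (simp add: B'_def add_pos_nonneg)
  have lower: "t * (c0\<^sup>2 / 4) * mass c \<le> T.qf (comb c)" for c
    using energy_comb_lower[OF C t big Rbig, of c] toeplitz_form(1)[OF C comb_in, of c] by (simp add: T.qf_def)
  have "comb c \<noteq> 0 \<and> c0\<^sup>2 / 4 / (7 * B * B') * t * (nrm2 (comb c))\<^sup>2 \<le> T.qf (comb c)"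
    if c: "\<exists>j\<in>S. c j \<noteq> 0" for c
  proof
    obtain j where j: "j \<in> S" "c j \<noteq> 0" using c by blast
    have "0 < (cmod (c j))\<^sup>2 * (\<tau> j)\<^sup>2" using j S_\<tau>[OF j(1)] by simp
    then have "0 < mass c" unfolding mass_def using S(1) j(1) by (intro sum_pos2[of S j]) auto
    then have "0 < t * (c0\<^sup>2 / 4) * mass c" using t c0 by simp
    then have "0 < T.qf (comb c)" using lower[of c] by linarith
    then show "comb c \<noteq> 0" by (auto simp: T.qf_def T.T_zero A2.ip_zero_left[OF A2.zero_in])
    have "c0\<^sup>2 / 4 / (7 * B * B') * t * (nrm2 (comb c))\<^sup>2 \<le> c0\<^sup>2 / 4 / (7 * B * B') * t * (7 * B * B' * mass c)"
      using BB t by (intro mult_left_mono norm_comb_le) auto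
    also have "\<dots> = t * (c0\<^sup>2 / 4) * mass c" using less_imp_neq[OF BB] by (auto simp: field_simps)
    also have "\<dots> \<le> T.qf (comb c)" by (rule lower)
    finally show "c0\<^sup>2 / 4 / (7 * B * B') * t * (nrm2 (comb c))\<^sup>2 \<le> T.qf (comb c)" .
  qed
  then show ?thesis
    using T.spectral_sequence_lower[OF sp S(1) k test_in] by (simp add: comb_def)
qed

section \<open>From counting separated points to an integral\<close>

context W_measure
begin

text \<open>The balls are the sections of the set \<open>dist z w < \<delta> * \<tau> z\<close> in
  the product space, and for a finite measure the section measures depend measurably on z.\<close>

lemma averaging_measurable:
  assumes "\<delta> \<le> m"
  shows "averaging \<tau> \<mu> \<delta> \<in> borel_measurable area"
proof -
  interpret \<mu>: finite_measure \<mu> by (rule finite_\<mu>)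
  have id1: "(\<lambda>z. z) \<in> area \<rightarrow>\<^sub>M borel" "(\<lambda>z. z) \<in> \<mu> \<rightarrow>\<^sub>M borel"
    by (simp_all add: measurable_\<mu> continuous_on_measurable_area)
  have \<tau>m: "\<tau> \<in> borel_measurable area" by (rule continuous_on_measurable_area[OF \<tau>_continuous])
  define Q where "Q = {x \<in> space (area \<Otimes>\<^sub>M \<mu>). dist (fst x) (snd x) < \<delta> * \<tau> (fst x)}"
  have "Q \<in> sets (area \<Otimes>\<^sub>M \<mu>)"
  proof -
    have [measurable]: "fst \<in> borel_measurable (area \<Otimes>\<^sub>M \<mu>)" "snd \<in> borel_measurable (area \<Otimes>\<^sub>M \<mu>)"
      "(\<lambda>x. \<tau> (fst x)) \<in> borel_measurable (area \<Otimes>\<^sub>M \<mu>)"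
      using measurable_compose[OF measurable_fst id1(1)] measurable_compose[OF measurable_snd id1(2)]
        measurable_compose[OF measurable_fst \<tau>m] by auto
    show ?thesis unfolding Q_def by measurable
  qed
  then have "(\<lambda>z. emeasure \<mu> (Pair z -` Q)) \<in> borel_measurable area"
    by (rule \<mu>.measurable_emeasure_Pair)
  then have "(\<lambda>z. enn2real (emeasure \<mu> (Pair z -` Q)) / (\<tau> z)\<^sup>2) \<in> borel_measurable area"
    using \<tau>m by measurable
  moreover have "averaging \<tau> \<mu> \<delta> z = enn2real (emeasure \<mu> (Pair z -` Q)) / (\<tau> z)\<^sup>2" if "z \<in> space area" for z
  proof -
    have z: "z \<in> \<D>" using that by simp
    have "Pair z -` Q = ball z (\<delta> * \<tau> z)"
      using ball_subset_disc(2)[OF z assms] z by (auto simp: Q_def space_pair_measure)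
    then show ?thesis by (simp add: averaging_def measure_def)
  qed
  ultimately show ?thesis using measurable_cong by (metis (no_types, lifting))
qed

text \<open>The discs of radius \<open>2 * R * \<tau> a\<close> around the net cover U, and the part
  of U assigned to one of them has \<open>lambda_tau\<close> measure at most
  \<open>8 * R\<^sup>2\<close>. For large R the comparability of \<tau> over distances
  \<open>R * \<tau> a\<close> is not automatic; it is what \<open>flat\<close> provides.\<close>

lemma separated_net_mass:
  assumes R: "1 \<le> R" and sep: "separated R F" "finite F" and U: "U \<subseteq> \<D>" "U \<in> sets area"
    and flat: "\<And>z w. z \<in> U \<Longrightarrow> w \<in> F \<Longrightarrow> \<bar>\<tau> z - \<tau> w\<bar> \<le> 1 / (4 * R) * cmod (z - w)"
    and net: "\<And>z. z \<in> U \<Longrightarrow> \<exists>a\<in>F. cmod (z - a) < R * max (\<tau> a) (\<tau> z)"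
  shows "(\<integral>\<^sup>+z. ennreal (1 / (\<tau> z)\<^sup>2) * indicator U z \<partial>area) \<le> ennreal (8 * R\<^sup>2 * card F)"
proof -
  have F\<tau>: "0 < \<tau> a" if "a \<in> F" for a using that sep \<tau>_pos by (auto simp: separated_def)
  define D where "D a = ball a (2 * R * \<tau> a) \<inter> \<D>" for a
  have [measurable]: "D a \<in> sets area" for a
    by (auto simp: D_def sets_area sets_restrict_space_iff)
  have "(\<integral>\<^sup>+z. ennreal (1 / (\<tau> z)\<^sup>2) * indicator U z \<partial>area) \<le>
      (\<integral>\<^sup>+z. (\<Sum>a\<in>F. ennreal (2 / (\<tau> a)\<^sup>2) * indicator (D a) z) \<partial>area)"
  proof (rule nn_integral_mono)
    fix z
    show "ennreal (1 / (\<tau> z)\<^sup>2) * indicator U z \<le> (\<Sum>a\<in>F. ennreal (2 / (\<tau> a)\<^sup>2) * indicator (D a) z)"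
    proof (cases "z \<in> U")
      case True
      obtain a where a: "a \<in> F" "cmod (z - a) < R * max (\<tau> a) (\<tau> z)" using net[OF True] by blast
      have \<tau>z: "0 < \<tau> z" using True U \<tau>_pos by blast
      have "1 / (4 * R) * cmod (z - a) \<le> 1 / (4 * R) * (R * max (\<tau> a) (\<tau> z))"
        using a R by (intro mult_left_mono) auto
      then have "\<bar>\<tau> z - \<tau> a\<bar> \<le> 1/4 * max (\<tau> a) (\<tau> z)"
        using flat[OF True a(1)] R by simp
      then have comp: "3/4 * \<tau> a \<le> \<tau> z" "max (\<tau> a) (\<tau> z) \<le> 2 * \<tau> a"
        using F\<tau>[OF a(1)] \<tau>z by (auto simp: max_def abs_le_iff split: if_splits)
      have "R * max (\<tau> a) (\<tau> z) \<le> R * (2 * \<tau> a)" using comp R by (intro mult_left_mono) auto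
      then have zD: "z \<in> D a" using a True U by (auto simp: D_def dist_norm norm_minus_commute)
      have "1 / (\<tau> z)\<^sup>2 \<le> 1 / (3/4 * \<tau> a)\<^sup>2"
        using comp F\<tau>[OF a(1)] by (intro divide_left_mono power_mono) auto
      also have "\<dots> \<le> 2 / (\<tau> a)\<^sup>2" using F\<tau>[OF a(1)] by (simp add: power_mult_distrib power_divide field_simps)
      finally have "ennreal (1 / (\<tau> z)\<^sup>2) * indicator U z \<le> ennreal (2 / (\<tau> a)\<^sup>2) * indicator (D a) z"
        using True zD by (simp add: ennreal_leI)
      also have "\<dots> \<le> (\<Sum>a\<in>F. ennreal (2 / (\<tau> a)\<^sup>2) * indicator (D a) z)"
        using a sep(2) by (intro member_le_sum) auto
      finally show ?thesis .
    qed simp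
  qed
  also have "\<dots> = (\<Sum>a\<in>F. ennreal (2 / (\<tau> a)\<^sup>2) * emeasure area (D a))"
    by (subst nn_integral_sum) (auto simp: nn_integral_cmult_indicator)
  also have "\<dots> \<le> (\<Sum>a\<in>F. ennreal (2 / (\<tau> a)\<^sup>2) * ennreal ((2 * R * \<tau> a)\<^sup>2))"
    unfolding D_def using R F\<tau> by (intro sum_mono mult_left_mono emeasure_area_ball_le) (auto simp: less_imp_le)
  also have "\<dots> = (\<Sum>a\<in>F. ennreal (8 * R\<^sup>2))"
  proof (rule sum.cong[OF refl])
    fix a assume "a \<in> F"
    then show "ennreal (2 / (\<tau> a)\<^sup>2) * ennreal ((2 * R * \<tau> a)\<^sup>2) = ennreal (8 * R\<^sup>2)"
      using F\<tau>[of a] by (subst ennreal_mult[symmetric]) (auto simp: power_mult_distrib)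
  qed
  also have "\<dots> = ennreal (8 * R\<^sup>2 * card F)"
    by (simp add: ennreal_of_nat_eq_real_of_nat mult.commute flip: ennreal_mult)
  finally show ?thesis .
qed

theorem necessity:
  assumes \<delta>: "0 < \<delta>" "\<delta> \<le> m" and p: "0 < p"
    and conv: "toeplitz_converges \<omega> \<mu>" and T: "T\<mu> \<in> schatten_class A2 ip2 p"
  shows "averaging \<tau> \<mu> \<delta> \<in> Lp_space (lambda_tau \<tau>) p"
proof -
  interpret \<mu>: finite_measure \<mu> by (rule finite_\<mu>)
  define avg where "avg = averaging \<tau> \<mu> \<delta>"
  have avg0: "0 \<le> avg z" for z by (simp add: avg_def averaging_def)
  have avgm [measurable]: "avg \<in> borel_measurable area" unfolding avg_def by (rule averaging_measurable[OF \<delta>(2)])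
  have \<tau>m [measurable]: "\<tau> \<in> borel_measurable area" by (rule continuous_on_measurable_area[OF \<tau>_continuous])
  have normm [measurable]: "cmod \<in> borel_measurable area" by (rule continuous_on_measurable_area) (intro continuous_intros)
  have compact: "compact_operator_on A2 ip2 T\<mu>" using T by (simp add: schatten_class_def)
  obtain C where C: "Carleson C" using compact_toeplitz_Carleson[OF conv compact] by blast
  interpret T: compact_positive A2 ip2 T\<mu> by (rule toeplitz_compact_positive[OF C compact])
  obtain e s where sp: "T.spectral_sequence e s" using T.spectral_sequence_exists by blast
  have summ: "summable (\<lambda>k. s k powr p)" using T T.schatten_class_iff[OF sp] by simp
  have s0: "0 \<le> s k" for k using sp by (auto simp: T.spectral_sequence_def)
  have slim: "s \<longlonglongrightarrow> 0" using sp by (auto simp: T.spectral_sequence_def)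
  obtain r1 B0 where r1: "1/2 \<le> r1" "r1 < 1" and B0: "0 < B0"
    "\<And>a z. a \<in> \<D> \<Longrightarrow> r1 \<le> cmod a \<Longrightarrow> z \<in> \<D> \<Longrightarrow> cmod (test_fun a z) * sqrt (\<omega> z) \<le> B0"
    "\<And>a z. a \<in> \<D> \<Longrightarrow> r1 \<le> cmod a \<Longrightarrow> z \<in> \<D> \<Longrightarrow>
       cmod (test_fun a z) * sqrt (\<omega> z) * cmod (z - a) ^ 4 \<le> B0 * (min (\<tau> a) (\<tau> z)) ^ 4"
    and \<tau>_half: "\<And>a. a \<in> \<D> \<Longrightarrow> r1 \<le> cmod a \<Longrightarrow> \<tau> a \<le> 1/2"
    using test_fun_upper by blast
  define B where "B = max 1 B0"
  have B: "1 \<le> B" "B0 \<le> B" by (auto simp: B_def)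
  define c0 where "c0 = exp (- 1 - 8 * K) / (4::real) ^ 4"
  have c0: "0 < c0" by (simp add: c0_def)
  \<comment> \<open>3840 is twice 40 times 48, so that the leakage constant is at most
    \<open>c0 / 2\<close>; since R is at least 1, the condition on its first power suffices.\<close>
  define R where "R = max 1 (3840 * B / c0)"
  have R: "1 \<le> R" "3840 * B / c0 \<le> R" by (auto simp: R_def)
  have Rbig: "40 * B * 48 / R ^ 4 \<le> c0 / 2"
  proof -
    have "R ^ 1 \<le> R ^ 4" using R(1) by (intro power_increasing) auto
    then have "3840 * B / c0 \<le> R ^ 4" using R(2) by simp
    then have "3840 * B \<le> R ^ 4 * c0" using c0 by (simp add: pos_divide_le_eq)
    moreover have "0 < R ^ 4" using R(1) by simp
    ultimately show ?thesis by (simp add: pos_divide_le_eq mult.commute)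
  qed
  define \<kappa> where "\<kappa> = c0\<^sup>2 / 4 / (7 * B * (B * (1 + 192 / m\<^sup>2)))"
  have \<kappa>: "0 < \<kappa>" unfolding \<kappa>_def using c0 B m_bounds by (intro divide_pos_pos mult_pos_pos) (auto simp: add_pos_nonneg)
  obtain r0 where r0: "r0 < 1" "\<And>z w. z \<in> \<D> \<Longrightarrow> w \<in> \<D> \<Longrightarrow> r0 \<le> cmod z \<Longrightarrow> r0 \<le> cmod w \<Longrightarrow>
      \<bar>\<tau> z - \<tau> w\<bar> \<le> 1 / (4 * R) * \<bar>cmod z - cmod w\<bar>"
    using \<tau>_flat[of "1 / (4 * R)"] R by auto
  \<comment> \<open>Beyond r2 the bounds on the test functions hold and \<tau> is flat enough for
    separation R.\<close>
  define r2 where "r2 = max r1 r0"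
  have r2: "r1 \<le> r2" "r0 \<le> r2" "r2 < 1" "0 \<le> r2" using r1 r0 by (auto simp: r2_def)
  define U where "U t = {z \<in> \<D>. r2 \<le> cmod z \<and> t < avg z}" for t
  have Um [measurable]: "U t \<in> sets area" for t
  proof -
    have "{z \<in> space area. r2 \<le> cmod z \<and> t < avg z} \<in> sets area" by measurable
    then show ?thesis by (simp only: U_def space_area)
  qed
  define I where "I t = {k. \<kappa> * t \<le> s k}" for t
  have finI: "finite (I t)" if "0 < t" for t
  proof -
    have "\<forall>\<^sub>F k in sequentially. s k < \<kappa> * t" using slim \<kappa> that by (intro order_tendstoD) auto
    then obtain N where "\<And>k. k \<ge> N \<Longrightarrow> s k < \<kappa> * t" by (auto simp: eventually_sequentially)
    then have "I t \<subseteq> {..<N}" by (force simp: I_def not_le[symmetric])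
    then show ?thesis by (rule finite_subset) simp
  qed
  have card_le: "card F \<le> card (I t)" if t: "0 < t" and F: "finite F" "separated R F" "F \<subseteq> U t" for t F
  proof -
    interpret te: W_test \<omega> \<tau> \<psi> \<psi>1 \<psi>2 c1 c2 K \<mu> \<delta> r1 B R F
    proof
      show "kappa a z \<le> B" if "a \<in> \<D>" "r1 \<le> cmod a" "z \<in> \<D>" for a z
        using B0(2)[OF that] B by (simp add: kappa_def)
      show "kappa a z * cmod (z - a) ^ 4 \<le> B * (min (\<tau> a) (\<tau> z)) ^ 4" if "a \<in> \<D>" "r1 \<le> cmod a" "z \<in> \<D>" for a z
      proof -
        have "B0 * (min (\<tau> a) (\<tau> z)) ^ 4 \<le> B * (min (\<tau> a) (\<tau> z)) ^ 4"
          using B \<tau>_pos that by (intro mult_right_mono zero_le_power) (auto simp: less_imp_le)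
        then show ?thesis using B0(3)[OF that] by (simp add: kappa_def)
      qed
    qed (use \<delta> r1 B R \<tau>_half F r2 in \<open>auto simp: U_def\<close>)
    have e: "te.c0 = c0" "\<kappa> = c0\<^sup>2 / 4 / (7 * B * te.B')"
      by (simp_all add: te.c0_def te.B'_def c0_def \<kappa>_def)
    have big: "t < averaging \<tau> \<mu> \<delta> b" if "b \<in> F" for b
      using F(3) that by (auto simp: U_def avg_def)
    have "k \<in> I t" if "k < card F" for k
      using te.sampling_singular_value[OF C compact sp t big _ that, unfolded e(1), folded e(2)] Rbig
      by (simp add: I_def)
    then have "{..<card F} \<subseteq> I t" by auto
    then have "card {..<card F} \<le> card (I t)" by (rule card_mono[OF finI[OF t]])
    then show ?thesis by (simp only: card_lessThan)
  qed
  have level: "(\<integral>\<^sup>+z. ennreal (1 / (\<tau> z)\<^sup>2) * indicator (U t) z \<partial>area) \<le> ennreal (8 * R\<^sup>2 * card (I t))"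
    if t: "0 < t" for t
  proof -
    define P where "P F \<longleftrightarrow> finite F \<and> separated R F \<and> F \<subseteq> U t" for F
    have "P {}" by (simp add: P_def separated_def)
    moreover have "\<forall>F. P F \<longrightarrow> card F < Suc (card (I t))"
      using card_le[OF t] unfolding P_def less_Suc_eq_le by blast
    ultimately have "\<exists>F. P F \<and> (\<forall>F'. P F' \<longrightarrow> card F' \<le> card F)"
      by (rule ex_has_greatest_nat)
    \<comment> \<open>Separated subsets of \<open>U t\<close> have at most \<open>card (I t)\<close>
      points, so one of largest cardinality exists, and it is a net because no point can be
      added.\<close>
    then obtain F where F: "P F" "\<And>F'. P F' \<Longrightarrow> card F' \<le> card F"
      by (elim exE conjE) (use that in blast)
    have "(\<integral>\<^sup>+z. ennreal (1 / (\<tau> z)\<^sup>2) * indicator (U t) z \<partial>area) \<le> ennreal (8 * R\<^sup>2 * card F)"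
    proof (rule separated_net_mass[OF R(1)])
      show "separated R F" "finite F" using F by (auto simp: P_def)
      show "U t \<subseteq> \<D>" by (auto simp: U_def)
      show "\<bar>\<tau> z - \<tau> w\<bar> \<le> 1 / (4 * R) * cmod (z - w)" if "z \<in> U t" "w \<in> F" for z w
      proof -
        have "\<bar>\<tau> z - \<tau> w\<bar> \<le> 1 / (4 * R) * \<bar>cmod z - cmod w\<bar>"
          using that F r2 by (intro r0) (auto simp: P_def U_def)
        also have "\<dots> \<le> 1 / (4 * R) * cmod (z - w)"
          using R norm_triangle_ineq3[of z w] by (intro mult_left_mono) auto
        finally show ?thesis .
      qed
      show "\<exists>a\<in>F. cmod (z - a) < R * max (\<tau> a) (\<tau> z)" if z: "z \<in> U t" for z
      proof (rule ccontr)
        assume "\<not> (\<exists>a\<in>F. cmod (z - a) < R * max (\<tau> a) (\<tau> z))"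
        then have far: "R * max (\<tau> a) (\<tau> z) \<le> cmod (z - a)" if "a \<in> F" for a using that by force
        have zD: "z \<in> \<D>" using z by (simp add: U_def)
        have "z \<notin> F"
        proof
          assume "z \<in> F"
          then have "R * \<tau> z \<le> 0" using far[of z] by simp
          then show False using R \<tau>_pos[OF zD] by (simp add: mult_le_0_iff)
        qed
        moreover have "P (insert z F)"
          using F(1) z zD far by (auto simp: P_def separated_def max.commute norm_minus_commute)
        ultimately show False using F(2)[of "insert z F"] F(1) by (simp add: P_def)
      qed
    qed simp
    also have "\<dots> \<le> ennreal (8 * R\<^sup>2 * card (I t))"
      using card_le[OF t] F(1) by (intro ennreal_leI mult_left_mono) (auto simp: P_def)
    finally show ?thesis .
  qed
  have outer: "(\<integral>\<^sup>+z. ennreal (1 / (\<tau> z)\<^sup>2) * (ennreal (avg z powr p) * indicator {z. r2 \<le> cmod z} z) \<partial>area) < top"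
  proof -
    define G where "G z = avg z powr p * indicator {z. r2 \<le> cmod z} z" for z
    have [measurable]: "G \<in> borel_measurable area" unfolding G_def by measurable
    interpret pair: pair_sigma_finite area "lborel :: real measure"
      unfolding pair_sigma_finite_def
      using finite_measure.axioms(1)[OF finite_area] lborel.sigma_finite_measure_axioms by (rule conjI)
    have "(\<integral>\<^sup>+z. ennreal (1 / (\<tau> z)\<^sup>2) * (ennreal (avg z powr p) * indicator {z. r2 \<le> cmod z} z) \<partial>area) =
        (\<integral>\<^sup>+z. ennreal (1 / (\<tau> z)\<^sup>2) * ennreal (G z) \<partial>area)"
      by (intro nn_integral_cong) (auto simp: G_def split: split_indicator)
    \<comment> \<open>Layer cake in the variable u = t^p: \<open>G z\<close> is the length of the
      interval of u below it, and after the exchange of integrals the super-level sets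
      \<open>U t\<close> appear.\<close>
    also have "\<dots> = (\<integral>\<^sup>+z. \<integral>\<^sup>+u. ennreal (1 / (\<tau> z)\<^sup>2) * indicator {0<..<G z} u \<partial>lborel \<partial>area)"
    proof (rule nn_integral_cong)
      fix z
      have "0 \<le> G z" by (simp add: G_def)
      then show "ennreal (1 / (\<tau> z)\<^sup>2) * ennreal (G z) = (\<integral>\<^sup>+u. ennreal (1 / (\<tau> z)\<^sup>2) * indicator {0<..<G z} u \<partial>lborel)"
        by (subst nn_integral_cmult_indicator) auto
    qed
    also have "\<dots> = (\<integral>\<^sup>+u. \<integral>\<^sup>+z. ennreal (1 / (\<tau> z)\<^sup>2) * indicator {0<..<G z} u \<partial>area \<partial>lborel)"
    proof (rule pair.Fubini'[symmetric])
      have "(\<lambda>(z, u). ennreal (1 / (\<tau> z)\<^sup>2) * (if 0 < u \<and> u < G z then 1 else 0)) \<in> borel_measurable (area \<Otimes>\<^sub>M lborel)"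
        by measurable
      moreover have "(\<lambda>(z, u). ennreal (1 / (\<tau> z)\<^sup>2) * indicator {0<..<G z} u) =
          (\<lambda>(z, u). ennreal (1 / (\<tau> z)\<^sup>2) * (if 0 < u \<and> u < G z then 1 else 0))"
        by (auto simp: fun_eq_iff split: split_indicator)
      ultimately show "(\<lambda>(z, u). ennreal (1 / (\<tau> z)\<^sup>2) * indicator {0<..<G z} u) \<in> borel_measurable (area \<Otimes>\<^sub>M lborel)"
        by simp
    qed
    \<comment> \<open>The same device on the side of the singular numbers: the cardinality of
      \<open>I t\<close> is a sum of indicators in u, whose integrals are the terms
      \<open>(s k / \<kappa>) powr p\<close>. The interval is closed on the right because
      \<open>I t\<close> is defined by a weak inequality.\<close>
    also have "\<dots> \<le> (\<integral>\<^sup>+u. \<integral>\<^sup>+k. ennreal (8 * R\<^sup>2) * indicator {0<..(s k / \<kappa>) powr p} u \<partial>count_space UNIV \<partial>lborel)"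
    proof (rule nn_integral_mono)
      fix u :: real
      show "(\<integral>\<^sup>+z. ennreal (1 / (\<tau> z)\<^sup>2) * indicator {0<..<G z} u \<partial>area) \<le>
          (\<integral>\<^sup>+k. ennreal (8 * R\<^sup>2) * indicator {0<..(s k / \<kappa>) powr p} u \<partial>count_space UNIV)"
      proof (cases "0 < u")
        case True
        define t where "t = u powr (1 / p)"
        have t: "0 < t" "t powr p = u" using True p by (auto simp: t_def powr_powr)
        have "(\<integral>\<^sup>+z. ennreal (1 / (\<tau> z)\<^sup>2) * indicator {0<..<G z} u \<partial>area) \<le>
            (\<integral>\<^sup>+z. ennreal (1 / (\<tau> z)\<^sup>2) * indicator (U t) z \<partial>area)"
        proof (intro nn_integral_mono mult_left_mono)
          fix z assume "z \<in> space area"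
          have "z \<in> U t" if "u < G z"
          proof -
            have *: "r2 \<le> cmod z" "u < avg z powr p" using that True by (auto simp: G_def split: split_indicator_asm)
            have "t < avg z"
            proof (rule ccontr)
              assume "\<not> t < avg z"
              then have "avg z powr p \<le> t powr p" using avg0 p by (intro powr_mono2) auto
              then show False using * t by simp
            qed
            then show ?thesis using * \<open>z \<in> space area\<close> by (simp add: U_def)
          qed
          then show "indicator {0<..<G z} u \<le> (indicator (U t) z :: ennreal)" by (auto split: split_indicator)
        qed simp
        also have "\<dots> \<le> ennreal (8 * R\<^sup>2 * card (I t))" by (rule level[OF t(1)])
        also have "\<dots> = ennreal (8 * R\<^sup>2) * emeasure (count_space UNIV) (I t)"
          using finI[OF t(1)] by (simp add: emeasure_count_space_finite ennreal_mult ennreal_of_nat_eq_real_of_nat)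
        also have "\<dots> = (\<integral>\<^sup>+k. ennreal (8 * R\<^sup>2) * indicator (I t) k \<partial>count_space UNIV)"
          by (rule nn_integral_cmult_indicator[symmetric]) simp
        also have "\<dots> \<le> (\<integral>\<^sup>+k. ennreal (8 * R\<^sup>2) * indicator {0<..(s k / \<kappa>) powr p} u \<partial>count_space UNIV)"
        proof (intro nn_integral_mono mult_left_mono)
          fix k
          have "u \<le> (s k / \<kappa>) powr p" if "k \<in> I t"
          proof -
            have "t \<le> s k / \<kappa>" using that \<kappa> by (simp add: I_def pos_le_divide_eq mult.commute)
            then have "t powr p \<le> (s k / \<kappa>) powr p" using t p by (intro powr_mono2) auto
            then show ?thesis using t by simp
          qed
          then show "indicator (I t) k \<le> (indicator {0<..(s k / \<kappa>) powr p} u :: ennreal)"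
            using True by (auto split: split_indicator)
        qed simp
        finally show ?thesis .
      next
        case False
        then show ?thesis by simp
      qed
    qed
    also have "\<dots> = (\<integral>\<^sup>+k. \<integral>\<^sup>+u. ennreal (8 * R\<^sup>2) * indicator {0<..(s k / \<kappa>) powr p} u \<partial>lborel \<partial>count_space UNIV)"
      by (rule nn_integral_count_space_nn_integral) auto
    also have "\<dots> = (\<integral>\<^sup>+k. ennreal (8 * R\<^sup>2 * (s k / \<kappa>) powr p) \<partial>count_space UNIV)"
      by (intro nn_integral_cong) (simp add: nn_integral_cmult_indicator ennreal_mult)
    also have "\<dots> = (\<Sum>k. ennreal (8 * R\<^sup>2 * (s k / \<kappa>) powr p))" by (rule nn_integral_count_space_nat)
    also have "\<dots> = ennreal (\<Sum>k. 8 * R\<^sup>2 * (s k / \<kappa>) powr p)"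
    proof (rule suminf_ennreal2)
      have "(s k / \<kappa>) powr p = s k powr p / \<kappa> powr p" for k using s0 \<kappa> by (simp add: powr_divide)
      then show "summable (\<lambda>k. 8 * R\<^sup>2 * (s k / \<kappa>) powr p)" using summ by (simp add: summable_mult summable_divide)
    qed simp
    finally show ?thesis by (simp add: le_less_trans)
  qed
  \<comment> \<open>Away from the boundary \<tau> is bounded below and \<mu> is finite, so the
    integrand is bounded on a set of finite area.\<close>
  have inner: "(\<integral>\<^sup>+z. ennreal (1 / (\<tau> z)\<^sup>2) * (ennreal (avg z powr p) * indicator {z. cmod z < r2} z) \<partial>area) < top"
  proof -
    define t2 where "t2 = \<tau> (of_real r2)"
    have r2D: "of_real r2 \<in> \<D>" using r2 by simp
    have t2: "0 < t2" using \<tau>_pos[OF r2D] by (simp add: t2_def)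
    define M where "M = 1 / t2\<^sup>2 * (measure \<mu> \<D> / t2\<^sup>2) powr p"
    have "(\<integral>\<^sup>+z. ennreal (1 / (\<tau> z)\<^sup>2) * (ennreal (avg z powr p) * indicator {z. cmod z < r2} z) \<partial>area) \<le>
        (\<integral>\<^sup>+z. ennreal M \<partial>area)"
    proof (rule nn_integral_mono)
      fix z assume "z \<in> space area"
      then have z: "z \<in> \<D>" by simp
      show "ennreal (1 / (\<tau> z)\<^sup>2) * (ennreal (avg z powr p) * indicator {z. cmod z < r2} z) \<le> ennreal M"
      proof (cases "cmod z < r2")
        case True
        have tz: "t2 \<le> \<tau> z" unfolding t2_def using True z r2D r2 by (intro \<tau>_antimono) auto
        have "measure \<mu> (ball z (\<delta> * \<tau> z)) \<le> measure \<mu> \<D>"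
          using ball_subset_disc(2)[OF z \<delta>(2)] sets.top[of \<mu>] by (intro \<mu>.finite_measure_mono) auto
        then have "avg z \<le> measure \<mu> \<D> / t2\<^sup>2"
          unfolding avg_def averaging_def using tz t2 by (intro frac_le power_mono) auto
        then have "avg z powr p \<le> (measure \<mu> \<D> / t2\<^sup>2) powr p" using avg0 p by (intro powr_mono2) auto
        moreover have "1 / (\<tau> z)\<^sup>2 \<le> 1 / t2\<^sup>2" using tz t2 by (intro divide_left_mono power_mono) auto
        ultimately have "1 / (\<tau> z)\<^sup>2 * avg z powr p \<le> M" unfolding M_def by (intro mult_mono) auto
        then show ?thesis using True by (simp add: ennreal_leI flip: ennreal_mult)
      qed simp
    qed
    also have "\<dots> < top" by (simp add: emeasure_area_disc)
    finally show ?thesis .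
  qed
  have "(\<integral>\<^sup>+z. ennreal (avg z powr p) \<partial>lambda_tau \<tau>) = (\<integral>\<^sup>+z. ennreal (1 / (\<tau> z)\<^sup>2) * ennreal (avg z powr p) \<partial>area)"
    unfolding lambda_tau_def by (rule nn_integral_density) measurable
  also have "\<dots> = (\<integral>\<^sup>+z. ennreal (1 / (\<tau> z)\<^sup>2) * (ennreal (avg z powr p) * indicator {z. r2 \<le> cmod z} z) +
      ennreal (1 / (\<tau> z)\<^sup>2) * (ennreal (avg z powr p) * indicator {z. cmod z < r2} z) \<partial>area)"
    by (intro nn_integral_cong) (auto split: split_indicator)
  also have "\<dots> = (\<integral>\<^sup>+z. ennreal (1 / (\<tau> z)\<^sup>2) * (ennreal (avg z powr p) * indicator {z. r2 \<le> cmod z} z) \<partial>area) +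
      (\<integral>\<^sup>+z. ennreal (1 / (\<tau> z)\<^sup>2) * (ennreal (avg z powr p) * indicator {z. cmod z < r2} z) \<partial>area)"
    by (rule nn_integral_add) measurable
  also have "\<dots> < top" using outer inner by simp
  finally have fin: "(\<integral>\<^sup>+z. ennreal (avg z powr p) \<partial>lambda_tau \<tau>) < top" .
  have sl: "sets (lambda_tau \<tau>) = sets area" by (simp add: lambda_tau_def)
  have avgl: "avg \<in> borel_measurable (lambda_tau \<tau>)" using avgm by (simp add: measurable_cong_sets[OF sl refl])
  have "integrable (lambda_tau \<tau>) (\<lambda>z. avg z powr p)"
    using avgl fin by (intro integrableI_nonneg) auto
  then show ?thesis
    using avgl avg0 by (simp add: Lp_space_def avg_def)
qed

end

theorem theorem1p2:
  fixes \<omega> \<tau> :: "complex \<Rightarrow> real" and c1 c2 :: real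
  assumes "class_W \<omega> \<tau>"
    and "class_L_with \<tau> c1 c2"
  shows "\<exists>\<delta>0. 0 < \<delta>0 \<and> \<delta>0 \<le> m_tau c1 c2 \<and>
           (\<forall>\<delta> (p::real) \<mu>. 0 < \<delta> \<and> \<delta> < \<delta>0 \<and> 0 < p \<and> finite_borel_on_disc \<mu> \<longrightarrow>
              (toeplitz_converges \<omega> \<mu> \<and>
               toeplitz \<omega> \<mu> \<in> schatten_class (bergman \<omega>) (bergman_inner \<omega>) p
               \<longleftrightarrow> averaging \<tau> \<mu> \<delta> \<in> Lp_space (lambda_tau \<tau>) p))"
proof -
  obtain \<psi> \<psi>1 \<psi>2 K where "W_profile \<omega> \<tau> \<psi> \<psi>1 \<psi>2 c1 c2 K"
    using class_W_profile[OF assms] by blast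
  then interpret W_profile \<omega> \<tau> \<psi> \<psi>1 \<psi>2 c1 c2 K .
  show ?thesis
  \<comment> \<open>Every \<delta> below m is admissible, whatever p and \<mu>: the witness is m
    itself.\<close>
  proof (intro exI[of _ m] conjI allI impI)
    show "0 < m" "m \<le> m" using m_bounds by auto
    fix \<delta> p :: real and \<mu> :: "complex measure"
    assume *: "0 < \<delta> \<and> \<delta> < m \<and> 0 < p \<and> finite_borel_on_disc \<mu>"
    then have \<delta>: "0 < \<delta>" "\<delta> \<le> m" and p: "0 < p" and fb: "finite_borel_on_disc \<mu>" by linarith+
    interpret W_measure \<omega> \<tau> \<psi> \<psi>1 \<psi>2 c1 c2 K \<mu>
      by (rule W_measure.intro[OF W_profile_axioms W_measure_axioms.intro[OF fb]])
    show "toeplitz_converges \<omega> \<mu> \<and> toeplitz \<omega> \<mu> \<in> schatten_class (bergman \<omega>) (bergman_inner \<omega>) p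
        \<longleftrightarrow> averaging \<tau> \<mu> \<delta> \<in> Lp_space (lambda_tau \<tau>) p"
      (is "?conv \<and> ?T \<longleftrightarrow> ?avg")
    proof (rule iffI)
      assume "?conv \<and> ?T"
      then show ?avg by (elim conjE) (rule necessity[OF \<delta> p])
    next
      assume ?avg
      then show "?conv \<and> ?T" by (intro conjI) (rule sufficiency[OF \<delta> p], assumption)+
    qed
  qed
qed

end
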